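(* Under the setting in the context (in particular $(\mathrm{VD})$ and $(\mathrm{RVD})$ hold), for every $0<q<1$, condition $(\mathrm{wPH}_q^0)$ holds if and only if condition $(\mathrm{wPH}_q)$ holds.
   Context: Space. $(M,d)$ is a locally compact, complete, separable metric space, $\mu$ is a Radon measure on $M$ with full support; every metric ball $B(x,r)=\{y\in M:d(x,y)<r\}$ (understood with fixed center and radius) is precompact; $\overline{R}:=2\,\mathrm{diam}(M,d)\in[0,\infty]$. For $B=B(x,r)$ and $\lambda>0$, $\lambda B:=B(x,\lambda r)$, and $V(x,r):=\mu(B(x,r))$. $U\Subset\Omega$ means that $\overline{U}$ is compact and contained in $\Omega$; $C_0(\Omega)$ denotes continuous functions compactly supported in $\Omega$; $\fint_A f\,d\nu:=\nu(A)^{-1}\int_A f\,d\nu$; $\mathrm{esup},\mathrm{einf}$ are the $\mu$-essential supremum and infimum; $f_-=\max(-f,0)$. $(\mathrm{VD})$: there is $C\ge1$ with $V(x,2R)\le CV(x,R)$ for all $x\in M$, $R>0$. $(\mathrm{RVD})$: there is $C\ge1$ with $V(x,R)\ge2V(x,C^{-1}R)$ for all $x\in M$, $0<R<\overline{R}$. Both are assumed. Form. $(\mathcal{E},\mathcal{F})$ is a regular Dirichlet form on $L^2(M,\mu)$ whose Beurling-Deny decomposition has no killing part: $\mathcal{E}(u,v)=\mathcal{E}^{(L)}(u,v)+\int_{M\times M}(u(x)-u(y))(v(x)-v(y))\,dj(x,y)$, with $\mathcal{E}^{(L)}$ strongly local and $j$ a symmetric Radon measure, $j(\mathrm{diag})=0$,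 $j(dx,dy)=d\mu(x)J(x,dy)=d\mu(y)J(y,dx)$ for a Borel transition kernel $J$. For open $\Omega\subset M$, $\mathcal{F}(\Omega)$ is the closure of $\mathcal{F}\cap C_0(\Omega)$ in $\mathcal{F}$ under $\mathcal{E}_1=\mathcal{E}+(\cdot,\cdot)_{L^2(\mu)}$. Scale. $W:M\times\mathbb{R}_+\to\mathbb{R}_+$ is such that each $W(x,\cdot)$ is strictly increasing and continuous, and there are $C_W\ge1$, $0<\beta_1\le\beta_2<\infty$ with $C_W^{-1}(R/r)^{\beta_1}\le W(x,R)/W(y,r)\le C_W(R/r)^{\beta_2}$ for all $0<r\le R<\infty$ and $d(x,y)\le R$. $W(B):=W(x,r)$ for $B=B(x,r)$. Caloricity. For open $\Omega$, $\mathcal{F}'(\Omega)$ is the set of $v\in L^1_{loc}(M)$ for which there are $w\in\mathcal{F}$ and a strict neighbourhood $\Omega'$ of $\Omega$ (open, with $K\cap\Omega\Subset\Omega'$ for all compact $K\subset M$) with $v=w$ on $\Omega'$ and $\int_\Omega\int_M(v(x)-v(y))^2J(x,dy)d\mu(x)<\infty$; for $\varphi\in\mathcal{F}(\Omega)$, $\tilde{\mathcal{E}}(v,\varphi):=\mathcal{E}^{(L)}(w,\varphi)+\int_{M\times M}(\varphi(x)-\varphi(y))(v(x)-v(y))\,dj(x,y)$. $\hat\mu$ is the completion of (Lebesgue measure)$\otimes\mu$ on $\mathbb{R}\times M$. A function $u:(t_1,t_2]\to\mathcal{F}'(\Omega)$ is supercaloric on $(t_1,t_2]\times\Omega$ if: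 $u$ is $\hat\mu$-measurable on $(t_1,t_2]\times M$; for every $\varphi\in L^2(\Omega)$, $I_\varphi(t):=(u(t,\cdot),\varphi)_{L^2(\Omega)}$ is continuous on $(t_1,t_2]$ and has a left derivative at every $t\in(t_1,t_2]$; for every $0\le\varphi\in\mathcal{F}(\Omega)$ and all $t\in(t_1,t_2]$, $\frac{\mathrm{d}_-}{\mathrm{d}t}(u(t,\cdot),\varphi)+\tilde{\mathcal{E}}(u(t,\cdot),\varphi)\ge0$; and there is a finite set $S\subset(t_1,t_2]$ containing $t_2$ such that for all $\varphi\in L^2(\Omega)$, $I_\varphi$ is differentiable on $(t_1,t_2]\setminus S$. For $Q=(t_1,t_2]\times\Omega$: $\mathrm{einf}_Qu:=\inf_{t_1<t\le t_2}\mathrm{einf}_\Omega u(t,\cdot)$. For a ball $B$, $0<\lambda<1$, $Q=(t_1,t_2]\times B$: $\overline{T}_Q^{(\lambda)}(u):=\int_{t_1}^{t_2}\mathrm{esup}_{z\in\lambda B}\int_{B^c}|u(s,y)|J(z,dy)\,ds$. Conditions. $(\mathrm{wPH}_q)$: there exist $\delta>0$, $C>1$, $\lambda_0\in(0,1)$ such that for every ball $B=B(x_0,R)$ with $R\in(0,\overline{R})$, all $0<\lambda\le\lambda_0$, all $t_0$ and all $u$ that is non-negative, bounded and supercaloric on $Q=(t_0-4\delta W(\lambda B),t_0]\times B$, $$\Big(\fint_{(t_0-3\delta W(\lambda B),t_0-2\delta W(\lambda B)]\times\lambda B}u^q\,d\hat\mu\Big)^{1/q}\le C\Big(\mathrm{einf}_{(t_0-\delta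 W(\lambda B),t_0]\times\lambda B}u+\overline{T}_Q^{(2/3)}(u_-)\Big).$$ $(\mathrm{wPH}_q^0)$: the same, but required only for those $u$ that are in addition non-negative on $(t_0-4\delta W(\lambda B),t_0]\times M$ (so that the tail term vanishes). *)

theory Defs
  imports "HOL-Probability.Probability"
begin

section \<open>The metric measure space\<close>

text \<open>Taking U open and different from UNIV covers jump measures, which are Radon on the
  off-diagonal set only: they may charge compact sets meeting the diagonal infinitely.\<close>

definition radon_on :: "'b::topological_space set \<Rightarrow> 'b measure \<Rightarrow> bool" where
  "radon_on U \<nu> \<longleftrightarrow> sets \<nu> = sets borel \<and>
     (\<forall>K. compact K \<and> K \<subseteq> U \<longrightarrow> emeasure \<nu> K < \<infinity>) \<and>
     (\<forall>A\<in>sets borel. A \<subseteq> U \<longrightarrow>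
        emeasure \<nu> A = (INF V\<in>{V. open V \<and> A \<subseteq> V \<and> V \<subseteq> U}. emeasure \<nu> V)) \<and>
     (\<forall>V. open V \<and> V \<subseteq> U \<longrightarrow>
        emeasure \<nu> V = (SUP K\<in>{K. compact K \<and> K \<subseteq> V}. emeasure \<nu> K))"

definition ediameter :: "'a::metric_space set \<Rightarrow> ereal" where
  "ediameter S = (SUP p\<in>S \<times> S. ereal (dist (fst p) (snd p)))"

definition Rbar :: "'a::metric_space measure \<Rightarrow> ereal" where
  "Rbar \<mu> = 2 * ediameter (UNIV :: 'a set)"

text \<open>Completeness and separability of the space are supplied by the class polish_space.\<close>

definition metric_measure_space :: "'a::polish_space measure \<Rightarrow> bool" where
  "metric_measure_space \<mu> \<longleftrightarrow>
     locally compact (UNIV :: 'a set) \<and>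
     radon_on UNIV \<mu> \<and>
     (\<forall>U. open U \<and> U \<noteq> {} \<longrightarrow> 0 < emeasure \<mu> U) \<and>
     (\<forall>x::'a. \<forall>r. compact (closure (ball x r)))"

definition vol :: "'a::metric_space measure \<Rightarrow> 'a \<Rightarrow> real \<Rightarrow> real" where
  "vol \<mu> x r = measure \<mu> (ball x r)"

definition VD :: "'a::metric_space measure \<Rightarrow> bool" where
  "VD \<mu> \<longleftrightarrow> (\<exists>C\<ge>1. \<forall>x. \<forall>R>0. vol \<mu> x (2 * R) \<le> C * vol \<mu> x R)"

definition RVD :: "'a::metric_space measure \<Rightarrow> bool" where
  "RVD \<mu> \<longleftrightarrow> (\<exists>C\<ge>1. \<forall>x. \<forall>R>0. ereal R < Rbar \<mu> \<longrightarrow> vol \<mu> x R \<ge> 2 * vol \<mu> x (R / C))"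


section \<open>Function spaces\<close>

text \<open>Elements of the Lebesgue spaces, of the form domain and of Fprime are Borel
  functions on the whole space standing for their \<mu>-a.e. classes.\<close>

definition L2 :: "'a::topological_space measure \<Rightarrow> 'a set \<Rightarrow> ('a \<Rightarrow> real) set" where
  "L2 \<mu> \<Omega> = {f \<in> borel_measurable borel. set_integrable \<mu> \<Omega> (\<lambda>x. (f x)\<^sup>2)}"

definition L1loc :: "'a::topological_space measure \<Rightarrow> ('a \<Rightarrow> real) set" where
  "L1loc \<mu> = {f \<in> borel_measurable borel. \<forall>K. compact K \<longrightarrow> set_integrable \<mu> K f}"

definition C0 :: "'a::topological_space set \<Rightarrow> ('a \<Rightarrow> real) set" where
  "C0 \<Omega> = {f. continuous_on UNIV f \<and> compact (closure {x. f x \<noteq> 0}) \<and> closure {x. f x \<noteq> 0} \<subseteq> \<Omega>}"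

definition ess_supp :: "'a::topological_space measure \<Rightarrow> ('a \<Rightarrow> real) \<Rightarrow> 'a set" where
  "ess_supp \<mu> f = - \<Union>{U. open U \<and> (AE x in \<mu>. x \<in> U \<longrightarrow> f x = 0)}"

definition essinf_on :: "'a measure \<Rightarrow> 'a set \<Rightarrow> ('a \<Rightarrow> real) \<Rightarrow> ereal" where
  "essinf_on \<mu> A f = - esssup (restrict_space \<mu> A) (\<lambda>x. - ereal (f x))"

definition average :: "'b measure \<Rightarrow> 'b set \<Rightarrow> ('b \<Rightarrow> real) \<Rightarrow> real" where
  "average \<nu> A f = (LINT x:A|\<nu>. f x) / measure \<nu> A"


section \<open>Dirichlet forms\<close>

type_synonym 'a form = "('a \<Rightarrow> real) \<Rightarrow> ('a \<Rightarrow> real) \<Rightarrow> real"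

definition E1 :: "'a measure \<Rightarrow> 'a form \<Rightarrow> 'a form" where
  "E1 \<mu> E u v = E u v + (LINT x|\<mu>. u x * v x)"

definition form_domain :: "'a::topological_space measure \<Rightarrow> ('a \<Rightarrow> real) set \<Rightarrow> bool" where
  "form_domain \<mu> F \<longleftrightarrow> F \<subseteq> L2 \<mu> UNIV \<and>
     (\<forall>u\<in>F. \<forall>v\<in>borel_measurable borel. (AE x in \<mu>. u x = v x) \<longrightarrow> v \<in> F) \<and>
     (\<lambda>x. 0) \<in> F \<and>
     (\<forall>u\<in>F. \<forall>v\<in>F. \<forall>a b. (\<lambda>x. a * u x + b * v x) \<in> F) \<and>
     (\<forall>f\<in>L2 \<mu> UNIV. \<forall>\<epsilon>>0. \<exists>u\<in>F. (LINT x|\<mu>. (f x - u x)\<^sup>2) < \<epsilon>)"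

definition symmetric_form :: "'a measure \<Rightarrow> ('a \<Rightarrow> real) set \<Rightarrow> 'a form \<Rightarrow> bool" where
  "symmetric_form \<mu> F E \<longleftrightarrow>
     (\<forall>u\<in>F. \<forall>u'\<in>F. \<forall>v\<in>F. (AE x in \<mu>. u x = u' x) \<longrightarrow> E u v = E u' v) \<and>
     (\<forall>u\<in>F. \<forall>v\<in>F. E u v = E v u) \<and>
     (\<forall>u\<in>F. \<forall>v\<in>F. \<forall>w\<in>F. \<forall>a b. E (\<lambda>x. a * u x + b * v x) w = a * E u w + b * E v w) \<and>
     (\<forall>u\<in>F. 0 \<le> E u u)"

definition dirichlet_form :: "'a::topological_space measure \<Rightarrow> ('a \<Rightarrow> real) set \<Rightarrow> 'a form \<Rightarrow> bool" where
  "dirichlet_form \<mu> F E \<longleftrightarrow> form_domain \<mu> F \<and> symmetric_form \<mu> F E \<and>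
     (\<forall>f. (\<forall>n::nat. f n \<in> F) \<and>
          (\<forall>\<epsilon>>0. \<exists>N. \<forall>m\<ge>N. \<forall>n\<ge>N. E1 \<mu> E (\<lambda>x. f m x - f n x) (\<lambda>x. f m x - f n x) < \<epsilon>) \<longrightarrow>
          (\<exists>g\<in>F. (\<lambda>n. E1 \<mu> E (\<lambda>x. f n x - g x) (\<lambda>x. f n x - g x)) \<longlonglongrightarrow> 0)) \<and>
     (\<forall>u\<in>F. (\<lambda>x. min (max (u x) 0) 1) \<in> F \<and>
             E (\<lambda>x. min (max (u x) 0) 1) (\<lambda>x. min (max (u x) 0) 1) \<le> E u u)"

definition regular_dirichlet_form :: "'a::topological_space measure \<Rightarrow> ('a \<Rightarrow> real) set \<Rightarrow> 'a form \<Rightarrow> bool" where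
  "regular_dirichlet_form \<mu> F E \<longleftrightarrow> dirichlet_form \<mu> F E \<and>
     (\<forall>u\<in>F. \<forall>\<epsilon>>0. \<exists>v\<in>F \<inter> C0 UNIV. E1 \<mu> E (\<lambda>x. u x - v x) (\<lambda>x. u x - v x) < \<epsilon>) \<and>
     (\<forall>f\<in>C0 UNIV. \<forall>\<epsilon>>0. \<exists>v\<in>F \<inter> C0 UNIV. \<forall>x. \<bar>f x - v x\<bar> < \<epsilon>)"

definition strongly_local :: "'a::topological_space measure \<Rightarrow> ('a \<Rightarrow> real) set \<Rightarrow> 'a form \<Rightarrow> bool" where
  "strongly_local \<mu> F EL \<longleftrightarrow>
     (\<forall>u\<in>F. \<forall>v\<in>F. compact (ess_supp \<mu> u) \<and> compact (ess_supp \<mu> v) \<and>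
        (\<exists>U c. open U \<and> ess_supp \<mu> u \<subseteq> U \<and> (AE x in \<mu>. x \<in> U \<longrightarrow> v x = c)) \<longrightarrow> EL u v = 0)"

definition transition_kernel :: "('a::topological_space \<Rightarrow> 'a measure) \<Rightarrow> bool" where
  "transition_kernel J \<longleftrightarrow> (\<forall>x. sets (J x) = sets borel) \<and>
     (\<forall>A\<in>sets borel. (\<lambda>x. emeasure (J x) A) \<in> borel_measurable borel)"

definition jump_measure ::
  "'a::topological_space measure \<Rightarrow> ('a \<times> 'a) measure \<Rightarrow> ('a \<Rightarrow> 'a measure) \<Rightarrow> bool" where
  "jump_measure \<mu> j J \<longleftrightarrow>
     radon_on {(x, y). x \<noteq> y} j \<and>
     distr j borel prod.swap = j \<and>
     emeasure j {(x, y). x = y} = 0 \<and>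
     transition_kernel J \<and>
     (\<forall>A\<in>sets borel. emeasure j A = (\<integral>\<^sup>+x. emeasure (J x) {y. (x, y) \<in> A} \<partial>\<mu>)) \<and>
     (\<forall>A\<in>sets borel. emeasure j A = (\<integral>\<^sup>+y. emeasure (J y) {x. (x, y) \<in> A} \<partial>\<mu>))"

definition jump_form :: "('a \<times> 'a) measure \<Rightarrow> 'a form" where
  "jump_form j u v = (LINT (x, y)|j. (u x - u y) * (v x - v y))"

text \<open>Since j disintegrates over \<mu>, the jump part does not depend on the chosen
  representatives, so no quasi-continuous versions are needed. Integrability is stated because
  the Bochner integral of a non-integrable function is 0.\<close>

definition beurling_deny_without_killing ::
  "'a::topological_space measure \<Rightarrow> ('a \<Rightarrow> real) set \<Rightarrow> 'a form \<Rightarrow> 'a form \<Rightarrow>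
   ('a \<times> 'a) measure \<Rightarrow> ('a \<Rightarrow> 'a measure) \<Rightarrow> bool" where
  "beurling_deny_without_killing \<mu> F E EL j J \<longleftrightarrow>
     symmetric_form \<mu> F EL \<and> strongly_local \<mu> F EL \<and> jump_measure \<mu> j J \<and>
     (\<forall>u\<in>F. integrable j (\<lambda>(x, y). (u x - u y)\<^sup>2)) \<and>
     (\<forall>u\<in>F. \<forall>v\<in>F. E u v = EL u v + jump_form j u v)"

definition F_on :: "'a::topological_space measure \<Rightarrow> ('a \<Rightarrow> real) set \<Rightarrow> 'a form \<Rightarrow> 'a set \<Rightarrow> ('a \<Rightarrow> real) set" where
  "F_on \<mu> F E \<Omega> = {u \<in> F. \<forall>\<epsilon>>0. \<exists>v\<in>F \<inter> C0 \<Omega>. E1 \<mu> E (\<lambda>x. u x - v x) (\<lambda>x. u x - v x) < \<epsilon>}"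


section \<open>The scale\<close>

definition scale_function :: "('a::metric_space \<Rightarrow> real \<Rightarrow> real) \<Rightarrow> bool" where
  "scale_function W \<longleftrightarrow>
     (\<forall>x. (\<forall>r>0. 0 < W x r) \<and> strict_mono_on {0<..} (W x) \<and> continuous_on {0<..} (W x)) \<and>
     (\<exists>C \<beta>1 \<beta>2. 1 \<le> C \<and> 0 < \<beta>1 \<and> \<beta>1 \<le> \<beta>2 \<and>
        (\<forall>x y r R. 0 < r \<and> r \<le> R \<and> dist x y \<le> R \<longrightarrow>
           (R / r) powr \<beta>1 / C \<le> W x R / W y r \<and> W x R / W y r \<le> C * (R / r) powr \<beta>2))"


section \<open>Supercaloric functions\<close>

definition strict_nbhd :: "'a::topological_space set \<Rightarrow> 'a set \<Rightarrow> bool" where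
  "strict_nbhd \<Omega> \<Omega>' \<longleftrightarrow> open \<Omega>' \<and>
     (\<forall>K. compact K \<longrightarrow> compact (closure (K \<inter> \<Omega>)) \<and> closure (K \<inter> \<Omega>) \<subseteq> \<Omega>')"

definition local_extension ::
  "'a::topological_space measure \<Rightarrow> ('a \<Rightarrow> real) set \<Rightarrow> 'a set \<Rightarrow> ('a \<Rightarrow> real) \<Rightarrow> ('a \<Rightarrow> real) \<Rightarrow> bool" where
  "local_extension \<mu> F \<Omega> v w \<longleftrightarrow>
     w \<in> F \<and> (\<exists>\<Omega>'. strict_nbhd \<Omega> \<Omega>' \<and> (AE x in \<mu>. x \<in> \<Omega>' \<longrightarrow> v x = w x))"

definition Fprime ::
  "'a::topological_space measure \<Rightarrow> ('a \<Rightarrow> real) set \<Rightarrow> ('a \<Rightarrow> 'a measure) \<Rightarrow> 'a set \<Rightarrow> ('a \<Rightarrow> real) set" where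
  "Fprime \<mu> F J \<Omega> = {v \<in> L1loc \<mu>. (\<exists>w. local_extension \<mu> F \<Omega> v w) \<and>
     (\<integral>\<^sup>+x\<in>\<Omega>. (\<integral>\<^sup>+y. ennreal ((v x - v y)\<^sup>2) \<partial>J x) \<partial>\<mu>) < \<infinity>}"

text \<open>For a test function in F_on the local term is the same for every local extension, by strong
  locality, so it does not matter which one is selected.\<close>

definition ext_form ::
  "'a::topological_space measure \<Rightarrow> ('a \<Rightarrow> real) set \<Rightarrow> 'a form \<Rightarrow> ('a \<times> 'a) measure \<Rightarrow> 'a set \<Rightarrow> 'a form" where
  "ext_form \<mu> F EL j \<Omega> v \<phi> =
     EL (SOME w. local_extension \<mu> F \<Omega> v w) \<phi> + jump_form j \<phi> v"

definition mu_hat :: "'a measure \<Rightarrow> (real \<times> 'a) measure" where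
  "mu_hat \<mu> = completion (lborel \<Otimes>\<^sub>M \<mu>)"

definition pairing :: "'a measure \<Rightarrow> 'a set \<Rightarrow> (real \<Rightarrow> 'a \<Rightarrow> real) \<Rightarrow> ('a \<Rightarrow> real) \<Rightarrow> real \<Rightarrow> real" where
  "pairing \<mu> \<Omega> u \<phi> t = (LINT x:\<Omega>|\<mu>. u t x * \<phi> x)"

text \<open>The values of u outside the time interval are never used.\<close>

definition supercaloric ::
  "'a::topological_space measure \<Rightarrow> ('a \<Rightarrow> real) set \<Rightarrow> 'a form \<Rightarrow> 'a form \<Rightarrow>
   ('a \<times> 'a) measure \<Rightarrow> ('a \<Rightarrow> 'a measure) \<Rightarrow> real \<Rightarrow> real \<Rightarrow> 'a set \<Rightarrow> (real \<Rightarrow> 'a \<Rightarrow> real) \<Rightarrow> bool" where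
  "supercaloric \<mu> F E EL j J t1 t2 \<Omega> u \<longleftrightarrow>
     (\<forall>t\<in>{t1<..t2}. u t \<in> Fprime \<mu> F J \<Omega>) \<and>
     (\<lambda>(t, x). u t x) \<in> borel_measurable (restrict_space (mu_hat \<mu>) ({t1<..t2} \<times> UNIV)) \<and>
     (\<forall>\<phi>\<in>L2 \<mu> \<Omega>. continuous_on {t1<..t2} (pairing \<mu> \<Omega> u \<phi>) \<and>
        (\<forall>t\<in>{t1<..t2}. \<exists>D. (pairing \<mu> \<Omega> u \<phi> has_real_derivative D) (at_left t))) \<and>
     (\<forall>\<phi>\<in>F_on \<mu> F E \<Omega>. (AE x in \<mu>. 0 \<le> \<phi> x) \<longrightarrow>
        (\<forall>t\<in>{t1<..t2}. \<exists>D. (pairing \<mu> \<Omega> u \<phi> has_real_derivative D) (at_left t) \<and>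
           0 \<le> D + ext_form \<mu> F EL j \<Omega> (u t) \<phi>)) \<and>
     (\<exists>S. finite S \<and> S \<subseteq> {t1<..t2} \<and> t2 \<in> S \<and>
        (\<forall>\<phi>\<in>L2 \<mu> \<Omega>. \<forall>t\<in>{t1<..t2} - S. pairing \<mu> \<Omega> u \<phi> differentiable (at t)))"


section \<open>Weak parabolic Harnack inequalities\<close>

definition nonneg_on :: "'a measure \<Rightarrow> real \<Rightarrow> real \<Rightarrow> 'a set \<Rightarrow> (real \<Rightarrow> 'a \<Rightarrow> real) \<Rightarrow> bool" where
  "nonneg_on \<mu> t1 t2 A u \<longleftrightarrow> (\<forall>t\<in>{t1<..t2}. AE x in \<mu>. x \<in> A \<longrightarrow> 0 \<le> u t x)"

definition bounded_in :: "'a measure \<Rightarrow> real \<Rightarrow> real \<Rightarrow> 'a set \<Rightarrow> (real \<Rightarrow> 'a \<Rightarrow> real) \<Rightarrow> bool" where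
  "bounded_in \<mu> t1 t2 A u \<longleftrightarrow> (\<exists>K. \<forall>t\<in>{t1<..t2}. AE x in \<mu>. x \<in> A \<longrightarrow> \<bar>u t x\<bar> \<le> K)"

definition einf_cyl :: "'a measure \<Rightarrow> real \<Rightarrow> real \<Rightarrow> 'a set \<Rightarrow> (real \<Rightarrow> 'a \<Rightarrow> real) \<Rightarrow> ereal" where
  "einf_cyl \<mu> t1 t2 A u = (INF t\<in>{t1<..t2}. essinf_on \<mu> A (u t))"

text \<open>lam shrinks the ball of the essential supremum only; the tail may be infinite, hence ennreal.\<close>

definition tail ::
  "'a::metric_space measure \<Rightarrow> ('a \<Rightarrow> 'a measure) \<Rightarrow> real \<Rightarrow> real \<Rightarrow> real \<Rightarrow> 'a \<Rightarrow> real \<Rightarrow> (real \<Rightarrow> 'a \<Rightarrow> real) \<Rightarrow> ennreal" where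
  "tail \<mu> J lam t1 t2 x0 R u =
     (\<integral>\<^sup>+s\<in>{t1<..t2}. esssup (restrict_space \<mu> (ball x0 (lam * R)))
        (\<lambda>z. \<integral>\<^sup>+y\<in>- ball x0 R. ennreal \<bar>u s y\<bar> \<partial>J z) \<partial>lebesgue)"

definition neg_part :: "(real \<Rightarrow> 'a \<Rightarrow> real) \<Rightarrow> real \<Rightarrow> 'a \<Rightarrow> real" where
  "neg_part u t x = max (- u t x) 0"

text \<open>The inequality shared by both conditions, with T standing for W(\<lambda>B).\<close>

definition wPH_inequality ::
  "'a::metric_space measure \<Rightarrow> ('a \<Rightarrow> 'a measure) \<Rightarrow> real \<Rightarrow> real \<Rightarrow> real \<Rightarrow> real \<Rightarrow>
   real \<Rightarrow> 'a \<Rightarrow> real \<Rightarrow> real \<Rightarrow> (real \<Rightarrow> 'a \<Rightarrow> real) \<Rightarrow> bool" where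
  "wPH_inequality \<mu> J q \<delta> C T lam x0 R t0 u \<longleftrightarrow>
     ereal ((average (mu_hat \<mu>) ({t0 - 3 * \<delta> * T<..t0 - 2 * \<delta> * T} \<times> ball x0 (lam * R))
               (\<lambda>(t, x). u t x powr q)) powr (1 / q))
     \<le> ereal C * (einf_cyl \<mu> (t0 - \<delta> * T) t0 (ball x0 (lam * R)) u
          + enn2ereal (tail \<mu> J (2 / 3) (t0 - 4 * \<delta> * T) t0 x0 R (neg_part u)))"

definition wPH ::
  "'a::metric_space measure \<Rightarrow> ('a \<Rightarrow> real) set \<Rightarrow> 'a form \<Rightarrow> 'a form \<Rightarrow> ('a \<times> 'a) measure \<Rightarrow>
   ('a \<Rightarrow> 'a measure) \<Rightarrow> ('a \<Rightarrow> real \<Rightarrow> real) \<Rightarrow> real \<Rightarrow> bool" where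
  "wPH \<mu> F E EL j J W q \<longleftrightarrow>
     (\<exists>\<delta> C lam0. 0 < \<delta> \<and> 1 < C \<and> 0 < lam0 \<and> lam0 < 1 \<and>
        (\<forall>x0 R lam t0 u.
           0 < R \<and> ereal R < Rbar \<mu> \<and> 0 < lam \<and> lam \<le> lam0 \<and>
           nonneg_on \<mu> (t0 - 4 * \<delta> * W x0 (lam * R)) t0 (ball x0 R) u \<and>
           bounded_in \<mu> (t0 - 4 * \<delta> * W x0 (lam * R)) t0 (ball x0 R) u \<and>
           supercaloric \<mu> F E EL j J (t0 - 4 * \<delta> * W x0 (lam * R)) t0 (ball x0 R) u \<longrightarrow>
           wPH_inequality \<mu> J q \<delta> C (W x0 (lam * R)) lam x0 R t0 u))"

definition wPH0 ::
  "'a::metric_space measure \<Rightarrow> ('a \<Rightarrow> real) set \<Rightarrow> 'a form \<Rightarrow> 'a form \<Rightarrow> ('a \<times> 'a) measure \<Rightarrow>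
   ('a \<Rightarrow> 'a measure) \<Rightarrow> ('a \<Rightarrow> real \<Rightarrow> real) \<Rightarrow> real \<Rightarrow> bool" where
  "wPH0 \<mu> F E EL j J W q \<longleftrightarrow>
     (\<exists>\<delta> C lam0. 0 < \<delta> \<and> 1 < C \<and> 0 < lam0 \<and> lam0 < 1 \<and>
        (\<forall>x0 R lam t0 u.
           0 < R \<and> ereal R < Rbar \<mu> \<and> 0 < lam \<and> lam \<le> lam0 \<and>
           nonneg_on \<mu> (t0 - 4 * \<delta> * W x0 (lam * R)) t0 (ball x0 R) u \<and>
           bounded_in \<mu> (t0 - 4 * \<delta> * W x0 (lam * R)) t0 (ball x0 R) u \<and>
           supercaloric \<mu> F E EL j J (t0 - 4 * \<delta> * W x0 (lam * R)) t0 (ball x0 R) u \<and>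
           nonneg_on \<mu> (t0 - 4 * \<delta> * W x0 (lam * R)) t0 UNIV u \<longrightarrow>
           wPH_inequality \<mu> J q \<delta> C (W x0 (lam * R)) lam x0 R t0 u))"

end

theory Submission
  imports Defs
begin

text \<open>One direction is a weakening of hypotheses. For the other, let u be non-negative on the
  cylinder over the ball B of radius R only. Adding to u the time integral of its tail would
  compensate its negative values outside B, but the inequality for a supercaloric function is
  required at every time, while the tail is a function of time that is finite almost everywhere
  at best and need not be measurable. So u is replaced by a time average that lives on the half
  ball.

  Let K bound u, let \<psi> be a cutoff function that is 1 near the half ball, and let trunc be the
  minimum of u and K \<psi>, which is non-negative everywhere, belongs to the form domain and equals u
  near the half ball. Against a test function supported in the half ball, putting trunc in place
  of u changes the form by at most twice the tail times the integral of the test function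
  (\<open>test_inequality\<close>). To integrate this in time one needs integrability of the energy. Testing
  with the deficit K \<psi> - trunc gives a bound for the energy by the tail and the derivative of
  half the squared L2 norm of the deficit (\<open>caccioppoli\<close>). That derivative exists since the
  pairings of u are differentiable, by the uniform boundedness principle
  (\<open>deficit_sq_derivative\<close>); its gauge integral is an increment of a bounded function. The tail
  enters through a measurable minorant with the same integral, which almost everywhere dominates
  every measurable function below the tail (\<open>nn_integral_maximal_minorant\<close>). The Riesz theorem
  then shows that time integrals of trunc belong to the form domain and commute with the form
  (\<open>trunc_integral_energy\<close>), which gives the integrated inequality (\<open>integrated_inequality\<close>).

  Consequently the average of trunc over the times [t - h, t], plus the average of twice the
  accumulated tail, plus a small constant, is supercaloric on the half ball and positive
  everywhere (\<open>steklov_supercaloric\<close>). The Harnack inequality for globally non-negative functions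
  applies to it on the ball of radius R/2 with parameter 2 \<lambda>', where \<lambda>' < \<lambda>: the shrunk ball has
  radius \<lambda>' R, and the cylinder is shorter than the original one, which leaves room for the
  averaging. Letting \<lambda>' increase to \<lambda> while h tends to 0, the left-hand side is controlled by
  concavity of y^q (\<open>average_powr_cylinder\<close>) and the essential infimum by weak continuity in time
  (\<open>einf_average_le\<close>). The result holds with constants \<delta>, 2 C and half of the original bound on
  the parameter.\<close>

section \<open>Complete semi-inner product spaces of functions\<close>

text \<open>Functions stand for their almost-everywhere classes, so a form on them is only semidefinite
  and limits are not unique.\<close>

locale semi_inner =
  fixes H :: "('a \<Rightarrow> real) set" and ip :: "('a \<Rightarrow> real) \<Rightarrow> ('a \<Rightarrow> real) \<Rightarrow> real"
  assumes zero_mem: "(\<lambda>x. 0) \<in> H"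
    and lin_mem: "u \<in> H \<Longrightarrow> v \<in> H \<Longrightarrow> (\<lambda>x. a * u x + b * v x) \<in> H"
    and sym: "u \<in> H \<Longrightarrow> v \<in> H \<Longrightarrow> ip u v = ip v u"
    and lin_left: "u \<in> H \<Longrightarrow> v \<in> H \<Longrightarrow> w \<in> H \<Longrightarrow> ip (\<lambda>x. a * u x + b * v x) w = a * ip u w + b * ip v w"
    and nonneg: "u \<in> H \<Longrightarrow> 0 \<le> ip u u"
begin

definition nrm where "nrm u = sqrt (ip u u)"

lemma lin_right: "u \<in> H \<Longrightarrow> v \<in> H \<Longrightarrow> w \<in> H \<Longrightarrow> ip w (\<lambda>x. a * u x + b * v x) = a * ip w u + b * ip w v"
  using lin_left[of u v w a b] sym lin_mem by metis

lemma add_mem: "u \<in> H \<Longrightarrow> v \<in> H \<Longrightarrow> (\<lambda>x. u x + v x) \<in> H"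
  using lin_mem[of u v 1 1] by simp
lemma diff_mem: "u \<in> H \<Longrightarrow> v \<in> H \<Longrightarrow> (\<lambda>x. u x - v x) \<in> H"
  using lin_mem[of u v 1 "-1"] by simp
lemma scale_mem: "u \<in> H \<Longrightarrow> (\<lambda>x. a * u x) \<in> H"
  using lin_mem[of u u a 0] by simp

lemma add_left: "u \<in> H \<Longrightarrow> v \<in> H \<Longrightarrow> w \<in> H \<Longrightarrow> ip (\<lambda>x. u x + v x) w = ip u w + ip v w"
  using lin_left[of u v w 1 1] by simp
lemma diff_left: "u \<in> H \<Longrightarrow> v \<in> H \<Longrightarrow> w \<in> H \<Longrightarrow> ip (\<lambda>x. u x - v x) w = ip u w - ip v w"
  using lin_left[of u v w 1 "-1"] by simp
lemma scale_left: "u \<in> H \<Longrightarrow> w \<in> H \<Longrightarrow> ip (\<lambda>x. a * u x) w = a * ip u w"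
  using lin_left[of u u w a 0] by simp
lemma add_right: "u \<in> H \<Longrightarrow> v \<in> H \<Longrightarrow> w \<in> H \<Longrightarrow> ip w (\<lambda>x. u x + v x) = ip w u + ip w v"
  using lin_right[of u v w 1 1] by simp
lemma diff_right: "u \<in> H \<Longrightarrow> v \<in> H \<Longrightarrow> w \<in> H \<Longrightarrow> ip w (\<lambda>x. u x - v x) = ip w u - ip w v"
  using lin_right[of u v w 1 "-1"] by simp
lemma scale_right: "u \<in> H \<Longrightarrow> w \<in> H \<Longrightarrow> ip w (\<lambda>x. a * u x) = a * ip w u"
  using lin_right[of u u w a 0] by simp

lemmas mems = add_mem diff_mem scale_mem
lemmas bilin = mems add_left diff_left scale_left add_right diff_right scale_right

lemma nrm_nonneg: "u \<in> H \<Longrightarrow> 0 \<le> nrm u" by (simp add: nrm_def nonneg)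
lemma nrm_sq: "u \<in> H \<Longrightarrow> (nrm u)\<^sup>2 = ip u u" by (simp add: nrm_def nonneg)

lemma cauchy_schwarz_sq:
  assumes u: "u \<in> H" and v: "v \<in> H"
  shows "(ip u v)\<^sup>2 \<le> ip u u * ip v v"
proof -
  have q: "0 \<le> ip u u + 2 * t * ip u v + t\<^sup>2 * ip v v" for t
  proof -
    have "0 \<le> ip (\<lambda>x. u x + t * v x) (\<lambda>x. u x + t * v x)"
      by (intro nonneg mems u v)
    also have "\<dots> = ip u u + 2 * t * ip u v + t\<^sup>2 * ip v v"
      using sym[OF u v] by (simp add: bilin u v algebra_simps power2_eq_square)
    finally show ?thesis .
  qed
  show ?thesis
  proof (cases "ip v v = 0")
    case True
    show ?thesis
    proof (rule ccontr)
      assume "\<not> ?thesis"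
      then have ne: "ip u v \<noteq> 0" using True by auto
      from q[of "- (ip u u + 1) / (2 * ip u v)"] True ne show False
        by (simp add: field_simps)
    qed
  next
    case False
    then have p: "ip v v > 0" using nonneg[OF v] by simp
    have "0 \<le> ip u u - (ip u v)\<^sup>2 / ip v v"
      using q[of "- ip u v / ip v v"] p by (simp add: field_simps power2_eq_square)
    then show ?thesis using p by (simp add: field_simps)
  qed
qed

lemma cauchy_schwarz: "u \<in> H \<Longrightarrow> v \<in> H \<Longrightarrow> \<bar>ip u v\<bar> \<le> nrm u * nrm v"
  using cauchy_schwarz_sq[of u v] unfolding nrm_def
  by (metis real_sqrt_abs real_sqrt_le_iff real_sqrt_mult)

lemma young: "u \<in> H \<Longrightarrow> v \<in> H \<Longrightarrow> 2 * \<bar>ip u v\<bar> \<le> ip u u + ip v v"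
proof -
  assume u: "u \<in> H" and v: "v \<in> H"
  have "0 \<le> ip (\<lambda>x. u x + v x) (\<lambda>x. u x + v x)" "0 \<le> ip (\<lambda>x. u x - v x) (\<lambda>x. u x - v x)"
    by (intro nonneg mems u v)+
  then show ?thesis using sym[OF u v] by (simp add: bilin u v abs_if)
qed

lemma nrm_triangle:
  assumes u: "u \<in> H" and v: "v \<in> H"
  shows "nrm (\<lambda>x. u x + v x) \<le> nrm u + nrm v"
proof -
  have "(nrm (\<lambda>x. u x + v x))\<^sup>2 = ip u u + 2 * ip u v + ip v v"
    using sym[OF u v] by (simp add: nrm_sq bilin u v)
  also have "\<dots> \<le> (nrm u)\<^sup>2 + 2 * (nrm u * nrm v) + (nrm v)\<^sup>2"
    using cauchy_schwarz[OF u v] by (simp add: nrm_sq u v)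
  also have "\<dots> = (nrm u + nrm v)\<^sup>2" by (simp add: power2_eq_square algebra_simps)
  finally show ?thesis using nrm_nonneg[OF u] nrm_nonneg[OF v] by (meson add_nonneg_nonneg power2_le_imp_le)
qed

lemma lin_sq:
  assumes u: "u \<in> H" and v: "v \<in> H"
  shows "ip (\<lambda>x. a * u x + b * v x) (\<lambda>x. a * u x + b * v x) = a\<^sup>2 * ip u u + 2 * a * b * ip u v + b\<^sup>2 * ip v v"
  unfolding lin_left[OF u v lin_mem[OF u v]] lin_right[OF u v u] lin_right[OF u v v] sym[OF v u]
  by (simp add: algebra_simps power2_eq_square)

lemma sq_diff_le: "u \<in> H \<Longrightarrow> v \<in> H \<Longrightarrow> ip (\<lambda>x. u x - v x) (\<lambda>x. u x - v x) \<le> 2 * ip u u + 2 * ip v v"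
  using young[of u v] sym[of u v] by (simp add: bilin)

end

locale semi_hilbert = semi_inner +
  assumes complete: "(\<And>n::nat. f n \<in> H) \<Longrightarrow>
       (\<And>e. e > 0 \<Longrightarrow> \<exists>N. \<forall>m\<ge>N. \<forall>n\<ge>N. ip (\<lambda>x. f m x - f n x) (\<lambda>x. f m x - f n x) < e) \<Longrightarrow>
       \<exists>g\<in>H. (\<lambda>n. ip (\<lambda>x. f n x - g x) (\<lambda>x. f n x - g x)) \<longlonglongrightarrow> 0"
begin

lemma limit_left:
  assumes x: "\<And>n::nat. x n \<in> H" and y: "y \<in> H" and v: "v \<in> H"
    and lim: "(\<lambda>n. ip (\<lambda>z. x n z - y z) (\<lambda>z. x n z - y z)) \<longlonglongrightarrow> 0"
  shows "(\<lambda>n. ip (x n) v) \<longlonglongrightarrow> ip y v"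
proof -
  have "(\<lambda>n. nrm (\<lambda>z. x n z - y z) * nrm v) \<longlonglongrightarrow> 0"
    unfolding nrm_def[of "\<lambda>z. x _ z - y z"]
      using tendsto_mult_left_zero[OF tendsto_real_sqrt[OF lim, simplified]] by simp
  moreover have "\<bar>ip (x n) v - ip y v\<bar> \<le> nrm (\<lambda>z. x n z - y z) * nrm v" for n
    using cauchy_schwarz[OF diff_mem[OF x[of n] y] v] by (simp add: bilin x y v)
  ultimately have "(\<lambda>n. ip (x n) v - ip y v) \<longlonglongrightarrow> 0"
    by (intro Lim_null_comparison[where f="\<lambda>n. ip (x n) v - ip y v"]) auto
  then show ?thesis by (simp add: LIM_zero_iff)
qed

text \<open>Minimising sequences of ip v v - 2 l v over V are Cauchy by the parallelogram law. As V
  need not be closed, the representative is only a limit of elements of V, which is recorded as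
  the last property.\<close>

lemma riesz_subspace:
  assumes V: "V \<subseteq> H" and V0: "(\<lambda>x. 0) \<in> V"
    and Vlin: "\<And>u v a b. u \<in> V \<Longrightarrow> v \<in> V \<Longrightarrow> (\<lambda>x. a * u x + b * v x) \<in> V"
    and l_lin: "\<And>u v a b. u \<in> V \<Longrightarrow> v \<in> V \<Longrightarrow> l (\<lambda>x. a * u x + b * v x) = a * l u + b * l v"
    and l_bdd: "\<And>v. v \<in> V \<Longrightarrow> (l v)\<^sup>2 \<le> C * ip v v"
  obtains y where "y \<in> H" "\<And>v. v \<in> V \<Longrightarrow> ip y v = l v"
    "\<And>e. e > 0 \<Longrightarrow> \<exists>v\<in>V. ip (\<lambda>x. y x - v x) (\<lambda>x. y x - v x) < e"
proof -
  define J where "J v = ip v v - 2 * l v" for v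
  have VH: "v \<in> V \<Longrightarrow> v \<in> H" for v using V by auto
  have lb: "- \<bar>C\<bar> \<le> J v" if "v \<in> V" for v
  proof -
    have "(l v)\<^sup>2 \<le> \<bar>C\<bar> * ip v v"
      using l_bdd[OF that] nonneg[OF VH[OF that]] by (meson abs_ge_self mult_right_mono order_trans)
    moreover have "(\<bar>C\<bar> - ip v v)\<^sup>2 \<ge> 0" by simp
    ultimately have "4 * (l v)\<^sup>2 \<le> (\<bar>C\<bar> + ip v v)\<^sup>2" by (simp add: power2_eq_square algebra_simps)
    then have "(2 * l v)\<^sup>2 \<le> (\<bar>C\<bar> + ip v v)\<^sup>2" by (simp add: power_mult_distrib)
    then have "2 * l v \<le> \<bar>C\<bar> + ip v v" using nonneg[OF VH[OF that]]
      by (meson abs_ge_zero abs_le_square_iff add_nonneg_nonneg abs_le_D1 abs_of_nonneg order_trans power2_le_imp_le)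
    then show ?thesis by (simp add: J_def)
  qed
  define d where "d = (INF v\<in>V. J v)"
  have bdd: "bdd_below (J ` V)" using lb by (auto intro!: bdd_belowI2)
  have dle: "d \<le> J v" if "v \<in> V" for v unfolding d_def using bdd that by (rule cINF_lower)
  have "\<exists>v\<in>V. J v < d + 1 / Suc n" for n
  proof -
    have "(INF v\<in>V. J v) < d + 1 / Suc n" unfolding d_def[symmetric] by simp
    then show ?thesis using cINF_less_iff[OF _ bdd] V0 by blast
  qed
  then obtain w where w: "\<And>n::nat. w n \<in> V" "\<And>n. J (w n) < d + 1 / Suc n" by metis
  have wH: "w n \<in> H" for n using w VH by blast
  have half: "(\<lambda>x. (1/2) * u x + (1/2) * v x) \<in> V" if "u \<in> V" "v \<in> V" for u v
    using Vlin[OF that] .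
  have par: "ip (\<lambda>x. u x - v x) (\<lambda>x. u x - v x) \<le> 2 * J u + 2 * J v - 4 * d" if "u \<in> V" "v \<in> V" for u v
  proof -
    have "J (\<lambda>x. (1/2) * u x + (1/2) * v x) = (ip u u + 2 * ip u v + ip v v) / 4 - (l u + l v)"
      unfolding J_def l_lin[OF that] lin_sq[OF VH[OF that(1)] VH[OF that(2)]]
      by (simp add: field_simps power2_eq_square)
    moreover have "ip (\<lambda>x. u x - v x) (\<lambda>x. u x - v x) = ip u u - 2 * ip u v + ip v v"
      using sym[of u v] VH that by (simp add: bilin)
    moreover have "d \<le> J (\<lambda>x. (1/2) * u x + (1/2) * v x)" by (rule dle[OF half[OF that]])
    ultimately have dd: "d \<le> (ip u u + 2 * ip u v + ip v v) / 4 - (l u + l v)"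
      and *: "ip (\<lambda>x. u x - v x) (\<lambda>x. u x - v x) = ip u u - 2 * ip u v + ip v v" by (simp_all only:)
    have aux: "4 * r \<le> a + 2 * b + c - 4 * (p + q)" if "r \<le> (a + 2 * b + c) / 4 - (p + q)"
      for r a b c p q :: real using that by (simp add: field_simps)
    have aux2: "a - 2 * b + c \<le> 2 * (a - 2 * p) + 2 * (c - 2 * q) - 4 * r"
      if "4 * r \<le> a + 2 * b + c - 4 * (p + q)" for r a b c p q :: real using that by (simp add: algebra_simps)
    show ?thesis unfolding J_def[of u] J_def[of v] * by (rule aux2[OF aux[OF dd]])
  qed
  have "\<exists>N. \<forall>m\<ge>N. \<forall>n\<ge>N. ip (\<lambda>x. w m x - w n x) (\<lambda>x. w m x - w n x) < e" if "e > 0" for e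
  proof -
    obtain N :: nat where "4 / e < real N" using reals_Archimedean2 by blast
    then have N: "4 / real (Suc N) < e" using that by (simp add: field_simps)
    have "ip (\<lambda>x. w m x - w n x) (\<lambda>x. w m x - w n x) < e" if mn: "m \<ge> N" "n \<ge> N" for m n
    proof -
      have "ip (\<lambda>x. w m x - w n x) (\<lambda>x. w m x - w n x) \<le> 2 * J (w m) + 2 * J (w n) - 4 * d"
        by (rule par[OF w(1) w(1)])
      also have "\<dots> \<le> 2 / Suc m + 2 / Suc n" using w(2)[of m] w(2)[of n] by simp
      also have "\<dots> \<le> 2 / Suc N + 2 / Suc N"
        using mn by (intro add_mono divide_left_mono) auto
      also have "\<dots> < e" using N by simp
      finally show ?thesis .
    qed
    then show ?thesis by blast
  qed
  from complete[OF wH this] obtain y where y: "y \<in> H"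
    and lim: "(\<lambda>n. ip (\<lambda>x. w n x - y x) (\<lambda>x. w n x - y x)) \<longlonglongrightarrow> 0" by blast
  have eq: "ip y v = l v" if v: "v \<in> V" for v
  proof -
    have vH: "v \<in> H" using VH v .
    have key: "\<bar>ip (w n) v - l v\<bar>\<^sup>2 \<le> (1 / Suc n) * (ip v v + 1)" for n
    proof -
      define t where "t = - (ip (w n) v - l v) / (ip v v + 1)"
      have pos: "ip v v + 1 > 0" using nonneg[OF vH] by simp
      have "(\<lambda>x. 1 * w n x + t * v x) \<in> V" by (rule Vlin[OF w(1) v])
      from dle[OF this] have "d \<le> J (w n) + 2 * t * (ip (w n) v - l v) + t\<^sup>2 * ip v v"
        unfolding J_def l_lin[OF w(1) v] lin_left[OF wH vH lin_mem[OF wH vH]] lin_right[OF wH vH wH]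
          lin_right[OF wH vH vH]
        using sym[OF wH vH, of n] by (simp add: algebra_simps power2_eq_square)
      also have "\<dots> \<le> J (w n) + 2 * t * (ip (w n) v - l v) + t\<^sup>2 * (ip v v + 1)"
        by (simp add: distrib_left)
      also have "\<dots> = J (w n) - (ip (w n) v - l v)\<^sup>2 / (ip v v + 1)"
      proof -
        have "2 * (- z / p) * z + (- z / p)\<^sup>2 * p = - (z\<^sup>2 / p)" if "p > 0" for z p :: real
          using that by (simp add: power2_eq_square field_simps)
        from this[OF pos, of "ip (w n) v - l v"] show ?thesis unfolding t_def by linarith
      qed
      finally have "(ip (w n) v - l v)\<^sup>2 / (ip v v + 1) \<le> 1 / Suc n" using w(2)[of n] by simp
      then show ?thesis using pos by (simp add: divide_le_eq)
    qed
    have "(\<lambda>n. (1 / Suc n) * (ip v v + 1)) \<longlonglongrightarrow> 0 * (ip v v + 1)"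
      by (intro tendsto_intros LIMSEQ_Suc[OF lim_1_over_n])
    then have "(\<lambda>n. \<bar>ip (w n) v - l v\<bar>\<^sup>2) \<longlonglongrightarrow> 0"
      using key by (rule_tac Lim_null_comparison[where g="\<lambda>n. (1 / Suc n) * (ip v v + 1)"]) simp_all
    then have "(\<lambda>n. sqrt (\<bar>ip (w n) v - l v\<bar>\<^sup>2)) \<longlonglongrightarrow> sqrt 0" by (rule tendsto_real_sqrt)
    then have "(\<lambda>n. ip (w n) v - l v) \<longlonglongrightarrow> 0" by (simp add: tendsto_rabs_zero_iff)
    then have "(\<lambda>n. ip (w n) v) \<longlonglongrightarrow> l v" by (simp add: LIM_zero_iff)
    with limit_left[OF wH y vH lim] show ?thesis by (rule LIMSEQ_unique)
  qed
  have appr: "\<exists>v\<in>V. ip (\<lambda>x. y x - v x) (\<lambda>x. y x - v x) < e" if "e > 0" for e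
  proof -
    from order_tendstoD(2)[OF lim that] obtain n where "ip (\<lambda>x. w n x - y x) (\<lambda>x. w n x - y x) < e"
      by (auto simp: eventually_sequentially)
    moreover have "ip (\<lambda>x. y x - w n x) (\<lambda>x. y x - w n x) = ip (\<lambda>x. w n x - y x) (\<lambda>x. w n x - y x)"
      using wH y by (simp add: bilin)
    ultimately have "ip (\<lambda>x. y x - w n x) (\<lambda>x. y x - w n x) < e" by (simp only:)
    then show ?thesis by (rule bexI[OF _ w(1)])
  qed
  show thesis using that[OF y eq appr] .
qed

text \<open>A gliding hump argument: if the norms of a subsequence exceed 4^k, successive steps of
  length 3^-k can be taken so that the k-th pairing is at least (4/3)^k after step k; the later
  steps add up to at most half of step k, so that the limit point still sees half of this
  growth.\<close>

lemma uniform_boundedness: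
  assumes g: "\<And>n::nat. g n \<in> H" and pt: "\<And>v. v \<in> H \<Longrightarrow> \<exists>c. \<forall>n. \<bar>ip (g n) v\<bar> \<le> c"
  shows "\<exists>c. \<forall>n. nrm (g n) \<le> c"
proof (rule ccontr)
  assume "\<not> ?thesis"
  then have "\<exists>n. nrm (g n) > 4 ^ k" for k :: nat by (meson not_le)
  then obtain N where N: "\<And>k::nat. nrm (g (N k)) > 4 ^ k" by metis
  \<comment> \<open>moving from x by r in the direction of g n, with the sign that does not decrease the modulus of the pairing\<close>
  have ex: "\<exists>y\<in>H. nrm (\<lambda>z. y z - x z) = r \<and> r * nrm (g n) \<le> \<bar>ip (g n) y\<bar>"
    if x: "x \<in> H" and r: "r > 0" and n: "nrm (g n) > 0" for x r n
  proof -
    define s where "s = r / nrm (g n) * (if ip (g n) x \<ge> 0 then 1 else -1)"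
    define y where "y z = x z + s * g n z" for z
    have yH: "y \<in> H" unfolding y_def by (intro mems x g)
    have "(\<lambda>z. y z - x z) = (\<lambda>z. s * g n z)" by (simp add: y_def)
    then have "nrm (\<lambda>z. y z - x z) = \<bar>s\<bar> * nrm (g n)"
      by (simp add: nrm_def bilin g real_sqrt_mult flip: mult.assoc)
    also have "\<dots> = r" using r n by (simp add: s_def abs_mult)
    finally have a: "nrm (\<lambda>z. y z - x z) = r" .
    have "ip (g n) y = ip (g n) x + s * (nrm (g n))\<^sup>2"
      unfolding y_def by (simp add: bilin g x nrm_sq)
    also have "s * (nrm (g n))\<^sup>2 = r * nrm (g n) * (if ip (g n) x \<ge> 0 then 1 else -1)"
      using n by (simp add: s_def power2_eq_square)
    finally have "\<bar>ip (g n) y\<bar> \<ge> r * nrm (g n)" using r n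
      by (auto simp: abs_if not_less split: if_splits)
    then show ?thesis using a yH by blast
  qed
  define P where "P k x y \<longleftrightarrow> nrm (\<lambda>z. y z - x z) = (1/3) ^ k \<and> (1/3) ^ k * nrm (g (N k)) \<le> \<bar>ip (g (N k)) y\<bar>"
    for k :: nat and x y
  have Npos: "nrm (g (N k)) > 0" for k using N[of k] by (meson less_trans zero_less_numeral zero_less_power)
  have "\<exists>f. \<forall>n. f n \<in> H \<and> P (Suc n) (f n) (f (Suc n))"
  proof (rule dependent_nat_choice)
    show "\<exists>x. x \<in> H" using zero_mem by blast
    show "\<exists>y. y \<in> H \<and> P (Suc n) x y" if "x \<in> H" for x n
      using ex[OF that _ Npos, of "(1/3) ^ Suc n" "Suc n"] unfolding P_def by auto
  qed
  then obtain f where f: "\<And>n. f n \<in> H" "\<And>n. P (Suc n) (f n) (f (Suc n))" by auto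
  have step: "nrm (\<lambda>z. f (n + k) z - f n z) \<le> (1/2) * (1/3) ^ n * (1 - (1/3)^k)" for n k
  proof (induction k)
    case 0
    have "ip (\<lambda>z. 0) (\<lambda>z. 0) = 0" using scale_left[OF zero_mem zero_mem, of 0] by simp
    then show ?case by (simp add: nrm_def)
  next
    case (Suc k)
    have "nrm (\<lambda>z. (f (n + Suc k) z - f (n + k) z) + (f (n + k) z - f n z))
        \<le> nrm (\<lambda>z. f (n + Suc k) z - f (n + k) z) + nrm (\<lambda>z. f (n + k) z - f n z)"
      by (intro nrm_triangle mems f)
    also have "\<dots> \<le> (1/3) ^ (Suc (n + k)) + (1/2) * (1/3) ^ n * (1 - (1/3)^k)"
      using f(2)[of "n + k"] Suc by (simp add: P_def)
    also have "\<dots> = (1/2) * (1/3) ^ n * (1 - (1/3)^Suc k)" by (simp add: power_add field_simps)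
    finally show ?case by simp
  qed
  have stepb: "nrm (\<lambda>z. f (n + k) z - f n z) \<le> (1/2) * (1/3) ^ n" for n k
  proof -
    have "(1/2) * (1/3::real) ^ n * (1 - (1/3)^k) \<le> (1/2) * (1/3) ^ n * 1"
      by (intro mult_left_mono) auto
    then show ?thesis using step[of n k] unfolding mult_1_right by (rule order_trans[rotated])
  qed
  have stepb2: "ip (\<lambda>z. f m z - f n z) (\<lambda>z. f m z - f n z) \<le> ((1/2) * (1/3) ^ n)\<^sup>2" if "n \<le> m" for m n
    using power_mono[OF stepb[of n "m - n"] nrm_nonneg, of 2] that f(1) by (simp add: nrm_sq mems)
  have "\<exists>M. \<forall>m\<ge>M. \<forall>n\<ge>M. ip (\<lambda>x. f m x - f n x) (\<lambda>x. f m x - f n x) < e" if "e > 0" for e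
  proof -
    have "(\<lambda>n. 4 * ((1/2) * (1/3::real) ^ n)\<^sup>2) \<longlonglongrightarrow> 4 * ((1/2) * 0)\<^sup>2"
      by (intro tendsto_intros LIMSEQ_power_zero) auto
    then have "eventually (\<lambda>n. 4 * ((1/2) * (1/3::real) ^ n)\<^sup>2 < e) sequentially"
      using that by (intro order_tendstoD(2)) auto
    then obtain M where M: "4 * ((1/2) * (1/3::real) ^ M)\<^sup>2 < e" by (auto simp: eventually_sequentially)
    have "ip (\<lambda>x. f m x - f n x) (\<lambda>x. f m x - f n x) < e" if mn: "m \<ge> M" "n \<ge> M" for m n
    proof -
      have "ip (\<lambda>x. (f m x - f M x) - (f n x - f M x)) (\<lambda>x. (f m x - f M x) - (f n x - f M x))
        \<le> 2 * ip (\<lambda>z. f m z - f M z) (\<lambda>z. f m z - f M z) + 2 * ip (\<lambda>z. f n z - f M z) (\<lambda>z. f n z - f M z)"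
        by (intro sq_diff_le mems f)
      also have "\<dots> \<le> 2 * ((1/2) * (1/3) ^ M)\<^sup>2 + 2 * ((1/2) * (1/3) ^ M)\<^sup>2"
        by (intro add_mono mult_left_mono stepb2 mn) auto
      also have "\<dots> < e" using M by simp
      finally show ?thesis by simp
    qed
    then show ?thesis by blast
  qed
  from complete[OF f(1) this] obtain y where y: "y \<in> H"
    and lim: "(\<lambda>n. ip (\<lambda>x. f n x - y x) (\<lambda>x. f n x - y x)) \<longlonglongrightarrow> 0" by blast
  have dist: "nrm (\<lambda>z. f n z - y z) \<le> (1/2) * (1/3) ^ n" for n
  proof (rule field_le_epsilon)
    fix e :: real assume e: "e > 0"
    have "(\<lambda>n. sqrt (ip (\<lambda>x. f n x - y x) (\<lambda>x. f n x - y x))) \<longlonglongrightarrow> sqrt 0" using lim by (rule tendsto_real_sqrt)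
    then have "eventually (\<lambda>n. nrm (\<lambda>x. f n x - y x) < e) sequentially"
      using e by (intro order_tendstoD(2)) (auto simp: nrm_def)
    then obtain k where k: "nrm (\<lambda>x. f (n + k) x - y x) < e"
      by (auto simp: eventually_sequentially) (metis add.commute le_add1)
    have "nrm (\<lambda>z. (f (n + k) z - y z) + (- 1) * (f (n + k) z - f n z))
      \<le> nrm (\<lambda>x. f (n + k) x - y x) + nrm (\<lambda>z. (- 1) * (f (n + k) z - f n z))"
      by (intro nrm_triangle mems f y)
    also have "nrm (\<lambda>z. (- 1) * (f (n + k) z - f n z)) = nrm (\<lambda>z. f (n + k) z - f n z)"
      unfolding nrm_def scale_left[OF diff_mem[OF f(1) f(1)] scale_mem[OF diff_mem[OF f(1) f(1)]]]
        scale_right[OF diff_mem[OF f(1) f(1)] diff_mem[OF f(1) f(1)]] by simp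
    finally show "nrm (\<lambda>z. f n z - y z) \<le> (1/2) * (1/3) ^ n + e" using k stepb[of n k] by simp
  qed
  obtain c where c: "\<And>n. \<bar>ip (g n) y\<bar> \<le> c" using pt[OF y] by blast
  have grow: "(1/2) * (4/3) ^ Suc k \<le> c" for k
  proof -
    let ?n = "N (Suc k)"
    have "(1/3) ^ Suc k * nrm (g ?n) \<le> \<bar>ip (g ?n) (f (Suc k))\<bar>" using f(2)[of k] by (simp add: P_def)
    also have "\<bar>ip (g ?n) (f (Suc k))\<bar> \<le> \<bar>ip (g ?n) y\<bar> + \<bar>ip (g ?n) (\<lambda>z. f (Suc k) z - y z)\<bar>"
      by (simp add: bilin f g y)
    also have "\<bar>ip (g ?n) (\<lambda>z. f (Suc k) z - y z)\<bar> \<le> nrm (g ?n) * ((1/2) * (1/3) ^ Suc k)"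
      using cauchy_schwarz[OF g diff_mem[OF f(1) y], of ?n "Suc k"] dist[of "Suc k"] nrm_nonneg[OF g, of ?n]
      by (meson mult_left_mono order_trans)
    finally have "(1/3) ^ Suc k * nrm (g ?n) - nrm (g ?n) * ((1/2) * (1/3) ^ Suc k) \<le> c"
      using c[of ?n] by linarith
    then have "(1/2) * (1/3) ^ Suc k * nrm (g ?n) \<le> c" by (simp add: algebra_simps)
    moreover have "(1/2) * ((1/3) ^ Suc k * 4 ^ Suc k) \<le> (1/2) * (1/3) ^ Suc k * nrm (g ?n)"
      unfolding mult.assoc using N[of "Suc k"] by (intro mult_left_mono) auto
    ultimately have "(1/2) * ((1/3) ^ Suc k * 4 ^ Suc k) \<le> c" by (rule order_trans[rotated])
    moreover have "(1/3::real) ^ Suc k * 4 ^ Suc k = (4/3) ^ Suc k"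
      unfolding power_mult_distrib[symmetric] by simp
    ultimately show ?thesis by (simp only:)
  qed
  obtain k where "2 * c < (4/3::real) ^ k" using real_arch_pow[of "4/3" "2 * c"] by auto
  also have "\<dots> \<le> (4/3) ^ Suc k" by simp
  finally show False using grow[of k] by simp
qed

end

section \<open>Square-integrable functions\<close>

lemma L2_borel: "f \<in> L2 \<mu> \<Omega> \<Longrightarrow> f \<in> borel_measurable borel"
  by (simp add: L2_def)

lemma L2_prod_integrable:
  assumes s: "sets \<mu> = sets borel" and O: "\<Omega> \<in> sets borel" and f: "f \<in> L2 \<mu> \<Omega>" and g: "g \<in> L2 \<mu> \<Omega>"
  shows "set_integrable \<mu> \<Omega> (\<lambda>x. f x * g x)"
proof -
  have [measurable_cong]: "sets \<mu> = sets borel" by (rule s)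
  have [measurable]: "f \<in> borel_measurable borel" "g \<in> borel_measurable borel" "\<Omega> \<in> sets borel"
    using f g O by (auto simp: L2_def)
  have i: "set_integrable \<mu> \<Omega> (\<lambda>x. (f x)\<^sup>2 + (g x)\<^sup>2)"
    using f g by (intro set_integral_add) (auto simp: L2_def)
  have "\<bar>a * b\<bar> \<le> \<bar>a\<^sup>2 + b\<^sup>2\<bar>" for a b :: real
  proof -
    have "0 \<le> (\<bar>a\<bar> - \<bar>b\<bar>)\<^sup>2" by simp
    then have "2 * (\<bar>a\<bar> * \<bar>b\<bar>) \<le> a\<^sup>2 + b\<^sup>2" by (simp add: power2_eq_square algebra_simps)
    moreover have "0 \<le> \<bar>a\<bar> * \<bar>b\<bar>" by simp
    ultimately show ?thesis unfolding abs_mult by linarith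
  qed
  then show ?thesis
    unfolding set_integrable_def
    by (intro Bochner_Integration.integrable_bound[OF i[unfolded set_integrable_def]])
       (auto intro!: AE_I2 simp: indicator_def)
qed

lemma L2_lin:
  assumes s: "sets \<mu> = sets borel" and O: "\<Omega> \<in> sets borel" and f: "f \<in> L2 \<mu> \<Omega>" and g: "g \<in> L2 \<mu> \<Omega>"
  shows "(\<lambda>x. a * f x + b * g x) \<in> L2 \<mu> \<Omega>"
proof -
  have "set_integrable \<mu> \<Omega> (\<lambda>x. a\<^sup>2 * (f x)\<^sup>2 + (2 * a * b) * (f x * g x) + b\<^sup>2 * (g x)\<^sup>2)"
    using f g L2_prod_integrable[OF s O f g]
    by (intro set_integral_add set_integrable_mult_right) (auto simp: L2_def)
  moreover have "(\<lambda>x. a\<^sup>2 * (f x)\<^sup>2 + (2 * a * b) * (f x * g x) + b\<^sup>2 * (g x)\<^sup>2) = (\<lambda>x. (a * f x + b * g x)\<^sup>2)"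
    by (auto simp: power2_eq_square algebra_simps)
  ultimately show ?thesis using f g by (auto simp: L2_def)
qed

lemma L2_of_bound:
  assumes s: "sets \<mu> = sets borel" and O: "\<Omega> \<in> sets borel" and f: "f \<in> borel_measurable borel" and g: "g \<in> L2 \<mu> \<Omega>"
    and b: "AE x in \<mu>. x \<in> \<Omega> \<longrightarrow> \<bar>f x\<bar> \<le> \<bar>g x\<bar>"
  shows "f \<in> L2 \<mu> \<Omega>"
proof -
  have [measurable_cong]: "sets \<mu> = sets borel" by (rule s)
  note [measurable] = f O
  have "set_integrable \<mu> \<Omega> (\<lambda>x. (f x)\<^sup>2)"
    unfolding set_integrable_def
  proof (rule Bochner_Integration.integrable_bound)
    show "integrable \<mu> (\<lambda>x. indicator \<Omega> x *\<^sub>R (g x)\<^sup>2)" using g by (simp add: L2_def set_integrable_def)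
    show "AE x in \<mu>. norm (indicator \<Omega> x *\<^sub>R (f x)\<^sup>2) \<le> norm (indicator \<Omega> x *\<^sub>R (g x)\<^sup>2)"
      using b by eventually_elim (auto simp: indicator_def abs_le_square_iff)
  qed measurable
  then show ?thesis using f by (simp add: L2_def)
qed

lemma L2_of_bounded:
  assumes s: "sets \<mu> = sets borel" and O: "\<Omega> \<in> sets borel" and f: "f \<in> borel_measurable borel"
    and fin: "emeasure \<mu> \<Omega> < \<infinity>"
    and b: "AE x in \<mu>. x \<in> \<Omega> \<longrightarrow> \<bar>f x\<bar> \<le> K"
  shows "f \<in> L2 \<mu> \<Omega>"
proof (rule L2_of_bound[OF s O f])
  show "(\<lambda>x. K) \<in> L2 \<mu> \<Omega>" using O s fin unfolding L2_def set_integrable_def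
    by (auto intro!: integrable_mult_left integrable_real_indicator)
  show "AE x in \<mu>. x \<in> \<Omega> \<longrightarrow> \<bar>f x\<bar> \<le> \<bar>K\<bar>" using b by eventually_elim auto
qed

text \<open>On a set of finite measure an L2-Cauchy sequence is L1-Cauchy, hence converges almost
  everywhere along a subsequence; Fatou's lemma identifies the pointwise limit as the L2 limit.\<close>

lemma L2_complete:
  assumes s: "sets \<mu> = sets borel" and O: "\<Omega> \<in> sets borel" and fin: "emeasure \<mu> \<Omega> < \<infinity>"
    and f: "\<And>n::nat. f n \<in> L2 \<mu> \<Omega>"
    and cau: "\<And>e. e > 0 \<Longrightarrow> \<exists>N. \<forall>m\<ge>N. \<forall>n\<ge>N. (LINT x:\<Omega>|\<mu>. (f m x - f n x) * (f m x - f n x)) < e"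
  shows "\<exists>g\<in>L2 \<mu> \<Omega>. (\<lambda>n. LINT x:\<Omega>|\<mu>. (f n x - g x) * (f n x - g x)) \<longlonglongrightarrow> 0"
proof -
  have [measurable_cong]: "sets \<mu> = sets borel" by (rule s)
  have [measurable]: "\<And>n. f n \<in> borel_measurable borel" "\<Omega> \<in> sets borel"
    using f O by (auto simp: L2_def)
  define M where "M = measure \<mu> \<Omega>"
  define h where "h n x = indicator \<Omega> x * f n x" for n x
  have const: "(\<lambda>x. c) \<in> L2 \<mu> \<Omega>" for c
    by (rule L2_of_bounded[OF s O _ fin, where K="\<bar>c\<bar>"]) auto
  have d: "(\<lambda>x. f m x - f n x) \<in> L2 \<mu> \<Omega>" for m n
    using L2_lin[OF s O f f, of 1 m "-1" n] by simp
  have dsq: "integrable \<mu> (\<lambda>x. indicator \<Omega> x * (f m x - f n x)\<^sup>2)" for m n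
    using d[of m n] by (simp add: L2_def set_integrable_def)
  have hi: "integrable \<mu> (h n)" for n
    using L2_prod_integrable[OF s O f const[of 1], of n] by (simp add: h_def[abs_def] set_integrable_def)
  have Iind: "integrable \<mu> (indicat_real \<Omega>)" using fin O s by (simp add: integrable_indicator_iff)
  have L1: "\<exists>N. \<forall>i\<ge>N. \<forall>j\<ge>N. (LINT x|\<mu>. norm (h i x - h j x)) < e" if e: "e > 0" for e
  proof -
    define \<eta> where "\<eta> = e / (M + 1)"
    have M0: "M \<ge> 0" by (simp add: M_def)
    have \<eta>: "\<eta> > 0" using e M0 by (simp add: \<eta>_def)
    obtain N where N: "\<And>m n. m \<ge> N \<Longrightarrow> n \<ge> N \<Longrightarrow> (LINT x:\<Omega>|\<mu>. (f m x - f n x) * (f m x - f n x)) < \<eta> * e"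
      using cau[of "\<eta> * e"] e \<eta> by auto
    have "(LINT x|\<mu>. norm (h i x - h j x)) < e" if ij: "i \<ge> N" "j \<ge> N" for i j
    proof -
      have "(LINT x|\<mu>. norm (h i x - h j x))
        \<le> (LINT x|\<mu>. (\<eta> / 2) * indicator \<Omega> x + (1 / (2 * \<eta>)) * (indicator \<Omega> x * (f i x - f j x)\<^sup>2))"
      proof (intro integral_mono)
        show "integrable \<mu> (\<lambda>x. norm (h i x - h j x))"
          by (intro integrable_norm Bochner_Integration.integrable_diff hi)
        show "integrable \<mu> (\<lambda>x. (\<eta> / 2) * indicator \<Omega> x + (1 / (2 * \<eta>)) * (indicator \<Omega> x * (f i x - f j x)\<^sup>2))"
          by (intro Bochner_Integration.integrable_add integrable_mult_right dsq Iind)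
        fix x
        have "\<bar>a\<bar> \<le> \<eta> / 2 + (1 / (2 * \<eta>)) * a\<^sup>2" for a
        proof -
          have "0 \<le> (\<bar>a\<bar> - \<eta>)\<^sup>2" by simp
          then have "2 * \<eta> * \<bar>a\<bar> \<le> \<eta>\<^sup>2 + a\<^sup>2" by (simp add: power2_eq_square algebra_simps)
          then show ?thesis using \<eta> by (simp add: field_simps power2_eq_square)
        qed
        then show "norm (h i x - h j x) \<le> (\<eta> / 2) * indicator \<Omega> x + (1 / (2 * \<eta>)) * (indicator \<Omega> x * (f i x
          - f j x)\<^sup>2)"
          by (auto simp: h_def indicator_def)
      qed
      also have "\<dots> = (\<eta> / 2) * M + (1 / (2 * \<eta>)) * (LINT x:\<Omega>|\<mu>. (f i x - f j x) * (f i x - f j x))"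
        using dsq[of i j] Iind O s by (simp add: set_lebesgue_integral_def M_def power2_eq_square
          sets_eq_imp_space_eq[OF s])
      also have "\<dots> < (\<eta> / 2) * M + (1 / (2 * \<eta>)) * (\<eta> * e)"
        using N[OF ij] \<eta> by (intro add_strict_left_mono mult_strict_left_mono) auto
      also have "\<dots> \<le> e"
      proof -
        have "\<eta> * (M + 1) = e" using M0 by (simp add: \<eta>_def)
        then have "\<eta> * M \<le> e" using \<eta> by (simp add: distrib_left)
        moreover have "(1 / (2 * \<eta>)) * (\<eta> * e) = e / 2" using \<eta> by simp
        ultimately show ?thesis by simp
      qed
      finally show ?thesis .
    qed
    then show ?thesis by blast
  qed
  obtain r where r: "strict_mono r" "AE x in \<mu>. Cauchy (\<lambda>i. h (r i) x)"
    using cauchy_L1_AE_cauchy_subseq[OF hi L1] by blast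
  define g where "g x = lim (\<lambda>i. h (r i) x)" for x
  have [measurable]: "g \<in> borel_measurable borel" unfolding g_def h_def by measurable
  have AElim: "AE x in \<mu>. x \<in> \<Omega> \<longrightarrow> (\<lambda>i. f (r i) x) \<longlonglongrightarrow> g x"
    using r(2)
  proof eventually_elim
    case (elim x)
    then have "(\<lambda>i. h (r i) x) \<longlonglongrightarrow> g x" unfolding g_def using Cauchy_convergent convergent_LIMSEQ_iff by blast
    then show ?case by (auto simp: h_def indicator_def)
  qed
  have key: "(\<integral>\<^sup>+x. ennreal (indicator \<Omega> x * (f n x - g x)\<^sup>2) \<partial>\<mu>) \<le> ennreal e"
    if e: "e > 0" and N: "\<And>m n. m \<ge> N \<Longrightarrow> n \<ge> N \<Longrightarrow> (LINT x:\<Omega>|\<mu>. (f m x - f n x) * (f m x - f n x)) < e"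
      and n: "n \<ge> N" for e N n
  proof -
    have "(\<integral>\<^sup>+x. ennreal (indicator \<Omega> x * (f n x - g x)\<^sup>2) \<partial>\<mu>)
       \<le> (\<integral>\<^sup>+x. liminf (\<lambda>i. ennreal (indicator \<Omega> x * (f n x - f (r i) x)\<^sup>2)) \<partial>\<mu>)"
    proof (rule nn_integral_mono_AE)
      show "AE x in \<mu>. ennreal (indicator \<Omega> x * (f n x - g x)\<^sup>2)
        \<le> liminf (\<lambda>i. ennreal (indicator \<Omega> x * (f n x - f (r i) x)\<^sup>2))"
        using AElim
      proof eventually_elim
        case (elim x)
        show ?case
        proof (cases "x \<in> \<Omega>")
          case True
          have "(\<lambda>i. ennreal (indicator \<Omega> x * (f n x - f (r i) x)\<^sup>2)) \<longlonglongrightarrow> ennreal (indicator \<Omega> x * (f n x - g x)\<^sup>2)"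
            using elim True by (intro tendsto_ennrealI tendsto_intros) auto
          from lim_imp_Liminf[OF _ this] show ?thesis by simp
        qed simp
      qed
    qed
    also have "\<dots> \<le> liminf (\<lambda>i. \<integral>\<^sup>+x. ennreal (indicator \<Omega> x * (f n x - f (r i) x)\<^sup>2) \<partial>\<mu>)"
      by (intro nn_integral_liminf) measurable
    also have "\<dots> \<le> ennreal e"
    proof (rule Liminf_le)
      have "eventually (\<lambda>i. r i \<ge> N) sequentially"
        using r(1) by (meson eventually_sequentiallyI le_trans seq_suble)
      then show "eventually (\<lambda>i. (\<integral>\<^sup>+x. ennreal (indicator \<Omega> x * (f n x - f (r i) x)\<^sup>2) \<partial>\<mu>) \<le> ennreal e) sequentially"
      proof eventually_elim
        case (elim i)
        have "(\<integral>\<^sup>+x. ennreal (indicator \<Omega> x * (f n x - f (r i) x)\<^sup>2) \<partial>\<mu>)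
          = ennreal (LINT x|\<mu>. indicator \<Omega> x * (f n x - f (r i) x)\<^sup>2)"
          by (intro nn_integral_eq_integral dsq) auto
        also have "\<dots> \<le> ennreal e" using N[OF n elim]
          by (intro ennreal_leI) (simp add: set_lebesgue_integral_def power2_eq_square)
        finally show ?case .
      qed
    qed simp
    finally show ?thesis .
  qed
  have dg: "integrable \<mu> (\<lambda>x. indicator \<Omega> x * (f n x - g x)\<^sup>2) \<and> (LINT x|\<mu>. indicator \<Omega> x * (f n x - g x)\<^sup>2) \<le> e"
    if e: "e > 0" and N: "\<And>m n. m \<ge> N \<Longrightarrow> n \<ge> N \<Longrightarrow> (LINT x:\<Omega>|\<mu>. (f m x - f n x) * (f m x - f n x)) < e"
      and n: "n \<ge> N" for e N n
  proof -
    have k: "(\<integral>\<^sup>+x. ennreal (indicator \<Omega> x * (f n x - g x)\<^sup>2) \<partial>\<mu>) \<le> ennreal e"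
      by (rule key[OF e _ n]) (rule N)
    have i: "integrable \<mu> (\<lambda>x. indicator \<Omega> x * (f n x - g x)\<^sup>2)"
      using k by (intro integrableI_bounded) (auto intro: le_less_trans simp: ennreal_less_top)
    moreover have "ennreal (LINT x|\<mu>. indicator \<Omega> x * (f n x - g x)\<^sup>2) \<le> ennreal e"
      using k by (subst (asm) nn_integral_eq_integral[OF i]) auto
    ultimately show ?thesis using e by simp
  qed
  obtain N1 where N1: "\<And>m n. m \<ge> N1 \<Longrightarrow> n \<ge> N1 \<Longrightarrow> (LINT x:\<Omega>|\<mu>. (f m x - f n x) * (f m x - f n x)) < 1"
    using cau[of 1] by auto
  have "(\<lambda>x. f N1 x - g x) \<in> L2 \<mu> \<Omega>" using dg[OF _ N1, of N1] by (simp add: L2_def set_integrable_def)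
  from L2_lin[OF s O f this, of 1 N1 "-1"] have gL: "g \<in> L2 \<mu> \<Omega>" by simp
  have "(\<lambda>n. LINT x|\<mu>. indicator \<Omega> x * (f n x - g x)\<^sup>2) \<longlonglongrightarrow> 0"
  proof (rule LIMSEQ_I)
    fix e :: real assume e: "e > 0"
    obtain N where N: "\<And>m n. m \<ge> N \<Longrightarrow> n \<ge> N \<Longrightarrow> (LINT x:\<Omega>|\<mu>. (f m x - f n x) * (f m x - f n x)) < e / 2"
      using cau[of "e / 2"] e by auto
    have "norm ((LINT x|\<mu>. indicator \<Omega> x * (f n x - g x)\<^sup>2) - 0) < e" if "n \<ge> N" for n
    proof -
      have "(LINT x|\<mu>. indicator \<Omega> x * (f n x - g x)\<^sup>2) \<le> e / 2" using dg[OF _ N that] e by simp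
      moreover have "0 \<le> (LINT x|\<mu>. indicator \<Omega> x * (f n x - g x)\<^sup>2)" by (intro integral_nonneg_AE) auto
      ultimately show ?thesis using e by simp
    qed
    then show "\<exists>no. \<forall>n\<ge>no. norm ((LINT x|\<mu>. indicator \<Omega> x * (f n x - g x)\<^sup>2) - 0) < e" by blast
  qed
  then show ?thesis using gL by (auto simp: set_lebesgue_integral_def power2_eq_square)
qed

lemma semi_hilbert_L2:
  assumes s: "sets \<mu> = sets borel" and O: "\<Omega> \<in> sets borel" and fin: "emeasure \<mu> \<Omega> < \<infinity>"
  shows "semi_hilbert (L2 \<mu> \<Omega>) (\<lambda>f g. LINT x:\<Omega>|\<mu>. f x * g x)"
proof
  show "(\<lambda>x. 0) \<in> L2 \<mu> \<Omega>" by (simp add: L2_def set_integrable_def)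
  show "(LINT x:\<Omega>|\<mu>. u x * v x) = (LINT x:\<Omega>|\<mu>. v x * u x)" for u v :: "'a \<Rightarrow> real"
    by (simp only: mult.commute[of "u _"])
  show "0 \<le> (LINT x:\<Omega>|\<mu>. u x * u x)" for u :: "'a \<Rightarrow> real"
    unfolding set_lebesgue_integral_def by (intro integral_nonneg_AE) auto
  show "(LINT x:\<Omega>|\<mu>. (a * u x + b * v x) * w x) = a * (LINT x:\<Omega>|\<mu>. u x * w x) + b * (LINT x:\<Omega>|\<mu>. v x * w x)"
    if "u \<in> L2 \<mu> \<Omega>" "v \<in> L2 \<mu> \<Omega>" "w \<in> L2 \<mu> \<Omega>" for u v w a b
  proof -
    have "(LINT x:\<Omega>|\<mu>. a * (u x * w x) + b * (v x * w x)) = a * (LINT x:\<Omega>|\<mu>. u x * w x) + b * (LINT x:\<Omega>|\<mu>. v x * w x)"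
      using that by (subst set_integral_add) (auto intro!: set_integrable_mult_right L2_prod_integrable[OF s O])
    then show ?thesis by (simp add: algebra_simps)
  qed
qed (auto intro: L2_lin[OF s O] L2_complete[OF s O fin])

section \<open>The form domain as a Hilbert space\<close>

locale metric_measure =
  fixes \<mu> :: "'a::polish_space measure"
  assumes mms: "metric_measure_space \<mu>"
begin

lemma sets_mu[measurable_cong]: "sets \<mu> = sets borel"
  using mms by (simp add: metric_measure_space_def radon_on_def)

lemma space_mu[simp]: "space \<mu> = UNIV"
  using sets_eq_imp_space_eq[OF sets_mu] by simp

lemma compact_cball: "compact (cball (x::'a) r)"
proof -
  have c: "compact (closure (ball x (r + 1)))" using mms by (simp add: metric_measure_space_def)
  have "cball x r \<subseteq> ball x (r + 1)" by auto
  then have "cball x r \<subseteq> closure (ball x (r + 1))" using closure_subset by blast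
  then have "cball x r = cball x r \<inter> closure (ball x (r + 1))" by blast
  then show ?thesis using closed_Int_compact[OF closed_cball c] by metis
qed

lemma emeasure_compact: "compact K \<Longrightarrow> emeasure \<mu> K < \<infinity>"
  using mms by (auto simp: metric_measure_space_def radon_on_def)

lemma emeasure_cball: "emeasure \<mu> (cball x r) < \<infinity>"
  by (intro emeasure_compact compact_cball)

lemma emeasure_ball: "emeasure \<mu> (ball x r) < \<infinity>"
proof -
  have "emeasure \<mu> (ball x r) \<le> emeasure \<mu> (cball x r)" by (intro emeasure_mono) (auto simp: sets_mu)
  then show ?thesis using emeasure_cball[of x r] by (rule le_less_trans)
qed

lemma emeasure_ball_pos: "r > 0 \<Longrightarrow> emeasure \<mu> (ball x r) > 0"
  using mms by (auto simp: metric_measure_space_def)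

lemma sigma_finite: "sigma_finite_measure \<mu>"
proof
  fix x0 :: 'a
  show "\<exists>A. countable A \<and> A \<subseteq> sets \<mu> \<and> \<Union>A = space \<mu> \<and> (\<forall>a\<in>A. emeasure \<mu> a \<noteq> \<infinity>)"
  proof (intro exI conjI ballI)
    let ?A = "range (\<lambda>n::nat. ball x0 (real n))"
    show "countable ?A" by simp
    show "?A \<subseteq> sets \<mu>" by (auto simp: sets_mu)
    show "\<Union>?A = space \<mu>" using reals_Archimedean2 by (auto simp: space_mu)
    show "emeasure \<mu> a \<noteq> \<infinity>" if "a \<in> ?A" for a using that emeasure_ball by (auto simp: less_top[symmetric])
  qed
qed

end

sublocale metric_measure \<subseteq> sigma_finite_measure \<mu>
  by (rule sigma_finite)

locale jump_diffusion = metric_measure \<mu> for \<mu> :: "'a::polish_space measure" +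
  fixes F :: "('a \<Rightarrow> real) set" and E EL :: "('a \<Rightarrow> real) \<Rightarrow> ('a \<Rightarrow> real) \<Rightarrow> real"
    and j :: "('a \<times> 'a) measure" and J :: "'a \<Rightarrow> 'a measure"
  assumes reg: "regular_dirichlet_form \<mu> F E"
    and bd: "beurling_deny_without_killing \<mu> F E EL j J"
begin

lemma dir: "dirichlet_form \<mu> F E" using reg by (simp add: regular_dirichlet_form_def)
lemma fdom: "form_domain \<mu> F" using dir by (simp add: dirichlet_form_def)
lemma Esym: "symmetric_form \<mu> F E" using dir by (simp add: dirichlet_form_def)
lemma ELsym: "symmetric_form \<mu> F EL" using bd by (simp add: beurling_deny_without_killing_def)

lemma F_L2: "u \<in> F \<Longrightarrow> u \<in> L2 \<mu> UNIV" using fdom by (auto simp: form_domain_def)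
lemma F_borel: "u \<in> F \<Longrightarrow> u \<in> borel_measurable borel" using F_L2 L2_borel by blast
lemma F_cong: "u \<in> F \<Longrightarrow> v \<in> borel_measurable borel \<Longrightarrow> AE x in \<mu>. u x = v x \<Longrightarrow> v \<in> F"
  using fdom by (auto simp: form_domain_def)
lemma F_zero: "(\<lambda>x. 0) \<in> F" using fdom unfolding form_domain_def by blast
lemma F_lin: "u \<in> F \<Longrightarrow> v \<in> F \<Longrightarrow> (\<lambda>x. a * u x + b * v x) \<in> F" using fdom unfolding form_domain_def by blast
lemma L2_prod: "f \<in> L2 \<mu> UNIV \<Longrightarrow> g \<in> L2 \<mu> UNIV \<Longrightarrow> integrable \<mu> (\<lambda>x. f x * g x)"
  using L2_prod_integrable[OF sets_mu, of UNIV f g] by (simp add: set_integrable_def)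

lemma L2_UNIV_diff: "f \<in> L2 \<mu> UNIV \<Longrightarrow> g \<in> L2 \<mu> UNIV \<Longrightarrow> (\<lambda>x. f x - g x) \<in> L2 \<mu> UNIV"
  using L2_lin[OF sets_mu, of UNIV f g 1 "-1"] by simp

lemma E_lin: "u \<in> F \<Longrightarrow> v \<in> F \<Longrightarrow> w \<in> F \<Longrightarrow> E (\<lambda>x. a * u x + b * v x) w = a * E u w + b * E v w"
  using Esym unfolding symmetric_form_def by blast
lemma E_commute: "u \<in> F \<Longrightarrow> v \<in> F \<Longrightarrow> E u v = E v u" using Esym unfolding symmetric_form_def by blast
lemma E_nonneg: "u \<in> F \<Longrightarrow> 0 \<le> E u u" using Esym unfolding symmetric_form_def by blast
lemma E_cong: "u \<in> F \<Longrightarrow> u' \<in> F \<Longrightarrow> v \<in> F \<Longrightarrow> AE x in \<mu>. u x = u' x \<Longrightarrow> E u v = E u' v"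
  using Esym unfolding symmetric_form_def by blast
lemma EL_lin: "u \<in> F \<Longrightarrow> v \<in> F \<Longrightarrow> w \<in> F \<Longrightarrow> EL (\<lambda>x. a * u x + b * v x) w = a * EL u w + b * EL v w"
  using ELsym unfolding symmetric_form_def by blast
lemma EL_commute: "u \<in> F \<Longrightarrow> v \<in> F \<Longrightarrow> EL u v = EL v u" using ELsym unfolding symmetric_form_def by blast
lemma EL_nonneg: "u \<in> F \<Longrightarrow> 0 \<le> EL u u" using ELsym unfolding symmetric_form_def by blast

lemma E_split: "u \<in> F \<Longrightarrow> v \<in> F \<Longrightarrow> E u v = EL u v + jump_form j u v"
  using bd by (simp add: beurling_deny_without_killing_def)

lemma jm: "jump_measure \<mu> j J" using bd by (simp add: beurling_deny_without_killing_def)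

abbreviation E1' where "E1' \<equiv> E1 \<mu> E"

sublocale l2: semi_inner "L2 \<mu> UNIV" "\<lambda>f g. LINT x|\<mu>. f x * g x"
proof
  show "(\<lambda>x. 0) \<in> L2 \<mu> UNIV" by (simp add: L2_def set_integrable_def)
  show "(LINT x|\<mu>. u x * v x) = (LINT x|\<mu>. v x * u x)" for u v :: "'a \<Rightarrow> real"
    by (simp only: mult.commute[of "u _"])
  show "0 \<le> (LINT x|\<mu>. u x * u x)" for u :: "'a \<Rightarrow> real"
    by (intro integral_nonneg_AE) auto
  show "(LINT x|\<mu>. (a * u x + b * v x) * w x) = a * (LINT x|\<mu>. u x * w x) + b * (LINT x|\<mu>. v x * w x)"
    if "u \<in> L2 \<mu> UNIV" "v \<in> L2 \<mu> UNIV" "w \<in> L2 \<mu> UNIV" for u v w a b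
  proof -
    have "(LINT x|\<mu>. a * (u x * w x) + b * (v x * w x)) = a * (LINT x|\<mu>. u x * w x) + b * (LINT x|\<mu>. v x * w x)"
      using L2_prod that by simp
    then show ?thesis by (simp add: algebra_simps)
  qed
qed (auto intro: L2_lin[OF sets_mu])

sublocale en: semi_inner F E
  by unfold_locales (auto intro: F_zero F_lin E_commute E_lin E_nonneg)

sublocale el: semi_inner F EL
  by unfold_locales (auto intro: F_zero F_lin EL_commute EL_lin EL_nonneg)

sublocale e1: semi_hilbert F "E1 \<mu> E"
proof
  show "E1' u v = E1' v u" if "u \<in> F" "v \<in> F" for u v
  proof -
    have "(LINT x|\<mu>. u x * v x) = (LINT x|\<mu>. v x * u x)" by (simp only: mult.commute[of "u _"])
    then show ?thesis unfolding E1_def using E_commute[OF that] by simp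
  qed
  show "E1' (\<lambda>x. a * u x + b * v x) w = a * E1' u w + b * E1' v w" if "u \<in> F" "v \<in> F" "w \<in> F" for u v w a b
  proof -
    have "(LINT x|\<mu>. (a * u x + b * v x) * w x) = (LINT x|\<mu>. a * (u x * w x) + b * (v x * w x))"
      by (simp add: algebra_simps)
    also have "\<dots> = a * (LINT x|\<mu>. u x * w x) + b * (LINT x|\<mu>. v x * w x)"
      using L2_prod[OF F_L2 F_L2] that by simp
    finally show ?thesis unfolding E1_def E_lin[OF that] by (simp add: algebra_simps)
  qed
  show "0 \<le> E1' u u" if "u \<in> F" for u
    unfolding E1_def using E_nonneg[OF that] by (intro add_nonneg_nonneg integral_nonneg_AE) auto
  show "\<exists>g\<in>F. (\<lambda>n. E1' (\<lambda>x. f n x - g x) (\<lambda>x. f n x - g x)) \<longlonglongrightarrow> 0"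
    if "\<And>n. f n \<in> F" "\<And>e. e > 0 \<Longrightarrow> \<exists>N. \<forall>m\<ge>N. \<forall>n\<ge>N. E1' (\<lambda>x. f m x - f n x) (\<lambda>x. f m x - f n x) < e"
      for f :: "nat \<Rightarrow> 'a \<Rightarrow> real"
    using dir that unfolding dirichlet_form_def by blast
qed (auto intro: F_zero F_lin)

lemma riesz:
  assumes lin: "\<And>u v a b. u \<in> F \<Longrightarrow> v \<in> F \<Longrightarrow> l (\<lambda>x. a * u x + b * v x) = a * l u + b * l v"
    and bdd: "\<And>v. v \<in> F \<Longrightarrow> (l v)\<^sup>2 \<le> C * E1' v v"
  shows "\<exists>z\<in>F. \<forall>v\<in>F. E1' z v = l v"
proof (rule e1.riesz_subspace[of F l C])
  fix y assume "y \<in> F" "\<And>v. v \<in> F \<Longrightarrow> E1' y v = l v"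
  then show "\<exists>z\<in>F. \<forall>v\<in>F. E1' z v = l v" by blast
qed (use F_zero F_lin lin bdd in \<open>simp_all only: order_refl\<close>)

lemma E_le_E1: "u \<in> F \<Longrightarrow> E u u \<le> E1' u u"
  unfolding E1_def by simp

lemma sq_le_E1: "u \<in> F \<Longrightarrow> (LINT x|\<mu>. (u x)\<^sup>2) \<le> E1' u u"
  unfolding E1_def using E_nonneg[of u] by (simp add: power2_eq_square)

lemma E1_cong:
  assumes "u \<in> F" "u' \<in> F" "v \<in> F" "AE x in \<mu>. u x = u' x"
  shows "E1' u v = E1' u' v"
proof -
  note [measurable] = F_borel[OF assms(1)] F_borel[OF assms(2)] F_borel[OF assms(3)]
  have "(LINT x|\<mu>. u x * v x) = (LINT x|\<mu>. u' x * v x)"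
    by (rule integral_cong_AE) (measurable, use assms(4) in eventually_elim, auto)
  then show ?thesis unfolding E1_def E_cong[OF assms] by simp
qed

lemma L2_holder:
  assumes "f \<in> L2 \<mu> UNIV" "g \<in> L2 \<mu> UNIV"
  shows "(LINT x|\<mu>. f x * g x)\<^sup>2 \<le> (LINT x|\<mu>. (f x)\<^sup>2) * (LINT x|\<mu>. (g x)\<^sup>2)"
  using l2.cauchy_schwarz_sq[OF assms] by (simp add: power2_eq_square)

lemma resolvent_exists:
  assumes g: "g \<in> L2 \<mu> UNIV"
  shows "\<exists>G\<in>F. \<forall>v\<in>F. E1' G v = (LINT x|\<mu>. g x * v x)"
proof -
  have "\<And>u v a b. u \<in> F \<Longrightarrow> v \<in> F \<Longrightarrow> (LINT x|\<mu>. g x * (a * u x + b * v x))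
    = a * (LINT x|\<mu>. g x * u x) + b * (LINT x|\<mu>. g x * v x)"
  proof -
    fix u v a b assume uv: "u \<in> F" "v \<in> F"
    have "(LINT x|\<mu>. g x * (a * u x + b * v x)) = (LINT x|\<mu>. a * (g x * u x) + b * (g x * v x))"
      by (simp add: algebra_simps)
    also have "\<dots> = a * (LINT x|\<mu>. g x * u x) + b * (LINT x|\<mu>. g x * v x)"
      using L2_prod[OF g F_L2] uv by simp
    finally show "(LINT x|\<mu>. g x * (a * u x + b * v x)) = a * (LINT x|\<mu>. g x * u x) + b * (LINT x|\<mu>. g x * v x)" .
  qed
  moreover have "(LINT x|\<mu>. g x * v x)\<^sup>2 \<le> (LINT x|\<mu>. (g x)\<^sup>2) * E1' v v" if "v \<in> F" for v
  proof -
    have "(LINT x|\<mu>. g x * v x)\<^sup>2 \<le> (LINT x|\<mu>. (g x)\<^sup>2) * (LINT x|\<mu>. (v x)\<^sup>2)" by (rule L2_holder[OF g F_L2[OF that]])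
    also have "\<dots> \<le> (LINT x|\<mu>. (g x)\<^sup>2) * E1' v v"
      by (intro mult_left_mono sq_le_E1 that integral_nonneg_AE) auto
    finally show ?thesis .
  qed
  ultimately show ?thesis by (rule riesz)
qed

text \<open>The resolvent of the generator at 1. Pairings with resolvents under the form are L2
  pairings, which is how measurability and convergence are transferred from L2 to the form
  domain.\<close>

definition resolvent where "resolvent g = (SOME G. G \<in> F \<and> (\<forall>v\<in>F. E1' G v = (LINT x|\<mu>. g x * v x)))"

lemma resolvent: "g \<in> L2 \<mu> UNIV \<Longrightarrow> resolvent g \<in> F \<and> (\<forall>v\<in>F. E1' (resolvent g) v = (LINT x|\<mu>. g x * v x))"
proof -
  assume "g \<in> L2 \<mu> UNIV"
  then have "\<exists>G. G \<in> F \<and> (\<forall>v\<in>F. E1' G v = (LINT x|\<mu>. g x * v x))" using resolvent_exists[of g] by blast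
  then show ?thesis unfolding resolvent_def by (rule someI_ex)
qed

lemma zero_of_L2_orthogonal:
  assumes u: "u \<in> L2 \<mu> UNIV" and z: "\<And>g. g \<in> L2 \<mu> UNIV \<Longrightarrow> (LINT x|\<mu>. g x * u x) = 0"
  shows "AE x in \<mu>. u x = 0"
proof -
  have "(LINT x|\<mu>. (u x)\<^sup>2) = 0" using z[OF u] by (simp add: power2_eq_square)
  moreover have "integrable \<mu> (\<lambda>x. (u x)\<^sup>2)" using u by (simp add: L2_def set_integrable_def)
  ultimately have "AE x in \<mu>. (u x)\<^sup>2 = 0" using integral_nonneg_eq_0_iff_AE[of \<mu> "\<lambda>x. (u x)\<^sup>2"] by simp
  then show ?thesis by simp
qed

text \<open>A function that is orthogonal to all resolvents is orthogonal in L2 to every function, so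
  it vanishes almost everywhere; the projection onto the span of the resolvents is therefore the
  identity.\<close>

lemma resolvent_dense:
  assumes y: "y \<in> F" and e: "e > 0"
  shows "\<exists>g\<in>L2 \<mu> UNIV. E1' (\<lambda>x. y x - resolvent g x) (\<lambda>x. y x - resolvent g x) < e"
proof -
  define V where "V = {v \<in> F. \<exists>g\<in>L2 \<mu> UNIV. \<forall>w\<in>F. E1' v w = (LINT x|\<mu>. g x * w x)}"
  have "V \<subseteq> F" by (auto simp: V_def)
  moreover have "(\<lambda>x. 0) \<in> V"
  proof -
    have a: "(\<lambda>x. 0) \<in> L2 \<mu> UNIV" by (simp add: L2_def set_integrable_def)
    have b: "\<forall>w\<in>F. E1' (\<lambda>x. 0) w = (LINT x|\<mu>. 0 * w x)" using e1.scale_left[OF F_zero, of _ 0] by simp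
    show ?thesis unfolding V_def
      by (rule CollectI, rule conjI[OF F_zero], rule bexI[of _ "\<lambda>x. 0"], rule b, rule a)
  qed
  moreover have "(\<lambda>x. a * u x + b * v x) \<in> V" if uv: "u \<in> V" "v \<in> V" for u v a b
  proof -
    obtain g h where g: "g \<in> L2 \<mu> UNIV" "\<And>w. w \<in> F \<Longrightarrow> E1' u w = (LINT x|\<mu>. g x * w x)"
      and h: "h \<in> L2 \<mu> UNIV" "\<And>w. w \<in> F \<Longrightarrow> E1' v w = (LINT x|\<mu>. h x * w x)"
      using uv by (auto simp: V_def)
    have "E1' (\<lambda>x. a * u x + b * v x) w = (LINT x|\<mu>. (a * g x + b * h x) * w x)" if w: "w \<in> F" for w
    proof -
      have "(LINT x|\<mu>. (a * g x + b * h x) * w x) = (LINT x|\<mu>. a * (g x * w x) + b * (h x * w x))"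
        by (simp add: algebra_simps)
      also have "\<dots> = a * (LINT x|\<mu>. g x * w x) + b * (LINT x|\<mu>. h x * w x)"
        using L2_prod[OF g(1) F_L2[OF w]] L2_prod[OF h(1) F_L2[OF w]] by simp
      finally show ?thesis using e1.lin_left[of u v w a b] uv w g h by (simp add: V_def)
    qed
    then have c: "\<forall>w\<in>F. E1' (\<lambda>x. a * u x + b * v x) w = (LINT x|\<mu>. (a * g x + b * h x) * w x)" by blast
    have d: "(\<lambda>x. a * g x + b * h x) \<in> L2 \<mu> UNIV" by (rule L2_lin[OF sets_mu _ g(1) h(1)]) simp
    have "u \<in> F" "v \<in> F" using uv by (auto simp: V_def)
    then have f: "(\<lambda>x. a * u x + b * v x) \<in> F" by (rule F_lin)
    show ?thesis unfolding V_def
    proof (rule CollectI, rule conjI)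
      show "(\<lambda>x. a * u x + b * v x) \<in> F" by (rule f)
      show "\<exists>g\<in>L2 \<mu> UNIV. \<forall>w\<in>F. E1' (\<lambda>x. a * u x + b * v x) w = (LINT x|\<mu>. g x * w x)"
        by (rule bexI[of _ "\<lambda>x. a * g x + b * h x"], rule c, rule d)
    qed
  qed
  moreover have "(E1' y v)\<^sup>2 \<le> E1' y y * E1' v v" if "v \<in> V" for v
    using that y e1.cauchy_schwarz_sq by (auto simp: V_def)
  moreover have "E1' y (\<lambda>x. a * u x + b * v x) = a * E1' y u + b * E1' y v" if "u \<in> V" "v \<in> V" for u v a b
    using that y e1.lin_right by (auto simp: V_def)
  ultimately obtain z where z: "z \<in> F" "\<And>v. v \<in> V \<Longrightarrow> E1' z v = E1' y v"
    and appr: "\<And>e. e > 0 \<Longrightarrow> \<exists>v\<in>V. E1' (\<lambda>x. z x - v x) (\<lambda>x. z x - v x) < e"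
    using e1.riesz_subspace[of V "E1' y" "E1' y y"] by blast
  have "AE x in \<mu>. z x - y x = 0"
  proof (rule zero_of_L2_orthogonal)
    show "(\<lambda>x. z x - y x) \<in> L2 \<mu> UNIV" by (intro F_L2 e1.diff_mem z y)
    fix g assume g: "g \<in> L2 \<mu> UNIV"
    have RV: "resolvent g \<in> V" using resolvent[OF g] g by (auto simp: V_def)
    have "(LINT x|\<mu>. g x * (z x - y x)) = E1' (resolvent g) (\<lambda>x. z x - y x)"
      using resolvent[OF g] e1.diff_mem[OF z(1) y] by simp
    also have "\<dots> = E1' z (resolvent g) - E1' y (resolvent g)"
      using resolvent[OF g] z y e1.sym[of "resolvent g"] by (simp add: e1.bilin)
    finally show "(LINT x|\<mu>. g x * (z x - y x)) = 0" using z(2)[OF RV] by simp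
  qed
  then have zy: "AE x in \<mu>. z x = y x" by simp
  obtain v where v: "v \<in> V" "E1' (\<lambda>x. z x - v x) (\<lambda>x. z x - v x) < e" using appr[OF e] by blast
  obtain g where g: "g \<in> L2 \<mu> UNIV" "\<And>w. w \<in> F \<Longrightarrow> E1' v w = (LINT x|\<mu>. g x * w x)"
    using v by (auto simp: V_def)
  have vF: "v \<in> F" using v by (auto simp: V_def)
  have RF: "resolvent g \<in> F" using resolvent[OF g(1)] by blast
  let ?d = "\<lambda>x. y x - resolvent g x" and ?d' = "\<lambda>x. z x - v x"
  have eq: "E1' ?d w = E1' ?d' w" if w: "w \<in> F" for w
  proof -
    have "E1' ?d w = E1' y w - E1' v w" using g(2)[OF w] resolvent[OF g(1)] w y RF by (simp add: e1.bilin)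
    also have "E1' y w = E1' z w" using E1_cong[OF z(1) y w zy] by simp
    finally show ?thesis using vF z w by (simp add: e1.bilin)
  qed
  have dF: "?d \<in> F" "?d' \<in> F" using y RF z vF by (auto intro: e1.diff_mem)
  have "E1' ?d ?d = E1' ?d' ?d'" using eq[OF dF(1)] eq[OF dF(2)] e1.sym[OF dF] by simp
  then have "E1' ?d ?d < e" using v(2) by simp
  then show ?thesis by (rule bexI[of _ g]) (rule g(1))
qed

text \<open>Pairings with resolvents converge because they are L2 pairings, and by density so do all
  pairings. The limit functional is bounded; its Riesz representative has the same L2 pairings as
  y.\<close>

lemma weak_limit:
  assumes x: "\<And>n::nat. x n \<in> F" and C: "\<And>n. E1' (x n) (x n) \<le> C" and y: "y \<in> L2 \<mu> UNIV"
    and lim: "\<And>g. g \<in> L2 \<mu> UNIV \<Longrightarrow> (\<lambda>n. LINT z|\<mu>. g z * x n z) \<longlonglongrightarrow> (LINT z|\<mu>. g z * y z)"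
  shows "y \<in> F" and "\<And>v. v \<in> F \<Longrightarrow> (\<lambda>n. E1' (x n) v) \<longlonglongrightarrow> E1' y v" and "E1' y y \<le> C"
proof -
  have C0: "C \<ge> 0" using C[of 0] e1.nonneg[OF x[of 0]] by simp
  have nb: "e1.nrm (x n) \<le> sqrt C" for n using C[of n] by (simp add: e1.nrm_def)
  have conv: "convergent (\<lambda>n. E1' (x n) v)" if v: "v \<in> F" for v
  proof -
    have "Cauchy (\<lambda>n. E1' (x n) v)"
    proof (rule CauchyI)
      fix e :: real assume e: "e > 0"
      define \<eta> where "\<eta> = e / (4 * (sqrt C + 1))"
      have \<eta>: "\<eta> > 0" using e C0 by (simp add: \<eta>_def add_nonneg_pos)
      obtain g where g: "g \<in> L2 \<mu> UNIV" and gv: "E1' (\<lambda>x. v x - resolvent g x) (\<lambda>x. v x - resolvent g x) < \<eta>\<^sup>2"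
        using resolvent_dense[OF v, of "\<eta>\<^sup>2"] \<eta> by auto
      have RF: "resolvent g \<in> F" using resolvent[OF g] by blast
      have n\<eta>: "e1.nrm (\<lambda>x. v x - resolvent g x) \<le> \<eta>" using gv \<eta>
        unfolding e1.nrm_def by (metis less_eq_real_def real_sqrt_le_iff real_sqrt_abs abs_of_pos)
      have ER: "E1' (x n) (resolvent g) = (LINT z|\<mu>. g z * x n z)" for n
        using resolvent[OF g] x[of n] e1.sym[OF x[of n] RF] by simp
      have app: "\<bar>E1' (x n) v - E1' (x n) (resolvent g)\<bar> \<le> e / 4" for n
      proof -
        have "\<bar>E1' (x n) (\<lambda>x. v x - resolvent g x)\<bar> \<le> e1.nrm (x n) * e1.nrm (\<lambda>x. v x - resolvent g x)"
          by (intro e1.cauchy_schwarz x e1.mems v RF)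
        also have "\<dots> \<le> sqrt C * \<eta>" by (intro mult_mono nb n\<eta> e1.nrm_nonneg e1.mems v RF) (use C0 in auto)
        also have "\<dots> \<le> e / 4"
        proof -
          have "sqrt C * \<eta> \<le> (sqrt C + 1) * \<eta>" using \<eta> by simp
          also have "\<dots> = e / 4"
          proof -
            have "sqrt C + 1 \<noteq> 0" using real_sqrt_ge_zero[OF C0] by linarith
            then show ?thesis unfolding \<eta>_def by (simp add: divide_simps)
          qed
          finally show ?thesis .
        qed
        finally show ?thesis using x v RF by (simp add: e1.bilin)
      qed
      have "Cauchy (\<lambda>n. LINT z|\<mu>. g z * x n z)" using lim[OF g] by (rule LIMSEQ_imp_Cauchy)
      then obtain M where M: "\<And>m n. m \<ge> M \<Longrightarrow> n \<ge> M \<Longrightarrow> norm ((LINT z|\<mu>. g z * x m z) - (LINT z|\<mu>. g z * x n z)) < e / 4"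
        using CauchyD[of "\<lambda>n. LINT z|\<mu>. g z * x n z" "e / 4"] e by auto
      have "norm (E1' (x m) v - E1' (x n) v) < e" if "m \<ge> M" "n \<ge> M" for m n
        using app[of m] app[of n] M[OF that] e unfolding ER real_norm_def by linarith
      then show "\<exists>M. \<forall>m\<ge>M. \<forall>n\<ge>M. norm (E1' (x m) v - E1' (x n) v) < e" by blast
    qed
    then show ?thesis by (rule Cauchy_convergent)
  qed
  define l where "l v = lim (\<lambda>n. E1' (x n) v)" for v
  have l: "(\<lambda>n. E1' (x n) v) \<longlonglongrightarrow> l v" if "v \<in> F" for v
    using conv[OF that] unfolding l_def by (simp add: convergent_LIMSEQ_iff)
  have l_lin: "l (\<lambda>x. a * u x + b * v x) = a * l u + b * l v" if "u \<in> F" "v \<in> F" for u v a b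
  proof -
    have "(\<lambda>n. a * E1' (x n) u + b * E1' (x n) v) \<longlonglongrightarrow> a * l u + b * l v"
      using l that by (intro tendsto_intros) auto
    then have "(\<lambda>n. E1' (x n) (\<lambda>x. a * u x + b * v x)) \<longlonglongrightarrow> a * l u + b * l v"
      using x that by (simp add: e1.lin_right)
    then show ?thesis using l[OF F_lin[OF that]] LIMSEQ_unique by blast
  qed
  have l_bdd: "(l v)\<^sup>2 \<le> C * E1' v v" if v: "v \<in> F" for v
  proof (rule LIMSEQ_le_const2)
    show "(\<lambda>n. (E1' (x n) v)\<^sup>2) \<longlonglongrightarrow> (l v)\<^sup>2" using l[OF v] by (intro tendsto_intros)
    have "(E1' (x n) v)\<^sup>2 \<le> C * E1' v v" for n
      using e1.cauchy_schwarz_sq[OF x v, of n] C[of n] e1.nonneg[OF v]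
      by (meson mult_right_mono order_trans)
    then show "\<exists>N. \<forall>n\<ge>N. (E1' (x n) v)\<^sup>2 \<le> C * E1' v v" by blast
  qed
  have "\<exists>z\<in>F. \<forall>v\<in>F. E1' z v = l v" by (rule riesz[OF l_lin l_bdd])
  then obtain z where z: "z \<in> F" "\<And>v. v \<in> F \<Longrightarrow> E1' z v = l v" by blast
  have "AE t in \<mu>. y t - z t = 0"
  proof (rule zero_of_L2_orthogonal)
    show "(\<lambda>t. y t - z t) \<in> L2 \<mu> UNIV" by (intro L2_UNIV_diff y F_L2 z)
    fix g assume g: "g \<in> L2 \<mu> UNIV"
    have RF: "resolvent g \<in> F" using resolvent[OF g] by blast
    have "E1' (x n) (resolvent g) = (LINT z|\<mu>. g z * x n z)" for n
      using resolvent[OF g] x[of n] e1.sym[OF x[of n] RF] by simp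
    then have "l (resolvent g) = (LINT z|\<mu>. g z * y z)"
      using l[OF RF] lim[OF g] LIMSEQ_unique by simp blast
    moreover have "l (resolvent g) = (LINT t|\<mu>. g t * z t)"
      using z(2)[OF RF] resolvent[OF g] z(1) e1.sym[OF z(1) RF] by simp
    ultimately show "(LINT t|\<mu>. g t * (y t - z t)) = 0"
      using L2_prod[OF g y] L2_prod[OF g F_L2[OF z(1)]] by (simp add: right_diff_distrib)
  qed
  then have zy: "AE t in \<mu>. z t = y t" by auto
  show yF: "y \<in> F" using F_cong[OF z(1) L2_borel[OF y] zy] .
  have ey: "E1' y v = l v" if "v \<in> F" for v using E1_cong[OF z(1) yF that zy] z(2)[OF that] by simp
  show "(\<lambda>n. E1' (x n) v) \<longlonglongrightarrow> E1' y v" if "v \<in> F" for v using l[OF that] ey[OF that] by simp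
  show "E1' y y \<le> C"
  proof (cases "E1' y y > 0")
    case True
    have "(E1' y y)\<^sup>2 \<le> C * E1' y y" using l_bdd[OF yF] ey[OF yF] by simp
    then show ?thesis using True by (simp add: power2_eq_square)
  qed (use C0 in simp)
qed

lemma weak_limit_strong:
  assumes x: "\<And>n::nat. x n \<in> F" and C: "\<And>n. E1' (x n) (x n) \<le> C" and y: "y \<in> L2 \<mu> UNIV"
    and lim: "(\<lambda>n. LINT z|\<mu>. (x n z - y z)\<^sup>2) \<longlonglongrightarrow> 0"
  shows "y \<in> F" and "\<And>v. v \<in> F \<Longrightarrow> (\<lambda>n. E1' (x n) v) \<longlonglongrightarrow> E1' y v" and "E1' y y \<le> C"
proof -
  have w: "(\<lambda>n. LINT z|\<mu>. g z * x n z) \<longlonglongrightarrow> (LINT z|\<mu>. g z * y z)" if g: "g \<in> L2 \<mu> UNIV" for g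
  proof -
    have "(\<lambda>n. LINT z|\<mu>. g z * (x n z - y z)) \<longlonglongrightarrow> 0"
    proof (rule Lim_null_comparison)
      show "eventually (\<lambda>n. norm (LINT z|\<mu>. g z * (x n z - y z))
        \<le> sqrt ((LINT z|\<mu>. (g z)\<^sup>2) * (LINT z|\<mu>. (x n z - y z)\<^sup>2))) sequentially"
      proof (intro always_eventually allI)
        fix n
        show "norm (LINT z|\<mu>. g z * (x n z - y z)) \<le> sqrt ((LINT z|\<mu>. (g z)\<^sup>2) * (LINT z|\<mu>. (x n z - y z)\<^sup>2))"
          using L2_holder[OF g L2_UNIV_diff[OF F_L2[OF x] y], of n]
          by (metis real_norm_def real_sqrt_abs real_sqrt_le_iff)
      qed
      show "(\<lambda>n. sqrt ((LINT z|\<mu>. (g z)\<^sup>2) * (LINT z|\<mu>. (x n z - y z)\<^sup>2))) \<longlonglongrightarrow> 0"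
        using tendsto_real_sqrt[OF tendsto_mult[OF tendsto_const lim, of "LINT z|\<mu>. (g z)\<^sup>2"]] by simp
    qed
    moreover have "(LINT z|\<mu>. g z * (x n z - y z)) = (LINT z|\<mu>. g z * x n z) - (LINT z|\<mu>. g z * y z)" for n
      using L2_prod[OF g y] L2_prod[OF g F_L2[OF x]] by (simp add: right_diff_distrib)
    ultimately show ?thesis by (simp add: LIM_zero_iff)
  qed
  show "y \<in> F" "\<And>v. v \<in> F \<Longrightarrow> (\<lambda>n. E1' (x n) v) \<longlonglongrightarrow> E1' y v" "E1' y y \<le> C"
    using weak_limit[OF x C y w] by blast+
qed

section \<open>Lattice operations on the form domain\<close>

lemma sq_integrable: "u \<in> F \<Longrightarrow> integrable \<mu> (\<lambda>x. (u x)\<^sup>2)"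
  using F_L2[of u] by (simp add: L2_def set_integrable_def)

lemma clamp_1:
  assumes u: "u \<in> F"
  shows "(\<lambda>x. min (max (u x) 0) 1) \<in> F" (is "?c \<in> F")
    and "E1' (\<lambda>x. min (max (u x) 0) 1) (\<lambda>x. min (max (u x) 0) 1) \<le> E1' u u"
proof -
  show c: "?c \<in> F" using dir u unfolding dirichlet_form_def by blast
  have "E ?c ?c \<le> E u u" using dir u unfolding dirichlet_form_def by blast
  moreover have "(LINT x|\<mu>. ?c x * ?c x) \<le> (LINT x|\<mu>. u x * u x)"
  proof (rule integral_mono)
    show "integrable \<mu> (\<lambda>x. ?c x * ?c x)" using sq_integrable[OF c] by (simp add: power2_eq_square)
    show "integrable \<mu> (\<lambda>x. u x * u x)" using sq_integrable[OF u] by (simp add: power2_eq_square)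
    show "?c x * ?c x \<le> u x * u x" for x
      by (simp add: abs_le_square_iff[symmetric] power2_eq_square[symmetric])
  qed
  ultimately show "E1' ?c ?c \<le> E1' u u" unfolding E1_def by (rule add_mono)
qed

lemma clamp:
  assumes u: "u \<in> F" and c: "c > 0"
  shows "(\<lambda>x. min (max (u x) 0) c) \<in> F"
    and "E1' (\<lambda>x. min (max (u x) 0) c) (\<lambda>x. min (max (u x) 0) c) \<le> E1' u u"
proof -
  let ?v = "\<lambda>x. (1 / c) * u x"
  let ?w = "\<lambda>x. min (max (?v x) 0) 1"
  have v: "?v \<in> F" by (rule e1.scale_mem[OF u])
  have w: "?w \<in> F" "E1' ?w ?w \<le> E1' ?v ?v" by (rule clamp_1[OF v])+
  have eq: "(\<lambda>x. min (max (u x) 0) c) = (\<lambda>x. c * ?w x)"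
  proof
    fix x show "min (max (u x) 0) c = c * ?w x" using c
      by (auto simp: min_def max_def field_simps)
  qed
  show "(\<lambda>x. min (max (u x) 0) c) \<in> F" unfolding eq by (rule e1.scale_mem[OF w(1)])
  have "E1' (\<lambda>x. c * ?w x) (\<lambda>x. c * ?w x) = c\<^sup>2 * E1' ?w ?w"
    unfolding e1.scale_left[OF w(1) e1.scale_mem[OF w(1)]] e1.scale_right[OF w(1) w(1)]
    by (simp add: power2_eq_square)
  also have "\<dots> \<le> c\<^sup>2 * E1' ?v ?v" using w(2) by (intro mult_left_mono) auto
  also have "E1' ?v ?v = (1 / c)\<^sup>2 * E1' u u"
    unfolding e1.scale_left[OF u e1.scale_mem[OF u]] e1.scale_right[OF u u]
    by (simp add: power2_eq_square)
  also have "c\<^sup>2 * ((1 / c)\<^sup>2 * E1' u u) = E1' u u" using c by (simp add: power2_eq_square)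
  finally show "E1' (\<lambda>x. min (max (u x) 0) c) (\<lambda>x. min (max (u x) 0) c) \<le> E1' u u" unfolding eq .
qed

text \<open>The clamps of u at increasing heights have bounded energies and converge in L2.\<close>

lemma pos_part:
  assumes u: "u \<in> F"
  shows "(\<lambda>x. max (u x) 0) \<in> F" and "E1' (\<lambda>x. max (u x) 0) (\<lambda>x. max (u x) 0) \<le> E1' u u"
proof -
  note [measurable] = F_borel[OF u]
  define x where "x n z = min (max (u z) 0) (real (Suc n))" for n z
  have xF: "x n \<in> F" and xE: "E1' (x n) (x n) \<le> E1' u u" for n
    unfolding x_def by (rule clamp[OF u], simp)+
  have yL: "(\<lambda>x. max (u x) 0) \<in> L2 \<mu> UNIV"
    by (rule L2_of_bound[OF sets_mu _ _ F_L2[OF u]]) (auto intro!: AE_I2)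
  have "(\<lambda>n. LINT z|\<mu>. (x n z - max (u z) 0)\<^sup>2) \<longlonglongrightarrow> (LINT z|\<mu>. 0)"
  proof (rule integral_dominated_convergence[where w="\<lambda>z. (u z)\<^sup>2"])
    show "integrable \<mu> (\<lambda>z. (u z)\<^sup>2)" by (rule sq_integrable[OF u])
    show "AE z in \<mu>. (\<lambda>n. (x n z - max (u z) 0)\<^sup>2) \<longlonglongrightarrow> 0"
    proof (intro AE_I2)
      fix z
      have "eventually (\<lambda>n. (x n z - max (u z) 0)\<^sup>2 = 0) sequentially"
        using eventually_ge_at_top[of "nat \<lceil>u z\<rceil>"]
      proof eventually_elim
        case (elim n)
        then have "u z \<le> real (Suc n)" by linarith
        then show ?case by (auto simp: x_def)
      qed
      then show "(\<lambda>n. (x n z - max (u z) 0)\<^sup>2) \<longlonglongrightarrow> 0" by (rule tendsto_eventually)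
    qed
    show "AE z in \<mu>. norm ((x n z - max (u z) 0)\<^sup>2) \<le> (u z)\<^sup>2" for n
      by (intro AE_I2) (auto simp: x_def abs_le_square_iff[symmetric])
    show "(\<lambda>z. (x n z - max (u z) 0)\<^sup>2) \<in> borel_measurable \<mu>" for n unfolding x_def by measurable
  qed simp
  then have "(\<lambda>n. LINT z|\<mu>. (x n z - max (u z) 0)\<^sup>2) \<longlonglongrightarrow> 0" by simp
  from weak_limit_strong[OF xF xE yL this]
  show "(\<lambda>x. max (u x) 0) \<in> F" and "E1' (\<lambda>x. max (u x) 0) (\<lambda>x. max (u x) 0) \<le> E1' u u" by blast+
qed

lemma neg_part_mem: "u \<in> F \<Longrightarrow> (\<lambda>x. max (- u x) 0) \<in> F"
  using pos_part(1)[OF e1.scale_mem[of u "-1"]] by simp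

text \<open>The positive part of x_+ - t x_- is x_+ for every t > 0; letting t tend to 0 in the
  contraction property gives the sign.\<close>

lemma E_pos_neg_le:
  assumes u: "u \<in> F"
  shows "E (\<lambda>x. max (u x) 0) (\<lambda>x. max (- u x) 0) \<le> 0"
proof -
  let ?p = "\<lambda>x. max (u x) 0" and ?n = "\<lambda>x. max (- u x) 0"
  have p: "?p \<in> F" and n: "?n \<in> F" using pos_part(1)[OF u] neg_part_mem[OF u] by auto
  have z: "?p x * ?n x = 0" for x by (auto simp: max_def)
  have "E ?p ?n = E1' ?p ?n" unfolding E1_def z by simp
  also have "\<dots> \<le> 0"
  proof (rule field_le_epsilon)
    fix e :: real assume e: "e > 0"
    define t where "t = e / (E1' ?n ?n + 1)"
    have n0: "E1' ?n ?n \<ge> 0" by (rule e1.nonneg[OF n])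
    have t: "t > 0" using e n0 by (simp add: t_def)
    let ?y = "\<lambda>x. 1 * ?p x + (- t) * ?n x"
    have y: "?y \<in> F" by (rule F_lin[OF p n])
    have "(\<lambda>x. max (?y x) 0) = ?p" using t by (auto simp: max_def fun_eq_iff mult_less_0_iff split: if_splits)
    then have "E1' ?p ?p \<le> E1' ?y ?y" using pos_part(2)[OF y] by simp
    also have "\<dots> = 1\<^sup>2 * E1' ?p ?p + 2 * 1 * (- t) * E1' ?p ?n + (- t)\<^sup>2 * E1' ?n ?n"
      by (rule e1.lin_sq[OF p n])
    finally have "t * (2 * E1' ?p ?n) \<le> t * (t * E1' ?n ?n)" by (simp add: power2_eq_square)
    then have "2 * E1' ?p ?n \<le> t * E1' ?n ?n" using t by simp
    also have "\<dots> \<le> e" using n0 e unfolding t_def by (simp add: divide_simps)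
    finally show "E1' ?p ?n \<le> 0 + e" using e by simp
  qed
  finally show ?thesis .
qed

text \<open>The minimum is a - (a - b)_+, and each of the two subtractions at most doubles the sum of
  the energies, which gives the constants.\<close>

lemma min_mem:
  assumes a: "a \<in> F" and b: "b \<in> F"
  shows "(\<lambda>x. min (a x) (b x)) \<in> F"
    and "E1' (\<lambda>x. min (a x) (b x)) (\<lambda>x. min (a x) (b x)) \<le> 6 * E1' a a + 4 * E1' b b"
proof -
  let ?d = "\<lambda>x. a x - b x"
  let ?p = "\<lambda>x. max (?d x) 0"
  have d: "?d \<in> F" by (intro e1.mems a b)
  have p: "?p \<in> F" "E1' ?p ?p \<le> E1' ?d ?d" by (rule pos_part[OF d])+
  have eq: "(\<lambda>x. min (a x) (b x)) = (\<lambda>x. a x - ?p x)" by (auto simp: min_def max_def)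
  show "(\<lambda>x. min (a x) (b x)) \<in> F" unfolding eq by (intro e1.mems a p)
  have "E1' (\<lambda>x. a x - ?p x) (\<lambda>x. a x - ?p x) \<le> 2 * E1' a a + 2 * E1' ?p ?p" by (intro e1.sq_diff_le a p)
  also have "\<dots> \<le> 2 * E1' a a + 2 * (2 * E1' a a + 2 * E1' b b)"
    using p(2) e1.sq_diff_le[OF a b] by simp
  finally show "E1' (\<lambda>x. min (a x) (b x)) (\<lambda>x. min (a x) (b x)) \<le> 6 * E1' a a + 4 * E1' b b" unfolding eq by simp
qed

section \<open>Cutoff functions\<close>

lemma C0_I:
  assumes "continuous_on UNIV f" "compact K" "K \<subseteq> \<Omega>" "\<And>x. x \<notin> K \<Longrightarrow> f x = 0"
  shows "f \<in> C0 (\<Omega> :: 'a set)"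
proof -
  have "closure {x. f x \<noteq> 0} \<subseteq> K" using assms by (intro closure_minimal compact_imp_closed) auto
  moreover from this have "compact (closure {x. f x \<noteq> 0})"
    using assms(2) by (metis closed_closure compact_Int_closed inf.absorb_iff2)
  ultimately show ?thesis using assms unfolding C0_def by blast
qed

lemma C0_D:
  assumes "f \<in> C0 (\<Omega> :: 'a set)"
  shows "\<exists>K. continuous_on UNIV f \<and> compact K \<and> K \<subseteq> \<Omega> \<and> (\<forall>x. x \<notin> K \<longrightarrow> f x = 0)"
proof (intro exI conjI allI impI)
  show "f x = 0" if "x \<notin> closure {x. f x \<noteq> 0}" for x using that closure_subset[of "{x. f x \<noteq> 0}"] by auto
qed (use assms in \<open>auto simp: C0_def\<close>)

lemma C0_lin:
  assumes "f \<in> C0 \<Omega>" "g \<in> C0 (\<Omega> :: 'a set)"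
  shows "(\<lambda>x. a * f x + b * g x) \<in> C0 \<Omega>"
proof -
  obtain K where K: "continuous_on UNIV f" "compact K" "K \<subseteq> \<Omega>" "\<And>x. x \<notin> K \<Longrightarrow> f x = 0" using C0_D[OF assms(1)] by blast
  obtain L where L: "continuous_on UNIV g" "compact L" "L \<subseteq> \<Omega>" "\<And>x. x \<notin> L \<Longrightarrow> g x = 0" using C0_D[OF assms(2)] by blast
  show ?thesis
    by (rule C0_I[of _ "K \<union> L"]) (use K L in \<open>auto intro!: continuous_intros\<close>)
qed

lemma F_C0_approx: "u \<in> F \<Longrightarrow> e > 0 \<Longrightarrow> \<exists>v\<in>F \<inter> C0 UNIV. E1' (\<lambda>x. u x - v x) (\<lambda>x. u x - v x) < e"
  using reg unfolding regular_dirichlet_form_def by blast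

lemma F_C0_uniform: "f \<in> C0 UNIV \<Longrightarrow> e > 0 \<Longrightarrow> \<exists>v\<in>F \<inter> C0 UNIV. \<forall>x. \<bar>f x - v x\<bar> < e"
  using reg unfolding regular_dirichlet_form_def by blast

text \<open>A function of the core that is uniformly close to a tent of height 2 is cut between the
  levels 1/2 and 3/2.\<close>

lemma cutoff_exists:
  fixes x0 :: 'a
  assumes r: "0 < r1" "r1 < r2"
  shows "\<exists>\<psi>\<in>F \<inter> C0 (ball x0 r2). (\<forall>x. 0 \<le> \<psi> x \<and> \<psi> x \<le> 1) \<and> (\<forall>x\<in>ball x0 r1. \<psi> x = 1)"
proof -
  define s where "s = (r1 + r2) / 2"
  have s: "r1 < s" "s < r2" using r by (auto simp: s_def)
  define f where "f x = max 0 (min 2 (2 * (s - dist x0 x) / (s - r1)))" for x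
  have f0: "f x = 0" if "x \<notin> cball x0 s" for x
  proof -
    have "2 * (s - dist x0 x) / (s - r1) \<le> 0" using that s by (intro divide_nonpos_pos) auto
    then show ?thesis by (simp add: f_def)
  qed
  have f2: "f x = 2" if "x \<in> ball x0 r1" for x
    using that s by (simp add: f_def le_divide_eq max_def min_def)
  have "continuous_on UNIV f" unfolding f_def using s by (intro continuous_intros) auto
  then have "f \<in> C0 UNIV" by (rule C0_I[OF _ compact_cball]) (use f0 in auto)
  then obtain v where v: "v \<in> F" "v \<in> C0 UNIV" and fv: "\<And>x. \<bar>f x - v x\<bar> < 1/2"
    using F_C0_uniform[of f "1/2"] by auto
  define \<psi> where "\<psi> x = min (max (v x) 0) (3/2) - min (max (v x) 0) (1/2)" for x
  have "\<psi> \<in> F" unfolding \<psi>_def by (intro e1.mems clamp v) auto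
  moreover have z: "\<psi> x = 0" if "x \<notin> cball x0 s" for x
    using fv[of x] f0[OF that] by (auto simp: \<psi>_def min_def max_def)
  have "\<psi> \<in> C0 (ball x0 r2)"
  proof (rule C0_I[OF _ compact_cball _ z])
    show "continuous_on UNIV \<psi>" using v(2) unfolding \<psi>_def C0_def by (intro continuous_intros) auto
    show "cball x0 s \<subseteq> ball x0 r2" using s by auto
  qed
  moreover have "0 \<le> \<psi> x \<and> \<psi> x \<le> 1" for x by (auto simp: \<psi>_def min_def max_def)
  moreover have "\<psi> x = 1" if "x \<in> ball x0 r1" for x
    using fv[of x] f2[OF that] by (auto simp: \<psi>_def min_def max_def abs_if split: if_splits)
  ultimately show ?thesis by blast
qed

lemma L2_dist_le:
  assumes u: "u \<in> F" and v: "v \<in> F" and w: "w \<in> F" and le: "AE x in \<mu>. \<bar>w x - u x\<bar> \<le> \<bar>v x - u x\<bar>"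
  shows "(LINT x|\<mu>. (w x - u x)\<^sup>2) \<le> E1' (\<lambda>x. u x - v x) (\<lambda>x. u x - v x)"
proof -
  have "(LINT x|\<mu>. (w x - u x)\<^sup>2) \<le> (LINT x|\<mu>. (u x - v x)\<^sup>2)"
  proof (rule integral_mono_AE)
    show "integrable \<mu> (\<lambda>x. (w x - u x)\<^sup>2)" by (intro sq_integrable e1.mems u w)
    show "integrable \<mu> (\<lambda>x. (u x - v x)\<^sup>2)" by (intro sq_integrable e1.mems u v)
    show "AE x in \<mu>. (w x - u x)\<^sup>2 \<le> (u x - v x)\<^sup>2"
      using le by eventually_elim (simp add: abs_le_square_iff power2_commute)
  qed
  also have "\<dots> \<le> E1' (\<lambda>x. u x - v x) (\<lambda>x. u x - v x)" by (intro sq_le_E1 e1.mems u v)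
  finally show ?thesis .
qed

text \<open>Core functions approximating u need not lie below b. Truncating them into the order
  interval from 0 to b keeps their energies bounded and their L2 limit, so they still converge to
  u weakly in F.\<close>

lemma truncated_approximation:
  assumes u: "u \<in> F" and b: "b \<in> F" and ub: "AE x in \<mu>. 0 \<le> u x \<and> u x \<le> b x"
  obtains v x where "\<And>n::nat. v n \<in> F \<inter> C0 UNIV" "\<And>n z. x n z = min (max (v n z) 0) (b z)" "\<And>n. x n \<in> F"
    "\<And>w. w \<in> F \<Longrightarrow> (\<lambda>n. E1' (x n) w) \<longlonglongrightarrow> E1' u w"
proof -
  have "\<exists>v\<in>F \<inter> C0 UNIV. E1' (\<lambda>x. u x - v x) (\<lambda>x. u x - v x) < 1 / Suc n" for n
    by (rule F_C0_approx[OF u]) simp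
  then obtain v where v: "\<And>n::nat. v n \<in> F \<inter> C0 UNIV" "\<And>n. E1' (\<lambda>x. u x - v n x) (\<lambda>x. u x - v n x) < 1 / Suc n"
    by metis
  have vF: "v n \<in> F" for n using v by blast
  define x where "x n z = min (max (v n z) 0) (b z)" for n z
  have xF: "x n \<in> F" for n unfolding x_def by (intro min_mem pos_part vF b)
  have vE: "E1' (v n) (v n) \<le> 2 * E1' u u + 2" for n
  proof -
    have "E1' (\<lambda>x. u x - (u x - v n x)) (\<lambda>x. u x - (u x - v n x))
      \<le> 2 * E1' u u + 2 * E1' (\<lambda>x. u x - v n x) (\<lambda>x. u x - v n x)"
      by (intro e1.sq_diff_le e1.mems u vF)
    also have "\<dots> \<le> 2 * E1' u u + 2 * 1"
    proof -
      have "1 / real (Suc n) \<le> 1" by simp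
      then show ?thesis using v(2)[of n] by linarith
    qed
    finally show ?thesis by simp
  qed
  have xE: "E1' (x n) (x n) \<le> 6 * (2 * E1' u u + 2) + 4 * E1' b b" for n
  proof -
    have "E1' (x n) (x n) \<le> 6 * E1' (\<lambda>z. max (v n z) 0) (\<lambda>z. max (v n z) 0) + 4 * E1' b b"
      unfolding x_def by (intro min_mem pos_part vF b)
    also have "\<dots> \<le> 6 * (2 * E1' u u + 2) + 4 * E1' b b" using vE[of n] pos_part(2)[OF vF, of n] by simp
    finally show ?thesis .
  qed
  have lim: "(\<lambda>n. LINT z|\<mu>. (x n z - u z)\<^sup>2) \<longlonglongrightarrow> 0"
  proof (rule tendsto_sandwich[OF _ _ tendsto_const])
    show "eventually (\<lambda>n. 0 \<le> (LINT z|\<mu>. (x n z - u z)\<^sup>2)) sequentially"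
      by (intro always_eventually allI integral_nonneg_AE) auto
    show "eventually (\<lambda>n. (LINT z|\<mu>. (x n z - u z)\<^sup>2) \<le> 1 / Suc n) sequentially"
    proof (intro always_eventually allI)
      fix n
      have "AE z in \<mu>. \<bar>x n z - u z\<bar> \<le> \<bar>v n z - u z\<bar>"
        using ub by eventually_elim (auto simp: x_def min_def max_def)
      from L2_dist_le[OF u vF xF this] show "(LINT z|\<mu>. (x n z - u z)\<^sup>2) \<le> 1 / Suc n" using v(2)[of n] by simp
    qed
    show "(\<lambda>n. 1 / real (Suc n)) \<longlonglongrightarrow> 0" using LIMSEQ_Suc[OF lim_1_over_n] .
  qed
  show thesis
  proof (rule that[OF v(1) _ xF])
    show "x n z = min (max (v n z) 0) (b z)" for n z by (rule x_def)
    show "(\<lambda>n. E1' (x n) w) \<longlonglongrightarrow> E1' u w" if "w \<in> F" for w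
      by (rule weak_limit_strong(2)[OF xF xE F_L2[OF u] lim that])
  qed
qed

text \<open>The approximants truncated by b are core functions of \<Omega> that converge weakly to u. The
  Riesz theorem on the core replaces u by a norm limit y of core functions with the same pairings
  with the core; then y - u is orthogonal to the core, hence to y, and to u by weak convergence,
  so it has norm zero.\<close>

lemma F_on_of_dominated:
  assumes u: "u \<in> F" and b: "b \<in> F" "b \<in> C0 \<Omega>" and ub: "AE x in \<mu>. 0 \<le> u x \<and> u x \<le> b x"
  shows "u \<in> F_on \<mu> F E \<Omega>"
proof -
  obtain v x where v: "\<And>n::nat. v n \<in> F \<inter> C0 UNIV" and x: "\<And>n z. x n z = min (max (v n z) 0) (b z)"
    and xF: "\<And>n. x n \<in> F"
    and lim: "\<And>w. w \<in> F \<Longrightarrow> (\<lambda>n. E1' (x n) w) \<longlonglongrightarrow> E1' u w"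
    using truncated_approximation[OF u b(1) ub] by metis
  define V where "V = F \<inter> C0 \<Omega>"
  have xV: "x n \<in> V" for n
  proof -
    obtain K where K: "continuous_on UNIV b" "compact K" "K \<subseteq> \<Omega>" "\<And>x. x \<notin> K \<Longrightarrow> b x = 0" using C0_D[OF b(2)] by blast
    have eq: "x n = (\<lambda>z. min (max (v n z) 0) (b z))" using x by auto
    have "x n \<in> C0 \<Omega>"
    proof (rule C0_I[OF _ K(2,3)])
      show "continuous_on UNIV (x n)" using v[of n] K(1) unfolding eq C0_def by (intro continuous_intros) auto
      show "x n z = 0" if "z \<notin> K" for z using K(4)[OF that] by (simp add: eq)
    qed
    then show ?thesis using xF by (simp add: V_def)
  qed
  have z0: "(\<lambda>x. 0) \<in> V" using F_zero by (auto simp: V_def C0_def)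
  have VF: "V \<subseteq> F" by (auto simp: V_def)
  have Vlin: "(\<lambda>x. a * p x + c * q x) \<in> V" if "p \<in> V" "q \<in> V" for p q a c
    using that F_lin C0_lin by (auto simp: V_def)
  have llin: "E1' u (\<lambda>x. a * p x + c * q x) = a * E1' u p + c * E1' u q" if "p \<in> V" "q \<in> V" for p q a c
    using that VF by (intro e1.lin_right u) auto
  have lbdd: "(E1' u p)\<^sup>2 \<le> E1' u u * E1' p p" if "p \<in> V" for p
    using that VF by (intro e1.cauchy_schwarz_sq u) auto
  show ?thesis
  proof (rule e1.riesz_subspace[OF VF z0 Vlin llin lbdd])
    fix y assume y: "y \<in> F" and yV: "\<And>p. p \<in> V \<Longrightarrow> E1' y p = E1' u p"
      and app: "\<And>e. e > 0 \<Longrightarrow> \<exists>p\<in>V. E1' (\<lambda>x. y x - p x) (\<lambda>x. y x - p x) < e"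
    let ?d = "\<lambda>x. y x - u x"
    have d: "?d \<in> F" by (intro e1.mems y u)
    have dV: "E1' ?d p = 0" if "p \<in> V" for p using yV[OF that] that VF y u by (auto simp: e1.bilin)
    have "(\<lambda>n. E1' (x n) ?d) \<longlonglongrightarrow> E1' u ?d" by (rule lim[OF d])
    moreover have "E1' (x n) ?d = 0" for n using dV[OF xV] e1.sym[OF xF d] by simp
    ultimately have du: "E1' u ?d = 0" using LIMSEQ_unique[OF tendsto_const[of 0]] by simp
    have dy: "E1' ?d y = 0"
    proof (rule ccontr)
      assume ne: "E1' ?d y \<noteq> 0"
      have n0: "E1' ?d ?d \<ge> 0" by (rule e1.nonneg[OF d])
      obtain p where p: "p \<in> V" "E1' (\<lambda>x. y x - p x) (\<lambda>x. y x - p x) < (E1' ?d y)\<^sup>2 / (E1' ?d ?d + 1)"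
        using app[of "(E1' ?d y)\<^sup>2 / (E1' ?d ?d + 1)"] ne n0 by auto
      have pF: "p \<in> F" using p VF by auto
      have yp: "(\<lambda>x. y x - p x) \<in> F" by (intro e1.mems y pF)
      have "E1' ?d y = E1' ?d (\<lambda>x. y x - p x)" using dV[OF p(1)] e1.diff_right[OF y pF d] by simp
      then have "(E1' ?d y)\<^sup>2 \<le> E1' ?d ?d * E1' (\<lambda>x. y x - p x) (\<lambda>x. y x - p x)"
        using e1.cauchy_schwarz_sq[OF d yp] by simp
      also have "\<dots> \<le> (E1' ?d ?d + 1) * E1' (\<lambda>x. y x - p x) (\<lambda>x. y x - p x)"
        using e1.nonneg[OF yp] by (simp add: distrib_right)
      also have "\<dots> < (E1' ?d y)\<^sup>2"
      proof -
        have "E1' ?d ?d + 1 > 0" using n0 by linarith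
        then show ?thesis using p(2) by (simp add: less_divide_eq mult.commute)
      qed
      finally show False by simp
    qed
    have dd: "E1' ?d ?d = 0" using du dy e1.sym[OF u d] e1.diff_right[OF y u d] by simp
    show ?thesis unfolding F_on_def
    proof (rule CollectI, intro conjI allI impI)
      show "u \<in> F" by (rule u)
      fix e :: real assume e: "e > 0"
      obtain p where p: "p \<in> V" "E1' (\<lambda>x. y x - p x) (\<lambda>x. y x - p x) < e / 2" using app[of "e / 2"] e by auto
      have pF: "p \<in> F" using p VF by auto
      have yp: "(\<lambda>x. y x - p x) \<in> F" by (intro e1.mems y pF)
      have "E1' (\<lambda>x. (y x - p x) - ?d x) (\<lambda>x. (y x - p x) - ?d x)
          \<le> 2 * E1' (\<lambda>x. y x - p x) (\<lambda>x. y x - p x) + 2 * E1' ?d ?d" by (rule e1.sq_diff_le[OF yp d])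
      also have "(\<lambda>x. (y x - p x) - ?d x) = (\<lambda>x. u x - p x)" by auto
      finally have "E1' (\<lambda>x. u x - p x) (\<lambda>x. u x - p x) < e" using dd p(2) by simp
      then show "\<exists>v\<in>F \<inter> C0 \<Omega>. E1' (\<lambda>x. u x - v x) (\<lambda>x. u x - v x) < e"
        using p(1) unfolding V_def by (rule bexI)
    qed
  qed
qed

section \<open>Supports and strong locality\<close>

lemma closed_ess_supp: "closed (ess_supp \<mu> f)"
  unfolding ess_supp_def by (intro closed_Compl open_Union) auto

lemma ess_supp_subset: "open U \<Longrightarrow> AE x in \<mu>. x \<in> U \<longrightarrow> f x = 0 \<Longrightarrow> ess_supp \<mu> f \<subseteq> - U"
  unfolding ess_supp_def by blast

lemma compact_ess_supp:
  fixes f :: "'a \<Rightarrow> real"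
  assumes "compact K" "\<And>x. x \<notin> K \<Longrightarrow> f x = 0"
  shows "compact (ess_supp \<mu> f)" "ess_supp \<mu> f \<subseteq> K"
proof -
  show s: "ess_supp \<mu> f \<subseteq> K"
    using ess_supp_subset[of "- K" f] assms by (auto intro: compact_imp_closed)
  show "compact (ess_supp \<mu> f)" using s assms(1) closed_ess_supp
    by (metis compact_Int_closed inf.absorb_iff2)
qed

lemma F_on_zero_outside:
  assumes u: "u \<in> F_on \<mu> F E \<Omega>" and O: "open \<Omega>"
  shows "AE x in \<mu>. x \<notin> \<Omega> \<longrightarrow> u x = 0"
proof -
  have uF: "u \<in> F" using u by (simp add: F_on_def)
  note [measurable] = F_borel[OF uF]
  have [measurable]: "\<Omega> \<in> sets borel" using O by simp
  let ?g = "\<lambda>x. indicator (- \<Omega>) x * (u x)\<^sup>2"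
  have i: "integrable \<mu> ?g"
    by (rule Bochner_Integration.integrable_bound[OF sq_integrable[OF uF]]) (auto intro!: AE_I2 simp: indicator_def)
  have "(LINT x|\<mu>. ?g x) \<le> 0"
  proof (rule field_le_epsilon)
    fix e :: real assume "e > 0"
    then obtain v where v: "v \<in> F" "v \<in> C0 \<Omega>" "E1' (\<lambda>x. u x - v x) (\<lambda>x. u x - v x) < e"
      using u by (auto simp: F_on_def)
    obtain K where K: "K \<subseteq> \<Omega>" "\<And>x. x \<notin> K \<Longrightarrow> v x = 0" using C0_D[OF v(2)] by blast
    have uv: "(\<lambda>x. u x - v x) \<in> F" by (intro e1.mems uF v)
    have "(LINT x|\<mu>. ?g x) \<le> (LINT x|\<mu>. (u x - v x)\<^sup>2)"
    proof (rule integral_mono[OF i sq_integrable[OF uv]])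
      have "v x = 0" if "x \<notin> \<Omega>" for x using K that by blast
      then show "?g x \<le> (u x - v x)\<^sup>2" for x by (auto simp: indicator_def)
    qed
    also have "\<dots> \<le> e" using sq_le_E1[OF uv] v(3) by simp
    finally show "(LINT x|\<mu>. ?g x) \<le> 0 + e" by simp
  qed
  moreover have "0 \<le> (LINT x|\<mu>. ?g x)" by (intro integral_nonneg_AE) auto
  ultimately have "(LINT x|\<mu>. ?g x) = 0" by simp
  then have "AE x in \<mu>. ?g x = 0" using integral_nonneg_eq_0_iff_AE[OF i] by auto
  then show ?thesis by eventually_elim (auto simp: indicator_def)
qed

lemma F_on_ess_supp:
  assumes u: "u \<in> F_on \<mu> F E \<Omega>" and O: "open \<Omega>" and c: "compact (closure \<Omega>)"
  shows "compact (ess_supp \<mu> u)" "ess_supp \<mu> u \<subseteq> closure \<Omega>"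
proof -
  have "AE x in \<mu>. x \<in> - closure \<Omega> \<longrightarrow> u x = 0"
    using F_on_zero_outside[OF u O] by eventually_elim (use closure_subset in blast)
  from ess_supp_subset[OF _ this] show s: "ess_supp \<mu> u \<subseteq> closure \<Omega>" by auto
  show "compact (ess_supp \<mu> u)" using s c closed_ess_supp
    by (metis compact_Int_closed inf.absorb_iff2)
qed

lemma jump_form_nonneg: "0 \<le> jump_form j v v"
  unfolding jump_form_def by (intro integral_nonneg_AE) auto

lemma EL_le_E1: "v \<in> F \<Longrightarrow> EL v v \<le> E1' v v"
  using E_split[of v v] jump_form_nonneg[of v] E_le_E1[of v] by simp

text \<open>Strong locality speaks of functions with compact support. Truncated core functions between
  0 and w have compact support and vanish where w does, and the bounded functional EL(., \<phi>)
  passes to their weak limit.\<close>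

lemma EL_zero_nonneg:
  assumes p: "\<phi> \<in> F" "compact (ess_supp \<mu> \<phi>)" and U: "open U" "ess_supp \<mu> \<phi> \<subseteq> U"
    and w: "w \<in> F" "AE x in \<mu>. x \<in> U \<longrightarrow> w x = 0" and w0: "\<And>x. 0 \<le> w x"
  shows "EL w \<phi> = 0"
proof -
  have "AE x in \<mu>. 0 \<le> w x \<and> w x \<le> w x" using w0 by simp
  from truncated_approximation[OF w(1) w(1) this]
  obtain v x where v: "\<And>n::nat. v n \<in> F \<inter> C0 UNIV" and x: "\<And>n z. x n z = min (max (v n z) 0) (w z)"
    and xF: "\<And>n. x n \<in> F"
    and lim: "\<And>w'. w' \<in> F \<Longrightarrow> (\<lambda>n. E1' (x n) w') \<longlonglongrightarrow> E1' w w'"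
    by metis
  have z: "EL (x n) \<phi> = 0" for n
  proof -
    obtain K where K: "compact K" "\<And>x. x \<notin> K \<Longrightarrow> v n x = 0" using C0_D[of "v n" UNIV] v[of n] by blast
    have "compact (ess_supp \<mu> (x n))"
      by (rule compact_ess_supp(1)[OF K(1)]) (use K(2) w0 in \<open>simp add: x min_def\<close>)
    moreover have "AE z in \<mu>. z \<in> U \<longrightarrow> x n z = 0" using w(2) by eventually_elim (simp add: x)
    ultimately have "EL \<phi> (x n) = 0"
      using bd p U xF unfolding beurling_deny_without_killing_def strongly_local_def by blast
    then show ?thesis using EL_commute[OF xF p(1)] by simp
  qed
  have "\<exists>z\<in>F. \<forall>v\<in>F. E1' z v = EL v \<phi>"
  proof (rule riesz)
    show "EL (\<lambda>x. a * u x + b * v x) \<phi> = a * EL u \<phi> + b * EL v \<phi>" if "u \<in> F" "v \<in> F" for u v a b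
      using EL_lin[OF that p(1)] .
    show "(EL v \<phi>)\<^sup>2 \<le> EL \<phi> \<phi> * E1' v v" if "v \<in> F" for v
    proof -
      have "(EL v \<phi>)\<^sup>2 \<le> EL v v * EL \<phi> \<phi>" by (rule el.cauchy_schwarz_sq[OF that p(1)])
      also have "\<dots> \<le> E1' v v * EL \<phi> \<phi>" by (intro mult_right_mono EL_le_E1 EL_nonneg that p)
      finally show ?thesis by (simp add: mult.commute)
    qed
  qed
  then obtain y where y: "y \<in> F" "\<And>v. v \<in> F \<Longrightarrow> E1' y v = EL v \<phi>" by blast
  have "(\<lambda>n. E1' (x n) y) \<longlonglongrightarrow> E1' w y" by (rule lim[OF y(1)])
  moreover have "E1' (x n) y = 0" for n using y(2)[OF xF] e1.sym[OF y(1) xF] z by simp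
  ultimately have "E1' w y = 0" using LIMSEQ_unique[OF tendsto_const[of 0]] by simp
  then show ?thesis using y(2)[OF w(1)] e1.sym[OF y(1) w(1)] by simp
qed

lemma EL_zero:
  assumes p: "\<phi> \<in> F" "compact (ess_supp \<mu> \<phi>)" and U: "open U" "ess_supp \<mu> \<phi> \<subseteq> U"
    and w: "w \<in> F" "AE x in \<mu>. x \<in> U \<longrightarrow> w x = 0"
  shows "EL w \<phi> = 0"
proof -
  let ?p = "\<lambda>x. max (w x) 0" and ?n = "\<lambda>x. max (- w x) 0"
  have pF: "?p \<in> F" and nF: "?n \<in> F" using pos_part(1)[OF w(1)] neg_part_mem[OF w(1)] by auto
  have "EL ?p \<phi> = 0"
    by (rule EL_zero_nonneg[OF p U pF]) (use w(2) in \<open>auto elim!: eventually_mono\<close>)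
  moreover have "EL ?n \<phi> = 0"
    by (rule EL_zero_nonneg[OF p U nF]) (use w(2) in \<open>auto elim!: eventually_mono\<close>)
  moreover have "w = (\<lambda>x. ?p x - ?n x)" by (auto simp: max_def)
  ultimately show ?thesis using el.diff_left[OF pF nF p(1)] by simp
qed

text \<open>Two functions of F that agree near the support of \<phi> have the same local pairing with \<phi>.\<close>

lemma ext_form_eq:
  assumes ext: "local_extension \<mu> F \<Omega> v w0" and c: "compact (closure \<Omega>)"
    and p: "\<phi> \<in> F" "compact (ess_supp \<mu> \<phi>)" "ess_supp \<mu> \<phi> \<subseteq> closure \<Omega>"
    and U: "open U" "ess_supp \<mu> \<phi> \<subseteq> U" and w: "w \<in> F" "AE x in \<mu>. x \<in> U \<longrightarrow> v x = w x"
  shows "ext_form \<mu> F EL j \<Omega> v \<phi> = EL w \<phi> + jump_form j \<phi> v"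
proof -
  define W where "W = (SOME w. local_extension \<mu> F \<Omega> v w)"
  have "local_extension \<mu> F \<Omega> v W" unfolding W_def by (rule someI[of "\<lambda>w. local_extension \<mu> F \<Omega> v w", OF ext])
  then obtain \<Omega>' where W: "W \<in> F" "strict_nbhd \<Omega> \<Omega>'" "AE x in \<mu>. x \<in> \<Omega>' \<longrightarrow> v x = W x"
    by (auto simp: local_extension_def)
  have "closure \<Omega> \<subseteq> \<Omega>'" "open \<Omega>'"
  proof -
    have "closure \<Omega> \<inter> \<Omega> = \<Omega>" using closure_subset by blast
    then show "closure \<Omega> \<subseteq> \<Omega>'" "open \<Omega>'" using W(2) c unfolding strict_nbhd_def by metis+
  qed
  then have U': "open (U \<inter> \<Omega>')" "ess_supp \<mu> \<phi> \<subseteq> U \<inter> \<Omega>'" using U p(3) by auto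
  have "AE x in \<mu>. x \<in> U \<inter> \<Omega>' \<longrightarrow> W x - w x = 0"
    using W(3) w(2) by eventually_elim auto
  from EL_zero[OF p(1,2) U' e1.diff_mem[OF W(1) w(1)] this]
  have "EL W \<phi> = EL w \<phi>" using el.diff_left[OF W(1) w(1) p(1)] by simp
  then show ?thesis by (simp add: ext_form_def W_def)
qed

end

lemma integral_le_of_nn_integral:
  assumes g: "integrable M g" and le: "(\<integral>\<^sup>+x. ennreal (g x) \<partial>M) \<le> ennreal C" and C: "0 \<le> C"
  shows "(LINT x|M. g x) \<le> (C::real)"
proof -
  have "(LINT x|M. g x) = enn2real (\<integral>\<^sup>+x. ennreal (g x) \<partial>M) - enn2real (\<integral>\<^sup>+x. ennreal (- g x) \<partial>M)"
    by (rule real_lebesgue_integral_def[OF g])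
  also have "\<dots> \<le> enn2real (\<integral>\<^sup>+x. ennreal (g x) \<partial>M)" by simp
  also have "\<dots> \<le> enn2real (ennreal C)" using le by (intro enn2real_mono) auto
  finally show ?thesis using C by simp
qed

context jump_diffusion begin

section \<open>Disintegration of the jump measure\<close>

lemma sets_J[measurable_cong]: "sets (J x) = sets borel"
  using jm by (simp add: jump_measure_def transition_kernel_def)
lemma space_J[simp]: "space (J x) = UNIV" using sets_eq_imp_space_eq[OF sets_J] by simp
lemma J_meas: "A \<in> sets borel \<Longrightarrow> (\<lambda>x. emeasure (J x) A) \<in> borel_measurable borel"
  using jm by (simp add: jump_measure_def transition_kernel_def)
lemma sets_j[measurable_cong]: "sets j = sets borel"
  using jm by (simp add: jump_measure_def radon_on_def)
lemma space_j[simp]: "space j = UNIV" using sets_eq_imp_space_eq[OF sets_j] by simp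
lemma j_emeasure: "A \<in> sets borel \<Longrightarrow> emeasure j A = (\<integral>\<^sup>+x. emeasure (J x) {y. (x, y) \<in> A} \<partial>\<mu>)"
  using jm unfolding jump_measure_def by blast
lemma j_emeasure': "A \<in> sets borel \<Longrightarrow> emeasure j A = (\<integral>\<^sup>+y. emeasure (J y) {x. (x, y) \<in> A} \<partial>\<mu>)"
  using jm unfolding jump_measure_def by blast
lemma j_swap: "distr j borel prod.swap = j"
  using jm unfolding jump_measure_def by blast

lemma Times_borel: "A \<in> sets borel \<Longrightarrow> B \<in> sets borel \<Longrightarrow> (A :: 'a set) \<times> (B :: 'a set) \<in> sets borel"
  unfolding borel_prod[symmetric] by (rule pair_measureI)

lemma AE_j_fst:
  assumes "AE x in \<mu>. P x"
  shows "AE z in j. P (fst z)"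
proof -
  obtain N where "N \<in> null_sets \<mu>" and N1: "{x. \<not> P x} \<subseteq> N"
    using assms unfolding eventually_ae_filter by auto
  then have N: "{x. \<not> P x} \<subseteq> N" "N \<in> sets borel" "emeasure \<mu> N = 0" by (auto simp: null_sets_def sets_mu)
  have "emeasure j (N \<times> UNIV) = (\<integral>\<^sup>+x. emeasure (J x) {y. (x, y) \<in> N \<times> UNIV} \<partial>\<mu>)"
    by (intro j_emeasure Times_borel N) auto
  also have "\<dots> = (\<integral>\<^sup>+x. 0 \<partial>\<mu>)"
  proof (rule nn_integral_cong_AE)
    have "AE x in \<mu>. x \<notin> N" using N by (intro AE_not_in) (auto simp: null_sets_def sets_mu)
    then show "AE x in \<mu>. emeasure (J x) {y. (x, y) \<in> N \<times> UNIV} = 0" by eventually_elim auto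
  qed
  finally have "N \<times> UNIV \<in> null_sets j" using N(2) by (auto intro!: null_setsI Times_borel simp: sets_j)
  moreover have "{z \<in> space j. \<not> P (fst z)} \<subseteq> N \<times> UNIV" using N(1) by force
  ultimately show ?thesis by (rule AE_I')
qed

lemma AE_j_snd:
  assumes "AE x in \<mu>. P x"
  shows "AE z in j. P (snd z)"
proof -
  obtain N where "N \<in> null_sets \<mu>" and N1: "{x. \<not> P x} \<subseteq> N"
    using assms unfolding eventually_ae_filter by auto
  then have N: "{x. \<not> P x} \<subseteq> N" "N \<in> sets borel" "emeasure \<mu> N = 0" by (auto simp: null_sets_def sets_mu)
  have "emeasure j (UNIV \<times> N) = (\<integral>\<^sup>+x. emeasure (J x) {y. (y, x) \<in> UNIV \<times> N} \<partial>\<mu>)"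
    by (intro j_emeasure' Times_borel N) auto
  also have "\<dots> = (\<integral>\<^sup>+x. 0 \<partial>\<mu>)"
  proof (rule nn_integral_cong_AE)
    have "AE x in \<mu>. x \<notin> N" using N by (intro AE_not_in) (auto simp: null_sets_def sets_mu)
    then show "AE x in \<mu>. emeasure (J x) {y. (y, x) \<in> UNIV \<times> N} = 0" by eventually_elim auto
  qed
  finally have "UNIV \<times> N \<in> null_sets j" using N(2) by (auto intro!: null_setsI Times_borel simp: sets_j)
  moreover have "{z \<in> space j. \<not> P (snd z)} \<subseteq> UNIV \<times> N" using N(1) by force
  ultimately show ?thesis by (rule AE_I')
qed

lemma swap_borel: "prod.swap \<in> (borel :: ('a \<times> 'a) measure) \<rightarrow>\<^sub>M (borel :: ('a \<times> 'a) measure)"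
  by (intro borel_measurable_continuous_onI continuous_on_swap)

lemma nn_integral_j_swap:
  assumes [measurable]: "f \<in> borel_measurable borel"
  shows "(\<integral>\<^sup>+z. f (prod.swap z) \<partial>j) = (\<integral>\<^sup>+z. f z \<partial>j)"
proof -
  have "(\<integral>\<^sup>+z. f z \<partial>j) = (\<integral>\<^sup>+z. f z \<partial>distr j borel prod.swap)" unfolding j_swap ..
  also have "\<dots> = (\<integral>\<^sup>+z. f (prod.swap z) \<partial>j)"
    by (rule nn_integral_distr) (simp_all add: measurable_cong_sets[OF sets_j refl] swap_borel)
  finally show ?thesis by simp
qed

text \<open>Balls around points of a dense set, with rational radii below half the distance of their
  centres: the products of the closed balls are compact and miss the diagonal, where the jump
  measure is Radon.\<close>

lemma off_diagonal_cover:
  obtains U V :: "nat \<Rightarrow> 'a set" where "\<And>i. open (U i)" "\<And>i. open (V i)" "\<And>i. emeasure j (U i \<times> V i) < \<infinity>"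
    "{(x, y). x \<noteq> y} = (\<Union>i. U i \<times> V i)"
proof -
  obtain D :: "'a set" where D: "countable D" "\<And>X. open X \<Longrightarrow> X \<noteq> {} \<Longrightarrow> \<exists>d\<in>D. d \<in> X"
    using countable_dense_exists by metis
  define I where "I = {(p, q, r). p \<in> D \<and> q \<in> D \<and> r \<in> \<rat> \<and> 0 < r \<and> 2 * r < dist p q}"
  have "countable (D \<times> D \<times> (\<rat> :: real set))" using D(1) countable_rat by auto
  then have cI: "countable I" by (rule countable_subset[rotated]) (auto simp: I_def)
  define G where "G = insert ({}, {}) ((\<lambda>(p, q, r). (ball p r, ball q r)) ` I)"
  have G: "countable G" "G \<noteq> {}" using cI by (auto simp: G_def)
  define U where "U i = fst (from_nat_into G i)" for i
  define V where "V i = snd (from_nat_into G i)" for i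
  have inG: "(U i, V i) \<in> G" for i using from_nat_into[OF G(2), of i] by (simp add: U_def V_def)
  have fin: "emeasure j (ball p r \<times> ball q r) < \<infinity>" if "2 * r < dist p q" for p q r
  proof -
    have "emeasure j (ball p r \<times> ball q r) \<le> emeasure j (cball p r \<times> cball q r)"
      by (intro emeasure_mono) (auto simp: sets_j intro!: Times_borel)
    also have "\<dots> < \<infinity>"
    proof -
      have "x \<noteq> y" if "x \<in> cball p r" "y \<in> cball q r" for x y
      proof
        assume "x = y"
        then have "dist p q \<le> r + r" using that dist_triangle2[of p q x] by (auto simp: dist_commute)
        then show False using \<open>2 * r < dist p q\<close> by simp
      qed
      then have "fst z \<noteq> snd z" if "z \<in> cball p r \<times> cball q r" for z using that by (metis mem_Times_iff)
      then have "z \<in> {(x, y). x \<noteq> y}" if "z \<in> cball p r \<times> cball q r" for z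
        using that by (simp add: case_prod_beta)
      then have "cball p r \<times> cball q r \<subseteq> {(x, y). x \<noteq> y}" by (rule subsetI)
      moreover have "compact (cball p r \<times> cball q r)" by (intro compact_Times compact_cball)
      ultimately show ?thesis using jm by (simp add: jump_measure_def radon_on_def)
    qed
    finally show ?thesis .
  qed
  show thesis
  proof (rule that)
    show "open (U i)" "open (V i)" "emeasure j (U i \<times> V i) < \<infinity>" for i
      using inG[of i] fin by (auto simp: G_def I_def)
    show "{(x, y). x \<noteq> y} = (\<Union>i. U i \<times> V i)"
    proof (intro equalityI subsetI)
      fix z :: "'a \<times> 'a" assume "z \<in> {(x, y). x \<noteq> y}"
      then obtain x y where z: "z = (x, y)" "x \<noteq> y" by auto
      obtain r where r: "r \<in> \<rat>" "0 < r" "r < dist x y / 4"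
        using Rats_dense_in_real[of 0 "dist x y / 4"] z(2) by auto
      obtain p where p: "p \<in> D" "p \<in> ball x r" using D(2)[of "ball x r"] r by auto
      obtain q where q: "q \<in> D" "q \<in> ball y r" using D(2)[of "ball y r"] r by auto
      have "dist x y \<le> dist x p + dist p q + dist q y"
        by (meson add_mono_thms_linordered_semiring(3) dist_triangle dist_triangle_le order_trans)
      then have "2 * r < dist p q" using p q r by (simp add: dist_commute)
      then have "(p, q, r) \<in> I" using p q r by (simp add: I_def)
      then have "(ball p r, ball q r) \<in> G" by (force simp: G_def)
      then obtain i where "from_nat_into G i = (ball p r, ball q r)"
        using from_nat_into_surj[OF G(1)] by blast
      then show "z \<in> (\<Union>i. U i \<times> V i)" using p q by (auto simp: U_def V_def z dist_commute intro!: exI[of _ i])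
    next
      fix z assume "z \<in> (\<Union>i. U i \<times> V i)"
      then obtain i x y where z: "z = (x, y)" "x \<in> U i" "y \<in> V i" by auto
      then obtain p q r where "(p, q, r) \<in> I" "x \<in> ball p r" "y \<in> ball q r"
        using inG[of i] by (auto simp: G_def)
      then show "z \<in> {(x, y). x \<noteq> y}" using dist_triangle2[of p q x] by (auto simp: z I_def dist_commute)
    qed
  qed
qed

lemma section_measurable:
  assumes U: "U \<in> sets borel" and V: "V \<in> sets borel" and fin: "\<And>x. x \<in> U \<Longrightarrow> emeasure (J x) V < \<infinity>"
    and A: "A \<in> sets borel"
  shows "(\<lambda>x. emeasure (J x) {y. (x, y) \<in> A \<inter> U \<times> V}) \<in> borel_measurable borel"
proof -
  have sec: "{y. (x, y) \<in> A \<inter> U \<times> V} \<in> sets borel" if "A \<in> sets borel" for A x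
  proof -
    have "A \<inter> U \<times> V \<in> sets (borel \<Otimes>\<^sub>M borel)" unfolding borel_prod using that U V by (auto intro: Times_borel)
    from sets_Pair1[OF this, of x] show ?thesis by (simp add: vimage_def)
  qed
  have "A \<in> sigma_sets (space borel \<times> space borel) {a \<times> b |a b. a \<in> sets (borel::'a measure) \<and>
    b \<in> sets (borel :: 'a measure)}"
    using A unfolding borel_prod[symmetric] sets_pair_measure .
  with Int_stable_pair_measure_generator pair_measure_closed show ?thesis
  proof (induct A rule: sigma_sets_induct_disjoint)
    case (basic A)
    then obtain a b where ab: "A = a \<times> b" "a \<in> sets borel" "b \<in> sets borel" by auto
    have "(\<lambda>x. emeasure (J x) {y. (x, y) \<in> A \<inter> U \<times> V}) = (\<lambda>x. indicator (a \<inter> U) x * emeasure (J x) (b \<inter> V))"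
    proof
      fix x
      have "{y. (x, y) \<in> A \<inter> U \<times> V} = (if x \<in> a \<inter> U then b \<inter> V else {})" by (auto simp: ab)
      then show "emeasure (J x) {y. (x, y) \<in> A \<inter> U \<times> V} = indicator (a \<inter> U) x * emeasure (J x) (b \<inter> V)" by simp
    qed
    also have "\<dots> \<in> borel_measurable borel"
      using ab U V by (intro borel_measurable_times_ennreal borel_measurable_indicator J_meas) auto
    finally show ?case .
  next
    case empty
    then show ?case by simp
  next
    case (compl A)
    then have A: "A \<in> sets borel" unfolding borel_prod[symmetric] sets_pair_measure by simp
    have "(\<lambda>x. emeasure (J x) {y. (x, y) \<in> (space borel \<times> space borel - A) \<inter> U \<times> V})
       = (\<lambda>x. indicator U x * emeasure (J x) V - emeasure (J x) {y. (x, y) \<in> A \<inter> U \<times> V})"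
    proof
      fix x
      show "emeasure (J x) {y. (x, y) \<in> (space borel \<times> space borel - A) \<inter> U \<times> V}
       = indicator U x * emeasure (J x) V - emeasure (J x) {y. (x, y) \<in> A \<inter> U \<times> V}"
      proof (cases "x \<in> U")
        case True
        have "{y. (x, y) \<in> (space borel \<times> space borel - A) \<inter> U \<times> V} = V - {y. (x, y) \<in> A \<inter> U \<times> V}"
          using True by auto
        moreover have "emeasure (J x) {y. (x, y) \<in> A \<inter> U \<times> V} \<le> emeasure (J x) V"
          using V by (intro emeasure_mono) (auto simp: sets_J)
        then have "emeasure (J x) {y. (x, y) \<in> A \<inter> U \<times> V} \<noteq> \<infinity>" using fin[OF True] by auto
        moreover have "emeasure (J x) (V - {y. (x, y) \<in> A \<inter> U \<times> V})
          = emeasure (J x) V - emeasure (J x) {y. (x, y) \<in> A \<inter> U \<times> V}"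
          using \<open>_ \<noteq> \<infinity>\<close> V sec[OF A] by (intro emeasure_Diff) (auto simp: sets_J)
        ultimately show ?thesis using True by simp
      qed simp
    qed
    also have "\<dots> \<in> borel_measurable borel"
      using compl U V by (intro borel_measurable_minus_ennreal borel_measurable_times_ennreal
        borel_measurable_indicator J_meas) auto
    finally show ?case .
  next
    case (union A)
    then have A: "A i \<in> sets borel" for i unfolding borel_prod[symmetric] sets_pair_measure by auto
    have "(\<lambda>x. emeasure (J x) {y. (x, y) \<in> (\<Union>i. A i) \<inter> U \<times> V}) = (\<lambda>x. \<Sum>i. emeasure (J x) {y. (x, y) \<in> A i \<inter> U \<times> V})"
    proof
      fix x
      have "{y. (x, y) \<in> (\<Union>i. A i) \<inter> U \<times> V} = (\<Union>i. {y. (x, y) \<in> A i \<inter> U \<times> V})" by auto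
      moreover have "disjoint_family (\<lambda>i. {y. (x, y) \<in> A i \<inter> U \<times> V})"
        using union(1) unfolding disjoint_family_on_def by blast
      moreover have "range (\<lambda>i. {y. (x, y) \<in> A i \<inter> U \<times> V}) \<subseteq> sets (J x)" using sec[OF A] by (auto simp: sets_J)
      ultimately show "emeasure (J x) {y. (x, y) \<in> (\<Union>i. A i) \<inter> U \<times> V}
        = (\<Sum>i. emeasure (J x) {y. (x, y) \<in> A i \<inter> U \<times> V})"
        using suminf_emeasure[of "\<lambda>i. {y. (x, y) \<in> A i \<inter> U \<times> V}" "J x"] by (simp only:)
    qed
    also have "\<dots> \<in> borel_measurable borel" using union by (intro borel_measurable_suminf_order) auto
    finally show ?case .
  qed
qed

text \<open>A transition kernel need not be sigma-finite, and then the measure of a section need not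
  depend measurably on the point. Here the product sets covering the complement of the diagonal
  have finite mass, so the kernel is finite on their second factors for all points outside a null
  set.\<close>

lemma off_diagonal_sections:
  obtains N where "N \<in> null_sets \<mu>"
    "\<And>A. A \<in> sets borel \<Longrightarrow> A \<subseteq> {(x, y). x \<noteq> y} \<Longrightarrow>
       (\<lambda>x. indicator (- N) x * emeasure (J x) {y. (x, y) \<in> A}) \<in> borel_measurable borel"
proof -
  obtain U V :: "nat \<Rightarrow> 'a set" where UV: "\<And>i. open (U i)" "\<And>i. open (V i)" "\<And>i. emeasure j (U i \<times> V i) < \<infinity>"
    "{(x, y). x \<noteq> y} = (\<Union>i. U i \<times> V i)" using off_diagonal_cover by blast
  have [measurable]: "U i \<in> sets borel" "V i \<in> sets borel" for i using UV by auto
  define B where "B i = {x. x \<in> U i \<and> emeasure (J x) (V i) = \<infinity>}" for i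
  have Bs: "B i \<in> sets borel" for i
  proof -
    have [measurable]: "(\<lambda>x. emeasure (J x) (V i)) \<in> borel_measurable borel" by (intro J_meas) auto
    have "{x \<in> space borel. emeasure (J x) (V i) = \<infinity>} \<in> sets borel" by measurable
    then have "U i \<inter> {x. emeasure (J x) (V i) = \<infinity>} \<in> sets borel" by auto
    then show ?thesis by (simp add: B_def Int_def)
  qed
  have "B i \<in> null_sets \<mu>" for i
  proof -
    have "emeasure j (U i \<times> V i) = (\<integral>\<^sup>+x. emeasure (J x) {y. (x, y) \<in> U i \<times> V i} \<partial>\<mu>)"
      by (intro j_emeasure Times_borel) auto
    also have "\<dots> \<ge> (\<integral>\<^sup>+x. \<infinity> * indicator (B i) x \<partial>\<mu>)"
      by (intro nn_integral_mono) (auto simp: B_def indicator_def)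
    finally have "(\<integral>\<^sup>+x. \<infinity> * indicator (B i) x \<partial>\<mu>) < \<infinity>" using UV(3)[of i] by (meson le_less_trans)
    then have "\<infinity> * emeasure \<mu> (B i) < \<infinity>" using Bs[of i]
      by (subst (asm) nn_integral_cmult_indicator) (auto simp: sets_mu)
    then have "emeasure \<mu> (B i) = 0" by (auto simp: ennreal_top_mult split: if_splits)
    then show ?thesis using Bs by (auto simp: null_sets_def sets_mu)
  qed
  then have N: "(\<Union>i. B i) \<in> null_sets \<mu>" by (intro null_sets_UN) auto
  define N where "N = (\<Union>i. B i)"
  have Ns: "N \<in> sets borel" unfolding N_def using Bs by auto
  define P where "P = disjointed (\<lambda>i. U i \<times> V i)"
  have Ps: "P i \<in> sets borel" for i
  proof -
    have "range (\<lambda>i. U i \<times> V i) \<subseteq> sets borel" by (auto intro!: Times_borel)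
    then show ?thesis unfolding P_def using sets.range_disjointed_sets[of "\<lambda>i. U i \<times> V i" borel] by blast
  qed
  have Psub: "P i \<subseteq> U i \<times> V i" for i unfolding P_def by (rule disjointed_subset)
  show thesis
  proof (rule that[of N])
    show "N \<in> null_sets \<mu>" using N by (simp add: N_def)
    fix A assume A: "A \<in> sets borel" and sub: "A \<subseteq> {(x::'a, y::'a). x \<noteq> y}"
    have m: "(\<lambda>x. emeasure (J x) {y. (x, y) \<in> (A \<inter> P i) \<inter> (U i - N) \<times> V i}) \<in> borel_measurable borel" for i
    proof (rule section_measurable)
      show "A \<inter> P i \<in> sets borel" using A Ps by auto
      show "U i - N \<in> sets borel" using Ns by auto
      show "emeasure (J x) (V i) < \<infinity>" if "x \<in> U i - N" for x
        using that by (auto simp: N_def B_def less_top[symmetric])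
    qed auto
    have "(\<lambda>x. indicator (- N) x * emeasure (J x) {y. (x, y) \<in> A})
       = (\<lambda>x. indicator (- N) x * (\<Sum>i. emeasure (J x) {y. (x, y) \<in> (A \<inter> P i) \<inter> (U i - N) \<times> V i}))"
    proof
      fix x
      show "indicator (- N) x * emeasure (J x) {y. (x, y) \<in> A}
        = indicator (- N) x * (\<Sum>i. emeasure (J x) {y. (x, y) \<in> (A \<inter> P i) \<inter> (U i - N) \<times> V i})"
      proof (cases "x \<in> N")
        case False
        have "{y. (x, y) \<in> A} = (\<Union>i. {y. (x, y) \<in> (A \<inter> P i) \<inter> (U i - N) \<times> V i})"
        proof (intro equalityI subsetI)
          fix y assume "y \<in> {y. (x, y) \<in> A}"
          then have "(x, y) \<in> A" "(x, y) \<in> (\<Union>i. P i)" using sub UV(4) by (auto simp: P_def UN_disjointed_eq)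
          then obtain i where "(x, y) \<in> A \<inter> P i" by auto
          moreover from this have "x \<in> U i" "y \<in> V i" using Psub by auto
          ultimately show "y \<in> (\<Union>i. {y. (x, y) \<in> (A \<inter> P i) \<inter> (U i - N) \<times> V i})" using False by auto
        qed auto
        moreover have "disjoint_family (\<lambda>i. {y. (x, y) \<in> (A \<inter> P i) \<inter> (U i - N) \<times> V i})"
          using disjoint_family_disjointed[of "\<lambda>i. U i \<times> V i"] unfolding disjoint_family_on_def P_def by blast
        moreover have "{y. (x, y) \<in> (A \<inter> P i) \<inter> (U i - N) \<times> V i} \<in> sets borel" for i
        proof -
          have "(A \<inter> P i) \<inter> (U i - N) \<times> V i \<in> sets (borel \<Otimes>\<^sub>M borel)" unfolding borel_prod
            using A Ps Ns by (intro sets.Int Times_borel) auto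
          from sets_Pair1[OF this, of x] show ?thesis by (simp add: vimage_def)
        qed
        ultimately show ?thesis
          using suminf_emeasure[of "\<lambda>i. {y. (x, y) \<in> (A \<inter> P i) \<inter> (U i - N) \<times> V i}" "J x"]
            by (simp add: sets_J image_subset_iff)
      qed simp
    qed
    also have "\<dots> \<in> borel_measurable borel"
      using Ns by (intro borel_measurable_times_ennreal borel_measurable_suminf_order m
        borel_measurable_indicator) auto
    finally show "(\<lambda>x. indicator (- N) x * emeasure (J x) {y. (x, y) \<in> A}) \<in> borel_measurable borel" .
  qed
qed

text \<open>By definition j integrates the kernel on sets; the extension to functions needs measurable
  sections, which are available off the diagonal and outside a null set.\<close>

lemma disintegration:
  assumes f: "f \<in> borel_measurable borel" and diag: "\<And>x. f (x, x) = (0::ennreal)"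
  shows "(\<integral>\<^sup>+z. f z \<partial>j) = (\<integral>\<^sup>+x. \<integral>\<^sup>+y. f (x, y) \<partial>J x \<partial>\<mu>)"
proof -
  obtain N where N: "N \<in> null_sets \<mu>"
    and m: "\<And>A. A \<in> sets borel \<Longrightarrow> A \<subseteq> {(x, y). x \<noteq> y} \<Longrightarrow>
       (\<lambda>x. indicator (- N) x * emeasure (J x) {y. (x, y) \<in> A}) \<in> borel_measurable borel"
    using off_diagonal_sections by blast
  define D where "D = {(x::'a, y). x \<noteq> y}"
  have Ds: "D \<in> sets borel"
  proof -
    have "closed {z::'a\<times>'a. fst z = snd z}" by (intro closed_Collect_eq continuous_intros)
    moreover have "D = - {z. fst z = snd z}" by (auto simp: D_def)
    ultimately show ?thesis by auto
  qed
  have AEN: "AE x in \<mu>. x \<notin> N" using N by (rule AE_not_in)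
  have sec: "(\<lambda>y. f (x, y)) \<in> borel_measurable borel" if "f \<in> borel_measurable borel"
    for f :: "'a \<times> 'a \<Rightarrow> ennreal" and x
    using that unfolding borel_prod[symmetric] by simp
  define Q where "Q f \<longleftrightarrow> (\<lambda>x. indicator (- N) x * (\<integral>\<^sup>+y. f (x, y) * indicator D (x, y) \<partial>J x))
    \<in> borel_measurable borel \<and>
     (\<integral>\<^sup>+z. f z * indicator D z \<partial>j)
       = (\<integral>\<^sup>+x. indicator (- N) x * (\<integral>\<^sup>+y. f (x, y) * indicator D (x, y) \<partial>J x) \<partial>\<mu>)" for f :: "'a \<times> 'a \<Rightarrow> ennreal"
  have Dsec[measurable]: "(\<lambda>y. indicator D (x, y) :: ennreal) \<in> borel_measurable borel" for x
    using sec[of "indicator D" x] Ds by auto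
  have "Q f" using f
  proof (induct rule: borel_measurable_induct)
    case (cong f g)
    then have "f = g" by auto
    then show ?case using cong by simp
  next
    case (set A)
    have AD: "A \<inter> D \<in> sets borel" "A \<inter> D \<subseteq> {(x, y). x \<noteq> y}" using set Ds by (auto simp: D_def)
    have eq: "(\<integral>\<^sup>+y. indicator A (x, y) * indicator D (x, y) \<partial>J x) = emeasure (J x) {y. (x, y) \<in> A \<inter> D}" for x
    proof -
      have "{y. (x, y) \<in> A \<inter> D} \<in> sets borel"
      proof -
        have "A \<inter> D \<in> sets (borel \<Otimes>\<^sub>M borel)" unfolding borel_prod using AD by simp
        from sets_Pair1[OF this, of x] show ?thesis by (simp add: vimage_def)
      qed
      then have "emeasure (J x) {y. (x, y) \<in> A \<inter> D} = (\<integral>\<^sup>+y. indicator {y. (x, y) \<in> A \<inter> D} y \<partial>J x)"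
        by (simp add: sets_J)
      also have "\<dots> = (\<integral>\<^sup>+y. indicator A (x, y) * indicator D (x, y) \<partial>J x)"
        by (intro nn_integral_cong) (auto simp: indicator_def)
      finally show ?thesis by simp
    qed
    have "(\<integral>\<^sup>+z. indicator A z * indicator D z \<partial>j) = emeasure j (A \<inter> D)"
      using AD(1) by (simp add: indicator_inter_arith[symmetric] sets_j)
    also have "\<dots> = (\<integral>\<^sup>+x. emeasure (J x) {y. (x, y) \<in> A \<inter> D} \<partial>\<mu>)" by (rule j_emeasure[OF AD(1)])
    also have "\<dots> = (\<integral>\<^sup>+x. indicator (- N) x * emeasure (J x) {y. (x, y) \<in> A \<inter> D} \<partial>\<mu>)"
      by (rule nn_integral_cong_AE) (use AEN in eventually_elim, auto)
    finally show ?case unfolding Q_def eq using m[OF AD] by simp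
  next
    case (mult u c)
    have c: "(\<integral>\<^sup>+y. c * u (x, y) * indicator D (x, y) \<partial>J x) = c * (\<integral>\<^sup>+y. u (x, y) * indicator D (x, y) \<partial>J x)" for x
      using sec[OF mult(2)] by (subst nn_integral_cmult[symmetric]) (auto simp: mult.assoc)
    have "(\<integral>\<^sup>+z. c * u z * indicator D z \<partial>j) = c * (\<integral>\<^sup>+z. u z * indicator D z \<partial>j)"
      using mult(2) Ds by (subst nn_integral_cmult[symmetric]) (auto simp: mult.assoc)
    moreover have "(\<integral>\<^sup>+x. indicator (- N) x * (c * (\<integral>\<^sup>+y. u (x, y) * indicator D (x, y) \<partial>J x)) \<partial>\<mu>)
       = c * (\<integral>\<^sup>+x. indicator (- N) x * (\<integral>\<^sup>+y. u (x, y) * indicator D (x, y) \<partial>J x) \<partial>\<mu>)"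
      using mult(4) unfolding Q_def by (subst nn_integral_cmult[symmetric]) (auto simp: ac_simps
        measurable_cong_sets[OF sets_mu refl])
    moreover have "(\<lambda>x. indicator (- N) x * (c * (\<integral>\<^sup>+y. u (x, y) * indicator D (x, y) \<partial>J x)))
      \<in> borel_measurable borel"
    proof -
      have "(\<lambda>x. c * (indicator (- N) x * (\<integral>\<^sup>+y. u (x, y) * indicator D (x, y) \<partial>J x))) \<in> borel_measurable borel"
        by (rule borel_measurable_times_ennreal[OF measurable_const]) (use mult(4) in \<open>simp_all add: Q_def\<close>)
      then show ?thesis by (simp add: ac_simps)
    qed
    ultimately show ?case using mult(4) unfolding Q_def c by simp
  next
    case (add u v)
    have c: "(\<integral>\<^sup>+y. (v (x, y) + u (x, y)) * indicator D (x, y) \<partial>J x)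
       = (\<integral>\<^sup>+y. v (x, y) * indicator D (x, y) \<partial>J x) + (\<integral>\<^sup>+y. u (x, y) * indicator D (x, y) \<partial>J x)" for x
      using sec[OF add(1)] sec[OF add(4)] by (subst nn_integral_add[symmetric]) (auto simp: distrib_right)
    have "(\<integral>\<^sup>+z. (v z + u z) * indicator D z \<partial>j) = (\<integral>\<^sup>+z. v z * indicator D z \<partial>j) + (\<integral>\<^sup>+z. u z * indicator D z \<partial>j)"
      using add(1,4) Ds by (subst nn_integral_add[symmetric]) (auto simp: distrib_right)
    moreover have "(\<integral>\<^sup>+x. indicator (- N) x * (\<integral>\<^sup>+y. v (x, y) * indicator D (x, y) \<partial>J x)
      + indicator (- N) x * (\<integral>\<^sup>+y. u (x, y) * indicator D (x, y) \<partial>J x) \<partial>\<mu>)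
       = (\<integral>\<^sup>+x. indicator (- N) x * (\<integral>\<^sup>+y. v (x, y) * indicator D (x, y) \<partial>J x) \<partial>\<mu>)
       + (\<integral>\<^sup>+x. indicator (- N) x * (\<integral>\<^sup>+y. u (x, y) * indicator D (x, y) \<partial>J x) \<partial>\<mu>)"
      using add(3,7) unfolding Q_def by (intro nn_integral_add) (auto simp: measurable_cong_sets[OF sets_mu refl])
    ultimately show ?case using add(3,7) unfolding Q_def c distrib_left by auto
  next
    case (seq U)
    have Um: "U i \<in> borel_measurable borel" for i using seq by auto
    have eqD: "(SUP i. U i) z * indicator D z = (SUP i. U i z * indicator D z)" for z
      by (simp add: SUP_mult_right_ennreal image_comp)
    have incD: "incseq (\<lambda>i z. U i z * indicator D z)"
      using seq(4) by (auto simp: incseq_def le_fun_def intro!: mult_right_mono)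
    have c: "(\<integral>\<^sup>+y. (SUP i. U i) (x, y) * indicator D (x, y) \<partial>J x)
      = (SUP i. \<integral>\<^sup>+y. U i (x, y) * indicator D (x, y) \<partial>J x)" for x
      unfolding eqD
      by (rule nn_integral_monotone_convergence_SUP) (use incD sec[OF Um] in \<open>auto simp: incseq_def le_fun_def\<close>)
    have d: "indicator (- N) x * (SUP i. \<integral>\<^sup>+y. U i (x, y) * indicator D (x, y) \<partial>J x)
        = (SUP i. indicator (- N) x * (\<integral>\<^sup>+y. U i (x, y) * indicator D (x, y) \<partial>J x))" for x
      by (simp add: SUP_mult_left_ennreal)
    have "(\<integral>\<^sup>+z. (SUP i. U i) z * indicator D z \<partial>j) = (SUP i. \<integral>\<^sup>+z. U i z * indicator D z \<partial>j)"
      unfolding eqD by (rule nn_integral_monotone_convergence_SUP[OF incD]) (use Um Ds in auto)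
    also have "\<dots> = (SUP i. \<integral>\<^sup>+x. indicator (- N) x * (\<integral>\<^sup>+y. U i (x, y) * indicator D (x, y) \<partial>J x) \<partial>\<mu>)"
      using seq(3) by (simp add: Q_def)
    also have "\<dots> = (\<integral>\<^sup>+x. (SUP i. indicator (- N) x * (\<integral>\<^sup>+y. U i (x, y) * indicator D (x, y) \<partial>J x)) \<partial>\<mu>)"
    proof (rule nn_integral_monotone_convergence_SUP[symmetric])
      show "incseq (\<lambda>i x. indicator (- N) x * (\<integral>\<^sup>+y. U i (x, y) * indicator D (x, y) \<partial>J x))"
        using incD by (auto simp: incseq_def le_fun_def intro!: mult_left_mono nn_integral_mono)
      show "(\<lambda>x. indicator (- N) x * (\<integral>\<^sup>+y. U i (x, y) * indicator D (x, y) \<partial>J x)) \<in> borel_measurable \<mu>" for i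
        using seq(3)[of i] by (simp add: Q_def measurable_cong_sets[OF sets_mu refl])
    qed
    finally have "(\<integral>\<^sup>+z. (SUP i. U i) z * indicator D z \<partial>j) = \<dots>" .
    moreover have "(\<lambda>x. SUP i. indicator (- N) x * (\<integral>\<^sup>+y. U i (x, y) * indicator D (x, y) \<partial>J x))
      \<in> borel_measurable borel"
      using seq(3) unfolding Q_def by (intro borel_measurable_SUP) auto
    ultimately show ?case unfolding Q_def c d by simp
  qed
  moreover have "f z * indicator D z = f z" for z
    by (cases z) (auto simp: D_def indicator_def diag)
  ultimately have "(\<integral>\<^sup>+z. f z \<partial>j) = (\<integral>\<^sup>+x. indicator (- N) x * (\<integral>\<^sup>+y. f (x, y) \<partial>J x) \<partial>\<mu>)"
    by (simp add: Q_def)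
  also have "\<dots> = (\<integral>\<^sup>+x. \<integral>\<^sup>+y. f (x, y) \<partial>J x \<partial>\<mu>)"
    by (rule nn_integral_cong_AE) (use AEN in eventually_elim, auto)
  finally show ?thesis .
qed

section \<open>The jump form\<close>

lemma fst_borel: "(v::'a \<Rightarrow> 'b::topological_space) \<in> borel_measurable borel \<Longrightarrow> (\<lambda>z. v (fst (z :: 'a \<times> 'a)))
  \<in> borel_measurable borel"
  by (rule measurable_compose[of fst _ borel]) (intro borel_measurable_continuous_onI continuous_intros, assumption)
lemma snd_borel: "(v::'a \<Rightarrow> 'b::topological_space) \<in> borel_measurable borel \<Longrightarrow> (\<lambda>z. v (snd (z :: 'a \<times> 'a)))
  \<in> borel_measurable borel"
  by (rule measurable_compose[of snd _ borel]) (intro borel_measurable_continuous_onI continuous_intros, assumption)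

lemma diff_borel: "(v::'a \<Rightarrow> real) \<in> borel_measurable borel \<Longrightarrow> (\<lambda>z. v (fst z) - v (snd z)) \<in> borel_measurable borel"
  by (intro borel_measurable_diff fst_borel snd_borel)

lemma jump_sq_integrable: "u \<in> F \<Longrightarrow> integrable j (\<lambda>z. (u (fst z) - u (snd z))\<^sup>2)"
  using bd unfolding beurling_deny_without_killing_def case_prod_beta by blast

lemma jump_nn_finite:
  assumes u: "u \<in> F" shows "(\<integral>\<^sup>+x\<in>\<Omega>. (\<integral>\<^sup>+y. ennreal ((u x - u y)\<^sup>2) \<partial>J x) \<partial>\<mu>) < \<infinity>"
proof -
  note [measurable] = diff_borel[OF F_borel[OF u]]
  have "(\<integral>\<^sup>+x\<in>\<Omega>. (\<integral>\<^sup>+y. ennreal ((u x - u y)\<^sup>2) \<partial>J x) \<partial>\<mu>) \<le> (\<integral>\<^sup>+x. (\<integral>\<^sup>+y. ennreal ((u x - u y)\<^sup>2) \<partial>J x) \<partial>\<mu>)"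
    by (intro nn_integral_mono) (auto simp: indicator_def)
  also have "\<dots> = (\<integral>\<^sup>+z. ennreal ((u (fst z) - u (snd z))\<^sup>2) \<partial>j)"
    by (subst disintegration) auto
  also have "\<dots> < \<infinity>" using jump_sq_integrable[OF u] by (simp add: nn_integral_eq_integral)
  finally show ?thesis .
qed

lemma jump_form_alt: "jump_form j u v = (LINT z|j. (u (fst z) - u (snd z)) * (v (fst z) - v (snd z)))"
  unfolding jump_form_def case_prod_beta ..

lemma jump_integrable:
  assumes p: "\<phi> \<in> F" and v: "v \<in> borel_measurable borel" and O: "\<Omega> \<in> sets borel"
    and z: "AE x in \<mu>. x \<notin> \<Omega> \<longrightarrow> \<phi> x = 0"
    and fin: "(\<integral>\<^sup>+x\<in>\<Omega>. (\<integral>\<^sup>+y. ennreal ((v x - v y)\<^sup>2) \<partial>J x) \<partial>\<mu>) < \<infinity>"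
  shows "integrable j (\<lambda>z. (\<phi> (fst z) - \<phi> (snd z)) * (v (fst z) - v (snd z)))"
proof -
  note [measurable] = diff_borel[OF F_borel[OF p]] diff_borel[OF v]
  have [measurable]: "(\<lambda>z. indicator \<Omega> (fst (z :: 'a \<times> 'a)) :: real) \<in> borel_measurable borel"
    "(\<lambda>z. indicator \<Omega> (snd (z :: 'a \<times> 'a)) :: real) \<in> borel_measurable borel"
    using O by (auto intro!: fst_borel snd_borel)
  let ?d = "\<lambda>z. (v (fst z) - v (snd z))\<^sup>2"
  have A: "(\<integral>\<^sup>+z. ennreal (indicator \<Omega> (fst z) * ?d z) \<partial>j) < \<infinity>"
  proof -
    have "(\<integral>\<^sup>+z. ennreal (indicator \<Omega> (fst z) * ?d z) \<partial>j)
      = (\<integral>\<^sup>+x. \<integral>\<^sup>+y. ennreal (indicator \<Omega> x * (v x - v y)\<^sup>2) \<partial>J x \<partial>\<mu>)"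
      by (subst disintegration) auto
    also have "\<dots> = (\<integral>\<^sup>+x\<in>\<Omega>. (\<integral>\<^sup>+y. ennreal ((v x - v y)\<^sup>2) \<partial>J x) \<partial>\<mu>)"
      by (intro nn_integral_cong) (auto simp: indicator_def)
    finally show ?thesis using fin by simp
  qed
  have "(\<integral>\<^sup>+z. ennreal (indicator \<Omega> (snd z) * ?d z) \<partial>j) = (\<integral>\<^sup>+z. ennreal (indicator \<Omega> (fst z) * ?d z) \<partial>j)"
    using nn_integral_j_swap[of "\<lambda>z. ennreal (indicator \<Omega> (fst z) * ?d z)"] by (simp add: power2_commute)
  then have B: "(\<integral>\<^sup>+z. ennreal (indicator \<Omega> (snd z) * ?d z) \<partial>j) < \<infinity>" using A by simp
  have iA: "integrable j (\<lambda>z. indicator \<Omega> (fst z) * ?d z)" by (rule integrableI_nonneg[OF _ _ A]) auto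
  have iB: "integrable j (\<lambda>z. indicator \<Omega> (snd z) * ?d z)" by (rule integrableI_nonneg[OF _ _ B]) auto
  have i: "integrable j (\<lambda>z. (\<phi> (fst z) - \<phi> (snd z))\<^sup>2 + indicator \<Omega> (fst z) * ?d z + indicator \<Omega> (snd z) * ?d z)"
    by (intro Bochner_Integration.integrable_add jump_sq_integrable p iA iB)
  show ?thesis
  proof (rule Bochner_Integration.integrable_bound[OF i])
    show "AE z in j. norm ((\<phi> (fst z) - \<phi> (snd z)) * (v (fst z) - v (snd z)))
       \<le> norm ((\<phi> (fst z) - \<phi> (snd z))\<^sup>2 + indicator \<Omega> (fst z) * ?d z + indicator \<Omega> (snd z) * ?d z)"
      using AE_j_fst[OF z] AE_j_snd[OF z]
    proof eventually_elim
      case (elim z)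
      have ab: "\<bar>a * b\<bar> \<le> a\<^sup>2 + b\<^sup>2" for a b :: real
      proof -
        have "0 \<le> (\<bar>a\<bar> - \<bar>b\<bar>)\<^sup>2" by simp
        then have "2 * (\<bar>a\<bar> * \<bar>b\<bar>) \<le> a\<^sup>2 + b\<^sup>2" by (simp add: power2_eq_square algebra_simps)
        moreover have "0 \<le> \<bar>a\<bar> * \<bar>b\<bar>" by simp
        ultimately show ?thesis unfolding abs_mult by linarith
      qed
      show ?case
      proof (cases "fst z \<in> \<Omega> \<or> snd z \<in> \<Omega>")
        case True
        then have "?d z \<le> indicator \<Omega> (fst z) * ?d z + indicator \<Omega> (snd z) * ?d z" by (auto simp: indicator_def)
        then show ?thesis using ab[of "\<phi> (fst z) - \<phi> (snd z)" "v (fst z) - v (snd z)"] by auto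
      next
        case False
        then show ?thesis using elim by auto
      qed
    qed
  qed measurable
qed

lemma jump_integrable_F: "u \<in> F \<Longrightarrow> v \<in> F \<Longrightarrow> integrable j (\<lambda>z. (u (fst z) - u (snd z)) * (v (fst z) - v (snd z)))"
  by (rule jump_integrable[of u v UNIV]) (simp_all add: F_borel jump_nn_finite[of v UNIV, simplified])

text \<open>As \<phi> k = 0, only the cross terms - \<phi>(x) k(y) - \<phi>(y) k(x) remain, and by symmetry of j each
  of them contributes at most the integral of \<phi>(x) p(y).\<close>

lemma jump_comparison:
  assumes b: "\<phi> \<in> borel_measurable borel" "k \<in> borel_measurable borel" "p \<in> borel_measurable borel"
    and i: "integrable j (\<lambda>z. (\<phi> (fst z) - \<phi> (snd z)) * (k (fst z) - k (snd z)))"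
    and p0: "AE x in \<mu>. 0 \<le> \<phi> x" and pk: "AE x in \<mu>. \<phi> x * k x = 0" and kp: "AE x in \<mu>. - p x \<le> k x"
      and pp: "\<And>x. 0 \<le> p x"
    and c: "(\<integral>\<^sup>+z. ennreal (\<phi> (fst z) * p (snd z)) \<partial>j) \<le> ennreal c" "0 \<le> c"
  shows "(LINT z|j. (\<phi> (fst z) - \<phi> (snd z)) * (k (fst z) - k (snd z))) \<le> 2 * c"
proof (rule integral_le_of_nn_integral[OF i])
  note [measurable] = fst_borel[OF b(1)] fst_borel[OF b(2)] fst_borel[OF b(3)] snd_borel[OF b(1)]
    snd_borel[OF b(2)] snd_borel[OF b(3)]
  have "(\<integral>\<^sup>+z. ennreal ((\<phi> (fst z) - \<phi> (snd z)) * (k (fst z) - k (snd z))) \<partial>j)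
      \<le> (\<integral>\<^sup>+z. ennreal (\<phi> (fst z) * p (snd z)) + ennreal (\<phi> (snd z) * p (fst z)) \<partial>j)"
  proof (rule nn_integral_mono_AE)
    show "AE z in j. ennreal ((\<phi> (fst z) - \<phi> (snd z)) * (k (fst z) - k (snd z)))
      \<le> ennreal (\<phi> (fst z) * p (snd z)) + ennreal (\<phi> (snd z) * p (fst z))"
      using AE_j_fst[OF p0] AE_j_snd[OF p0] AE_j_fst[OF pk] AE_j_snd[OF pk] AE_j_fst[OF kp] AE_j_snd[OF kp]
    proof eventually_elim
      case (elim z)
      have "(\<phi> (fst z) - \<phi> (snd z)) * (k (fst z) - k (snd z)) = \<phi> (fst z) * (- k (snd z)) + \<phi> (snd z) * (- k (fst z))"
      proof -
        have "(a - b) * (c - d) = a * (- d) + b * (- c)" if "a * c = 0" "b * d = 0" for a b c d :: real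
          using that by (simp only: left_diff_distrib right_diff_distrib)
        from this[OF elim(3,4)] show ?thesis .
      qed
      also have "\<dots> \<le> \<phi> (fst z) * p (snd z) + \<phi> (snd z) * p (fst z)"
        using elim by (intro add_mono mult_left_mono) auto
      finally have "ennreal ((\<phi> (fst z) - \<phi> (snd z)) * (k (fst z) - k (snd z)))
        \<le> ennreal (\<phi> (fst z) * p (snd z) + \<phi> (snd z) * p (fst z))"
        by (rule ennreal_leI)
      also have "\<dots> = ennreal (\<phi> (fst z) * p (snd z)) + ennreal (\<phi> (snd z) * p (fst z))"
        using elim pp by (intro ennreal_plus mult_nonneg_nonneg) auto
      finally show ?case .
    qed
  qed
  also have "\<dots> = (\<integral>\<^sup>+z. ennreal (\<phi> (fst z) * p (snd z)) \<partial>j) + (\<integral>\<^sup>+z. ennreal (\<phi> (snd z) * p (fst z)) \<partial>j)"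
    by (intro nn_integral_add) measurable
  also have "(\<integral>\<^sup>+z. ennreal (\<phi> (snd z) * p (fst z)) \<partial>j) = (\<integral>\<^sup>+z. ennreal (\<phi> (fst z) * p (snd z)) \<partial>j)"
    using nn_integral_j_swap[of "\<lambda>z. ennreal (\<phi> (fst z) * p (snd z))"] by simp
  also have "(\<integral>\<^sup>+z. ennreal (\<phi> (fst z) * p (snd z)) \<partial>j) + (\<integral>\<^sup>+z. ennreal (\<phi> (fst z) * p (snd z)) \<partial>j)
    \<le> ennreal c + ennreal c"
    using c by (intro add_mono)
  also have "\<dots> = ennreal (2 * c)" using c(2) by (simp flip: ennreal_plus)
  finally show "(\<integral>\<^sup>+z. ennreal ((\<phi> (fst z) - \<phi> (snd z)) * (k (fst z) - k (snd z))) \<partial>j) \<le> ennreal (2 * c)" .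
qed (use c in simp)

text \<open>A cutoff function between the two balls has finite jump energy and changes by 1 across
  every such jump.\<close>

lemma jump_far_finite:
  fixes x0 :: 'a
  assumes r: "0 < r1" "r1 < r2"
  shows "emeasure j (ball x0 r1 \<times> (- ball x0 r2)) < \<infinity>"
proof -
  obtain \<psi> where \<psi>: "\<psi> \<in> F" "\<psi> \<in> C0 (ball x0 r2)" "\<forall>x\<in>ball x0 r1. \<psi> x = 1" using cutoff_exists[OF r] by blast
  obtain K where K: "K \<subseteq> ball x0 r2" "\<And>x. x \<notin> K \<Longrightarrow> \<psi> x = 0" using C0_D[OF \<psi>(2)] by blast
  have "emeasure j (ball x0 r1 \<times> (- ball x0 r2)) = (\<integral>\<^sup>+z. indicator (ball x0 r1 \<times> (- ball x0 r2)) z \<partial>j)"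
    by (rule nn_integral_indicator[symmetric]) (auto simp: sets_j intro!: Times_borel)
  also have "\<dots> \<le> (\<integral>\<^sup>+z. ennreal ((\<psi> (fst z) - \<psi> (snd z))\<^sup>2) \<partial>j)"
  proof (rule nn_integral_mono)
    fix z :: "'a \<times> 'a"
    have "\<psi> (snd z) = 0" if "snd z \<notin> ball x0 r2" using K that by blast
    then show "indicator (ball x0 r1 \<times> (- ball x0 r2)) z \<le> ennreal ((\<psi> (fst z) - \<psi> (snd z))\<^sup>2)"
      using \<psi>(3) by (cases z) (auto simp: indicator_def)
  qed
  also have "\<dots> < \<infinity>" using jump_sq_integrable[OF \<psi>(1)] by (simp add: nn_integral_eq_integral)
  finally show ?thesis .
qed

end

section \<open>Supersolutions at a fixed time\<close>

text \<open>The cutoff function is 1 on a ball slightly larger than the half ball, where the averages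
  will be tested, and is supported in a ball smaller than the one of radius 2R/3 on which the
  tail is taken.\<close>

locale supersolution = jump_diffusion \<mu> F E EL j J
  for \<mu> :: "'a::polish_space measure" and F E EL j J +
  fixes u :: "real \<Rightarrow> 'a \<Rightarrow> real" and t1 t2 :: real and x0 :: 'a and R K :: real and \<psi> :: "'a \<Rightarrow> real"
  assumes R: "0 < R" and K: "0 < K" and t12: "t1 < t2"
    and sc: "supercaloric \<mu> F E EL j J t1 t2 (ball x0 R) u"
    and nn: "nonneg_on \<mu> t1 t2 (ball x0 R) u"
    and bdd: "\<And>t. t \<in> {t1<..t2} \<Longrightarrow> AE x in \<mu>. x \<in> ball x0 R \<longrightarrow> \<bar>u t x\<bar> \<le> K"
    and psi: "\<psi> \<in> F" "\<psi> \<in> C0 (ball x0 (3 * R / 5))" "\<And>x. 0 \<le> \<psi> x" "\<And>x. \<psi> x \<le> 1"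
      "\<And>x. x \<in> ball x0 (11 * R / 20) \<Longrightarrow> \<psi> x = 1"
begin

abbreviation "B \<equiv> ball x0 R"
abbreviation "B2 \<equiv> ball x0 (R / 2)"
abbreviation "I \<phi> \<equiv> pairing \<mu> (ball x0 R) u \<phi>"

definition tail_at :: "real \<Rightarrow> ennreal" where
  "tail_at s = esssup (restrict_space \<mu> (ball x0 (2 / 3 * R))) (\<lambda>z. \<integral>\<^sup>+y\<in>- ball x0 R. ennreal \<bar>neg_part u s y\<bar> \<partial>J z)"

text \<open>On B this is almost everywhere the minimum of u and K \<psi>; the maximum with 0 makes it lie
  between 0 and K \<psi> at every point.\<close>

definition trunc :: "real \<Rightarrow> 'a \<Rightarrow> real" where
  "trunc s x = min (min (max (u s x) 0) K) (K * \<psi> x)"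

definition deficit :: "real \<Rightarrow> 'a \<Rightarrow> real" where
  "deficit s x = K * \<psi> x - trunc s x"

lemma psi_out: "x \<notin> ball x0 (3 * R / 5) \<Longrightarrow> \<psi> x = 0"
  using C0_D[OF psi(2)] by blast

lemma K_psi_F: "(\<lambda>x. K * \<psi> x) \<in> F" by (rule e1.scale_mem[OF psi(1)])

lemma psi_C0: "(\<lambda>x. K * \<psi> x) \<in> C0 B"
proof -
  obtain C where C: "continuous_on UNIV \<psi>" "compact C" "C \<subseteq> ball x0 (3 * R / 5)" "\<And>x. x \<notin> C \<Longrightarrow> \<psi> x = 0"
    using C0_D[OF psi(2)] by blast
  have "ball x0 (3 * R / 5) \<subseteq> B" using R by auto
  then show ?thesis using C by (intro C0_I[of _ C]) (auto intro!: continuous_intros)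
qed

lemma Fprime_u: "s \<in> {t1<..t2} \<Longrightarrow> u s \<in> Fprime \<mu> F J B"
  using sc by (simp add: supercaloric_def)

lemma u_borel: "s \<in> {t1<..t2} \<Longrightarrow> u s \<in> borel_measurable borel"
  using Fprime_u[of s] by (simp add: Fprime_def L1loc_def)

lemma u_range: "s \<in> {t1<..t2} \<Longrightarrow> AE x in \<mu>. x \<in> B \<longrightarrow> 0 \<le> u s x \<and> u s x \<le> K"
proof -
  assume s: "s \<in> {t1<..t2}"
  have "AE x in \<mu>. x \<in> B \<longrightarrow> 0 \<le> u s x" using nn s by (simp add: nonneg_on_def)
  then show ?thesis using bdd[OF s] by eventually_elim auto
qed

lemma compact_closure_ball: "compact (closure (ball x0 r))"
  using mms by (simp add: metric_measure_space_def)

lemma extension: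
  assumes s: "s \<in> {t1<..t2}"
  obtains w0 w where "local_extension \<mu> F B (u s) w0" "w \<in> F" "\<And>x. 0 \<le> w x" "\<And>x. w x \<le> K"
    "AE x in \<mu>. x \<in> B \<longrightarrow> u s x = w x"
proof -
  obtain w0 where w0: "local_extension \<mu> F B (u s) w0" using Fprime_u[OF s] by (auto simp: Fprime_def)
  obtain O' where O: "w0 \<in> F" "strict_nbhd B O'" "AE x in \<mu>. x \<in> O' \<longrightarrow> u s x = w0 x"
    using w0 by (auto simp: local_extension_def)
  have "closure B \<inter> B = B" using closure_subset by blast
  then have "closure B \<subseteq> O'" using O(2) compact_closure_ball unfolding strict_nbhd_def by metis
  then have BO: "B \<subseteq> O'" using closure_subset by blast
  show thesis
  proof (rule that[OF w0])
    show "(\<lambda>x. min (max (w0 x) 0) K) \<in> F" by (rule clamp(1)[OF O(1) K])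
    show "AE x in \<mu>. x \<in> B \<longrightarrow> u s x = min (max (w0 x) 0) K"
      using O(3) u_range[OF s] by eventually_elim (use BO in auto)
  qed (use K in auto)
qed

lemma trunc_bounds: "0 \<le> trunc s x" "trunc s x \<le> K" "trunc s x \<le> K * \<psi> x"
  using K psi(3)[of x] by (auto simp: trunc_def)

lemma trunc_out: "x \<notin> ball x0 (3 * R / 5) \<Longrightarrow> trunc s x = 0"
  using trunc_bounds[of s x] psi_out[of x] by auto

lemma deficit_bounds: "0 \<le> deficit s x" "deficit s x \<le> K * \<psi> x" "deficit s x \<le> K"
proof -
  show a: "0 \<le> deficit s x" "deficit s x \<le> K * \<psi> x" using trunc_bounds[of s x] by (auto simp: deficit_def)
  have "K * \<psi> x \<le> K * 1" using K psi(4)[of x] by (intro mult_left_mono) auto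
  then show "deficit s x \<le> K" using a by simp
qed

lemma deficit_out: "x \<notin> ball x0 (3 * R / 5) \<Longrightarrow> deficit s x = 0"
  by (simp add: deficit_def trunc_out psi_out)

lemma trunc_borel: "s \<in> {t1<..t2} \<Longrightarrow> trunc s \<in> borel_measurable borel"
  using u_borel[of s] F_borel[OF psi(1)] unfolding trunc_def[abs_def] by measurable

lemma trunc_eq_ext:
  assumes s: "s \<in> {t1<..t2}" and w: "\<And>x. 0 \<le> w x" "\<And>x. w x \<le> K" "AE x in \<mu>. x \<in> B \<longrightarrow> u s x = w x"
  shows "AE x in \<mu>. min (w x) (K * \<psi> x) = trunc s x"
  using w(3)
proof eventually_elim
  case (elim x)
  show ?case
  proof (cases "x \<in> B")
    case True
    then show ?thesis using elim w(1,2)[of x] by (auto simp: trunc_def)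
  next
    case False
    then have "x \<notin> ball x0 (3 * R / 5)" using R by auto
    then show ?thesis using psi_out w(1)[of x] K by (auto simp: trunc_def)
  qed
qed

lemma trunc_F: assumes s: "s \<in> {t1<..t2}" shows "trunc s \<in> F"
proof -
  obtain w0 w where w: "local_extension \<mu> F B (u s) w0" "w \<in> F" "\<And>x. 0 \<le> w x" "\<And>x. w x \<le> K"
    "AE x in \<mu>. x \<in> B \<longrightarrow> u s x = w x" using extension[OF s] by blast
  show ?thesis
    by (rule F_cong[OF min_mem(1)[OF w(2) K_psi_F] trunc_borel[OF s] trunc_eq_ext[OF s w(3,4,5)]])
qed

lemma deficit_F: "s \<in> {t1<..t2} \<Longrightarrow> deficit s \<in> F"
  using e1.diff_mem[OF K_psi_F trunc_F] unfolding deficit_def[abs_def] .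

lemma deficit_F_on: assumes s: "s \<in> {t1<..t2}" shows "deficit s \<in> F_on \<mu> F E B"
  by (rule F_on_of_dominated[OF deficit_F[OF s] K_psi_F psi_C0]) (use deficit_bounds psi(3) K in auto)

lemma trunc_eq_u: assumes s: "s \<in> {t1<..t2}"
  shows "AE x in \<mu>. x \<in> ball x0 (11 * R / 20) \<longrightarrow> u s x = trunc s x"
    and "AE x in \<mu>. x \<in> B \<longrightarrow> trunc s x = min (u s x) (K * \<psi> x)"
proof -
  show "AE x in \<mu>. x \<in> B \<longrightarrow> trunc s x = min (u s x) (K * \<psi> x)"
    using u_range[OF s] by eventually_elim (auto simp: trunc_def)
  then show "AE x in \<mu>. x \<in> ball x0 (11 * R / 20) \<longrightarrow> u s x = trunc s x"
    using u_range[OF s] by eventually_elim (use psi(5) R in auto)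
qed

lemma jump_sq_finite: "(\<integral>\<^sup>+x\<in>B. (\<integral>\<^sup>+y. ennreal ((u s x - u s y)\<^sup>2) \<partial>J x) \<partial>\<mu>) < \<infinity>" if "s \<in> {t1<..t2}"
  using Fprime_u[OF that] by (simp add: Fprime_def)

lemma integrable_supported:
  assumes p: "\<phi> \<in> F" and z: "AE x in \<mu>. x \<notin> ball x0 r \<longrightarrow> \<phi> x = 0"
  shows "integrable \<mu> \<phi>"
proof -
  note [measurable] = F_borel[OF p]
  have [measurable]: "ball x0 r \<in> sets borel" by auto
  have "indicator (ball x0 r) \<in> L2 \<mu> UNIV"
    unfolding L2_def set_integrable_def using emeasure_ball[of x0 r]
    by (auto simp: power2_eq_square indicator_inter_arith[symmetric] sets_mu intro!: integrable_real_indicator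
      borel_measurable_indicator)
  then have "integrable \<mu> (\<lambda>x. indicator (ball x0 r) x * \<phi> x)" by (rule L2_prod[OF _ F_L2[OF p]])
  then show ?thesis
    by (rule integrable_cong_AE_imp) (use z in \<open>auto elim!: eventually_mono simp: indicator_def\<close>)
qed

text \<open>Disintegrating j, the inner integral is at most the essential supremum in the tail, at
  almost every point of the smaller ball.\<close>

lemma cross_integral:
  assumes p: "\<phi> \<in> borel_measurable borel" "AE x in \<mu>. 0 \<le> \<phi> x" "AE x in \<mu>. x \<notin> ball x0 r \<longrightarrow> \<phi> x = 0"
    and r: "r \<le> 2 / 3 * R" and s: "s \<in> {t1<..t2}"
  shows "(\<integral>\<^sup>+z. ennreal (\<phi> (fst z) * (indicator (- B) (snd z) * neg_part u s (snd z))) \<partial>j)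
    \<le> tail_at s * (\<integral>\<^sup>+x. ennreal (\<phi> x) \<partial>\<mu>)"
proof -
  note [measurable] = u_borel[OF s] p(1)
  have [measurable]: "ball x0 r \<in> sets borel" "B \<in> sets borel" by auto
  have nb[measurable]: "(\<lambda>y. neg_part u s y) \<in> borel_measurable borel" unfolding neg_part_def by measurable
  let ?g = "\<lambda>y. indicator (- B) y * neg_part u s y"
  have gb: "?g \<in> borel_measurable borel" by measurable
  have pb: "(\<lambda>x. indicator (ball x0 r) x * \<phi> x) \<in> borel_measurable borel" by measurable
  have "(\<integral>\<^sup>+z. ennreal (\<phi> (fst z) * ?g (snd z)) \<partial>j)
    = (\<integral>\<^sup>+z. ennreal ((indicator (ball x0 r) (fst z) * \<phi> (fst z)) * ?g (snd z)) \<partial>j)"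
    by (rule nn_integral_cong_AE) (use AE_j_fst[OF p(3)] in \<open>auto elim!: eventually_mono simp: indicator_def\<close>)
  also have "\<dots> = (\<integral>\<^sup>+x. \<integral>\<^sup>+y. ennreal ((indicator (ball x0 r) x * \<phi> x) * ?g y) \<partial>J x \<partial>\<mu>)"
  proof (subst disintegration)
    show "(\<lambda>z. ennreal (indicat_real (ball x0 r) (fst z) * \<phi> (fst z) * (indicat_real (- B) (snd z)
      * neg_part u s (snd z)))) \<in> borel_measurable borel"
      by (intro measurable_compose[OF _ measurable_ennreal] borel_measurable_times fst_borel[OF pb, simplified]
        snd_borel[OF gb, simplified])
    show "ennreal (indicat_real (ball x0 r) (fst (x, x)) * \<phi> (fst (x, x)) * (indicat_real (- B) (snd (x, x))
      * neg_part u s (snd (x, x)))) = 0" for x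
    proof -
      have "x \<in> ball x0 r \<Longrightarrow> x \<in> B" using r R by auto
      then show ?thesis by (auto simp: indicator_def)
    qed
  qed simp
  also have "\<dots> \<le> (\<integral>\<^sup>+x. tail_at s * ennreal (\<phi> x) \<partial>\<mu>)"
  proof (rule nn_integral_mono_AE)
    have "AE z in restrict_space \<mu> (ball x0 (2 / 3 * R)). (\<integral>\<^sup>+y\<in>- ball x0 R. ennreal \<bar>neg_part u s y\<bar> \<partial>J z)
      \<le> tail_at s"
      unfolding tail_at_def by (rule esssup_AE)
    then have "AE z in \<mu>. z \<in> ball x0 (2 / 3 * R) \<longrightarrow> (\<integral>\<^sup>+y\<in>- ball x0 R. ennreal \<bar>neg_part u s y\<bar> \<partial>J z) \<le> tail_at s"
      by (subst (asm) AE_restrict_space_iff) (auto simp: sets_mu)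
    then show "AE x in \<mu>. (\<integral>\<^sup>+y. ennreal ((indicator (ball x0 r) x * \<phi> x) * ?g y) \<partial>J x) \<le> tail_at s * ennreal (\<phi> x)"
      using p(2)
    proof eventually_elim
      case (elim x)
      show ?case
      proof (cases "x \<in> ball x0 r")
        case True
        then have T: "(\<integral>\<^sup>+y\<in>- ball x0 R. ennreal \<bar>neg_part u s y\<bar> \<partial>J x) \<le> tail_at s" using elim(1) r by auto
        have "(\<integral>\<^sup>+y. ennreal ((indicator (ball x0 r) x * \<phi> x) * ?g y) \<partial>J x)
          = (\<integral>\<^sup>+y. ennreal (\<phi> x) * (ennreal \<bar>neg_part u s y\<bar> * indicator (- B) y) \<partial>J x)"
          using True elim(2) by (intro nn_integral_cong) (auto simp: indicator_def neg_part_def ennreal_mult)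
        also have "\<dots> = ennreal (\<phi> x) * (\<integral>\<^sup>+y\<in>- ball x0 R. ennreal \<bar>neg_part u s y\<bar> \<partial>J x)"
          by (rule nn_integral_cmult) measurable
        also have "\<dots> \<le> ennreal (\<phi> x) * tail_at s" by (intro mult_left_mono T) auto
        finally show ?thesis by (simp add: mult.commute)
      qed simp
    qed
  qed
  also have "\<dots> = tail_at s * (\<integral>\<^sup>+x. ennreal (\<phi> x) \<partial>\<mu>)"
    by (intro nn_integral_cmult) (auto simp: measurable_cong_sets[OF sets_mu refl])
  finally show ?thesis .
qed

lemma left_derivative_unique:
  fixes f :: "real \<Rightarrow> real"
  assumes "(f has_real_derivative D) (at_left s)" "(f has_real_derivative D') (at_left s)"
  shows "D = D'"
  using assms unfolding has_field_derivative_iff by (intro tendsto_unique[OF trivial_limit_at_left_real])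

lemma supercaloric_test:
  assumes p: "\<phi> \<in> F_on \<mu> F E B" "AE x in \<mu>. 0 \<le> \<phi> x" and s: "s \<in> {t1<..t2}"
    and D: "(I \<phi> has_real_derivative D) (at_left s)"
  shows "0 \<le> D + ext_form \<mu> F EL j B (u s) \<phi>"
proof -
  obtain D' where "(I \<phi> has_real_derivative D') (at_left s)" "0 \<le> D' + ext_form \<mu> F EL j B (u s) \<phi>"
    using sc p s unfolding supercaloric_def by blast
  then show ?thesis using left_derivative_unique[OF D] by simp
qed

lemma jump_form_add:
  assumes "integrable j (\<lambda>z. (\<phi> (fst z) - \<phi> (snd z)) * (v (fst z) - v (snd z)))"
    "integrable j (\<lambda>z. (\<phi> (fst z) - \<phi> (snd z)) * (w (fst z) - w (snd z)))"
  shows "jump_form j \<phi> v = jump_form j \<phi> w + (LINT z|j. (\<phi> (fst z) - \<phi> (snd z)) * ((v (fst z) - w (fst z))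
    - (v (snd z) - w (snd z))))"
    and "integrable j (\<lambda>z. (\<phi> (fst z) - \<phi> (snd z)) * ((v (fst z) - w (fst z)) - (v (snd z) - w (snd z))))"
proof -
  have eq: "(\<lambda>z. (\<phi> (fst z) - \<phi> (snd z)) * ((v (fst z) - w (fst z)) - (v (snd z) - w (snd z))))
    = (\<lambda>z. (\<phi> (fst z) - \<phi> (snd z)) * (v (fst z) - v (snd z)) - (\<phi> (fst z) - \<phi> (snd z)) * (w (fst z) - w (snd z)))"
    by (auto simp: algebra_simps)
  show "integrable j (\<lambda>z. (\<phi> (fst z) - \<phi> (snd z)) * ((v (fst z) - w (fst z)) - (v (snd z) - w (snd z))))"
    unfolding eq by (intro Bochner_Integration.integrable_diff assms)
  show "jump_form j \<phi> v = jump_form j \<phi> w + (LINT z|j. (\<phi> (fst z) - \<phi> (snd z)) * ((v (fst z) - w (fst z))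
    - (v (snd z) - w (snd z))))"
    unfolding eq Bochner_Integration.integral_diff[OF assms] jump_form_alt by simp
qed

lemma jump_form_commute: "jump_form j v w = jump_form j w v"
  unfolding jump_form_def by (simp only: mult.commute)

lemma F_on_mono: "A \<subseteq> A' \<Longrightarrow> \<phi> \<in> F_on \<mu> F E A \<Longrightarrow> \<phi> \<in> F_on \<mu> F E A'"
  unfolding F_on_def C0_def by blast

text \<open>The difference k = u - trunc vanishes near the support of \<phi>, so the local terms agree, and
  k is bounded below by minus the negative part of u outside B; the jump terms are compared by
  \<open>jump_comparison\<close>. The inequality is stated in extended non-negative reals so that it makes
  sense when the tail is infinite.\<close>

lemma test_inequality:
  assumes p: "\<phi> \<in> F_on \<mu> F E B2" "AE x in \<mu>. 0 \<le> \<phi> x" and s: "s \<in> {t1<..t2}"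
    and D: "(I \<phi> has_real_derivative D) (at_left s)"
  shows "ennreal (- D - E (trunc s) \<phi>) \<le> 2 * (tail_at s * ennreal (LINT x|\<mu>. \<phi> x))"
proof (cases "tail_at s * ennreal (LINT x|\<mu>. \<phi> x) = \<infinity>")
  case True
  then show ?thesis by (simp add: ennreal_mult_top)
next
  case False
  then obtain c where c: "tail_at s * ennreal (LINT x|\<mu>. \<phi> x) = ennreal c" "0 \<le> c"
    by (cases "tail_at s * ennreal (LINT x|\<mu>. \<phi> x)") auto
  have B2B: "B2 \<subseteq> B" using R by auto
  have pB: "\<phi> \<in> F_on \<mu> F E B" by (rule F_on_mono[OF B2B p(1)])
  have pF: "\<phi> \<in> F" using p(1) by (simp add: F_on_def)
  have mF: "trunc s \<in> F" by (rule trunc_F[OF s])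
  have out: "AE x in \<mu>. x \<notin> B2 \<longrightarrow> \<phi> x = 0" by (rule F_on_zero_outside[OF p(1)]) simp
  have outB: "AE x in \<mu>. x \<notin> B \<longrightarrow> \<phi> x = 0" using out by eventually_elim (use B2B in auto)
  have supp: "compact (ess_supp \<mu> \<phi>)" "ess_supp \<mu> \<phi> \<subseteq> closure B2"
    by (rule F_on_ess_supp[OF p(1) _ compact_closure_ball], simp)+
  have cl: "closure B2 \<subseteq> cball x0 (R / 2)" by (intro closure_minimal) auto
  have "cball x0 (R / 2) \<subseteq> ball x0 (11 * R / 20)" using R by auto
  then have suppU: "ess_supp \<mu> \<phi> \<subseteq> ball x0 (11 * R / 20)" using supp(2) cl by blast
  have suppB: "ess_supp \<mu> \<phi> \<subseteq> closure B" using supp(2) closure_mono[OF B2B] by blast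
  obtain w0 where w0: "local_extension \<mu> F B (u s) w0" using Fprime_u[OF s] by (auto simp: Fprime_def)
  have ext: "ext_form \<mu> F EL j B (u s) \<phi> = EL (trunc s) \<phi> + jump_form j \<phi> (u s)"
    by (rule ext_form_eq[OF w0 compact_closure_ball pF supp(1) suppB open_ball suppU mF trunc_eq_u(1)[OF s]])
  have ju: "integrable j (\<lambda>z. (\<phi> (fst z) - \<phi> (snd z)) * (u s (fst z) - u s (snd z)))"
    by (rule jump_integrable[OF pF u_borel[OF s] _ outB jump_sq_finite[OF s]]) simp
  have jm': "integrable j (\<lambda>z. (\<phi> (fst z) - \<phi> (snd z)) * (trunc s (fst z) - trunc s (snd z)))"
    by (rule jump_integrable_F[OF pF mF])
  let ?k = "\<lambda>x. u s x - trunc s x" and ?g = "\<lambda>y. indicator (- B) y * neg_part u s y"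
  note [measurable] = u_borel[OF s] trunc_borel[OF s]
  have comp: "(LINT z|j. (\<phi> (fst z) - \<phi> (snd z)) * (?k (fst z) - ?k (snd z))) \<le> 2 * c"
  proof (rule jump_comparison[where p="?g"])
    show "\<phi> \<in> borel_measurable borel" by (rule F_borel[OF pF])
    show "?k \<in> borel_measurable borel" by measurable
    show "?g \<in> borel_measurable borel" unfolding neg_part_def by measurable
    show "integrable j (\<lambda>z. (\<phi> (fst z) - \<phi> (snd z)) * (?k (fst z) - ?k (snd z)))"
      by (rule jump_form_add(2)[OF ju jm'])
    show "AE x in \<mu>. 0 \<le> \<phi> x" by (rule p(2))
    show "AE x in \<mu>. \<phi> x * ?k x = 0"
      using out trunc_eq_u(1)[OF s]
    proof eventually_elim
      case (elim x)
      then show ?case using R by (cases "x \<in> B2") auto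
    qed
    show "AE x in \<mu>. - ?g x \<le> ?k x"
      using trunc_eq_u(2)[OF s]
    proof eventually_elim
      case (elim x)
      have "x \<notin> B \<Longrightarrow> trunc s x = 0" using trunc_out[of x s] R by auto
      then show ?case using elim by (cases "x \<in> B") (auto simp: neg_part_def)
    qed
    show "0 \<le> ?g x" for x by (simp add: neg_part_def)
    have "(\<integral>\<^sup>+z. ennreal (\<phi> (fst z) * ?g (snd z)) \<partial>j) \<le> tail_at s * (\<integral>\<^sup>+x. ennreal (\<phi> x) \<partial>\<mu>)"
      by (rule cross_integral[OF F_borel[OF pF] p(2) out _ s]) (use R in auto)
    also have "(\<integral>\<^sup>+x. ennreal (\<phi> x) \<partial>\<mu>) = ennreal (LINT x|\<mu>. \<phi> x)"
      by (rule nn_integral_eq_integral[OF integrable_supported[OF pF out] p(2)])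
    finally show "(\<integral>\<^sup>+z. ennreal (\<phi> (fst z) * ?g (snd z)) \<partial>j) \<le> ennreal c" using c by simp
  qed (rule c(2))
  have "jump_form j \<phi> (u s) \<le> jump_form j \<phi> (trunc s) + 2 * c"
    using jump_form_add(1)[OF ju jm'] comp by simp
  then have "0 \<le> D + E (trunc s) \<phi> + 2 * c"
    using supercaloric_test[OF pB p(2) s D] E_split[OF mF pF] jump_form_commute[of \<phi> "trunc s"] unfolding ext by simp
  then have "ennreal (- D - E (trunc s) \<phi>) \<le> ennreal (2 * c)" by (intro ennreal_leI) simp
  also have "\<dots> = 2 * ennreal c" using c(2) by (simp add: ennreal_mult)
  finally show ?thesis using c by simp
qed

definition jump_mass where "jump_mass = measure j (ball x0 (3 * R / 5) \<times> (- B))"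
definition ball_mass where "ball_mass = measure \<mu> B"
text \<open>The terms of the energy estimate that involve neither the tail nor the derivative in time.\<close>

definition energy_const where "energy_const = 2 * E1' (\<lambda>x. K * \<psi> x) (\<lambda>x. K * \<psi> x)
  + 2 * E (\<lambda>x. K * \<psi> x) (\<lambda>x. K * \<psi> x) + 8 * K\<^sup>2 * jump_mass + 2 * K\<^sup>2 * ball_mass"
definition tail_const where "tail_const = 8 * K * ball_mass"

lemma ball_mass_pos: "ball_mass > 0"
  using emeasure_ball_pos[OF R, of x0] emeasure_ball[of x0 R] unfolding ball_mass_def
  by (simp add: measure_def enn2real_positive_iff)

lemma tail_const_pos: "tail_const > 0" using K ball_mass_pos by (simp add: tail_const_def)

lemma E_cong2: "a \<in> F \<Longrightarrow> a' \<in> F \<Longrightarrow> v \<in> F \<Longrightarrow> v' \<in> F \<Longrightarrow> AE x in \<mu>. a x = a' x \<Longrightarrow> AE x in \<mu>. v x = v' x \<Longrightarrow> E a v = E a' v'"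
  using E_cong[of a a' v] E_cong[of v v' a'] E_commute[of a' v] E_commute[of a' v'] by simp

text \<open>Testing with (K \<psi> - u)_+, which is the deficit, and using that E(x_+, x_-) is at most 0 for
  the positive and negative parts of x = u - K \<psi>. This only needs the contraction property and no
  Leibniz rule for the local part.\<close>

lemma caccioppoli:
  assumes s: "s \<in> {t1<..t2}" and D: "(I (deficit s) has_real_derivative D) (at_left s)"
  shows "ennreal (E1' (trunc s) (trunc s) - energy_const - 4 * D) \<le> ennreal tail_const * tail_at s"
proof (cases "tail_at s = \<infinity>")
  case True
  then show ?thesis using tail_const_pos by (simp add: ennreal_mult_top)
next
  case False
  then obtain \<tau> where \<tau>: "tail_at s = ennreal \<tau>" "0 \<le> \<tau>" by (cases "tail_at s") auto
  obtain w0 w where w: "local_extension \<mu> F B (u s) w0" "w \<in> F" "\<And>x. 0 \<le> w x" "\<And>x. w x \<le> K"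
    "AE x in \<mu>. x \<in> B \<longrightarrow> u s x = w x" using extension[OF s] by blast
  let ?p = "deficit s"
  have pF: "?p \<in> F" by (rule deficit_F[OF s])
  have mF: "trunc s \<in> F" by (rule trunc_F[OF s])
  obtain C where C: "compact C" "C \<subseteq> B" "\<And>x. x \<notin> C \<Longrightarrow> K * \<psi> x = 0" using C0_D[OF psi_C0] by blast
  have supp: "compact (ess_supp \<mu> ?p)" "ess_supp \<mu> ?p \<subseteq> C"
  proof -
    have z: "deficit s x = 0" if "x \<notin> C" for x using deficit_bounds[of s x] C(3)[OF that] by simp
    show "compact (ess_supp \<mu> ?p)" "ess_supp \<mu> ?p \<subseteq> C" by (rule compact_ess_supp[OF C(1) z], simp)+
  qed
  have suppB: "ess_supp \<mu> ?p \<subseteq> B" using supp(2) C(2) by blast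
  then have suppcB: "ess_supp \<mu> ?p \<subseteq> closure B" using closure_subset by blast
  have ext: "ext_form \<mu> F EL j B (u s) ?p = EL w ?p + jump_form j ?p (u s)"
    by (rule ext_form_eq[OF w(1) compact_closure_ball pF supp(1) suppcB open_ball suppB w(2,5)])
  have r35: "ball x0 (3 * R / 5) \<subseteq> B" using R by auto
  have p0: "?p x = 0" if "x \<notin> B" for x using r35 deficit_out that by blast
  then have pz: "AE x in \<mu>. x \<notin> B \<longrightarrow> ?p x = 0" by auto
  have ju: "integrable j (\<lambda>z. (?p (fst z) - ?p (snd z)) * (u s (fst z) - u s (snd z)))"
    by (rule jump_integrable[OF pF u_borel[OF s] _ pz jump_sq_finite[OF s]]) simp
  have jw: "integrable j (\<lambda>z. (?p (fst z) - ?p (snd z)) * (w (fst z) - w (snd z)))"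
    by (rule jump_integrable_F[OF pF w(2)])
  let ?k = "\<lambda>x. u s x - w x"
  let ?n = "\<lambda>y. indicator (- B) y * neg_part u s y"
  let ?g = "\<lambda>y. indicator (- B) y * (K + neg_part u s y)"
  note [measurable] = u_borel[OF s] F_borel[OF w(2)] F_borel[OF pF]
  have [measurable]: "(\<lambda>y. neg_part u s y) \<in> borel_measurable borel" unfolding neg_part_def by measurable
  define c where "c = K\<^sup>2 * jump_mass + \<tau> * (K * ball_mass)"
  have c0: "0 \<le> c" using \<tau> K ball_mass_pos unfolding c_def jump_mass_def
    by (intro add_nonneg_nonneg mult_nonneg_nonneg) auto
  have comp: "(LINT z|j. (?p (fst z) - ?p (snd z)) * (?k (fst z) - ?k (snd z))) \<le> 2 * c"
  proof (rule jump_comparison[where p="?g"])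
    show "?p \<in> borel_measurable borel" "?k \<in> borel_measurable borel" "?g \<in> borel_measurable borel" by measurable
    show "integrable j (\<lambda>z. (?p (fst z) - ?p (snd z)) * (?k (fst z) - ?k (snd z)))"
      by (rule jump_form_add(2)[OF ju jw])
    show "AE x in \<mu>. 0 \<le> ?p x" using deficit_bounds by auto
    show "AE x in \<mu>. ?p x * ?k x = 0"
      using w(5)
    proof eventually_elim
      case (elim x)
      then show ?case using p0[of x] by (cases "x \<in> B") auto
    qed
    show "AE x in \<mu>. - ?g x \<le> ?k x"
      using w(5)
    proof eventually_elim
      case (elim x)
      then show ?case using w(3,4)[of x] by (cases "x \<in> B") (auto simp: neg_part_def)
    qed
    show "0 \<le> ?g x" for x using K by (simp add: neg_part_def)
    have a: "(\<integral>\<^sup>+z. ennreal (?p (fst z) * ?n (snd z)) \<partial>j) \<le> ennreal (\<tau> * (K * ball_mass))"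
    proof -
      have "(\<integral>\<^sup>+z. ennreal (?p (fst z) * ?n (snd z)) \<partial>j) \<le> tail_at s * (\<integral>\<^sup>+x. ennreal (?p x) \<partial>\<mu>)"
        by (rule cross_integral[OF F_borel[OF pF] _ _ _ s, of "3 * R / 5"]) (use deficit_bounds deficit_out R in auto)
      also have "(\<integral>\<^sup>+x. ennreal (?p x) \<partial>\<mu>) \<le> (\<integral>\<^sup>+x. ennreal K * indicator B x \<partial>\<mu>)"
      proof (rule nn_integral_mono)
        fix x show "ennreal (?p x) \<le> ennreal K * indicator B x"
          using deficit_bounds(3)[of s x] p0[of x] by (cases "x \<in> B") (auto intro: ennreal_leI)
      qed
      also have "(\<integral>\<^sup>+x. ennreal K * indicator B x \<partial>\<mu>) = ennreal K * emeasure \<mu> B"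
        by (rule nn_integral_cmult_indicator) (simp add: sets_mu)
      also have "\<dots> = ennreal (K * ball_mass)"
        unfolding ball_mass_def using K emeasure_ball[of x0 R] by (simp add: emeasure_eq_ennreal_measure ennreal_mult)
      also have "tail_at s * ennreal (K * ball_mass) = ennreal (\<tau> * (K * ball_mass))"
        using \<tau> K ball_mass_pos by (simp add: ennreal_mult)
      finally show ?thesis by (simp add: mult_left_mono)
    qed
    have b: "(\<integral>\<^sup>+z. ennreal (?p (fst z) * (indicator (- B) (snd z) * K)) \<partial>j) \<le> ennreal (K\<^sup>2 * jump_mass)"
    proof -
      have "(\<integral>\<^sup>+z. ennreal (?p (fst z) * (indicator (- B) (snd z) * K)) \<partial>j)
        \<le> (\<integral>\<^sup>+z. ennreal (K\<^sup>2) * indicator (ball x0 (3 * R / 5) \<times> (- B)) z \<partial>j)"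
      proof (rule nn_integral_mono)
        fix z :: "'a \<times> 'a"
        have "?p (fst z) * K \<le> K * K" using K deficit_bounds(3)[of s "fst z"] by (intro mult_right_mono) auto
        then show "ennreal (?p (fst z) * (indicator (- B) (snd z) * K))
          \<le> ennreal (K\<^sup>2) * indicator (ball x0 (3 * R / 5) \<times> (- B)) z"
          using deficit_out[of "fst z" s] by (cases z) (auto simp: indicator_def power2_eq_square intro!: ennreal_leI)
      qed
      also have "\<dots> = ennreal (K\<^sup>2) * emeasure j (ball x0 (3 * R / 5) \<times> (- B))"
        by (rule nn_integral_cmult_indicator) (auto simp: sets_j intro!: Times_borel)
      also have "\<dots> = ennreal (K\<^sup>2 * jump_mass)"
      proof -
        have "emeasure j (ball x0 (3 * R / 5) \<times> (- B)) < \<infinity>" using R by (intro jump_far_finite) auto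
        then show ?thesis unfolding jump_mass_def by (simp add: emeasure_eq_ennreal_measure ennreal_mult)
      qed
      finally show ?thesis .
    qed
    have "(\<integral>\<^sup>+z. ennreal (?p (fst z) * ?g (snd z)) \<partial>j)
       = (\<integral>\<^sup>+z. ennreal (?p (fst z) * (indicator (- B) (snd z) * K)) + ennreal (?p (fst z) * ?n (snd z)) \<partial>j)"
    proof (rule nn_integral_cong)
      fix z :: "'a \<times> 'a"
      have "?p (fst z) * ?g (snd z) = ?p (fst z) * (indicator (- B) (snd z) * K) + ?p (fst z) * ?n (snd z)"
        by (simp add: algebra_simps)
      moreover have "0 \<le> ?p (fst z) * (indicator (- B) (snd z) * K)" "0 \<le> ?p (fst z) * ?n (snd z)"
        using deficit_bounds(1)[of s "fst z"] K by (auto simp: neg_part_def intro!: mult_nonneg_nonneg)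
      ultimately show "ennreal (?p (fst z) * ?g (snd z)) = ennreal (?p (fst z) * (indicator (- B) (snd z) * K))
        + ennreal (?p (fst z) * ?n (snd z))"
        by (simp only: ennreal_plus)
    qed
    also have "\<dots> = (\<integral>\<^sup>+z. ennreal (?p (fst z) * (indicator (- B) (snd z) * K)) \<partial>j)
      + (\<integral>\<^sup>+z. ennreal (?p (fst z) * ?n (snd z)) \<partial>j)"
    proof (rule nn_integral_add)
      have "(\<lambda>y. indicator (- B) y * K) \<in> borel_measurable borel" "?n \<in> borel_measurable borel" by measurable
      note [measurable] = snd_borel[OF this(1)] snd_borel[OF this(2)] fst_borel[OF F_borel[OF pF]]
      show "(\<lambda>z. ennreal (?p (fst z) * (indicator (- B) (snd z) * K))) \<in> borel_measurable j"
        "(\<lambda>z. ennreal (?p (fst z) * ?n (snd z))) \<in> borel_measurable j" by measurable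
    qed
    also have "\<dots> \<le> ennreal (K\<^sup>2 * jump_mass) + ennreal (\<tau> * (K * ball_mass))" by (intro add_mono a b)
    also have "\<dots> = ennreal c" unfolding c_def using K \<tau> ball_mass_pos
      by (intro ennreal_plus[symmetric]) (auto simp: jump_mass_def intro!: mult_nonneg_nonneg)
    finally show "(\<integral>\<^sup>+z. ennreal (?p (fst z) * ?g (snd z)) \<partial>j) \<le> ennreal c" .
  qed (rule c0)
  have "jump_form j ?p (u s) \<le> jump_form j ?p w + 2 * c"
    using jump_form_add(1)[OF ju jw] comp by simp
  moreover have "0 \<le> D + ext_form \<mu> F EL j B (u s) ?p"
    by (rule supercaloric_test[OF deficit_F_on[OF s] _ s D]) (use deficit_bounds in auto)
  ultimately have 1: "0 \<le> D + E w ?p + 2 * c"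
    using E_split[OF w(2) pF] jump_form_commute[of ?p w] unfolding ext by simp
  \<comment> \<open>with x = w - K psi the two parts are x_+ = w - trunc and x_- = deficit\<close>
  have 2: "E w ?p \<le> E (trunc s) ?p"
  proof -
    let ?x = "\<lambda>x. w x - K * \<psi> x"
    have x: "?x \<in> F" by (intro e1.diff_mem w K_psi_F)
    have ae: "AE x in \<mu>. min (w x) (K * \<psi> x) = trunc s x" by (rule trunc_eq_ext[OF s w(3,4,5)])
    have "E (\<lambda>x. w x - trunc s x) ?p = E (\<lambda>x. max (?x x) 0) (\<lambda>x. max (- ?x x) 0)"
    proof (rule E_cong2)
      show "(\<lambda>x. w x - trunc s x) \<in> F" by (intro e1.diff_mem w mF)
      show "AE x in \<mu>. w x - trunc s x = max (?x x) 0" using ae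
        by eventually_elim (auto simp: min_def max_def split: if_splits)
      show "AE x in \<mu>. ?p x = max (- ?x x) 0" using ae unfolding deficit_def
        by eventually_elim (auto simp: min_def max_def split: if_splits)
    qed (intro pF pos_part(1) neg_part_mem x)+
    also have "\<dots> \<le> 0" by (rule E_pos_neg_le[OF x])
    finally show ?thesis using en.diff_left[OF w(2) mF pF] by simp
  qed
  have eqm: "trunc s = (\<lambda>x. K * \<psi> x - ?p x)" by (auto simp: deficit_def)
  have "E (trunc s) ?p = E (\<lambda>x. K * \<psi> x) ?p - E ?p ?p"
    by (subst eqm, rule en.diff_left[OF K_psi_F pF pF])
  moreover have "2 * E (\<lambda>x. K * \<psi> x) ?p \<le> E (\<lambda>x. K * \<psi> x) (\<lambda>x. K * \<psi> x) + E ?p ?p"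
    using en.young[OF K_psi_F pF] by simp
  ultimately have 3: "E ?p ?p \<le> E (\<lambda>x. K * \<psi> x) (\<lambda>x. K * \<psi> x) + 2 * D + 4 * c" using 1 2 by simp
  have "(LINT x|\<mu>. ?p x * ?p x) \<le> (LINT x|\<mu>. K\<^sup>2 * indicator B x)"
  proof (rule integral_mono)
    show "integrable \<mu> (\<lambda>x. ?p x * ?p x)" using sq_integrable[OF pF] by (simp add: power2_eq_square)
    show "integrable \<mu> (\<lambda>x. K\<^sup>2 * indicator B x)"
      using emeasure_ball[of x0 R] by (intro integrable_mult_right integrable_real_indicator) (auto simp: sets_mu)
    show "?p x * ?p x \<le> K\<^sup>2 * indicator B x" for x
      using deficit_bounds(1,3)[of s x] p0[of x] K
      by (cases "x \<in> B") (auto simp: power2_eq_square intro!: mult_mono)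
  qed
  also have "\<dots> = K\<^sup>2 * ball_mass" by (simp add: ball_mass_def)
  finally have 4: "E1' ?p ?p \<le> E ?p ?p + K\<^sup>2 * ball_mass" by (simp add: E1_def)
  have "E1' (trunc s) (trunc s) \<le> 2 * E1' (\<lambda>x. K * \<psi> x) (\<lambda>x. K * \<psi> x) + 2 * E1' ?p ?p"
    by (subst (1 2) eqm, rule e1.sq_diff_le[OF K_psi_F pF])
  then have "E1' (trunc s) (trunc s) - energy_const - 4 * D \<le> tail_const * \<tau>"
    using 3 4 unfolding energy_const_def tail_const_def c_def by (simp add: algebra_simps)
  then have "ennreal (E1' (trunc s) (trunc s) - energy_const - 4 * D) \<le> ennreal (tail_const * \<tau>)"
    by (rule ennreal_leI)
  then show ?thesis using \<tau> tail_const_pos by (simp add: ennreal_mult)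
qed

end

section \<open>Integration in time\<close>

text \<open>The integral of a function that need not be measurable is the supremum over measurable
  minorants. A minorant that attains it dominates every other one almost everywhere.\<close>

lemma nn_integral_maximal_minorant:
  fixes f :: "'b \<Rightarrow> ennreal"
  assumes fin: "(\<integral>\<^sup>+x. f x \<partial>M) < \<infinity>"
  obtains g where "g \<in> borel_measurable M" "\<And>x. g x \<le> f x" "(\<integral>\<^sup>+x. g x \<partial>M) = (\<integral>\<^sup>+x. f x \<partial>M)"
    "\<And>q. q \<in> borel_measurable M \<Longrightarrow> (\<And>x. q x \<le> f x) \<Longrightarrow> AE x in M. q x \<le> g x"
proof -
  let ?A = "{g. simple_function M g \<and> g \<le> f}"
  have ne: "?A \<noteq> {}" by (auto intro!: exI[of _ "\<lambda>x. 0"] simp: le_fun_def)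
  from ennreal_SUP_countable_SUP[OF ne, of "integral\<^sup>S M"]
  obtain F :: "nat \<Rightarrow> ennreal" where F: "range F \<subseteq> integral\<^sup>S M ` ?A" "(SUP g\<in>?A. integral\<^sup>S M g) = (SUP n. F n)"
    by (elim exE conjE)
  have "\<forall>n. \<exists>s\<in>?A. F n = integral\<^sup>S M s" using F(1) by auto
  then obtain s where s: "\<And>n::nat. simple_function M (s n)" "\<And>n x. s n x \<le> f x" "\<And>n. F n = integral\<^sup>S M (s n)"
    unfolding mem_Collect_eq Bex_def le_fun_def by metis
  define g where "g x = (SUP n. s n x)" for x
  have gm: "g \<in> borel_measurable M"
    unfolding g_def using s(1) by (intro borel_measurable_SUP) (auto intro: borel_measurable_simple_function)
  have gf: "g x \<le> f x" for x unfolding g_def by (intro SUP_least s)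
  have eq: "(\<integral>\<^sup>+x. g x \<partial>M) = (\<integral>\<^sup>+x. f x \<partial>M)"
  proof (rule antisym)
    show "(\<integral>\<^sup>+x. g x \<partial>M) \<le> (\<integral>\<^sup>+x. f x \<partial>M)" by (intro nn_integral_mono gf)
    have "F n \<le> (\<integral>\<^sup>+x. g x \<partial>M)" for n
    proof -
      have "F n = (\<integral>\<^sup>+x. s n x \<partial>M)" using s(1,3) by (simp add: nn_integral_eq_simple_integral)
      also have "\<dots> \<le> (\<integral>\<^sup>+x. g x \<partial>M)" unfolding g_def by (intro nn_integral_mono SUP_upper) auto
      finally show ?thesis .
    qed
    then have "(SUP n. F n) \<le> (\<integral>\<^sup>+x. g x \<partial>M)" by (intro SUP_least) auto
    then show "(\<integral>\<^sup>+x. f x \<partial>M) \<le> (\<integral>\<^sup>+x. g x \<partial>M)" unfolding nn_integral_def[of M f] F(2) .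
  qed
  have max: "AE x in M. q x \<le> g x" if q: "q \<in> borel_measurable M" "\<And>x. q x \<le> f x" for q
  proof -
    note [measurable] = gm q(1)
    let ?h = "\<lambda>x. max (g x) (q x)"
    have hg: "(\<integral>\<^sup>+x. ?h x \<partial>M) \<le> (\<integral>\<^sup>+x. g x \<partial>M)"
      unfolding eq by (intro nn_integral_mono) (simp add: gf q)
    have gfin: "(\<integral>\<^sup>+x. g x \<partial>M) \<noteq> \<infinity>" using fin eq by auto
    have "(\<integral>\<^sup>+x. ?h x - g x \<partial>M) = (\<integral>\<^sup>+x. ?h x \<partial>M) - (\<integral>\<^sup>+x. g x \<partial>M)"
      by (rule nn_integral_diff) (use gfin in auto)
    also have "\<dots> = 0"
    proof (rule diff_eq_0_ennreal[OF _ hg])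
      show "(\<integral>\<^sup>+x. ?h x \<partial>M) < top" using hg gfin by (simp add: less_top le_less_trans)
    qed
    finally have "AE x in M. ?h x - g x = 0" by (subst (asm) nn_integral_0_iff_AE) auto
    moreover have "AE x in M. g x \<noteq> \<infinity>" using nn_integral_PInf_AE[OF gm gfin] .
    ultimately show ?thesis
    proof eventually_elim
      case (elim x)
      then have "max (g x) (q x) \<le> g x" by (simp add: diff_eq_0_iff_ennreal)
      then show ?case by simp
    qed
  qed
  show thesis by (rule that[OF gm gf eq max])
qed

lemma borel_measurable_lebesgue_AE:
  fixes f g :: "real \<Rightarrow> real"
  assumes f: "f \<in> borel_measurable lebesgue" and ae: "AE x in lebesgue. f x = g x"
  shows "g \<in> borel_measurable lebesgue"
proof (rule measurableI)
  fix A :: "real set" assume A: "A \<in> sets borel"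
  show "g -` A \<inter> space lebesgue \<in> sets lebesgue"
  proof (rule completion.in_sets_AE)
    show "f -` A \<inter> space lebesgue \<in> sets lebesgue" using f A by (rule measurable_sets)
    show "AE x in lebesgue. x \<in> f -` A \<inter> space lebesgue \<longleftrightarrow> x \<in> g -` A \<inter> space lebesgue"
      using ae by eventually_elim auto
  qed auto
qed simp

text \<open>The intervals may end but not begin at an exceptional point, where the primitives that
  bound the integrals are continuous from the left only. Such intervals exhaust the gap between
  two consecutive exceptional points, and finitely many gaps add up.\<close>

lemma nn_integral_finite_pieces:
  fixes f :: "real \<Rightarrow> ennreal"
  assumes S: "finite S" and f[measurable]: "f \<in> borel_measurable lebesgue" and C: "C < \<infinity>"
    and le: "\<And>c d. a < c \<Longrightarrow> c < d \<Longrightarrow> d \<le> b \<Longrightarrow> {c..<d} \<inter> S = {} \<Longrightarrow> (\<integral>\<^sup>+s. f s * indicator {c..d} s \<partial>lebesgue) \<le> C"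
  shows "(\<integral>\<^sup>+s. f s * indicator {a<..b} s \<partial>lebesgue) < \<infinity>"
proof -
  define \<nu> where "\<nu> = density lebesgue f"
  have \<nu>: "emeasure \<nu> A = (\<integral>\<^sup>+s. f s * indicator A s \<partial>lebesgue)" if "A \<in> sets borel" for A
    unfolding \<nu>_def using that by (intro emeasure_density f) auto
  have sb: "A \<in> sets \<nu>" if "A \<in> sets borel" for A using that by (simp add: \<nu>_def)
  have 1: "emeasure \<nu> {c<..d} \<le> C" if cd: "a \<le> c" "c < d" "d \<le> b" "{c<..<d} \<inter> S = {}" for c d
  proof -
    let ?A = "\<lambda>n. {c + (d - c) / real (n + 2)..d}"
    have eq: "(\<Union>n. ?A n) = {c<..d}"
    proof (intro equalityI subsetI)
      fix x assume "x \<in> (\<Union>n. ?A n)"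
      then obtain n where n: "c + (d - c) / real (n + 2) \<le> x" "x \<le> d" by auto
      moreover have "0 < (d - c) / real (n + 2)" using cd by simp
      ultimately show "x \<in> {c<..d}" by simp
    next
      fix x assume x: "x \<in> {c<..d}"
      obtain n :: nat where "(d - c) / (x - c) < real n" using reals_Archimedean2 by blast
      then have "(d - c) / (x - c) \<le> real (n + 2)" by simp
      then have "(d - c) / real (n + 2) \<le> x - c" using x by (simp add: field_simps)
      then show "x \<in> (\<Union>n. ?A n)" using x by (auto intro!: exI[of _ n])
    qed
    have inc: "incseq ?A"
    proof (rule incseq_SucI)
      fix n
      have "(d - c) / real (Suc n + 2) \<le> (d - c) / real (n + 2)" using cd by (intro divide_left_mono) auto
      then show "?A n \<subseteq> ?A (Suc n)" by auto
    qed
    have "emeasure \<nu> {c<..d} = (SUP n. emeasure \<nu> (?A n))"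
      unfolding eq[symmetric] by (rule SUP_emeasure_incseq[symmetric, OF _ inc]) (auto intro: sb)
    also have "\<dots> \<le> C"
    proof (rule SUP_least)
      fix n
      define \<delta> where "\<delta> = (d - c) / real (n + 2)"
      have p: "0 < \<delta>" "\<delta> < d - c" unfolding \<delta>_def using cd by (auto simp: divide_less_eq)
      have "emeasure \<nu> {c + \<delta>..d} \<le> C"
      proof -
        have "{c + \<delta>..<d} \<subseteq> {c<..<d}" using p by auto
        then have "{c + \<delta>..<d} \<inter> S = {}" using cd(4) by blast
        then show ?thesis unfolding \<nu>[OF atLeastAtMost_borel] using p cd by (intro le) auto
      qed
      then show "emeasure \<nu> (?A n) \<le> C" unfolding \<delta>_def .
    qed
    finally show ?thesis .
  qed
  have 2: "a \<le> c \<Longrightarrow> c < d \<Longrightarrow> d \<le> b \<Longrightarrow> card (S \<inter> {c<..<d}) = n \<Longrightarrow> emeasure \<nu> {c<..d} < \<infinity>" for n c d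
  proof (induction n arbitrary: c d rule: less_induct)
    case (less n)
    show ?case
    proof (cases "S \<inter> {c<..<d} = {}")
      case True
      then show ?thesis using 1[of c d] less.prems C by (metis inf_commute le_less_trans)
    next
      case False
      then obtain p where p: "p \<in> S" "c < p" "p < d" by auto
      have "card (S \<inter> {c<..<p}) < n" "card (S \<inter> {p<..<d}) < n"
        unfolding less.prems(4)[symmetric] using S p by (auto intro!: psubset_card_mono)
      then have "emeasure \<nu> {c<..p} < \<infinity>" "emeasure \<nu> {p<..d} < \<infinity>"
        using less.IH[of _ c p] less.IH[of _ p d] less.prems p by auto
      moreover have "{c<..d} = {c<..p} \<union> {p<..d}" using p by auto
      moreover have "emeasure \<nu> ({c<..p} \<union> {p<..d}) \<le> emeasure \<nu> {c<..p} + emeasure \<nu> {p<..d}"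
        by (intro emeasure_subadditive sb) auto
      ultimately show ?thesis by (metis ennreal_add_eq_top infinity_ennreal_def less_top top.not_eq_extremum
        order_le_less_trans)
    qed
  qed
  show ?thesis
  proof (cases "a < b")
    case True
    then show ?thesis using 2[of a b] \<nu>[of "{a<..b}"] by simp
  qed simp
qed

text \<open>The derivative is the limit of the difference quotients with steps 1/(n+1).\<close>

lemma deriv_measurable_on_open:
  fixes f f' :: "real \<Rightarrow> real"
  assumes U: "open U" and d: "\<And>x. x \<in> U \<Longrightarrow> (f has_real_derivative f' x) (at x)"
  shows "(\<lambda>x. indicator U x * f' x) \<in> borel_measurable borel"
proof -
  have "continuous_on U f" using d by (intro continuous_at_imp_continuous_on ballI DERIV_isCont) auto
  then have "(\<lambda>x. indicator U x *\<^sub>R f x) \<in> borel_measurable borel"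
    using U by (intro borel_measurable_continuous_on_indicator) auto
  then have [measurable]: "(\<lambda>x. indicator U x * f x) \<in> borel_measurable borel" by simp
  have [measurable]: "U \<in> sets borel" using U by simp
  let ?q = "\<lambda>n x. ((indicator U (x + 1 / Suc n) * f (x + 1 / Suc n)) - indicator U x * f x) / (1 / Suc n)"
  have qm: "(\<lambda>x. indicator U x * ?q n x) \<in> borel_measurable borel" for n
  proof -
    have "(\<lambda>x. (\<lambda>x. indicator U x * f x) (x + 1 / Suc n)) \<in> borel_measurable borel"
      by (rule measurable_compose[of "\<lambda>x. x + 1 / Suc n" borel borel "\<lambda>x. indicator U x * f x"]) measurable
    then show ?thesis by measurable
  qed
  show ?thesis
  proof (rule borel_measurable_LIMSEQ_real[OF _ qm])
    fix x
    show "(\<lambda>n. indicator U x * ?q n x) \<longlonglongrightarrow> indicator U x * f' x"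
    proof (cases "x \<in> U")
      case True
      have lim0: "(\<lambda>n. 1 / real (Suc n)) \<longlonglongrightarrow> 0" using LIMSEQ_Suc[OF lim_1_over_n] .
      have "(\<lambda>h. (f (x + h) - f x) / h) \<midarrow>0\<rightarrow> f' x" using d[OF True] by (simp add: DERIV_def)
      then have A: "(\<lambda>n. (f (x + 1 / Suc n) - f x) / (1 / Suc n)) \<longlonglongrightarrow> f' x"
        by (rule filterlim_compose) (intro filterlim_atI lim0, simp)
      have "(\<lambda>n. x + 1 / real (Suc n)) \<longlonglongrightarrow> x + 0" by (intro tendsto_intros lim0)
      then have "eventually (\<lambda>n. x + 1 / real (Suc n) \<in> U) sequentially"
        using U True by (intro topological_tendstoD) auto
      then have "eventually (\<lambda>n. (f (x + 1 / Suc n) - f x) / (1 / Suc n) = indicator U x * ?q n x) sequentially"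
        by eventually_elim (use True in simp)
      from Lim_transform_eventually[OF A this] show ?thesis using True by simp
    qed simp
  qed
qed

text \<open>The function (a - x)_+ ^2 has weak second derivative at most 2; the error of its first
  order expansion is at most the square of the increment.\<close>

lemma quadratic_estimate:
  fixes a x y :: real
  shows "\<bar>(max (a - y) 0)\<^sup>2 - (max (a - x) 0)\<^sup>2 + 2 * (max (a - x) 0 * (y - x))\<bar> \<le> (y - x)\<^sup>2"
proof -
  consider "a \<ge> y" "a \<ge> x" | "a \<ge> y" "a < x" | "a < y" "a \<ge> x" | "a < y" "a < x" by linarith
  then show ?thesis
  proof cases
    case 1
    then have "(max (a - y) 0)\<^sup>2 - (max (a - x) 0)\<^sup>2 + 2 * (max (a - x) 0 * (y - x)) = (y - x)\<^sup>2"
      by (simp add: power2_eq_square algebra_simps)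
    then show ?thesis by simp
  next
    case 2
    then have "(a - y)\<^sup>2 \<le> (x - y)\<^sup>2" by (intro power_mono) auto
    then show ?thesis using 2 by (simp add: power2_commute)
  next
    case 3
    define p h where "p = a - x" and "h = y - x"
    have ph: "0 \<le> p" "p \<le> h" using 3 by (auto simp: p_def h_def)
    have "0 \<le> (h - p)\<^sup>2" by simp
    then have up: "2 * (p * h) - p\<^sup>2 \<le> h\<^sup>2" by (simp add: power2_eq_square algebra_simps)
    have pp: "p * p \<le> p * h" using ph by (intro mult_left_mono) auto
    have "0 \<le> p * h" using ph by simp
    with pp have "0 \<le> 2 * (p * h) - p\<^sup>2" unfolding power2_eq_square by linarith
    with up have "\<bar>2 * (p * h) - p\<^sup>2\<bar> \<le> h\<^sup>2" by simp
    then show ?thesis using 3 by (simp add: p_def h_def)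
  next
    case 4
    then show ?thesis by simp
  qed
qed

lemma quotient_estimate:
  fixes A L h C :: real
  assumes le: "\<bar>2 * (A + h * L)\<bar> \<le> h * (h * C)" and h: "h \<noteq> 0" and C: "0 \<le> C"
  shows "\<bar>A / h + L\<bar> \<le> \<bar>h\<bar> * C"
proof -
  have "A + h * L = h * (A / h + L)" using h by (simp add: distrib_left)
  then have "2 * (\<bar>h\<bar> * \<bar>A / h + L\<bar>) \<le> h * (h * C)" using le by (simp add: abs_mult)
  also have "h * (h * C) = \<bar>h\<bar> * (\<bar>h\<bar> * C)" by (simp add: abs_mult_self_eq mult.assoc[symmetric])
  finally have "\<bar>h\<bar> * (2 * \<bar>A / h + L\<bar>) \<le> \<bar>h\<bar> * (\<bar>h\<bar> * C)" by (simp add: ac_simps)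
  then have "2 * \<bar>A / h + L\<bar> \<le> \<bar>h\<bar> * C" using h by simp
  moreover have "\<bar>A / h + L\<bar> \<le> 2 * \<bar>A / h + L\<bar>" by simp
  ultimately show ?thesis by (rule order_trans[rotated])
qed

text \<open>The set S contains the exceptional times at which only left derivatives of the pairings are
  required.\<close>

locale supersolution_in_time = supersolution \<mu> F E EL j J u t1 t2 x0 R K \<psi>
  for \<mu> :: "'a::polish_space measure" and F E EL j J u t1 t2 x0 R K \<psi> +
  fixes S :: "real set"
  assumes S: "finite S" "S \<subseteq> {t1<..t2}" "t2 \<in> S"
    and diff: "\<And>\<phi> t. \<phi> \<in> L2 \<mu> (ball x0 R) \<Longrightarrow> t \<in> {t1<..t2} - S \<Longrightarrow> pairing \<mu> (ball x0 R) u \<phi> differentiable (at t)"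
    and tail_finite: "tail \<mu> J (2 / 3) t1 t2 x0 R (neg_part u) < \<infinity>"
begin

sublocale l2B: semi_hilbert "L2 \<mu> (ball x0 R)" "\<lambda>f g. LINT x:ball x0 R|\<mu>. f x * g x"
  by (rule semi_hilbert_L2[OF sets_mu _ emeasure_ball]) simp

lemma I_alt: "I \<phi> s = (LINT x:B|\<mu>. u s x * \<phi> x)" by (simp add: pairing_def)

lemma u_L2: "s \<in> {t1<..t2} \<Longrightarrow> u s \<in> L2 \<mu> B"
  by (rule L2_of_bounded[OF sets_mu _ u_borel emeasure_ball bdd]) auto

lemma F_L2B: assumes "\<phi> \<in> F" shows "\<phi> \<in> L2 \<mu> B"
proof -
  have i: "integrable \<mu> (\<lambda>x. (\<phi> x)\<^sup>2)" by (rule sq_integrable[OF assms])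
  have "set_integrable \<mu> B (\<lambda>x. (\<phi> x)\<^sup>2)"
    by (rule set_integrable_subset[of \<mu> UNIV]) (use i in \<open>auto simp: set_integrable_def sets_mu\<close>)
  then show ?thesis using F_borel[OF assms] by (simp add: L2_def)
qed

lemma deficit_eq: assumes s: "s \<in> {t1<..t2}"
  shows "AE x in \<mu>. x \<in> B \<longrightarrow> deficit s x = max (K * \<psi> x - u s x) 0"
  using trunc_eq_u(2)[OF s] by eventually_elim (auto simp: deficit_def)

text \<open>The factor 1/2 makes the derivative at time s minus that of u paired with the deficit
  frozen at time s.\<close>

definition deficit_sq :: "real \<Rightarrow> real" where "deficit_sq s = (LINT x:B|\<mu>. deficit s x * deficit s x) / 2"

lemma deficit_sq_nonneg: "0 \<le> deficit_sq s" unfolding deficit_sq_def set_lebesgue_integral_def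
  by (intro divide_nonneg_pos integral_nonneg_AE) auto

lemma deficit_sq_bound: assumes s: "s \<in> {t1<..t2}" shows "deficit_sq s \<le> K\<^sup>2 * ball_mass"
proof -
  have "(LINT x:B|\<mu>. deficit s x * deficit s x) \<le> (LINT x:B|\<mu>. K\<^sup>2)"
  proof (rule set_integral_mono)
    show "set_integrable \<mu> B (\<lambda>x. deficit s x * deficit s x)"
      using L2_prod_integrable[OF sets_mu _ F_L2B[OF deficit_F[OF s]] F_L2B[OF deficit_F[OF s]]] by simp
    show "set_integrable \<mu> B (\<lambda>x. K\<^sup>2)" using emeasure_ball[of x0 R]
      by (simp add: set_integrable_def sets_mu)
    show "deficit s x * deficit s x \<le> K\<^sup>2" for x
      using deficit_bounds(1,3)[of s x] K by (auto simp: power2_eq_square intro!: mult_mono)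
  qed
  also have "\<dots> = K\<^sup>2 * ball_mass" by (simp add: set_lebesgue_integral_def ball_mass_def mult.commute sets_mu)
  finally show ?thesis using deficit_sq_nonneg[of s] unfolding deficit_sq_def by simp
qed

text \<open>All pairings being differentiable makes the difference quotients of u pointwise bounded as
  functionals on L2(B), hence bounded in L2(B) by uniform boundedness. The error in the first
  order expansion of the square is then of second order in the time step.\<close>

lemma deficit_sq_derivative:
  assumes s: "s \<in> {t1<..t2}" and A: "A \<subseteq> {t1<..t2}"
    and d: "\<And>\<phi>. \<phi> \<in> L2 \<mu> B \<Longrightarrow> \<exists>D. (I \<phi> has_real_derivative D) (at s within A)"
    and D: "(I (deficit s) has_real_derivative D) (at s within A)"
  shows "(deficit_sq has_real_derivative - D) (at s within A)"
  unfolding has_field_derivative_iff tendsto_at_iff_sequentially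
proof (intro allI impI)
  fix X :: "nat \<Rightarrow> real" assume X: "\<forall>i. X i \<in> A - {s}" "X \<longlonglongrightarrow> s"
  have XA: "X n \<in> {t1<..t2}" and Xs: "X n - s \<noteq> 0" for n using X(1) A by auto
  define g where "g n x = (1 / (X n - s)) * (u (X n) x - u s x)" for n x
  have du: "(\<lambda>x. u (X n) x - u s x) \<in> L2 \<mu> B" for n by (intro l2B.diff_mem u_L2 XA s)
  have gL: "g n \<in> L2 \<mu> B" for n unfolding g_def by (rule l2B.scale_mem[OF du])
  have gv: "(LINT x:B|\<mu>. g n x * v x) = (I v (X n) - I v s) / (X n - s)" if v: "v \<in> L2 \<mu> B" for n v
    unfolding g_def l2B.scale_left[OF du v] l2B.diff_left[OF u_L2[OF XA] u_L2[OF s] v] I_alt by simp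
  have lim: "(\<lambda>n. (I v (X n) - I v s) / (X n - s)) \<longlonglongrightarrow> D'"
    if "(I v has_real_derivative D') (at s within A)" for v D'
    using that X unfolding has_field_derivative_iff tendsto_at_iff_sequentially by (auto simp: comp_def)
  have "\<exists>c. \<forall>n. l2B.nrm (g n) \<le> c"
  proof (rule l2B.uniform_boundedness[OF gL])
    fix v assume v: "v \<in> L2 \<mu> B"
    obtain D' where "(I v has_real_derivative D') (at s within A)" using d[OF v] by blast
    from lim[OF this] have "Bseq (\<lambda>n. (I v (X n) - I v s) / (X n - s))" by (intro convergent_imp_Bseq convergentI)
    then show "\<exists>c. \<forall>n. \<bar>LINT x:B|\<mu>. g n x * v x\<bar> \<le> c" unfolding gv[OF v] Bseq_def real_norm_def by blast
  qed
  then obtain c where c: "\<And>n. l2B.nrm (g n) \<le> c" by blast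
  have gc: "(LINT x:B|\<mu>. g n x * g n x) \<le> c\<^sup>2" for n
    using power_mono[OF c l2B.nrm_nonneg[OF gL], of n 2] unfolding l2B.nrm_sq[OF gL] .
  have phL: "deficit t \<in> L2 \<mu> B" if "t \<in> {t1<..t2}" for t by (rule F_L2B[OF deficit_F[OF that]])
  have est: "\<bar>(deficit_sq (X n) - deficit_sq s) / (X n - s) + (LINT x:B|\<mu>. g n x * deficit s x)\<bar>
    \<le> \<bar>X n - s\<bar> * c\<^sup>2" for n
  proof -
    let ?h = "X n - s" and ?d = "\<lambda>x. u (X n) x - u s x"
    have i1: "set_integrable \<mu> B (\<lambda>x. deficit (X n) x * deficit (X n) x)"
      "set_integrable \<mu> B (\<lambda>x. deficit s x * deficit s x)"
      "set_integrable \<mu> B (\<lambda>x. ?d x * deficit s x)" "set_integrable \<mu> B (\<lambda>x. ?d x * ?d x)"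
      using phL[OF XA] phL[OF s] du by (auto intro!: L2_prod_integrable[OF sets_mu])
    let ?e = "\<lambda>x. deficit (X n) x * deficit (X n) x - deficit s x * deficit s x + 2 * (?d x * deficit s x)"
    have ie: "set_integrable \<mu> B ?e" using i1
      by (intro set_integral_add set_integral_diff set_integrable_mult_right) auto
    have ee: "(LINT x:B|\<mu>. ?e x) = 2 * deficit_sq (X n) - 2 * deficit_sq s + 2 * (LINT x:B|\<mu>. ?d x * deficit s x)"
      using i1 unfolding deficit_sq_def by (simp add: set_integral_add set_integral_diff)
    have dg: "(LINT x:B|\<mu>. ?d x * v x) = ?h * (LINT x:B|\<mu>. g n x * v x)" if v: "v \<in> L2 \<mu> B" for v
      unfolding g_def l2B.scale_left[OF du v] using Xs[of n] by simp
    have dd: "(LINT x:B|\<mu>. ?d x * ?d x) = ?h * (?h * (LINT x:B|\<mu>. g n x * g n x))"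
    proof -
      have "(LINT x:B|\<mu>. ?d x * ?d x) = ?h * (LINT x:B|\<mu>. g n x * ?d x)" by (rule dg[OF du])
      also have "(LINT x:B|\<mu>. g n x * ?d x) = (LINT x:B|\<mu>. ?d x * g n x)" by (rule l2B.sym[OF gL du])
      also have "\<dots> = ?h * (LINT x:B|\<mu>. g n x * g n x)" by (rule dg[OF gL])
      finally show ?thesis .
    qed
    have "\<bar>LINT x:B|\<mu>. ?e x\<bar> \<le> (LINT x:B|\<mu>. ?d x * ?d x)"
    proof -
      have "\<bar>LINT x|\<mu>. indicator B x *\<^sub>R ?e x\<bar> \<le> (LINT x|\<mu>. \<bar>indicator B x *\<^sub>R ?e x\<bar>)" by (rule integral_abs_bound)
      also have "\<dots> \<le> (LINT x|\<mu>. indicator B x *\<^sub>R (?d x * ?d x))"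
      proof (rule integral_mono_AE)
        show "integrable \<mu> (\<lambda>x. \<bar>indicator B x *\<^sub>R ?e x\<bar>)" using ie unfolding set_integrable_def
          by (rule integrable_abs)
        show "integrable \<mu> (\<lambda>x. indicator B x *\<^sub>R (?d x * ?d x))" using i1(4) unfolding set_integrable_def .
        show "AE x in \<mu>. \<bar>indicator B x *\<^sub>R ?e x\<bar> \<le> indicator B x *\<^sub>R (?d x * ?d x)"
          using deficit_eq[OF XA[of n]] deficit_eq[OF s]
        proof eventually_elim
          case (elim x)
          show ?case
          proof (cases "x \<in> B")
            case True
            then show ?thesis using elim quadratic_estimate[of "K * \<psi> x" "u (X n) x" "u s x"]
              by (simp add: power2_eq_square mult.commute)
          qed simp
        qed
      qed
      finally show ?thesis unfolding set_lebesgue_integral_def .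
    qed
    also have "\<dots> \<le> ?h * (?h * c\<^sup>2)" unfolding dd mult.assoc[symmetric]
      using gc[of n] by (intro mult_left_mono) auto
    finally have "\<bar>2 * (deficit_sq (X n) - deficit_sq s + ?h * (LINT x:B|\<mu>. g n x * deficit s x))\<bar> \<le> ?h * (?h * c\<^sup>2)"
      unfolding ee dg[OF phL[OF s]] by (simp add: algebra_simps)
    from quotient_estimate[OF this Xs[of n]] show ?thesis by simp
  qed
  have b0: "(\<lambda>n. \<bar>X n - s\<bar> * c\<^sup>2) \<longlonglongrightarrow> \<bar>s - s\<bar> * c\<^sup>2" by (intro tendsto_intros X)
  have "(\<lambda>n. (deficit_sq (X n) - deficit_sq s) / (X n - s) + (LINT x:B|\<mu>. g n x * deficit s x)) \<longlonglongrightarrow> 0"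
  proof (rule Lim_null_comparison)
    show "eventually (\<lambda>n. norm ((deficit_sq (X n) - deficit_sq s) / (X n - s)
      + (LINT x:B|\<mu>. g n x * deficit s x)) \<le> \<bar>X n - s\<bar> * c\<^sup>2) sequentially"
      unfolding real_norm_def by (rule always_eventually[OF allI[OF est]])
    show "(\<lambda>n. \<bar>X n - s\<bar> * c\<^sup>2) \<longlonglongrightarrow> 0" using b0 by simp
  qed
  moreover have "(\<lambda>n. (LINT x:B|\<mu>. g n x * deficit s x)) \<longlonglongrightarrow> D"
    unfolding gv[OF phL[OF s]] by (rule lim[OF D])
  ultimately have "(\<lambda>n. ((deficit_sq (X n) - deficit_sq s) / (X n - s) + (LINT x:B|\<mu>. g n x * deficit s x))
    - (LINT x:B|\<mu>. g n x * deficit s x)) \<longlonglongrightarrow> 0 - D"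
    by (rule tendsto_diff)
  then show "((\<lambda>y. (deficit_sq y - deficit_sq s) / (y - s)) \<circ> X) \<longlonglongrightarrow> - D" by (simp add: comp_def)
qed

definition regular_times where "regular_times = {t1<..<t2} - S"

lemma regular_times_open: "open regular_times" unfolding regular_times_def using S(1)
  by (intro open_Diff finite_imp_closed) auto
lemma regular_times_sub: "s \<in> regular_times \<Longrightarrow> s \<in> {t1<..t2}" by (auto simp: regular_times_def)
lemma regular_times_eq: "{t1<..t2} - S = regular_times" using S(3) by (auto simp: regular_times_def less_le)

lemma I_deriv: "\<phi> \<in> L2 \<mu> B \<Longrightarrow> s \<in> regular_times \<Longrightarrow> (I \<phi> has_real_derivative deriv (I \<phi>) s) (at s)"
  using diff[of \<phi> s] regular_times_eq
    by (simp add: field_differentiable_derivI real_differentiable_def field_differentiable_def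
    DERIV_deriv_iff_real_differentiable)

lemma I_continuous: "\<phi> \<in> L2 \<mu> B \<Longrightarrow> continuous_on {t1<..t2} (I \<phi>)"
  using sc by (simp add: supercaloric_def)

lemma deficit_sq_has_derivative: assumes s: "s \<in> regular_times"
  shows "(deficit_sq has_real_derivative - deriv (I (deficit s)) s) (at s)"
proof -
  have o: "open {t1<..<t2}" and i: "s \<in> {t1<..<t2}" using s by (auto simp: regular_times_def)
  have "(deficit_sq has_real_derivative - deriv (I (deficit s)) s) (at s within {t1<..<t2})"
  proof (rule deficit_sq_derivative[OF regular_times_sub[OF s]])
    show "{t1<..<t2} \<subseteq> {t1<..t2}" by auto
    show "\<exists>D. (I \<phi> has_real_derivative D) (at s within {t1<..<t2})" if "\<phi> \<in> L2 \<mu> B" for \<phi>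
      using I_deriv[OF that s] has_field_derivative_at_within by blast
    show "(I (deficit s) has_real_derivative deriv (I (deficit s)) s) (at s within {t1<..<t2})"
      by (rule has_field_derivative_at_within[OF I_deriv[OF F_L2B[OF deficit_F[OF regular_times_sub[OF s]]] s]])
  qed
  then show ?thesis using at_within_open[OF i o] by simp
qed

text \<open>At exceptional times only left derivatives of the pairings exist, and they give left
  continuity.\<close>

lemma deficit_sq_left_continuous: assumes s: "s \<in> {t1<..t2}" shows "continuous (at s within {t1<..<s}) deficit_sq"
proof -
  have sub: "{t1<..<s} \<subseteq> {..<s}" by auto
  have ex: "\<exists>D. (I \<phi> has_real_derivative D) (at s within {t1<..<s})" if "\<phi> \<in> L2 \<mu> B" for \<phi>
  proof -
    have "\<exists>D. (I \<phi> has_real_derivative D) (at_left s)" using sc s that unfolding supercaloric_def by blast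
    then show ?thesis using has_field_derivative_subset[OF _ sub] by blast
  qed
  obtain D where D: "(I (deficit s) has_real_derivative D) (at s within {t1<..<s})"
    using ex[OF F_L2B[OF deficit_F[OF s]]] by blast
  have "(deficit_sq has_real_derivative - D) (at s within {t1<..<s})"
    by (rule deficit_sq_derivative[OF s _ ex D]) (use s in auto)
  then show ?thesis by (rule DERIV_continuous)
qed

definition deficit_sq_deriv where "deficit_sq_deriv s = - deriv (I (deficit s)) s"

lemma deficit_sq_increment:
  assumes cd: "t1 < c" "c < d" "d \<le> t2" "{c..<d} \<inter> S = {}"
  shows "(deficit_sq_deriv has_integral (deficit_sq d - deficit_sq c)) {c..d}"
proof (rule fundamental_theorem_of_calculus_interior)
  have inU: "x \<in> regular_times" if "x \<in> {c..<d}" for x using that cd by (auto simp: regular_times_def)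
  show "(deficit_sq has_vector_derivative deficit_sq_deriv x) (at x)" if "x \<in> {c<..<d}" for x
    using deficit_sq_has_derivative[OF inU] that
      by (auto simp: deficit_sq_deriv_def has_real_derivative_iff_has_vector_derivative)
  show "continuous_on {c..d} deficit_sq"
    unfolding continuous_on_eq_continuous_within
  proof
    fix x assume x: "x \<in> {c..d}"
    show "continuous (at x within {c..d}) deficit_sq"
    proof (cases "x < d")
      case True
      then have "isCont deficit_sq x" using deficit_sq_has_derivative[OF inU] x by (auto intro: DERIV_isCont)
      then show ?thesis by (rule continuous_at_imp_continuous_at_within)
    next
      case False
      then have xd: "x = d" using x by simp
      have "continuous (at d within {t1<..<d}) deficit_sq" using deficit_sq_left_continuous[of d] cd by auto
      moreover have "at d within {c..d} = at d within {t1<..<d}"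
        using cd by (intro at_within_nhd[of d "{c<..}"]) auto
      ultimately show ?thesis by (simp add: xd)
    qed
  qed
qed (use cd in auto)

lemma deficit_sq_deriv_measurable: "(\<lambda>s. indicator regular_times s * deficit_sq_deriv s) \<in> borel_measurable borel"
  by (rule deriv_measurable_on_open[OF regular_times_open, of deficit_sq]) (simp add: deficit_sq_deriv_def
    deficit_sq_has_derivative)

lemma I_deriv_measurable: "\<phi> \<in> L2 \<mu> B \<Longrightarrow> (\<lambda>s. indicator regular_times s * deriv (I \<phi>) s) \<in> borel_measurable borel"
  by (rule deriv_measurable_on_open[OF regular_times_open I_deriv])

lemma caccioppoli_regular: "s \<in> regular_times \<Longrightarrow>
  ennreal (E1' (trunc s) (trunc s) - energy_const + 4 * deficit_sq_deriv s) \<le> ennreal tail_const * tail_at s"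
  using caccioppoli[OF regular_times_sub, of s
    "deriv (I (deficit s)) s"] I_deriv[OF F_L2B[OF deficit_F[OF regular_times_sub]], of s s]
  by (simp add: deficit_sq_deriv_def has_field_derivative_at_within)

lemma test_regular: "s \<in> regular_times \<Longrightarrow> \<phi> \<in> F_on \<mu> F E B2 \<Longrightarrow> AE x in \<mu>. 0 \<le> \<phi> x \<Longrightarrow>
   ennreal (- deriv (I \<phi>) s - E (trunc s) \<phi>) \<le> 2 * (tail_at s * ennreal (LINT x|\<mu>. \<phi> x))"
  using test_inequality[OF _ _ regular_times_sub, of \<phi> s "deriv (I \<phi>) s"] I_deriv[OF F_L2B, of \<phi> s]
  by (simp add: F_on_def has_field_derivative_at_within)

text \<open>The tail need not be measurable in time, so its integral is a supremum over measurable
  minorants. A maximal one can replace it as a bound, since it dominates every other one at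
  almost every time.\<close>

definition maximal_tail_minorant :: "(real \<Rightarrow> real) \<Rightarrow> bool" where
  "maximal_tail_minorant T \<longleftrightarrow> T \<in> borel_measurable lebesgue \<and> (\<forall>s. 0 \<le> T s) \<and> integrable lebesgue T \<and>
     (LINT s|lebesgue. T s) = enn2real (tail \<mu> J (2 / 3) t1 t2 x0 R (neg_part u)) \<and>
     (\<forall>q\<in>borel_measurable lebesgue. (\<forall>s\<in>regular_times. ennreal (q s) \<le> tail_at s) \<longrightarrow>
       (AE s in lebesgue. s \<in> regular_times \<longrightarrow> q s \<le> T s))"

lemma maximal_tail_minorant_exists: "\<exists>T. maximal_tail_minorant T"
proof -
  let ?f = "\<lambda>s. tail_at s * indicator {t1<..t2} s"
  have tl: "tail \<mu> J (2 / 3) t1 t2 x0 R (neg_part u) = (\<integral>\<^sup>+s. ?f s \<partial>lebesgue)"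
    unfolding tail_def tail_at_def ..
  then have fin: "(\<integral>\<^sup>+s. ?f s \<partial>lebesgue) < \<infinity>" using tail_finite by simp
  obtain g where g: "g \<in> borel_measurable lebesgue" "\<And>x. g x \<le> ?f x" "(\<integral>\<^sup>+x. g x \<partial>lebesgue) = (\<integral>\<^sup>+x. ?f x \<partial>lebesgue)"
    "\<And>q. q \<in> borel_measurable lebesgue \<Longrightarrow> (\<And>x. q x \<le> ?f x) \<Longrightarrow> AE x in lebesgue. q x \<le> g x"
    using nn_integral_maximal_minorant[OF fin] by blast
  note [measurable] = g(1)
  have gfin: "AE s in lebesgue. g s \<noteq> \<infinity>" by (rule nn_integral_PInf_AE[OF g(1)]) (use g(3) fin in auto)
  have ge: "AE s in lebesgue. ennreal (enn2real (g s)) = g s" using gfin by eventually_elim (auto simp: less_top)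
  have ig: "(\<integral>\<^sup>+s. ennreal (enn2real (g s)) \<partial>lebesgue) = (\<integral>\<^sup>+x. ?f x \<partial>lebesgue)"
    unfolding g(3)[symmetric] by (rule nn_integral_cong_AE[OF ge])
  have "maximal_tail_minorant (\<lambda>s. enn2real (g s))"
    unfolding maximal_tail_minorant_def
  proof (intro conjI ballI impI allI)
    show "(\<lambda>s. enn2real (g s)) \<in> borel_measurable lebesgue" by measurable
    show "integrable lebesgue (\<lambda>s. enn2real (g s))"
      by (rule integrableI_nonneg) (use ig fin in auto)
    show "(LINT s|lebesgue. enn2real (g s)) = enn2real (tail \<mu> J (2 / 3) t1 t2 x0 R (neg_part u))"
      unfolding tl ig[symmetric] by (rule integral_eq_nn_integral) auto
    fix q assume q[measurable]: "q \<in> borel_measurable lebesgue" and qT: "\<forall>s\<in>regular_times. ennreal (q s) \<le> tail_at s"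
    have Us[measurable]: "regular_times \<in> sets lebesgue" using regular_times_open by (simp add: sets_completionI_sets)
    have "AE s in lebesgue. ennreal (q s) * indicator regular_times s \<le> g s"
    proof (rule g(4))
      show "(\<lambda>s. ennreal (q s) * indicator regular_times s) \<in> borel_measurable lebesgue" by measurable
      show "ennreal (q s) * indicator regular_times s \<le> ?f s" for s
        using qT regular_times_sub[of s] by (auto simp: indicator_def)
    qed
    then show "AE s in lebesgue. s \<in> regular_times \<longrightarrow> q s \<le> enn2real (g s)"
      using ge
    proof eventually_elim
      case (elim s)
      show ?case
      proof
        assume "s \<in> regular_times"
        then have "ennreal (q s) \<le> ennreal (enn2real (g s))" using elim by simp
        then show "q s \<le> enn2real (g s)" by (simp add: ennreal_le_iff)
      qed
    qed
  qed simp
  then show ?thesis by blast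
qed

definition tail_minorant where "tail_minorant = (SOME T. maximal_tail_minorant T)"

lemma tail_minorant: "maximal_tail_minorant tail_minorant" unfolding tail_minorant_def
  using maximal_tail_minorant_exists by (rule someI_ex)

lemma tail_minorant_measurable[measurable]: "tail_minorant \<in> borel_measurable lebesgue"
  and tail_minorant_nonneg: "0 \<le> tail_minorant s" and tail_minorant_integrable: "integrable lebesgue tail_minorant"
  and tail_minorant_integral: "(LINT s|lebesgue. tail_minorant s)
    = enn2real (tail \<mu> J (2 / 3) t1 t2 x0 R (neg_part u))"
  and tail_minorant_max: "q \<in> borel_measurable lebesgue \<Longrightarrow> (\<And>s. s \<in> regular_times \<Longrightarrow> ennreal (q s) \<le> tail_at s) \<Longrightarrow>
    AE s in lebesgue. s \<in> regular_times \<longrightarrow> q s \<le> tail_minorant s"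
  using tail_minorant by (auto simp: maximal_tail_minorant_def)

lemma regular_times_borel[measurable]: "regular_times \<in> sets borel" "regular_times \<in> sets lebesgue"
  using regular_times_open by (auto simp: sets_completionI_sets)

lemma AE_regular_times: "AE s in lebesgue. s \<in> {t1<..t2} \<longrightarrow> s \<in> regular_times"
proof -
  have "AE s in lebesgue. s \<notin> S"
    by (rule AE_completion[OF AE_not_in[OF finite_imp_null_set_lborel[OF S(1)]]])
  then show ?thesis by (rule eventually_mono) (use regular_times_eq in blast)
qed

end

text \<open>Optimising a quadratic inequality in a, as in the proof of the Cauchy-Schwarz inequality.\<close>

lemma discriminant_bound:
  fixes l N L C :: real
  assumes le: "\<And>a. 2 * \<bar>a * l\<bar> \<le> a\<^sup>2 * N * L + C" and C: "C > 0"
  shows "l\<^sup>2 \<le> (L * C) * N"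
proof (cases "l = 0")
  case True
  have "0 \<le> N * L + C" "0 \<le> a\<^sup>2 * N * L + C" for a using le[of 1] le[of a] by (auto intro: order_trans[rotated])
  have "0 \<le> N * L"
  proof (rule ccontr)
    assume "\<not> 0 \<le> N * L"
    then have n: "N * L < 0" by simp
    define a where "a = sqrt ((C + 1) / - (N * L))"
    have "a\<^sup>2 = (C + 1) / - (N * L)" unfolding a_def using n C by (intro real_sqrt_pow2 divide_nonneg_pos) auto
    moreover have "- (N * L) \<noteq> 0" using n by linarith
    ultimately have "a\<^sup>2 * - (N * L) = C + 1" by (metis nonzero_eq_divide_eq)
    then have "a\<^sup>2 * N * L = - (C + 1)" by simp
    then show False using \<open>0 \<le> a\<^sup>2 * N * L + C\<close> by simp
  qed
  then show ?thesis using True C by (simp add: ac_simps)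
next
  case False
  define a where "a = C / l"
  have "2 * \<bar>a * l\<bar> = 2 * C" using False C by (simp add: a_def)
  then have "C \<le> a\<^sup>2 * N * L" using le[of a] by simp
  then have "C * l\<^sup>2 \<le> (a\<^sup>2 * N * L) * l\<^sup>2" by (intro mult_right_mono) auto
  also have "\<dots> = C * ((L * C) * N)" using False by (simp add: a_def power2_eq_square)
  finally show ?thesis using C by simp
qed

context supersolution_in_time begin

section \<open>Measurability and integrability in time\<close>

interpretation lm: pair_sigma_finite lborel \<mu>
  by (intro pair_sigma_finite.intro lborel.sigma_finite_measure_axioms sigma_finite_measure_axioms)

lemma psi_borel[measurable]: "\<psi> \<in> borel_measurable borel" by (rule F_borel[OF psi(1)])

text \<open>Supercaloric functions are measurable for the completed product measure only; Tonelli's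
  theorem needs a version that is measurable for the product.\<close>

definition joint_version :: "(real \<times> 'a \<Rightarrow> real) \<Rightarrow> bool" where
  "joint_version h \<longleftrightarrow> h \<in> borel_measurable (lborel \<Otimes>\<^sub>M \<mu>) \<and> (\<forall>z. 0 \<le> h z) \<and> (\<forall>s x. h (s, x) \<le> K * \<psi> x) \<and>
     (AE s in lborel. s \<in> {t1<..t2} \<longrightarrow> (AE x in \<mu>. h (s, x) = trunc s x)) "

lemma joint_version_exists: "\<exists>h. joint_version h"
proof -
  let ?O = "{t1<..t2} \<times> (UNIV :: 'a set)"
  have "?O \<in> sets (lborel \<Otimes>\<^sub>M \<mu>)" by (intro pair_measureI) (auto simp: sets_mu)
  then have O: "?O \<inter> space (mu_hat \<mu>) \<in> sets (mu_hat \<mu>)"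
    unfolding mu_hat_def by (auto simp: space_pair_measure)
  have "(\<lambda>(t, x). u t x) \<in> borel_measurable (restrict_space (mu_hat \<mu>) ?O)"
    using sc by (simp add: supercaloric_def)
  then have "(\<lambda>z. indicator ?O z *\<^sub>R (case z of (t, x) \<Rightarrow> u t x)) \<in> borel_measurable (mu_hat \<mu>)"
    using borel_measurable_restrict_space_iff[OF O] by blast
  then obtain g where g[measurable]: "g \<in> borel_measurable (lborel \<Otimes>\<^sub>M \<mu>)"
    and ae: "AE z in lborel \<Otimes>\<^sub>M \<mu>. indicator ?O z *\<^sub>R (case z of (t, x) \<Rightarrow> u t x) = g z"
    using completion_ex_borel_measurable_real unfolding mu_hat_def by blast
  define h where "h z = min (min (max (g z) 0) K) (K * \<psi> (snd z))" for z
  have "h \<in> borel_measurable (lborel \<Otimes>\<^sub>M \<mu>)" unfolding h_def by measurable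
  moreover have "0 \<le> h z" for z using K psi(3)[of "snd z"] by (simp add: h_def)
  moreover have "h (s, x) \<le> K * \<psi> x" for s x by (simp add: h_def)
  moreover have "AE s in lborel. s \<in> {t1<..t2} \<longrightarrow> (AE x in \<mu>. h (s, x) = trunc s x)"
    using lm.AE_pair[OF ae]
  proof eventually_elim
    case (elim s)
    show ?case
    proof
      assume s: "s \<in> {t1<..t2}"
      from elim show "AE x in \<mu>. h (s, x) = trunc s x"
        by eventually_elim (use s in \<open>simp add: h_def trunc_def\<close>)
    qed
  qed
  ultimately show ?thesis unfolding joint_version_def by blast
qed

definition trunc_joint where "trunc_joint = (SOME h. joint_version h)"

lemma trunc_joint: "joint_version trunc_joint" unfolding trunc_joint_def using joint_version_exists by (rule someI_ex)

lemma trunc_joint_measurable[measurable]: "trunc_joint \<in> borel_measurable (lborel \<Otimes>\<^sub>M \<mu>)"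
  and trunc_joint_nonneg: "0 \<le> trunc_joint z" and trunc_joint_le: "trunc_joint (s, x) \<le> K * \<psi> x"
  and trunc_joint_AE: "AE s in lborel. s \<in> {t1<..t2} \<longrightarrow> (AE x in \<mu>. trunc_joint (s, x) = trunc s x)"
  using trunc_joint unfolding joint_version_def by blast+

lemma L2_times_psi: assumes g: "g \<in> L2 \<mu> UNIV" shows "integrable \<mu> (\<lambda>x. \<bar>g x\<bar> * (K * \<psi> x))"
proof -
  have "integrable \<mu> (\<lambda>x. \<bar>g x * (K * \<psi> x)\<bar>)" by (intro integrable_abs L2_prod g F_L2 K_psi_F)
  moreover have "\<bar>g x * (K * \<psi> x)\<bar> = \<bar>g x\<bar> * (K * \<psi> x)" for x
    using K psi(3)[of x] by (simp add: abs_mult)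
  ultimately show ?thesis by simp
qed

lemma pairing_AE:
  assumes g: "g \<in> L2 \<mu> UNIV"
  shows "AE s in lborel. s \<in> {t1<..t2} \<longrightarrow> (LINT x|\<mu>. g x * trunc_joint (s, x)) = (LINT x|\<mu>. g x * trunc s x)"
  using trunc_joint_AE
proof eventually_elim
  case (elim s)
  note [measurable] = L2_borel[OF g]
  show ?case
  proof
    assume s: "s \<in> {t1<..t2}"
    note [measurable] = trunc_borel[OF s]
    show "(LINT x|\<mu>. g x * trunc_joint (s, x)) = (LINT x|\<mu>. g x * trunc s x)"
      by (rule integral_cong_AE) (measurable, use elim s in auto)
  qed
qed

lemma pairing_trunc_measurable:
  assumes g: "g \<in> L2 \<mu> UNIV"
  shows "(\<lambda>s. indicator {t1<..t2} s * (LINT x|\<mu>. g x * trunc s x)) \<in> borel_measurable lebesgue"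
proof -
  note [measurable] = L2_borel[OF g]
  have "(\<lambda>s. indicator {t1<..t2} s * (LINT x|\<mu>. g x * trunc_joint (s, x))) \<in> borel_measurable lborel" by measurable
  then have a: "(\<lambda>s. indicator {t1<..t2} s * (LINT x|\<mu>. g x * trunc_joint (s, x))) \<in> borel_measurable lebesgue"
    by (rule measurable_completion)
  show ?thesis
    by (rule borel_measurable_lebesgue_AE[OF a], rule AE_completion)
       (use pairing_AE[OF g] in \<open>auto elim!: eventually_mono simp: indicator_def\<close>)
qed

text \<open>Pairings of trunc with \<phi> are limits of its pairings with resolvents, which are L2 pairings
  and hence measurable in time.\<close>

lemma E1_trunc_measurable:
  assumes p: "\<phi> \<in> F"
  shows "(\<lambda>s. indicator {t1<..t2} s * E1' (trunc s) \<phi>) \<in> borel_measurable lebesgue"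
proof -
  have "\<exists>g\<in>L2 \<mu> UNIV. E1' (\<lambda>x. \<phi> x - resolvent g x) (\<lambda>x. \<phi> x - resolvent g x) < 1 / Suc n" for n
    by (rule resolvent_dense[OF p]) simp
  then obtain g where g: "\<And>n::nat. g n \<in> L2 \<mu> UNIV"
    "\<And>n. E1' (\<lambda>x. \<phi> x - resolvent (g n) x) (\<lambda>x. \<phi> x - resolvent (g n) x) < 1 / Suc n" by metis
  have RF: "resolvent (g n) \<in> F" for n using resolvent[OF g(1)] by blast
  have lim: "(\<lambda>n. E1' (\<lambda>x. resolvent (g n) x - \<phi> x) (\<lambda>x. resolvent (g n) x - \<phi> x)) \<longlonglongrightarrow> 0"
  proof (rule tendsto_sandwich[OF _ _ tendsto_const LIMSEQ_Suc[OF lim_1_over_n]])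
    show "eventually (\<lambda>n. 0 \<le> E1' (\<lambda>x. resolvent (g n) x - \<phi> x) (\<lambda>x. resolvent (g n) x - \<phi> x)) sequentially"
      by (intro always_eventually allI e1.nonneg e1.mems RF p)
    have "E1' (\<lambda>x. resolvent (g n) x - \<phi> x) (\<lambda>x. resolvent (g n) x - \<phi> x)
      = E1' (\<lambda>x. \<phi> x - resolvent (g n) x) (\<lambda>x. \<phi> x - resolvent (g n) x)" for n
      using RF p by (simp add: e1.bilin)
    then show "eventually (\<lambda>n. E1' (\<lambda>x. resolvent (g n) x - \<phi> x) (\<lambda>x. resolvent (g n) x - \<phi> x)
      \<le> 1 / real (Suc n)) sequentially"
      using g(2) by (intro always_eventually allI) (simp add: less_imp_le)
  qed
  show ?thesis
  proof (rule borel_measurable_LIMSEQ_real[OF _ pairing_trunc_measurable[OF g(1)]])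
    fix s
    show "(\<lambda>n. indicator {t1<..t2} s * (LINT x|\<mu>. g n x * trunc s x)) \<longlonglongrightarrow> indicator {t1<..t2} s * E1' (trunc s) \<phi>"
    proof (cases "s \<in> {t1<..t2}")
      case True
      have "(\<lambda>n. E1' (resolvent (g n)) (trunc s)) \<longlonglongrightarrow> E1' \<phi> (trunc s)"
        by (rule e1.limit_left[OF RF p trunc_F[OF True] lim])
      then have "(\<lambda>n. LINT x|\<mu>. g n x * trunc s x) \<longlonglongrightarrow> E1' (trunc s) \<phi>"
        using resolvent[OF g(1)] trunc_F[OF True] e1.sym[OF p trunc_F[OF True]] by simp
      then show ?thesis using True by simp
    qed simp
  qed
qed

text \<open>The bound for the energy of trunc given by the energy estimate, with the tail replaced by
  its measurable minorant.\<close>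

definition energy_bound where "energy_bound s = energy_const + tail_const * tail_minorant s - 4 * deficit_sq_deriv s"

text \<open>The energy of trunc is not known to be measurable in time, so the maximality of the tail
  minorant cannot be applied to it. Its pairing with a fixed \<phi> is measurable, and Young's
  inequality bounds this pairing by the energy.\<close>

lemma energy_majorant:
  assumes p: "\<phi> \<in> F"
  shows "AE s in lebesgue. s \<in> regular_times \<longrightarrow> 2 * \<bar>E1' (trunc s) \<phi>\<bar> \<le> E1' \<phi> \<phi> + energy_bound s"
proof -
  let ?A = "\<lambda>s. indicator {t1<..t2} s * E1' (trunc s) \<phi>"
  let ?q = "\<lambda>s. indicator regular_times s * ((2 * \<bar>?A s\<bar> - E1' \<phi> \<phi> - energy_const) / tail_const)
    + (4 / tail_const) * (indicator regular_times s * deficit_sq_deriv s)"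
  note [measurable] = E1_trunc_measurable[OF p] measurable_completion[OF deficit_sq_deriv_measurable[folded
    measurable_lborel1]]
  have "AE s in lebesgue. s \<in> regular_times \<longrightarrow> ?q s \<le> tail_minorant s"
  proof (rule tail_minorant_max)
    have "(\<lambda>s. indicator regular_times s * deficit_sq_deriv s) \<in> borel_measurable lebesgue"
      using deficit_sq_deriv_measurable by (intro measurable_completion) simp
    note [measurable] = this
    show "?q \<in> borel_measurable lebesgue" by measurable
    fix s assume s: "s \<in> regular_times"
    show "ennreal (?q s) \<le> tail_at s"
    proof (cases "tail_at s")
      case (real \<tau>)
      have "ennreal (E1' (trunc s) (trunc s) - energy_const + 4 * deficit_sq_deriv s) \<le> ennreal (tail_const * \<tau>)"
        using caccioppoli_regular[OF s] real tail_const_pos by (simp add: ennreal_mult)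
      then have "E1' (trunc s) (trunc s) - energy_const + 4 * deficit_sq_deriv s \<le> tail_const * \<tau>"
        using real tail_const_pos by (simp add: ennreal_le_iff)
      moreover have "2 * \<bar>E1' (trunc s) \<phi>\<bar> \<le> E1' (trunc s) (trunc s) + E1' \<phi> \<phi>"
        by (rule e1.young[OF trunc_F[OF regular_times_sub[OF s]] p])
      ultimately have "2 * \<bar>E1' (trunc s) \<phi>\<bar> - E1' \<phi> \<phi> - energy_const + 4 * deficit_sq_deriv s \<le> tail_const * \<tau>"
        by linarith
      then have "(2 * \<bar>E1' (trunc s) \<phi>\<bar> - E1' \<phi> \<phi> - energy_const + 4 * deficit_sq_deriv s) / tail_const \<le> \<tau>"
        using tail_const_pos by (simp add: divide_le_eq mult.commute)
      then have "?q s \<le> \<tau>" using s regular_times_sub[OF s] by (simp add: add_divide_distrib)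
      then show ?thesis using real by (simp add: ennreal_leI)
    qed simp
  qed
  then show ?thesis
  proof eventually_elim
    case (elim s)
    show ?case
    proof
      assume s: "s \<in> regular_times"
      then have "(2 * \<bar>E1' (trunc s) \<phi>\<bar> - E1' \<phi> \<phi> - energy_const + 4 * deficit_sq_deriv s) / tail_const
        \<le> tail_minorant s"
        using elim regular_times_sub[OF s] by (simp add: add_divide_distrib)
      then show "2 * \<bar>E1' (trunc s) \<phi>\<bar> \<le> E1' \<phi> \<phi> + energy_bound s"
        using tail_const_pos by (simp add: divide_le_eq energy_bound_def mult.commute)
    qed
  qed
qed

lemma E1_zero: "E1' (\<lambda>x. 0) \<phi> = 0" if "\<phi> \<in> F"
  using e1.scale_left[OF F_zero that, of 0] by simp

lemma energy_bound_nonneg: "AE s in lebesgue. s \<in> regular_times \<longrightarrow> 0 \<le> energy_bound s"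
proof -
  have "E1' (trunc s) (\<lambda>x. 0) = 0" if "s \<in> regular_times" for s
    using E1_zero[OF trunc_F[OF regular_times_sub[OF that]]] e1.sym[OF F_zero
      trunc_F[OF regular_times_sub[OF that]]] by simp
  then show ?thesis using energy_majorant[OF F_zero] E1_zero[OF F_zero] by (auto elim!: eventually_mono)
qed

lemma energy_bound_measurable: "(\<lambda>s. indicator regular_times s * energy_bound s) \<in> borel_measurable lebesgue"
proof -
  have "(\<lambda>s. indicator regular_times s * deficit_sq_deriv s) \<in> borel_measurable lebesgue"
    using deficit_sq_deriv_measurable by (intro measurable_completion) simp
  then have "(\<lambda>s. indicator regular_times s * (energy_const + tail_const * tail_minorant s)
    - 4 * (indicator regular_times s * deficit_sq_deriv s)) \<in> borel_measurable lebesgue"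
    by measurable
  then show ?thesis by (simp add: energy_bound_def algebra_simps)
qed

text \<open>The gauge integral of the derivative of the squared deficit is an increment of a bounded
  function. A function that is gauge integrable and almost everywhere non-negative is Lebesgue
  integrable with the same integral.\<close>

lemma energy_bound_piece:
  assumes cd: "t1 < c" "c < d" "d \<le> t2" "{c..<d} \<inter> S = {}"
  shows "(\<integral>\<^sup>+s. ennreal (indicator regular_times s * energy_bound s) * indicator {c..d} s \<partial>lebesgue)
    \<le> ennreal (\<bar>energy_const\<bar> * (t2 - t1) + tail_const * (LINT s|lebesgue. tail_minorant s) + 4 * (K\<^sup>2 * ball_mass))"
proof -
  have sT: "set_integrable lebesgue {c..d} tail_minorant"
    using tail_minorant_integrable unfolding set_integrable_def by (intro integrable_mult_indicator) auto
  have "(energy_bound has_integral ((d - c) * energy_const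
    + tail_const * (LINT s:{c..d}|lebesgue. tail_minorant s) - 4 * (deficit_sq d - deficit_sq c))) {c..d}"
    unfolding energy_bound_def[abs_def]
  proof (intro has_integral_diff has_integral_add)
    show "((\<lambda>s. energy_const) has_integral (d - c) * energy_const) {c..d}"
      using has_integral_const_real[of energy_const c d] cd by simp
    show "((\<lambda>s. tail_const * tail_minorant s) has_integral tail_const * (LINT s:{c..d}|lebesgue. tail_minorant
      s)) {c..d}"
      by (intro has_integral_mult_right has_integral_set_lebesgue sT)
    show "((\<lambda>s. 4 * deficit_sq_deriv s) has_integral 4 * (deficit_sq d - deficit_sq c)) {c..d}"
      by (intro has_integral_mult_right deficit_sq_increment cd)
  qed
  moreover define V where "V = (d - c) * energy_const + tail_const * (LINT s:{c..d}|lebesgue. tail_minorant s)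
    - 4 * (deficit_sq d - deficit_sq c)"
  moreover define p where "p s = max (indicator regular_times s * energy_bound s) 0" for s
  moreover have "AE s in lborel. s \<in> {c..d} \<longrightarrow> energy_bound s = p s"
  proof -
    have "AE s in lebesgue. s \<in> {c..d} \<longrightarrow> energy_bound s = p s"
      using AE_regular_times energy_bound_nonneg
    proof eventually_elim
      case (elim s)
      then show ?case using cd by (auto simp: p_def)
    qed
    then show ?thesis by (simp add: AE_completion_iff)
  qed
  ultimately have pI: "(p has_integral V) {c..d}" using has_integral_AE[of "{c..d}" energy_bound p V] by simp
  have "(\<integral>\<^sup>+s. ennreal (indicator regular_times s * energy_bound s) * indicator {c..d} s \<partial>lebesgue)
    = (\<integral>\<^sup>+s. ennreal (p s) * indicator {c..d} s \<partial>lborel)"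
    unfolding nn_integral_completion by (intro nn_integral_cong) (simp add: p_def max_def ennreal_neg)
  also have "\<dots> = ennreal V" by (rule nn_integral_has_integral_lebesgue'[OF _ pI]) (simp add: p_def)
  also have "\<dots> \<le> ennreal (\<bar>energy_const\<bar> * (t2 - t1) + tail_const * (LINT s|lebesgue. tail_minorant s)
    + 4 * (K\<^sup>2 * ball_mass))"
  proof (rule ennreal_leI)
    have "(d - c) * energy_const \<le> (d - c) * \<bar>energy_const\<bar>" using cd by (intro mult_left_mono) auto
    also have "\<dots> \<le> (t2 - t1) * \<bar>energy_const\<bar>" using cd by (intro mult_right_mono) auto
    finally have "(d - c) * energy_const \<le> \<bar>energy_const\<bar> * (t2 - t1)" by (simp add: mult.commute)
    moreover have "tail_const * (LINT s:{c..d}|lebesgue. tail_minorant s)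
      \<le> tail_const * (LINT s|lebesgue. tail_minorant s)"
    proof (intro mult_left_mono)
      show "(LINT s:{c..d}|lebesgue. tail_minorant s) \<le> (LINT s|lebesgue. tail_minorant s)"
        unfolding set_lebesgue_integral_def
        by (rule integral_mono) (use sT tail_minorant_integrable tail_minorant_nonneg in \<open>auto simp:
          set_integrable_def indicator_def\<close>)
    qed (use tail_const_pos in simp)
    moreover have "- 4 * (deficit_sq d - deficit_sq c) \<le> 4 * (K\<^sup>2 * ball_mass)"
      using deficit_sq_bound[of c] deficit_sq_nonneg[of d] cd by simp
    ultimately show "V \<le> \<bar>energy_const\<bar> * (t2 - t1) + tail_const * (LINT s|lebesgue. tail_minorant s)
      + 4 * (K\<^sup>2 * ball_mass)"
      unfolding V_def by linarith
  qed
  finally show ?thesis .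
qed

lemma energy_bound_integrable: "integrable lebesgue (\<lambda>s. indicator regular_times s * energy_bound s)"
proof (rule integrableI_nonneg[OF energy_bound_measurable])
  show "AE s in lebesgue. 0 \<le> indicator regular_times s * energy_bound s" using energy_bound_nonneg
    by eventually_elim (auto simp: indicator_def)
  note [measurable] = energy_bound_measurable
  have "(\<integral>\<^sup>+s. ennreal (indicator regular_times s * energy_bound s) * indicator {t1<..t2} s \<partial>lebesgue) < \<infinity>"
    by (rule nn_integral_finite_pieces[OF S(1) _ _ energy_bound_piece]) auto
  also have "(\<integral>\<^sup>+s. ennreal (indicator regular_times s * energy_bound s) * indicator {t1<..t2} s \<partial>lebesgue)
    = (\<integral>\<^sup>+s. ennreal (indicator regular_times s * energy_bound s) \<partial>lebesgue)"
    using regular_times_sub by (intro nn_integral_cong) (auto simp: indicator_def)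
  finally show "(\<integral>\<^sup>+s. ennreal (indicator regular_times s * energy_bound s) \<partial>lebesgue) < \<infinity>" .
qed

section \<open>Time integrals of the truncated supersolution\<close>

definition trunc_integral where "trunc_integral c d x = (LINT s:{c..d}|lborel. trunc_joint (s, x))"

lemma trunc_integral_borel[measurable]: "trunc_integral c d \<in> borel_measurable borel"
proof -
  have "(\<lambda>(x, s). indicator {c..d} s *\<^sub>R trunc_joint (s, x)) \<in> borel_measurable (\<mu> \<Otimes>\<^sub>M lborel)" by measurable
  then have "(\<lambda>x. LINT s|lborel. indicator {c..d} s *\<^sub>R trunc_joint (s, x)) \<in> borel_measurable \<mu>"
    by (rule lborel.borel_measurable_lebesgue_integral)
  then show ?thesis unfolding trunc_integral_def[abs_def] set_lebesgue_integral_def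
    by (simp add: measurable_cong_sets[OF sets_mu refl])
qed

lemma trunc_joint_le_K: "trunc_joint (s, x) \<le> K"
proof -
  have "K * \<psi> x \<le> K * 1" using K psi(4) by (intro mult_left_mono) auto
  then show ?thesis using trunc_joint_le[of s x] by simp
qed

lemma trunc_joint_integrable: "set_integrable lborel {c..d} (\<lambda>s. trunc_joint (s, x))"
  unfolding set_integrable_def
proof (rule Bochner_Integration.integrable_bound)
  show "integrable lborel (\<lambda>s. indicator {c..d} s *\<^sub>R K)"
    by (intro integrable_scaleR_left integrable_real_indicator) (auto simp: emeasure_lborel_Icc_eq)
  show "AE s in lborel. norm (indicator {c..d} s *\<^sub>R trunc_joint (s, x)) \<le> norm (indicator {c..d} s *\<^sub>R K)"
    using trunc_joint_nonneg trunc_joint_le_K K by (intro AE_I2) (auto simp: indicator_def)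
qed measurable

lemma trunc_integral_nonneg: "0 \<le> trunc_integral c d x"
  unfolding trunc_integral_def set_lebesgue_integral_def using trunc_joint_nonneg by (intro integral_nonneg_AE) auto

lemma trunc_integral_le: assumes "c \<le> d" shows "trunc_integral c d x \<le> (d - c) * (K * \<psi> x)"
proof -
  have "trunc_integral c d x \<le> (LINT s:{c..d}|lborel. K * \<psi> x)"
    unfolding trunc_integral_def
  proof (rule set_integral_mono[OF trunc_joint_integrable])
    show "set_integrable lborel {c..d} (\<lambda>s. K * \<psi> x)" unfolding set_integrable_def
      by (intro integrable_scaleR_left integrable_real_indicator) (auto simp: emeasure_lborel_Icc_eq)
  qed (rule trunc_joint_le)
  also have "\<dots> = (d - c) * (K * \<psi> x)" using assms by (simp add: set_lebesgue_integral_def)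
  finally show ?thesis .
qed

lemma trunc_integral_L2: assumes "c \<le> d" shows "trunc_integral c d \<in> L2 \<mu> UNIV"
proof (rule L2_of_bound[OF sets_mu _ trunc_integral_borel])
  show "(\<lambda>x. (d - c) * (K * \<psi> x)) \<in> L2 \<mu> UNIV" by (intro F_L2 e1.scale_mem K_psi_F)
  show "AE x in \<mu>. x \<in> UNIV \<longrightarrow> \<bar>trunc_integral c d x\<bar> \<le> \<bar>(d - c) * (K * \<psi> x)\<bar>"
    using trunc_integral_nonneg[of c d] trunc_integral_le[OF assms]
      by (intro AE_I2) (simp add: order_trans[OF _ abs_ge_self])
qed simp

lemma trunc_integral_pairing:
  assumes g: "g \<in> L2 \<mu> UNIV" and cd: "t1 < c" "c \<le> d" "d \<le> t2"
  shows "(LINT x|\<mu>. g x * trunc_integral c d x) = (LINT s:{c..d}|lebesgue. (LINT x|\<mu>. g x * trunc s x))"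
    and "set_integrable lebesgue {c..d} (\<lambda>s. LINT x|\<mu>. g x * trunc s x)"
proof -
  note [measurable] = L2_borel[OF g]
  let ?f = "\<lambda>s x. indicator {c..d} s * (g x * trunc_joint (s, x))"
  let ?C = "LINT x|\<mu>. \<bar>g x\<bar> * (K * \<psi> x)"
  have bnd: "\<bar>g x * trunc_joint (s, x)\<bar> \<le> \<bar>g x\<bar> * (K * \<psi> x)" for s x
    using trunc_joint_nonneg[of "(s, x)"] trunc_joint_le[of s x] unfolding abs_mult by (intro mult_left_mono) auto
  have ix: "integrable \<mu> (\<lambda>x. ?f s x)" for s
    by (rule Bochner_Integration.integrable_bound[OF L2_times_psi[OF g]])
       (use bnd[of _ s] order_trans[OF _ bnd[of _ s]] K psi(3) in \<open>auto simp: indicator_def abs_mult intro!: AE_I2\<close>)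
  have int: "integrable (lborel \<Otimes>\<^sub>M \<mu>) (\<lambda>(s, x). ?f s x)"
  proof (rule lm.Fubini_integrable)
    show "(\<lambda>(s, x). ?f s x) \<in> borel_measurable (lborel \<Otimes>\<^sub>M \<mu>)" by measurable
    show "AE s in lborel. integrable \<mu> (\<lambda>x. case (s, x) of (s, x) \<Rightarrow> ?f s x)" using ix by simp
    show "integrable lborel (\<lambda>s. LINT x|\<mu>. norm (case (s, x) of (s, x) \<Rightarrow> ?f s x))"
    proof (rule Bochner_Integration.integrable_bound)
      show "integrable lborel (\<lambda>s. indicator {c..d} s *\<^sub>R ?C)"
        by (intro integrable_scaleR_left integrable_real_indicator) (auto simp: emeasure_lborel_Icc_eq)
      show "(\<lambda>s. LINT x|\<mu>. norm (case (s, x) of (s, x) \<Rightarrow> ?f s x)) \<in> borel_measurable lborel" by measurable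
      show "AE s in lborel. norm (LINT x|\<mu>. norm (case (s, x) of (s, x) \<Rightarrow> ?f s x)) \<le> norm (indicator {c..d} s *\<^sub>R ?C)"
      proof (intro AE_I2)
        fix s
        have "(LINT x|\<mu>. norm (?f s x)) \<le> (LINT x|\<mu>. indicator {c..d} s * (\<bar>g x\<bar> * (K * \<psi> x)))"
        proof (rule integral_mono)
          show "integrable \<mu> (\<lambda>x. norm (?f s x))" by (intro integrable_norm ix)
          show "integrable \<mu> (\<lambda>x. indicator {c..d} s * (\<bar>g x\<bar> * (K * \<psi> x)))"
            by (intro integrable_mult_right L2_times_psi g)
          show "norm (?f s x) \<le> indicator {c..d} s * (\<bar>g x\<bar> * (K * \<psi> x))" for x
            using bnd[of x s] by (simp add: indicator_def)
        qed
        also have "\<dots> = indicator {c..d} s * ?C" by simp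
        finally have "(LINT x|\<mu>. norm (?f s x)) \<le> indicator {c..d} s * ?C" .
        moreover have "0 \<le> (LINT x|\<mu>. norm (?f s x))" by (intro integral_nonneg_AE) auto
        ultimately show "norm (LINT x|\<mu>. norm (case (s, x) of (s, x) \<Rightarrow> ?f s x)) \<le> norm (indicator {c..d} s *\<^sub>R ?C)"
          by (simp add: order_trans[OF _ abs_ge_self])
      qed
    qed
  qed
  have eqx: "(LINT s|lborel. ?f s x) = g x * trunc_integral c d x" for x
  proof -
    have "(LINT s|lborel. ?f s x) = (LINT s|lborel. g x * (indicator {c..d} s *\<^sub>R trunc_joint (s, x)))"
      by (intro Bochner_Integration.integral_cong) auto
    also have "\<dots> = g x * trunc_integral c d x"
      unfolding trunc_integral_def set_lebesgue_integral_def using trunc_joint_integrable[of c d x] by simp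
    finally show ?thesis .
  qed
  have i1: "integrable lborel (\<lambda>s. LINT x|\<mu>. ?f s x)" using lm.integrable_fst[OF int] by simp
  have ae: "AE s in lborel. (LINT x|\<mu>. ?f s x) = indicator {c..d} s *\<^sub>R (LINT x|\<mu>. g x * trunc s x)"
    using pairing_AE[OF g]
  proof eventually_elim
    case (elim s)
    then show ?case using cd by (cases "s \<in> {c..d}") auto
  qed
  have mm: "(\<lambda>s. indicator {c..d} s *\<^sub>R (LINT x|\<mu>. g x * trunc s x)) \<in> borel_measurable lebesgue"
  proof -
    have "(\<lambda>s. indicator {c..d} s * (indicator {t1<..t2} s * (LINT x|\<mu>. g x * trunc s x)))
      \<in> borel_measurable lebesgue"
      by (intro borel_measurable_times borel_measurable_indicator pairing_trunc_measurable[OF g]) auto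
    also have "(\<lambda>s. indicator {c..d} s * (indicator {t1<..t2} s * (LINT x|\<mu>. g x * trunc s x)))
      = (\<lambda>s. indicator {c..d} s *\<^sub>R (LINT x|\<mu>. g x * trunc s x))"
      using cd by (auto simp: indicator_def)
    finally show ?thesis .
  qed
  have i1m: "(\<lambda>s. LINT x|\<mu>. ?f s x) \<in> borel_measurable lborel" using i1 by (rule borel_measurable_integrable)
  have i1l: "integrable lebesgue (\<lambda>s. LINT x|\<mu>. ?f s x)" using i1 i1m by (simp add: integrable_completion)
  show "set_integrable lebesgue {c..d} (\<lambda>s. LINT x|\<mu>. g x * trunc s x)"
    unfolding set_integrable_def by (rule integrable_cong_AE_imp[OF i1l mm])
      (use AE_completion[OF ae] in \<open>auto elim!: eventually_mono\<close>)
  have "(LINT x|\<mu>. g x * trunc_integral c d x) = (LINT x|\<mu>. (LINT s|lborel. ?f s x))" by (simp only: eqx)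
  also have "\<dots> = (LINT s|lborel. (LINT x|\<mu>. ?f s x))" by (rule lm.Fubini_integral[OF int])
  also have "\<dots> = (LINT s|lebesgue. (LINT x|\<mu>. ?f s x))" by (rule integral_completion[OF i1m, symmetric])
  also have "\<dots> = (LINT s|lebesgue. indicator {c..d} s *\<^sub>R (LINT x|\<mu>. g x * trunc s x))"
    by (rule integral_cong_AE[OF measurable_completion[OF i1m] mm AE_completion[OF ae]])
  finally show "(LINT x|\<mu>. g x * trunc_integral c d x) = (LINT s:{c..d}|lebesgue. (LINT x|\<mu>. g x * trunc s x))"
    unfolding set_lebesgue_integral_def .
qed

lemma E1_trunc_integrable:
  assumes p: "\<phi> \<in> F" and cd: "t1 < c" "c \<le> d" "d \<le> t2"
  shows "set_integrable lebesgue {c..d} (\<lambda>s. E1' (trunc s) \<phi>)"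
    and "2 * \<bar>LINT s:{c..d}|lebesgue. E1' (trunc s) \<phi>\<bar>
      \<le> E1' \<phi> \<phi> * (d - c) + (LINT s|lebesgue. indicator regular_times s * energy_bound s)"
proof -
  let ?f = "\<lambda>s. indicator {c..d} s *\<^sub>R E1' (trunc s) \<phi>"
  let ?g = "\<lambda>s. (E1' \<phi> \<phi> * indicator {c..d} s + indicator regular_times s * energy_bound s) / 2"
  have mm: "?f \<in> borel_measurable lebesgue"
  proof -
    have "(\<lambda>s. indicator {c..d} s * (indicator {t1<..t2} s * E1' (trunc s) \<phi>)) \<in> borel_measurable lebesgue"
      by (intro borel_measurable_times borel_measurable_indicator E1_trunc_measurable[OF p]) auto
    also have "(\<lambda>s. indicator {c..d} s * (indicator {t1<..t2} s * E1' (trunc s) \<phi>)) = ?f"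
      using cd by (auto simp: indicator_def)
    finally show ?thesis .
  qed
  have ii: "integrable lebesgue (indicat_real {c..d})"
    by (intro integrable_real_indicator) (auto simp: emeasure_lborel_Icc_eq)
  have gi: "integrable lebesgue ?g"
    by (intro integrable_divide Bochner_Integration.integrable_add integrable_mult_right ii energy_bound_integrable)
  have ae: "AE s in lebesgue. \<bar>?f s\<bar> \<le> ?g s"
    using energy_majorant[OF p] AE_regular_times energy_bound_nonneg
  proof eventually_elim
    case (elim s)
    show ?case
    proof (cases "s \<in> {c..d}")
      case True
      then have "s \<in> regular_times" using elim(2) cd by auto
      then show ?thesis using elim(1) True by simp
    next
      case False
      then show ?thesis using elim(3) by (auto simp: indicator_def)
    qed
  qed
  show i: "set_integrable lebesgue {c..d} (\<lambda>s. E1' (trunc s) \<phi>)"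
    unfolding set_integrable_def by (rule Bochner_Integration.integrable_bound[OF gi mm])
      (use ae in \<open>auto elim!: eventually_mono\<close>)
  have "\<bar>LINT s|lebesgue. ?f s\<bar> \<le> (LINT s|lebesgue. \<bar>?f s\<bar>)" by (rule integral_abs_bound)
  also have "\<dots> \<le> (LINT s|lebesgue. ?g s)"
    by (rule integral_mono_AE[OF integrable_abs[OF i[unfolded set_integrable_def]] gi ae])
  also have "\<dots> = (E1' \<phi> \<phi> * (d - c) + (LINT s|lebesgue. indicator regular_times s * energy_bound s)) / 2"
    using ii energy_bound_integrable cd by simp
  finally show "2 * \<bar>LINT s:{c..d}|lebesgue. E1' (trunc s) \<phi>\<bar>
    \<le> E1' \<phi> \<phi> * (d - c) + (LINT s|lebesgue. indicator regular_times s * energy_bound s)"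
    unfolding set_lebesgue_integral_def by simp
qed

text \<open>Integrating the pairings with trunc in time gives a bounded functional on F. Its Riesz
  representative has the same pairings with resolvents as the pointwise time integral, so the two
  agree almost everywhere.\<close>

lemma trunc_integral_energy:
  assumes cd: "t1 < c" "c \<le> d" "d \<le> t2"
  shows "trunc_integral c d \<in> F" and "\<And>\<phi>. \<phi> \<in> F \<Longrightarrow> set_integrable lebesgue {c..d} (\<lambda>s. E (trunc s) \<phi>)"
    and "\<And>\<phi>. \<phi> \<in> F \<Longrightarrow> E (trunc_integral c d) \<phi> = (LINT s:{c..d}|lebesgue. E (trunc s) \<phi>)"
proof -
  define l where "l \<phi> = (LINT s:{c..d}|lebesgue. E1' (trunc s) \<phi>)" for \<phi>
  define Cb where "Cb = \<bar>LINT s|lebesgue. indicator regular_times s * energy_bound s\<bar> + 1"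
  have sub: "s \<in> {c..d} \<Longrightarrow> s \<in> {t1<..t2}" for s using cd by auto
  have l_lin: "l (\<lambda>x. a * p x + e * q x) = a * l p + e * l q" if "p \<in> F" "q \<in> F" for p q a e
  proof -
    have "l (\<lambda>x. a * p x + e * q x) = (LINT s:{c..d}|lebesgue. a * E1' (trunc s) p + e * E1' (trunc s) q)"
      unfolding l_def by (rule set_lebesgue_integral_cong) (auto intro!: e1.lin_right that trunc_F sub)
    also have "\<dots> = a * l p + e * l q"
      unfolding l_def using E1_trunc_integrable(1)[OF _ cd] that by (subst set_integral_add) auto
    finally show ?thesis .
  qed
  have l_bdd: "(l p)\<^sup>2 \<le> ((d - c) * Cb) * E1' p p" if p: "p \<in> F" for p
  proof (rule discriminant_bound)
    fix a :: real
    have "l (\<lambda>x. a * p x) = a * l p" using l_lin[OF p F_zero, of a 0] by simp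
    moreover have "E1' (\<lambda>x. a * p x) (\<lambda>x. a * p x) = a\<^sup>2 * E1' p p"
      unfolding e1.scale_left[OF p e1.scale_mem[OF p]] e1.scale_right[OF p p] by (simp add: power2_eq_square)
    ultimately show "2 * \<bar>a * l p\<bar> \<le> a\<^sup>2 * E1' p p * (d - c) + Cb"
      using E1_trunc_integrable(2)[OF e1.scale_mem[OF p, of a] cd] unfolding l_def[symmetric] Cb_def by simp
  qed (simp add: Cb_def)
  have "\<exists>z\<in>F. \<forall>v\<in>F. E1' z v = l v" by (rule riesz[OF l_lin l_bdd])
  then obtain z where z: "z \<in> F" "\<And>v. v \<in> F \<Longrightarrow> E1' z v = l v" by blast
  have "AE x in \<mu>. z x - trunc_integral c d x = 0"
  proof (rule zero_of_L2_orthogonal)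
    show "(\<lambda>x. z x - trunc_integral c d x) \<in> L2 \<mu> UNIV" by (intro L2_UNIV_diff F_L2 z trunc_integral_L2 cd)
    fix g assume g: "g \<in> L2 \<mu> UNIV"
    have RF: "resolvent g \<in> F" using resolvent[OF g] by blast
    have "(LINT x|\<mu>. g x * z x) = l (resolvent g)" using resolvent[OF g] z e1.sym[OF z(1) RF] by simp
    also have "\<dots> = (LINT s:{c..d}|lebesgue. (LINT x|\<mu>. g x * trunc s x))"
      unfolding l_def
    proof (rule set_lebesgue_integral_cong)
      show "\<forall>s. s \<in> {c..d} \<longrightarrow> E1' (trunc s) (resolvent g) = (LINT x|\<mu>. g x * trunc s x)"
        using resolvent[OF g] trunc_F[OF sub] e1.sym[OF trunc_F[OF sub] RF] by simp
    qed simp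
    also have "\<dots> = (LINT x|\<mu>. g x * trunc_integral c d x)" by (rule trunc_integral_pairing(1)[OF g cd, symmetric])
    finally show "(LINT x|\<mu>. g x * (z x - trunc_integral c d x)) = 0"
      using L2_prod[OF g F_L2[OF z(1)]] L2_prod[OF g trunc_integral_L2[OF cd(2)]] by (simp add: right_diff_distrib)
  qed
  then have zm: "AE x in \<mu>. z x = trunc_integral c d x" by simp
  show mF: "trunc_integral c d \<in> F" by (rule F_cong[OF z(1) trunc_integral_borel zm])
  fix \<phi> assume p: "\<phi> \<in> F"
  note i1 = E1_trunc_integrable(1)[OF p cd] and i2 = trunc_integral_pairing(2)[OF F_L2[OF p] cd]
  have Em: "E (trunc s) \<phi> = E1' (trunc s) \<phi> - (LINT x|\<mu>. \<phi> x * trunc s x)" for s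
    unfolding E1_def by (simp add: mult.commute[of "\<phi> _"])
  show "set_integrable lebesgue {c..d} (\<lambda>s. E (trunc s) \<phi>)" unfolding Em by (rule set_integral_diff(1)[OF i1 i2])
  have "E (trunc_integral c d) \<phi> = E1' (trunc_integral c d) \<phi> - (LINT x|\<mu>. \<phi> x * trunc_integral c d x)"
    unfolding E1_def by (simp add: mult.commute[of "\<phi> _"])
  also have "E1' (trunc_integral c d) \<phi> = l \<phi>" using E1_cong[OF z(1) mF p zm] z(2)[OF p] by simp
  also have "(LINT x|\<mu>. \<phi> x * trunc_integral c d x) = (LINT s:{c..d}|lebesgue. (LINT x|\<mu>. \<phi> x * trunc s x))"
    by (rule trunc_integral_pairing(1)[OF F_L2[OF p] cd])
  finally show "E (trunc_integral c d) \<phi> = (LINT s:{c..d}|lebesgue. E (trunc s) \<phi>)"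
    unfolding Em l_def by (subst set_integral_diff(2)[OF i1 i2])
qed

text \<open>The derivative of a pairing need not be Lebesgue integrable, but as a derivative outside a
  finite set of a continuous function it is gauge integrable, and gauge integrals are monotone.\<close>

lemma integrated_inequality:
  assumes p: "\<phi> \<in> F_on \<mu> F E B2" "AE x in \<mu>. 0 \<le> \<phi> x" and cd: "t1 < c" "c \<le> d" "d \<le> t2"
  shows "- E (trunc_integral c d) \<phi> - 2 * (LINT s:{c..d}|lebesgue. tail_minorant s) * (LINT x|\<mu>. \<phi> x) \<le> I \<phi> d - I \<phi> c"
proof -
  have pF: "\<phi> \<in> F" using p(1) by (simp add: F_on_def)
  have pL: "\<phi> \<in> L2 \<mu> B" by (rule F_L2B[OF pF])
  define \<kappa> where "\<kappa> = (LINT x|\<mu>. \<phi> x)"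
  have k0: "0 \<le> \<kappa>" unfolding \<kappa>_def using p(2) by (rule integral_nonneg_AE)
  have D: "(deriv (I \<phi>) has_integral (I \<phi> d - I \<phi> c)) {c..d}"
  proof (rule fundamental_theorem_of_calculus_interior_strong[OF S(1) cd(2)])
    fix s assume "s \<in> {c<..<d} - S"
    then have "s \<in> regular_times" using cd by (auto simp: regular_times_def)
    then show "(I \<phi> has_vector_derivative deriv (I \<phi>) s) (at s)"
      using I_deriv[OF pL] by (simp add: has_real_derivative_iff_has_vector_derivative)
  next
    show "continuous_on {c..d} (I \<phi>)" by (rule continuous_on_subset[OF I_continuous[OF pL]]) (use cd in auto)
  qed
  have sT: "set_integrable lebesgue {c..d} tail_minorant"
    using tail_minorant_integrable unfolding set_integrable_def by (intro integrable_mult_indicator) auto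
  let ?h = "\<lambda>s. - E (trunc s) \<phi> - 2 * \<kappa> * tail_minorant s"
  have hI: "(?h has_integral (- (LINT s:{c..d}|lebesgue. E (trunc s) \<phi>)
    - 2 * \<kappa> * (LINT s:{c..d}|lebesgue. tail_minorant s))) {c..d}"
    by (intro has_integral_diff has_integral_neg has_integral_mult_right has_integral_set_lebesgue sT
      trunc_integral_energy(2) cd pF)
  have ae: "AE s in lebesgue. s \<in> regular_times \<longrightarrow> ?h s \<le> deriv (I \<phi>) s"
  proof (cases "\<kappa> = 0")
    case True
    have "?h s \<le> deriv (I \<phi>) s" if "s \<in> regular_times" for s
    proof -
      have "ennreal (- deriv (I \<phi>) s - E (trunc s) \<phi>) \<le> 0"
        using test_regular[OF that p] True by (simp add: \<kappa>_def)
      then show ?thesis using True by (simp add: ennreal_eq_0_iff)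
    qed
    then show ?thesis by simp
  next
    case False
    then have kp: "\<kappa> > 0" using k0 by simp
    let ?q = "\<lambda>s. (- (indicator regular_times s * deriv (I \<phi>) s)
      - indicator regular_times s * (indicator {t1<..t2} s * E1' (trunc s) \<phi>
      - indicator {t1<..t2} s * (LINT x|\<mu>. \<phi> x * trunc s x))) / (2 * \<kappa>)"
    have qe: "?q s = (- deriv (I \<phi>) s - E (trunc s) \<phi>) / (2 * \<kappa>)" if "s \<in> regular_times" for s
      using that regular_times_sub[OF that] unfolding E1_def by (simp add: mult.commute[of "\<phi> _"])
    have "AE s in lebesgue. s \<in> regular_times \<longrightarrow> ?q s \<le> tail_minorant s"
    proof (rule tail_minorant_max)
      have "(\<lambda>s. indicator regular_times s * deriv (I \<phi>) s) \<in> borel_measurable lebesgue"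
        using I_deriv_measurable[OF pL] by (intro measurable_completion) simp
      then show "?q \<in> borel_measurable lebesgue"
        using E1_trunc_measurable[OF pF] pairing_trunc_measurable[OF F_L2[OF pF]] by measurable
      fix s assume s: "s \<in> regular_times"
      show "ennreal (?q s) \<le> tail_at s"
        unfolding qe[OF s]
      proof (cases "tail_at s")
        case (real \<tau>)
        have "ennreal (- deriv (I \<phi>) s - E (trunc s) \<phi>) \<le> 2 * (ennreal \<tau> * ennreal \<kappa>)"
          using test_regular[OF s p] real by (simp add: \<kappa>_def)
        also have "\<dots> = ennreal (2 * (\<tau> * \<kappa>))" using real k0 by (simp add: ennreal_mult)
        finally have "- deriv (I \<phi>) s - E (trunc s) \<phi> \<le> 2 * (\<tau> * \<kappa>)" using real k0 by (simp add: ennreal_le_iff)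
        then have "(- deriv (I \<phi>) s - E (trunc s) \<phi>) / (2 * \<kappa>) \<le> \<tau>" using kp by (simp add: divide_le_eq ac_simps)
        then show "ennreal ((- deriv (I \<phi>) s - E (trunc s) \<phi>) / (2 * \<kappa>)) \<le> tail_at s" using real
          by (simp add: ennreal_leI)
      qed simp
    qed
    then show ?thesis
    proof eventually_elim
      case (elim s)
      show ?case
      proof
        assume s: "s \<in> regular_times"
        then have "?q s \<le> tail_minorant s" using elim by blast
        then have "(- deriv (I \<phi>) s - E (trunc s) \<phi>) / (2 * \<kappa>) \<le> tail_minorant s" unfolding qe[OF s] .
        then have "- deriv (I \<phi>) s - E (trunc s) \<phi> \<le> tail_minorant s * (2 * \<kappa>)" using kp by (simp add: divide_le_eq)
        then show "?h s \<le> deriv (I \<phi>) s" by (simp add: ac_simps)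
      qed
    qed
  qed
  define D' where "D' s = max (deriv (I \<phi>) s) (?h s)" for s
  have "AE s in lborel. s \<in> {c..d} \<longrightarrow> deriv (I \<phi>) s = D' s"
  proof -
    have "AE s in lebesgue. s \<in> {c..d} \<longrightarrow> deriv (I \<phi>) s = D' s"
      using ae AE_regular_times by eventually_elim (use cd in \<open>auto simp: D'_def\<close>)
    then show ?thesis by (simp add: AE_completion_iff)
  qed
  then have "(D' has_integral (I \<phi> d - I \<phi> c)) {c..d}" using D has_integral_AE by blast
  from has_integral_le[OF hI this]
  have "- (LINT s:{c..d}|lebesgue. E (trunc s) \<phi>) - 2 * \<kappa> * (LINT s:{c..d}|lebesgue. tail_minorant s) \<le> I \<phi> d - I \<phi> c"
    by (simp add: D'_def)
  then show ?thesis unfolding trunc_integral_energy(3)[OF cd pF] \<kappa>_def by (simp add: ac_simps)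
qed

end

text \<open>The derivative is taken within the half-open interval so that it is one-sided at the right
  end b, beyond which f is not controlled.\<close>

lemma moving_average_derivative:
  fixes f :: "real \<Rightarrow> real"
  assumes f: "continuous_on {a<..b} f" and h: "0 < h" and t: "t \<in> {a + h<..b}"
  shows "((\<lambda>t. integral {t - h..t} f) has_real_derivative f t - f (t - h)) (at t within {a + h<..b})"
proof -
  define a' where "a' = (a + (t - h)) / 2"
  have a': "a < a'" "a' < t - h" using t by (auto simp: a'_def)
  have fc: "continuous_on {a'..b} f" by (rule continuous_on_subset[OF f]) (use a' in auto)
  have fi: "f integrable_on {c..d}" if "a' \<le> c" "d \<le> b" for c d
    by (rule integrable_continuous_real[OF continuous_on_subset[OF fc]]) (use that in auto)
  let ?F = "\<lambda>s. integral {a'..s} f"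
  have d1: "(?F has_real_derivative f s) (at s within {a'..b})" if "s \<in> {a'..b}" for s
    by (rule integral_has_real_derivative[OF fc that])
  have "(?F has_real_derivative f t) (at t within {a' + h..b})"
    by (rule has_field_derivative_subset[OF d1]) (use t a' h in auto)
  moreover have "((\<lambda>s. ?F (s - h)) has_real_derivative f (t - h)) (at t within {a' + h..b})"
  proof -
    have "(?F has_real_derivative f (t - h)) (at (t - h) within (\<lambda>s. s - h) ` {a' + h..b})"
      by (rule has_field_derivative_subset[OF d1]) (use t a' h in auto)
    moreover have "((\<lambda>s. s - h) has_real_derivative 1) (at t within {a' + h..b})"
      by (auto intro!: derivative_eq_intros)
    ultimately have "(?F \<circ> (\<lambda>s. s - h) has_real_derivative f (t - h) * 1) (at t within {a' + h..b})"
      by (rule DERIV_image_chain)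
    then show ?thesis by (simp add: comp_def)
  qed
  ultimately have "((\<lambda>s. ?F s - ?F (s - h)) has_real_derivative f t - f (t - h)) (at t within {a' + h..b})"
    by (rule DERIV_diff)
  moreover have "at t within {a' + h..b} = at t within {a + h<..b}"
    by (rule at_within_nhd[of t "{a' + h<..}"]) (use a' t in auto)
  ultimately have D: "((\<lambda>s. ?F s - ?F (s - h)) has_real_derivative f t - f (t - h)) (at t within {a + h<..b})" by simp
  show ?thesis
  proof (rule has_field_derivative_transform_within[OF D])
    show "0 < t - h - a'" using a' by simp
    show "t \<in> {a + h<..b}" by (rule t)
    show "?F s - ?F (s - h) = integral {s - h..s} f" if "s \<in> {a + h<..b}" "dist s t < t - h - a'" for s
    proof -
      have s: "a' \<le> s - h" "s - h \<le> s" "s \<le> b" using that h by (auto simp: dist_real_def abs_if split: if_splits)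
      have "integral {a'..s - h} f + integral {s - h..s} f = integral {a'..s} f"
        by (rule Henstock_Kurzweil_Integration.integral_combine[OF s(1,2) fi]) (use s in auto)
      then show ?thesis by simp
    qed
  qed
qed

context supersolution_in_time begin

section \<open>Steklov averages\<close>

definition \<tau> :: real where "\<tau> = enn2real (tail \<mu> J (2 / 3) t1 t2 x0 R (neg_part u))"

text \<open>Added to u, this function of time makes up for the tail in the inequality for supercaloric
  functions.\<close>

definition compensator :: "real \<Rightarrow> real" where "compensator t = 2 * integral {t1..t} tail_minorant"

lemma tail_minorant_set_integrable: "set_integrable lebesgue {c..d} tail_minorant"
  using tail_minorant_integrable unfolding set_integrable_def by (intro integrable_mult_indicator) auto

lemma tail_minorant_integrable_on: "tail_minorant integrable_on {c..d}"
  by (rule set_lebesgue_integral_eq_integral(1)[OF tail_minorant_set_integrable])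

lemma compensator_diff: "t1 \<le> c \<Longrightarrow> c \<le> d \<Longrightarrow> compensator d - compensator c
  = 2 * (LINT s:{c..d}|lebesgue. tail_minorant s)"
  unfolding compensator_def set_lebesgue_integral_eq_integral(2)[OF tail_minorant_set_integrable]
  using Henstock_Kurzweil_Integration.integral_combine[of t1 c d tail_minorant] tail_minorant_integrable_on by simp

lemma compensator_nonneg: "0 \<le> compensator t"
  unfolding compensator_def by (intro mult_nonneg_nonneg integral_nonneg tail_minorant_integrable_on
    tail_minorant_nonneg) auto

lemma compensator_le: "compensator t \<le> 2 * \<tau>"
proof -
  have "integral {t1..t} tail_minorant = (LINT s:{t1..t}|lebesgue. tail_minorant s)"
    by (rule set_lebesgue_integral_eq_integral(2)[OF tail_minorant_set_integrable, symmetric])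
  also have "\<dots> \<le> (LINT s|lebesgue. tail_minorant s)"
    unfolding set_lebesgue_integral_def
    by (rule integral_mono) (use tail_minorant_set_integrable tail_minorant_integrable tail_minorant_nonneg in
      \<open>auto simp: set_integrable_def indicator_def\<close>)
  finally show ?thesis unfolding compensator_def tail_minorant_integral \<tau>_def by simp
qed

lemma compensator_continuous: "continuous_on {t1<..t2} compensator"
proof -
  have "continuous_on {t1..t2} compensator" unfolding compensator_def
    by (intro continuous_intros indefinite_integral_continuous_1 tail_minorant_integrable_on)
  then show ?thesis by (rule continuous_on_subset) auto
qed

definition mov_avg :: "(real \<Rightarrow> real) \<Rightarrow> real \<Rightarrow> real \<Rightarrow> real" where
  "mov_avg f h t = (1 / h) * integral {t - h..t} f"

text \<open>The constant e keeps the function positive, as the tangent inequality for y^q requires.\<close>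

definition steklov :: "real \<Rightarrow> real \<Rightarrow> real \<Rightarrow> 'a \<Rightarrow> real" where
  "steklov h e t x = (1 / h) * trunc_integral (t - h) t x + (mov_avg compensator h t + e)"

lemma compensator_integrable_on: "t1 < c \<Longrightarrow> d \<le> t2 \<Longrightarrow> compensator integrable_on {c..d}"
  by (rule integrable_continuous_real[OF continuous_on_subset[OF compensator_continuous]]) auto

lemma mov_avg_compensator: assumes h: "0 < h" and t: "t1 + h < t" "t \<le> t2"
  shows "0 \<le> mov_avg compensator h t" "mov_avg compensator h t \<le> 2 * \<tau>"
proof -
  have i: "compensator integrable_on {t - h..t}" by (rule compensator_integrable_on) (use t in auto)
  show "0 \<le> mov_avg compensator h t" unfolding mov_avg_def using h
    by (intro mult_nonneg_nonneg integral_nonneg i compensator_nonneg) auto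
  have "integral {t - h..t} compensator \<le> integral {t - h..t} (\<lambda>s. 2 * \<tau>)"
    by (rule integral_le[OF i]) (auto intro: compensator_le)
  also have "\<dots> = h * (2 * \<tau>)" using h by simp
  finally show "mov_avg compensator h t \<le> 2 * \<tau>" unfolding mov_avg_def using h
    by (simp add: divide_le_eq mult.commute)
qed

lemma average_F: assumes h: "0 < h" and t: "t1 + h < t" "t \<le> t2"
  shows "(\<lambda>x. (1 / h) * trunc_integral (t - h) t x) \<in> F"
  by (rule e1.scale_mem[OF trunc_integral_energy(1)]) (use h t in auto)

lemma average_bounds: assumes h: "0 < h"
  shows "0 \<le> (1 / h) * trunc_integral (t - h) t x" "(1 / h) * trunc_integral (t - h) t x \<le> K * \<psi> x"
    "(1 / h) * trunc_integral (t - h) t x \<le> K"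
proof -
  show "0 \<le> (1 / h) * trunc_integral (t - h) t x" using h trunc_integral_nonneg by simp
  have "trunc_integral (t - h) t x \<le> h * (K * \<psi> x)" using trunc_integral_le[of "t - h" t x] h by simp
  then show a: "(1 / h) * trunc_integral (t - h) t x \<le> K * \<psi> x" using h by (simp add: divide_le_eq mult.commute)
  have "K * \<psi> x \<le> K * 1" using K psi(4) by (intro mult_left_mono) auto
  then show "(1 / h) * trunc_integral (t - h) t x \<le> K" using a by simp
qed

lemma B2_nbhd: "strict_nbhd B2 (ball x0 (11 * R / 20))"
  unfolding strict_nbhd_def
proof (intro conjI allI impI)
  fix C :: "'a set" assume "compact C"
  have c: "closure (C \<inter> B2) \<subseteq> cball x0 (R / 2)" by (intro closure_minimal) auto
  show "compact (closure (C \<inter> B2))" using c compact_cball[of x0 "R / 2"]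
    by (metis closed_closure compact_Int_closed inf.absorb_iff2)
  have "cball x0 (R / 2) \<subseteq> ball x0 (11 * R / 20)" using R by auto
  then show "closure (C \<inter> B2) \<subseteq> ball x0 (11 * R / 20)" using c by blast
qed simp

text \<open>A function that is constant in space need not belong to F; multiplied by \<psi> it does, without
  a change near the half ball.\<close>

lemma steklov_local_extension:
  fixes h t e :: real
  assumes h: "0 < h" and t: "t1 + h < t" "t \<le> t2"
  defines "w \<equiv> (\<lambda>x. (1 / h) * trunc_integral (t - h) t x + (mov_avg compensator h t + e) * \<psi> x)"
  shows "w \<in> F" "AE x in \<mu>. x \<in> ball x0 (11 * R / 20) \<longrightarrow> steklov h e t x = w x"
    "local_extension \<mu> F B2 (steklov h e t) w"
proof -
  show wF: "w \<in> F" unfolding w_def by (intro e1.add_mem average_F e1.scale_mem psi h t)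
  show ae: "AE x in \<mu>. x \<in> ball x0 (11 * R / 20) \<longrightarrow> steklov h e t x = w x"
    using psi(5) by (intro AE_I2) (auto simp: steklov_def w_def)
  show "local_extension \<mu> F B2 (steklov h e t) w"
    unfolding local_extension_def using wF ae B2_nbhd by blast
qed

lemma steklov_Fprime:
  assumes h: "0 < h" and t: "t1 + h < t" "t \<le> t2"
  shows "steklov h e t \<in> Fprime \<mu> F J B2"
proof -
  have AF: "(\<lambda>x. (1 / h) * trunc_integral (t - h) t x) \<in> F" by (rule average_F[OF h t])
  have vb: "steklov h e t \<in> borel_measurable borel" unfolding steklov_def[abs_def] by measurable
  have "set_integrable \<mu> C (steklov h e t)" if C: "compact C" for C
    unfolding steklov_def[abs_def]
  proof (rule set_integral_add(1))
    have Cs: "C \<in> sets \<mu>" using C by (simp add: sets_mu borel_compact)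
    have "integrable \<mu> (\<lambda>x. (1 / h) * trunc_integral (t - h) t x)"
    proof (rule integrable_supported[OF AF, of "3 * R / 5"])
      have "(1 / h) * trunc_integral (t - h) t x = 0" if "x \<notin> ball x0 (3 * R / 5)" for x
        using average_bounds(1,2)[OF h, of t x] psi_out[OF that] by simp
      then show "AE x in \<mu>. x \<notin> ball x0 (3 * R / 5) \<longrightarrow> (1 / h) * trunc_integral (t - h) t x = 0" by blast
    qed
    then show "set_integrable \<mu> C (\<lambda>x. (1 / h) * trunc_integral (t - h) t x)"
      unfolding set_integrable_def using Cs by (intro integrable_mult_indicator)
    show "set_integrable \<mu> C (\<lambda>x. mov_avg compensator h t + e)"
      unfolding set_integrable_def using Cs emeasure_compact[OF C]
        by (intro integrable_scaleR_left integrable_real_indicator)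
  qed
  then have "steklov h e t \<in> L1loc \<mu>" using vb by (simp add: L1loc_def)
  moreover have "\<exists>w. local_extension \<mu> F B2 (steklov h e t) w" using steklov_local_extension(3)[OF h t] by blast
  moreover have "(\<integral>\<^sup>+x\<in>B2. (\<integral>\<^sup>+y. ennreal ((steklov h e t x - steklov h e t y)\<^sup>2) \<partial>J x) \<partial>\<mu>) < \<infinity>"
    using jump_nn_finite[OF AF, of B2] by (simp add: steklov_def)
  ultimately show ?thesis by (simp add: Fprime_def)
qed

lemma average_joint_measurable:
  "(\<lambda>(t, x). trunc_integral (t - h) t x) \<in> borel_measurable (lborel \<Otimes>\<^sub>M \<mu>)"
proof -
  have "(\<lambda>(z, s). if fst z - h \<le> s \<and> s \<le> fst z then trunc_joint (s, snd z) else 0)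
    \<in> borel_measurable ((lborel \<Otimes>\<^sub>M \<mu>) \<Otimes>\<^sub>M lborel)"
    by measurable
  then have "(\<lambda>z. LINT s|lborel. (if fst z - h \<le> s \<and> s \<le> fst z then trunc_joint (s, snd z) else 0))
    \<in> borel_measurable (lborel \<Otimes>\<^sub>M \<mu>)"
    by (rule lborel.borel_measurable_lebesgue_integral)
  also have "(\<lambda>z. LINT s|lborel. (if fst z - h \<le> s \<and> s \<le> fst z then trunc_joint (s, snd z) else 0))
    = (\<lambda>(t, x). trunc_integral (t - h) t x)"
  proof
    fix z :: "real \<times> 'a"
    obtain t x where z: "z = (t, x)" by (cases z)
    show "(LINT s|lborel. (if fst z - h \<le> s \<and> s \<le> fst z then trunc_joint (s, snd z) else 0))
      = (case z of (t, x) \<Rightarrow> trunc_integral (t - h) t x)"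
      unfolding z trunc_integral_def set_lebesgue_integral_def
        by (auto intro!: Bochner_Integration.integral_cong simp: indicator_def)
  qed
  finally show ?thesis .
qed

lemma mov_avg_compensator_derivative:
  "0 < h \<Longrightarrow> t \<in> {t1 + h<..t2} \<Longrightarrow>
    (mov_avg compensator h has_real_derivative (1 / h) * (compensator t - compensator (t - h))) (at t within {t1
    + h<..t2})"
  unfolding mov_avg_def[abs_def] by (intro DERIV_cmult moving_average_derivative compensator_continuous)

lemma steklov_joint_measurable:
  assumes h: "0 < h"
  shows "(\<lambda>z. indicator ({t1 + h<..t2} \<times> UNIV) z *\<^sub>R (case z of (t, x) \<Rightarrow> steklov h e t x))
    \<in> borel_measurable (lborel \<Otimes>\<^sub>M \<mu>)"
proof -
  have "continuous_on {t1 + h<..t2} (mov_avg compensator h)"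
    unfolding continuous_on_eq_continuous_within using mov_avg_compensator_derivative[OF h] DERIV_continuous by blast
  then have "(\<lambda>t. indicator {t1 + h<..t2} t *\<^sub>R mov_avg compensator h t) \<in> borel_measurable borel"
    by (intro borel_measurable_continuous_on_indicator) auto
  then have [measurable]: "(\<lambda>t. indicator {t1 + h<..t2} t * mov_avg compensator h t) \<in> borel_measurable borel" by simp
  note [measurable] = average_joint_measurable[of h]
  have "(\<lambda>z. indicator {t1 + h<..t2} (fst z) * ((1 / h) * (case z of (t, x) \<Rightarrow> trunc_integral (t - h) t x))
       + (indicator {t1 + h<..t2} (fst z) * mov_avg compensator h (fst z)
         + indicator {t1 + h<..t2} (fst z) * e)) \<in> borel_measurable (lborel \<Otimes>\<^sub>M \<mu>)"
    by measurable
  also have "(\<lambda>z. indicator {t1 + h<..t2} (fst z) * ((1 / h) * (case z of (t, x) \<Rightarrow> trunc_integral (t - h) t x))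
       + (indicator {t1 + h<..t2} (fst z) * mov_avg compensator h (fst z) + indicator {t1 + h<..t2} (fst z) * e))
    = (\<lambda>z. indicator ({t1 + h<..t2} \<times> UNIV) z *\<^sub>R (case z of (t, x) \<Rightarrow> steklov h e t x))"
    by (auto simp: fun_eq_iff steklov_def indicator_def)
  finally show ?thesis .
qed

text \<open>Fubini's theorem; near the half ball the truncation may be replaced by u.\<close>

lemma steklov_pairing:
  assumes p: "\<phi> \<in> L2 \<mu> B2" and h: "0 < h" and t: "t1 + h < t" "t \<le> t2"
  defines "\<phi>1 \<equiv> (\<lambda>x. indicator B2 x * \<phi> x)" and "\<kappa> \<equiv> (LINT x:B2|\<mu>. \<phi> x)"
  shows "pairing \<mu> B2 (steklov h e) \<phi> t = mov_avg (I \<phi>1) h t + (mov_avg compensator h t + e) * \<kappa>"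
    and "\<phi>1 \<in> L2 \<mu> UNIV" "\<phi>1 \<in> L2 \<mu> B"
proof -
  have [measurable]: "\<phi> \<in> borel_measurable borel" "B2 \<in> sets borel" using p by (auto simp: L2_def)
  have p1b: "\<phi>1 \<in> borel_measurable borel" unfolding \<phi>1_def by measurable
  have sq: "integrable \<mu> (\<lambda>x. (\<phi>1 x)\<^sup>2)"
  proof -
    have "integrable \<mu> (\<lambda>x. indicator B2 x * (\<phi> x)\<^sup>2)" using p by (simp add: L2_def set_integrable_def)
    moreover have "(\<lambda>x. indicator B2 x * (\<phi> x)\<^sup>2) = (\<lambda>x. (\<phi>1 x)\<^sup>2)" by (auto simp: \<phi>1_def indicator_def)
    ultimately show ?thesis by simp
  qed
  then show p1U: "\<phi>1 \<in> L2 \<mu> UNIV" using p1b by (simp add: L2_def set_integrable_def)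
  have "set_integrable \<mu> B (\<lambda>x. (\<phi>1 x)\<^sup>2)"
    unfolding set_integrable_def using sq by (intro integrable_mult_indicator) (auto simp: sets_mu)
  then show p1B: "\<phi>1 \<in> L2 \<mu> B" using p1b by (simp add: L2_def)
  have B2B: "B2 \<subseteq> B" "B2 \<subseteq> ball x0 (11 * R / 20)" using R by auto
  have pm: "(LINT x|\<mu>. \<phi>1 x * trunc s x) = I \<phi>1 s" if s: "s \<in> {t1<..t2}" for s
  proof -
    note [measurable] = trunc_borel[OF s] u_borel[OF s] p1b
    have [measurable]: "B \<in> sets borel" by simp
    have "(LINT x|\<mu>. \<phi>1 x * trunc s x) = (LINT x|\<mu>. indicator B x *\<^sub>R (u s x * \<phi>1 x))"
    proof (rule integral_cong_AE)
      show "AE x in \<mu>. \<phi>1 x * trunc s x = indicator B x *\<^sub>R (u s x * \<phi>1 x)"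
        using trunc_eq_u(1)[OF s]
      proof eventually_elim
        case (elim x)
        then show ?case using B2B by (cases "x \<in> B2") (auto simp: \<phi>1_def)
      qed
    qed measurable
    then show ?thesis by (simp add: I_alt set_lebesgue_integral_def)
  qed
  have cd: "t1 < t - h" "t - h \<le> t" "t \<le> t2" using h t by auto
  have mi: "(LINT x|\<mu>. \<phi>1 x * trunc_integral (t - h) t x) = integral {t - h..t} (I \<phi>1)"
  proof -
    have "(LINT x|\<mu>. \<phi>1 x * trunc_integral (t - h) t x) = (LINT s:{t - h..t}|lebesgue. (LINT x|\<mu>. \<phi>1 x * trunc s x))"
      by (rule trunc_integral_pairing(1)[OF p1U cd])
    also have "\<dots> = integral {t - h..t} (\<lambda>s. LINT x|\<mu>. \<phi>1 x * trunc s x)"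
      by (rule set_lebesgue_integral_eq_integral(2)[OF trunc_integral_pairing(2)[OF p1U cd]])
    also have "\<dots> = integral {t - h..t} (I \<phi>1)"
      using cd by (intro Henstock_Kurzweil_Integration.integral_cong pm) auto
    finally show ?thesis .
  qed
  have one_L2: "(\<lambda>x. 1) \<in> L2 \<mu> B2" by (rule L2_of_bounded[OF sets_mu _ _ emeasure_ball, where K=1]) auto
  have ip: "integrable \<mu> \<phi>1"
    using L2_prod_integrable[OF sets_mu _ p one_L2] by (simp add: set_integrable_def \<phi>1_def)
  have im: "integrable \<mu> (\<lambda>x. \<phi>1 x * trunc_integral (t - h) t x)"
    by (rule L2_prod[OF p1U trunc_integral_L2[OF cd(2)]])
  have "pairing \<mu> B2 (steklov h e) \<phi> t = (LINT x|\<mu>. (1 / h) * (\<phi>1 x * trunc_integral (t - h) t x)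
    + (mov_avg compensator h t + e) * \<phi>1 x)"
    unfolding pairing_def set_lebesgue_integral_def
    by (intro Bochner_Integration.integral_cong) (auto simp: steklov_def \<phi>1_def indicator_def algebra_simps)
  also have "\<dots> = (1 / h) * (LINT x|\<mu>. \<phi>1 x * trunc_integral (t - h) t x) + (mov_avg compensator h t
    + e) * (LINT x|\<mu>. \<phi>1 x)"
    using im ip by simp
  also have "(LINT x|\<mu>. \<phi>1 x) = \<kappa>" by (simp add: \<kappa>_def set_lebesgue_integral_def \<phi>1_def)
  finally show "pairing \<mu> B2 (steklov h e) \<phi> t = mov_avg (I \<phi>1) h t + (mov_avg compensator h t + e) * \<kappa>"
    unfolding mi mov_avg_def .
qed

lemma steklov_pairing_derivative:
  assumes p: "\<phi> \<in> L2 \<mu> B2" and h: "0 < h" and t: "t \<in> {t1 + h<..t2}"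
  defines "\<phi>1 \<equiv> (\<lambda>x. indicator B2 x * \<phi> x)" and "\<kappa> \<equiv> (LINT x:B2|\<mu>. \<phi> x)"
  shows "(pairing \<mu> B2 (steklov h e) \<phi> has_real_derivative
     (1 / h) * (I \<phi>1 t - I \<phi>1 (t - h)) + (1 / h) * (compensator t - compensator (t - h)) * \<kappa>) (at t within {t1
       + h<..t2})"
proof -
  have pB: "\<phi>1 \<in> L2 \<mu> B" unfolding \<phi>1_def by (rule steklov_pairing(3)[OF p h]) (use t in auto)
  have "(mov_avg (I \<phi>1) h has_real_derivative (1 / h) * (I \<phi>1 t - I \<phi>1 (t - h))) (at t within {t1 + h<..t2})"
    unfolding mov_avg_def[abs_def] by (intro DERIV_cmult moving_average_derivative I_continuous pB h t)
  then have "((\<lambda>t. mov_avg (I \<phi>1) h t + (mov_avg compensator h t + e) * \<kappa>) has_real_derivative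
     (1 / h) * (I \<phi>1 t - I \<phi>1 (t - h)) + (1 / h) * (compensator t - compensator (t - h)) * \<kappa>) (at t within {t1
       + h<..t2})"
    by (auto intro!: derivative_eq_intros mov_avg_compensator_derivative[OF h t])
  then show ?thesis
  proof (rule has_field_derivative_transform_within[OF _ zero_less_one t])
    fix s assume "s \<in> {t1 + h<..t2}"
    then show "mov_avg (I \<phi>1) h s + (mov_avg compensator h s + e) * \<kappa> = pairing \<mu> B2 (steklov h e) \<phi> s"
      unfolding \<phi>1_def \<kappa>_def by (intro steklov_pairing(1)[symmetric] p h) auto
  qed
qed

text \<open>The cutoff function is constant near the support of \<phi>.\<close>

lemma EL_psi_zero:
  assumes p: "\<phi> \<in> F" "compact (ess_supp \<mu> \<phi>)" "ess_supp \<mu> \<phi> \<subseteq> ball x0 (11 * R / 20)"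
  shows "EL \<psi> \<phi> = 0"
proof -
  obtain C where C: "compact C" "\<And>x. x \<notin> C \<Longrightarrow> \<psi> x = 0" using C0_D[OF psi(2)] by blast
  have "compact (ess_supp \<mu> \<psi>)" by (rule compact_ess_supp(1)[OF C])
  moreover have "\<exists>V c. open V \<and> ess_supp \<mu> \<phi> \<subseteq> V \<and> (AE x in \<mu>. x \<in> V \<longrightarrow> \<psi> x = c)"
    using p(3) psi(5) by (intro exI[of _ "ball x0 (11 * R / 20)"] exI[of _ 1]) auto
  ultimately have "EL \<phi> \<psi> = 0"
    using bd p psi(1) unfolding beurling_deny_without_killing_def strongly_local_def by blast
  then show ?thesis using EL_commute[OF psi(1) p(1)] by simp
qed

text \<open>Adding a constant in space changes neither the local nor the jump part.\<close>

lemma steklov_ext_form: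
  assumes p: "\<phi> \<in> F_on \<mu> F E B2" and h: "0 < h" and t: "t1 + h < t" "t \<le> t2"
  shows "ext_form \<mu> F EL j B2 (steklov h e t) \<phi> = (1 / h) * E (trunc_integral (t - h) t) \<phi>"
proof -
  let ?A = "\<lambda>x. (1 / h) * trunc_integral (t - h) t x"
  let ?w = "\<lambda>x. (1 / h) * trunc_integral (t - h) t x + (mov_avg compensator h t + e) * \<psi> x"
  have pF: "\<phi> \<in> F" using p by (simp add: F_on_def)
  have AF: "?A \<in> F" by (rule average_F[OF h t])
  have mF: "trunc_integral (t - h) t \<in> F" by (rule trunc_integral_energy(1)) (use h t in auto)
  have supp: "compact (ess_supp \<mu> \<phi>)" "ess_supp \<mu> \<phi> \<subseteq> closure B2"
    by (rule F_on_ess_supp[OF p _ compact_closure_ball], simp)+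
  have cl: "closure B2 \<subseteq> cball x0 (R / 2)" by (intro closure_minimal) auto
  have "cball x0 (R / 2) \<subseteq> ball x0 (11 * R / 20)" using R by auto
  then have suppU: "ess_supp \<mu> \<phi> \<subseteq> ball x0 (11 * R / 20)" using supp(2) cl by blast
  note ext = steklov_local_extension[OF h t, of e]
  have "ext_form \<mu> F EL j B2 (steklov h e t) \<phi> = EL ?w \<phi> + jump_form j \<phi> (steklov h e t)"
    by (rule ext_form_eq[OF ext(3) compact_closure_ball pF supp open_ball suppU ext(1,2)])
  also have "EL ?w \<phi> = EL ?A \<phi>"
    using el.add_left[OF AF e1.scale_mem[OF psi(1), of
      "mov_avg compensator h t + e"] pF] el.scale_left[OF psi(1) pF, of
      "mov_avg compensator h t + e"] EL_psi_zero[OF pF supp(1) suppU] by simp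
  also have "jump_form j \<phi> (steklov h e t) = jump_form j ?A \<phi>"
    unfolding jump_form_commute[of \<phi>] by (simp add: jump_form_def steklov_def)
  also have "EL ?A \<phi> + jump_form j ?A \<phi> = E ?A \<phi>" by (rule E_split[OF AF pF, symmetric])
  also have "\<dots> = (1 / h) * E (trunc_integral (t - h) t) \<phi>" by (rule en.scale_left[OF mF pF])
  finally show ?thesis .
qed

text \<open>The derivative of a pairing of the average is the increment of the pairing of u plus that
  of the compensator, divided by h, so the required inequality at time t is the integrated one
  over [t - h, t].\<close>

lemma steklov_supercaloric:
  assumes h: "0 < h" and a: "t1 + h \<le> a" "a < t2"
  shows "supercaloric \<mu> F E EL j J a t2 B2 (steklov h e)"
proof -
  have sub: "t \<in> {a<..t2} \<Longrightarrow> t \<in> {t1 + h<..t2}" for t using a by auto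
  have left: "(pairing \<mu> B2 (steklov h e) \<phi> has_real_derivative D) (at_left t)"
    if "(pairing \<mu> B2 (steklov h e) \<phi> has_real_derivative D) (at t within {t1 + h<..t2})" "t \<in> {a<..t2}" for \<phi> D t
  proof -
    have "(pairing \<mu> B2 (steklov h e) \<phi> has_real_derivative D) (at t within {t1 + h<..<t})"
      by (rule has_field_derivative_subset[OF that(1)]) (use that in auto)
    moreover have "at t within {t1 + h<..<t} = at_left t"
      by (rule at_within_nhd[of t "{t1 + h<..}"]) (use sub[OF that(2)] in auto)
    ultimately show ?thesis by simp
  qed
  show ?thesis
    unfolding supercaloric_def
  proof (intro conjI ballI impI)
    show "steklov h e t \<in> Fprime \<mu> F J B2" if "t \<in> {a<..t2}" for t
      by (rule steklov_Fprime[OF h]) (use sub[OF that] in auto)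
    show "(\<lambda>(t, x). steklov h e t x) \<in> borel_measurable (restrict_space (mu_hat \<mu>) ({a<..t2} \<times> UNIV))"
    proof -
      have s: "{c<..t2} \<times> (UNIV :: 'a set) \<in> sets (lborel \<Otimes>\<^sub>M \<mu>)" for c by (intro pair_measureI) (auto simp: sets_mu)
      have s': "{c<..t2} \<times> (UNIV :: 'a set) \<inter> space (mu_hat \<mu>) \<in> sets (mu_hat \<mu>)" for c
        using s[of c] by (auto simp: mu_hat_def space_pair_measure)
      have "(\<lambda>z. indicator ({t1 + h<..t2} \<times> UNIV) z *\<^sub>R (case z of (t, x) \<Rightarrow> steklov h e t x))
        \<in> borel_measurable (mu_hat \<mu>)"
        unfolding mu_hat_def by (rule measurable_completion[OF steklov_joint_measurable[OF h]])
      note vm = this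
      have "indicat_real ({a<..t2} \<times> (UNIV :: 'a set)) \<in> borel_measurable (mu_hat \<mu>)"
        using s[of a] by (intro borel_measurable_indicator) (simp add: mu_hat_def)
      from borel_measurable_scaleR[OF this vm]
      have "(\<lambda>z. indicator ({a<..t2} \<times> (UNIV :: 'a set)) z *\<^sub>R (indicator ({t1 + h<..t2} \<times> UNIV) z *\<^sub>R
        (case z of (t, x) \<Rightarrow> steklov h e t x))) \<in> borel_measurable (mu_hat \<mu>)" .
      also have "(\<lambda>z. indicator ({a<..t2} \<times> (UNIV :: 'a set)) z *\<^sub>R (indicator ({t1 + h<..t2} \<times> UNIV) z *\<^sub>R
        (case z of (t, x) \<Rightarrow> steklov h e t x)))
        = (\<lambda>z. indicator ({a<..t2} \<times> UNIV) z *\<^sub>R (case z of (t, x) \<Rightarrow> steklov h e t x))"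
        using sub by (auto simp: fun_eq_iff indicator_def)
      finally show ?thesis using borel_measurable_restrict_space_iff[OF s'] by blast
    qed
    show "continuous_on {a<..t2} (pairing \<mu> B2 (steklov h e) \<phi>)" if "\<phi> \<in> L2 \<mu> B2" for \<phi>
    proof -
      have "continuous_on {t1 + h<..t2} (pairing \<mu> B2 (steklov h e) \<phi>)"
        unfolding continuous_on_eq_continuous_within
          using steklov_pairing_derivative[OF that h] DERIV_continuous by blast
      then show ?thesis by (rule continuous_on_subset) (use sub in auto)
    qed
    show "\<exists>D. (pairing \<mu> B2 (steklov h e) \<phi> has_real_derivative D) (at_left t)" if "\<phi> \<in> L2 \<mu> B2" "t \<in> {a<..t2}"
      for \<phi> t
      using left[OF steklov_pairing_derivative[OF that(1) h sub[OF that(2)]] that(2)] by blast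
    show "\<exists>D. (pairing \<mu> B2 (steklov h e) \<phi> has_real_derivative D) (at_left t) \<and>
      0 \<le> D + ext_form \<mu> F EL j B2 (steklov h e t) \<phi>"
      if p: "\<phi> \<in> F_on \<mu> F E B2" "AE x in \<mu>. 0 \<le> \<phi> x" and t: "t \<in> {a<..t2}" for \<phi> t
    proof -
      have t': "t1 + h < t" "t \<le> t2" using sub[OF t] by auto
      have pF: "\<phi> \<in> F" using p by (simp add: F_on_def)
      note [measurable] = F_borel[OF pF]
      have [measurable]: "B2 \<in> sets borel" "B \<in> sets borel" by simp_all
      have pL: "\<phi> \<in> L2 \<mu> B2"
      proof -
        have "set_integrable \<mu> B2 (\<lambda>x. (\<phi> x)\<^sup>2)"
          unfolding set_integrable_def using sq_integrable[OF pF]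
            by (intro integrable_mult_indicator) (auto simp: sets_mu)
        then show ?thesis using F_borel[OF pF] by (simp add: L2_def)
      qed
      define \<phi>1 where "\<phi>1 x = indicator B2 x * \<phi> x" for x
      have out: "AE x in \<mu>. \<phi>1 x = \<phi> x"
        using F_on_zero_outside[OF p(1)] by (auto elim!: eventually_mono simp: \<phi>1_def indicator_def)
      have [measurable]: "\<phi>1 \<in> borel_measurable borel" unfolding \<phi>1_def by measurable
      have II: "I \<phi>1 s = I \<phi> s" if s: "s \<in> {t1<..t2}" for s
      proof -
        note [measurable] = u_borel[OF s]
        show ?thesis unfolding I_alt set_lebesgue_integral_def
          by (rule integral_cong_AE) (measurable, use out in \<open>auto elim!: eventually_mono\<close>)
      qed
      have kk: "(LINT x:B2|\<mu>. \<phi> x) = (LINT x|\<mu>. \<phi> x)"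
        unfolding set_lebesgue_integral_def
        by (rule integral_cong_AE) (measurable, use out in \<open>auto elim!: eventually_mono simp: \<phi>1_def\<close>)
      let ?D = "(1 / h) * (I \<phi>1 t - I \<phi>1 (t - h)) + (1 / h) * (compensator t - compensator (t
        - h)) * (LINT x:B2|\<mu>. \<phi> x)"
      have "(pairing \<mu> B2 (steklov h e) \<phi> has_real_derivative ?D) (at_left t)"
        unfolding \<phi>1_def by (rule left[OF steklov_pairing_derivative[OF pL h sub[OF t]] t])
      moreover have "0 \<le> ?D + ext_form \<mu> F EL j B2 (steklov h e t) \<phi>"
      proof -
        have cd: "t1 < t - h" "t - h \<le> t" "t \<le> t2" using h t' by auto
        have "- E (trunc_integral (t - h) t) \<phi> - 2 * (LINT s:{t - h..t}|lebesgue. tail_minorant s)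
          * (LINT x|\<mu>. \<phi> x) \<le> I \<phi> t - I \<phi> (t - h)"
          by (rule integrated_inequality[OF p cd])
        also have "2 * (LINT s:{t - h..t}|lebesgue. tail_minorant s) = compensator t - compensator (t - h)"
          using cd by (intro compensator_diff[symmetric]) auto
        finally have "0 \<le> (1 / h) * ((I \<phi> t - I \<phi> (t - h)) + (compensator t - compensator (t
          - h)) * (LINT x|\<mu>. \<phi> x) + E (trunc_integral (t - h) t) \<phi>)"
          using h by (intro mult_nonneg_nonneg) auto
        also have "\<dots> = ?D + ext_form \<mu> F EL j B2 (steklov h e t) \<phi>"
          unfolding steklov_ext_form[OF p(1) h t'] kk using II[of t] II[of "t - h"] cd h by (simp add: field_simps)
        finally show ?thesis .
      qed
      ultimately show ?thesis by blast
    qed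
    show "\<exists>S. finite S \<and> S \<subseteq> {a<..t2} \<and> t2 \<in> S \<and>
        (\<forall>\<phi>\<in>L2 \<mu> B2. \<forall>t\<in>{a<..t2} - S. pairing \<mu> B2 (steklov h e) \<phi> differentiable (at t))"
    proof (intro exI[of _ "{t2}"] conjI ballI)
      fix \<phi> t assume p: "\<phi> \<in> L2 \<mu> B2" and t: "t \<in> {a<..t2} - {t2}"
      obtain D where D: "(pairing \<mu> B2 (steklov h e) \<phi> has_real_derivative D) (at t within {t1 + h<..t2})"
        using steklov_pairing_derivative[OF p h sub] t by blast
      have "(pairing \<mu> B2 (steklov h e) \<phi> has_real_derivative D) (at t within {t1 + h<..<t2})"
        by (rule has_field_derivative_subset[OF D]) auto
      moreover have "at t within {t1 + h<..<t2} = at t"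
        using sub[of t] t by (intro at_within_open) auto
      ultimately have "(pairing \<mu> B2 (steklov h e) \<phi> has_real_derivative D) (at t)" by simp
      then show "pairing \<mu> B2 (steklov h e) \<phi> differentiable (at t)" by (auto simp: real_differentiable_def)
    qed (use a in auto)
  qed
qed

end

section \<open>Essential infima\<close>

context metric_measure begin

lemma essinf_ge:
  assumes f: "f \<in> borel_measurable borel" and A: "A \<in> sets borel" and ae: "AE x in \<mu>. x \<in> A \<longrightarrow> c \<le> f x"
  shows "ereal c \<le> essinf_on \<mu> A f"
proof -
  have "esssup (restrict_space \<mu> A) (\<lambda>x. - ereal (f x)) \<le> - ereal c"
  proof (rule esssup_I)
    have "(\<lambda>x. - ereal (f x)) \<in> borel_measurable \<mu>" using f by (simp add: measurable_cong_sets[OF sets_mu refl])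
    then show "(\<lambda>x. - ereal (f x)) \<in> borel_measurable (restrict_space \<mu> A)" by (rule measurable_restrict_space1)
    show "AE x in restrict_space \<mu> A. - ereal (f x) \<le> - ereal c"
      using ae A by (subst AE_restrict_space_iff) (auto simp: sets_mu)
  qed
  then show ?thesis unfolding essinf_on_def
    using ereal_minus_le_minus[of "- ereal c" "esssup (restrict_space \<mu> A) (\<lambda>x. - ereal (f x))"]
    by (simp add: ereal_uminus_le_reorder)
qed

lemma essinf_AE:
  assumes A: "A \<in> sets borel"
  shows "AE x in \<mu>. x \<in> A \<longrightarrow> essinf_on \<mu> A f \<le> ereal (f x)"
proof -
  have "AE x in restrict_space \<mu> A. - ereal (f x) \<le> esssup (restrict_space \<mu> A) (\<lambda>x. - ereal (f x))"
    by (rule esssup_AE)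
  then have "AE x in \<mu>. x \<in> A \<longrightarrow> - ereal (f x) \<le> esssup (restrict_space \<mu> A) (\<lambda>x. - ereal (f x))"
    using A by (subst (asm) AE_restrict_space_iff) (auto simp: sets_mu)
  then show ?thesis unfolding essinf_on_def by (auto elim!: eventually_mono simp: ereal_uminus_le_reorder)
qed

end

section \<open>Averages of a concave power\<close>

text \<open>The tangent to the concave function y^q at z lies above it.\<close>

lemma powr_tangent:
  fixes q y z :: real
  assumes q: "0 < q" "q < 1" and y: "0 \<le> y" and z: "0 < z"
  shows "y powr q \<le> z powr q + q * z powr (q - 1) * (y - z)"
proof (cases "y = 0")
  case True
  have "z powr (q - 1) * z = z powr q" using powr_add[of z "q - 1" 1] z by simp
  then have "z powr q + q * z powr (q - 1) * (0 - z) = (1 - q) * z powr q" by (simp add: algebra_simps)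
  moreover have "0 \<le> (1 - q) * z powr q" using q by simp
  ultimately show ?thesis using True by simp
next
  case False
  then have y: "y > 0" using assms by simp
  have "y powr q * z powr (1 - q) \<le> q * y + (1 - q) * z"
    by (rule Youngs_inequality_0) (use q y z in auto)
  then have "(y powr q * z powr (1 - q)) * z powr (q - 1) \<le> (q * y + (1 - q) * z) * z powr (q - 1)"
    by (intro mult_right_mono) auto
  moreover have "z powr (1 - q) * z powr (q - 1) = 1" using z by (simp flip: powr_add)
  moreover have "z * z powr (q - 1) = z powr q" using powr_add[of z 1 "q - 1"] z by simp
  ultimately show ?thesis by (simp add: algebra_simps)
qed

context supersolution_in_time begin

interpretation lm: pair_sigma_finite lborel \<mu>
  by (intro pair_sigma_finite.intro lborel.sigma_finite_measure_axioms sigma_finite_measure_axioms)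

lemma steklov_ge: assumes h: "0 < h" and t: "t1 + h < t" "t \<le> t2"
  shows "(1 / h) * trunc_integral (t - h) t x + e \<le> steklov h e t x"
  using mov_avg_compensator(1)[OF h t] by (simp add: steklov_def)

lemma steklov_pos: assumes h: "0 < h" and t: "t1 + h < t" "t \<le> t2" and e: "0 < e" shows "0 < steklov h e t x"
  using steklov_ge[OF h t, of x e] average_bounds(1)[OF h, of t x] e by linarith

lemma steklov_le: assumes h: "0 < h" and t: "t1 + h < t" "t \<le> t2" shows "steklov h e t x \<le> K + 2 * \<tau> + e"
  using mov_avg_compensator(2)[OF h t] average_bounds(3)[OF h, of t x] by (simp add: steklov_def)

text \<open>Jensen's inequality in one variable: integrate the tangent inequality at the value of the
  average.\<close>

lemma average_powr:
  assumes q: "0 < q" "q < 1" and h: "0 < h" and t: "t1 + h < t" "t \<le> t2" and e: "0 < e"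
  shows "(\<integral>\<^sup>+s. ennreal (trunc_joint (s, x) powr q) * indicator {t - h..t} s \<partial>lborel)
    \<le> ennreal (h * steklov h e t x powr q)"
proof -
  define z where "z = steklov h e t x"
  have z: "z > 0" unfolding z_def by (rule steklov_pos[OF h t e])
  have mi: "trunc_integral (t - h) t x \<le> h * z"
    using steklov_ge[OF h t, of x e] e h unfolding z_def[symmetric]
      by (simp add: field_simps) (smt (verit) mult_pos_pos)
  have i: "set_integrable lborel {t - h..t} (\<lambda>s. trunc_joint (s, x) powr q)"
    unfolding set_integrable_def
  proof (rule Bochner_Integration.integrable_bound)
    show "integrable lborel (\<lambda>s. indicator {t - h..t} s *\<^sub>R (K powr q))"
      by (intro integrable_scaleR_left integrable_real_indicator) (auto simp: emeasure_lborel_Icc_eq)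
    show "AE s in lborel. norm (indicator {t - h..t} s *\<^sub>R trunc_joint (s, x) powr q)
      \<le> norm (indicator {t - h..t} s *\<^sub>R K powr q)"
      using trunc_joint_nonneg trunc_joint_le_K q by (intro AE_I2) (auto simp: indicator_def intro!: powr_mono2)
  qed measurable
  have const: "set_integrable lborel {t - h..t} (\<lambda>s. c)" for c :: real
    unfolding set_integrable_def by (intro integrable_scaleR_left integrable_real_indicator)
      (auto simp: emeasure_lborel_Icc_eq)
  have mhi: "set_integrable lborel {t - h..t} (\<lambda>s. trunc_joint (s, x))" by (rule trunc_joint_integrable)
  have di: "set_integrable lborel {t - h..t} (\<lambda>s. q * z powr (q - 1) * (trunc_joint (s, x) - z))"
    by (intro set_integrable_mult_right set_integral_diff(1) mhi const)
  have ci: "(LINT s:{t - h..t}|lborel. c) = h * c" for c :: real using h by (simp add: set_lebesgue_integral_def)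
  have "(LINT s:{t - h..t}|lborel. trunc_joint (s, x) powr q)
    \<le> (LINT s:{t - h..t}|lborel. z powr q + q * z powr (q - 1) * (trunc_joint (s, x) - z))"
    by (rule set_integral_mono[OF i set_integral_add(1)[OF const di]]) (intro powr_tangent q z trunc_joint_nonneg)
  also have "\<dots> = h * z powr q + q * z powr (q - 1) * (trunc_integral (t - h) t x - h * z)"
    using set_integral_add(2)[OF const di, of "z powr q"] set_integral_diff(2)[OF mhi const, of z]
      by (simp add: ci trunc_integral_def)
  also have "\<dots> \<le> h * z powr q" using mi q by (simp add: mult_nonneg_nonpos)
  finally have le: "(LINT s:{t - h..t}|lborel. trunc_joint (s, x) powr q) \<le> h * z powr q" .
  have "(\<integral>\<^sup>+s. ennreal (trunc_joint (s, x) powr q) * indicator {t - h..t} s \<partial>lborel)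
    = (\<integral>\<^sup>+s. ennreal (indicator {t - h..t} s *\<^sub>R trunc_joint (s, x) powr q) \<partial>lborel)"
    by (intro nn_integral_cong) (auto simp: indicator_def)
  also have "\<dots> = ennreal (LINT s:{t - h..t}|lborel. trunc_joint (s, x) powr q)"
    unfolding set_lebesgue_integral_def by (rule nn_integral_eq_integral[OF i[unfolded set_integrable_def]]) auto
  also have "\<dots> \<le> ennreal (h * z powr q)" by (rule ennreal_leI[OF le])
  finally show ?thesis unfolding z_def .
qed

text \<open>By Tonelli's theorem each time s is counted, for every h, by the averages at the times from
  s to s + h, all of which lie in the longer cylinder when s lies in the shorter one.\<close>

lemma average_powr_cylinder:
  assumes q: "0 < q" "q < 1" and h: "0 < h" and e: "0 < e" and ab: "t1 + h \<le> a" "c + h \<le> d" "d \<le> t2"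
    and A[measurable]: "A \<in> sets borel"
  shows "(\<integral>\<^sup>+z. ennreal (trunc_joint z powr q) * indicator ({a<..c} \<times> A) z \<partial>(lborel \<Otimes>\<^sub>M \<mu>))
     \<le> (\<integral>\<^sup>+z. ennreal ((case z of (t, x) \<Rightarrow> steklov h e t x powr q)) * indicator ({a<..d} \<times> A) z \<partial>(lborel \<Otimes>\<^sub>M \<mu>))"
proof -
  note [measurable] = steklov_joint_measurable[OF h, of e]
  let ?g = "\<lambda>s x. ennreal (trunc_joint (s, x) powr q)"
  let ?w = "\<lambda>z. (case z of (t, x) \<Rightarrow> steklov h e t x powr q)"
  have vm: "(\<lambda>z. ennreal (?w z) * indicator ({a<..d} \<times> A) z) \<in> borel_measurable (lborel \<Otimes>\<^sub>M \<mu>)"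
  proof -
    have "(\<lambda>z. ennreal ((indicator ({t1 + h<..t2} \<times> UNIV) z *\<^sub>R (case z of (t, x) \<Rightarrow> steklov h e t x)) powr q)
      * indicator ({a<..d} \<times> A) z) \<in> borel_measurable (lborel \<Otimes>\<^sub>M \<mu>)"
      by measurable
    also have "(\<lambda>z. ennreal ((indicator ({t1 + h<..t2} \<times> UNIV) z *\<^sub>R (case z of (t, x) \<Rightarrow> steklov h e t x)) powr
      q) * indicator ({a<..d} \<times> A) z)
       = (\<lambda>z. ennreal (?w z) * indicator ({a<..d} \<times> A) z)"
      using ab by (auto simp: fun_eq_iff indicator_def)
    finally show ?thesis .
  qed
  have gm: "(\<lambda>z. ennreal (trunc_joint z powr q) * indicator ({a<..c} \<times> A) z) \<in> borel_measurable (lborel \<Otimes>\<^sub>M \<mu>)"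
    by measurable
  have sec: "(\<integral>\<^sup>+s. ?g s x * indicator {a<..c} s \<partial>lborel)
    \<le> (\<integral>\<^sup>+t. ennreal (steklov h e t x powr q) * indicator {a<..d} t \<partial>lborel)" for x
  proof -
    let ?k = "\<lambda>t s. (?g s x * indicator {a<..c} s) * (ennreal (1 / h) * (if t - h \<le> s \<and> s \<le> t then 1 else 0))"
    have km: "(\<lambda>(t, s). ?k t s) \<in> borel_measurable (lborel \<Otimes>\<^sub>M lborel)" by measurable
    have "(\<integral>\<^sup>+s. ?g s x * indicator {a<..c} s \<partial>lborel) = (\<integral>\<^sup>+s. (\<integral>\<^sup>+t. ?k t s \<partial>lborel) \<partial>lborel)"
    proof (rule nn_integral_cong)
      fix s
      have "(\<integral>\<^sup>+t. ennreal (1 / h) * (if t - h \<le> s \<and> s \<le> t then 1 else 0) \<partial>lborel)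
        = (\<integral>\<^sup>+t. ennreal (1 / h) * indicator {s..s + h} t \<partial>lborel)"
        by (intro nn_integral_cong) (auto simp: indicator_def)
      also have "\<dots> = ennreal (1 / h) * ennreal h" using h by (subst nn_integral_cmult_indicator) auto
      also have "\<dots> = 1" using h by (simp flip: ennreal_mult)
      finally have "(\<integral>\<^sup>+t. ennreal (1 / h) * (if t - h \<le> s \<and> s \<le> t then 1 else 0) \<partial>lborel) = 1" .
      moreover have "(\<integral>\<^sup>+t. ?k t s \<partial>lborel) = (?g s x * indicator {a<..c} s) * (\<integral>\<^sup>+t. ennreal (1 / h) * (if t
        - h \<le> s \<and> s \<le> t then 1 else 0) \<partial>lborel)"
        by (rule nn_integral_cmult) measurable
      ultimately show "?g s x * indicator {a<..c} s = (\<integral>\<^sup>+t. ?k t s \<partial>lborel)" by simp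
    qed
    also have "\<dots> = (\<integral>\<^sup>+t. (\<integral>\<^sup>+s. ?k t s \<partial>lborel) \<partial>lborel)" by (rule lborel_pair.Fubini'[OF km])
    also have "\<dots> \<le> (\<integral>\<^sup>+t. ennreal (steklov h e t x powr q) * indicator {a<..d} t \<partial>lborel)"
    proof (rule nn_integral_mono)
      fix t
      show "(\<integral>\<^sup>+s. ?k t s \<partial>lborel) \<le> ennreal (steklov h e t x powr q) * indicator {a<..d} t"
      proof (cases "t \<in> {a<..d}")
        case True
        have "(\<integral>\<^sup>+s. ?k t s \<partial>lborel) \<le> (\<integral>\<^sup>+s. ennreal (1 / h) * (?g s x * indicator {t - h..t} s) \<partial>lborel)"
          by (intro nn_integral_mono) (auto simp: indicator_def ac_simps)
        also have "\<dots> = ennreal (1 / h) * (\<integral>\<^sup>+s. ?g s x * indicator {t - h..t} s \<partial>lborel)"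
          by (rule nn_integral_cmult) measurable
        also have "\<dots> \<le> ennreal (1 / h) * ennreal (h * steklov h e t x powr q)"
          by (intro mult_left_mono average_powr q h e) (use True ab in auto)
        also have "\<dots> = ennreal (steklov h e t x powr q)" using h by (simp flip: ennreal_mult)
        finally show ?thesis using True by simp
      next
        case False
        have z: "?k t s = 0" for s using False ab by (auto simp: indicator_def)
        show ?thesis unfolding z by simp
      qed
    qed
    finally show ?thesis .
  qed
  have "(\<integral>\<^sup>+z. ennreal (trunc_joint z powr q) * indicator ({a<..c} \<times> A) z \<partial>(lborel \<Otimes>\<^sub>M \<mu>))
     = (\<integral>\<^sup>+x. (\<integral>\<^sup>+s. ?g s x * indicator {a<..c} s \<partial>lborel) * indicator A x \<partial>\<mu>)"
  proof (subst lm.nn_integral_snd[OF gm, symmetric], rule nn_integral_cong)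
    fix x show "(\<integral>\<^sup>+s. ?g s x * indicator ({a<..c} \<times> A) (s, x) \<partial>lborel)
      = (\<integral>\<^sup>+s. ?g s x * indicator {a<..c} s \<partial>lborel) * indicator A x"
      by (cases "x \<in> A") (auto simp: indicator_times)
  qed
  also have "\<dots> \<le> (\<integral>\<^sup>+x. (\<integral>\<^sup>+t. ennreal (steklov h e t x powr q) * indicator {a<..d} t \<partial>lborel) * indicator A x \<partial>\<mu>)"
    by (intro nn_integral_mono mult_right_mono sec) auto
  also have "\<dots> = (\<integral>\<^sup>+z. ennreal (?w z) * indicator ({a<..d} \<times> A) z \<partial>(lborel \<Otimes>\<^sub>M \<mu>))"
  proof (subst lm.nn_integral_snd[OF vm, symmetric], rule nn_integral_cong)
    fix x show "(\<integral>\<^sup>+t. ennreal (steklov h e t x powr q) * indicator {a<..d} t \<partial>lborel) * indicator A x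
      = (\<integral>\<^sup>+t. ennreal (?w (t, x)) * indicator ({a<..d} \<times> A) (t, x) \<partial>lborel)"
      by (cases "x \<in> A") (auto simp: indicator_times)
  qed
  finally show ?thesis .
qed

lemma set_integral_mu_hat:
  assumes f: "(\<lambda>z. indicator Q z *\<^sub>R f z) \<in> borel_measurable (mu_hat \<mu>)" and f0: "\<And>z. z \<in> Q \<Longrightarrow> 0 \<le> f z"
  shows "(LINT z:Q|mu_hat \<mu>. f z) = enn2real (\<integral>\<^sup>+z. ennreal (f z) * indicator Q z \<partial>(lborel \<Otimes>\<^sub>M \<mu>))"
proof -
  have "(LINT z:Q|mu_hat \<mu>. f z) = enn2real (\<integral>\<^sup>+z. ennreal (indicator Q z *\<^sub>R f z) \<partial>mu_hat \<mu>)"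
    unfolding set_lebesgue_integral_def by (rule integral_eq_nn_integral[OF f]) (use f0 in \<open>auto simp: indicator_def\<close>)
  also have "(\<integral>\<^sup>+z. ennreal (indicator Q z *\<^sub>R f z) \<partial>mu_hat \<mu>) = (\<integral>\<^sup>+z. ennreal (f z) * indicator Q z \<partial>mu_hat \<mu>)"
    by (intro nn_integral_cong) (auto simp: indicator_def)
  also have "\<dots> = (\<integral>\<^sup>+z. ennreal (f z) * indicator Q z \<partial>(lborel \<Otimes>\<^sub>M \<mu>))"
    unfolding mu_hat_def by (rule nn_integral_completion)
  finally show ?thesis .
qed

lemma cylinder_measure:
  assumes "a \<le> d"
  shows "emeasure (lborel \<Otimes>\<^sub>M \<mu>) ({a<..d} \<times> ball x0 r) = ennreal ((d - a) * measure \<mu> (ball x0 r))"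
    and "measure (mu_hat \<mu>) ({a<..d} \<times> ball x0 r) = (d - a) * measure \<mu> (ball x0 r)"
proof -
  have "emeasure (lborel \<Otimes>\<^sub>M \<mu>) ({a<..d} \<times> ball x0 r) = emeasure lborel {a<..d} * emeasure \<mu> (ball x0 r)"
    by (rule emeasure_pair_measure_Times) (auto simp: sets_mu)
  also have "\<dots> = ennreal (d - a) * ennreal (measure \<mu> (ball x0 r))"
    using assms emeasure_ball[of x0 r] by (simp add: emeasure_eq_ennreal_measure)
  also have "\<dots> = ennreal ((d - a) * measure \<mu> (ball x0 r))" using assms by (simp add: ennreal_mult)
  finally show e: "emeasure (lborel \<Otimes>\<^sub>M \<mu>) ({a<..d} \<times> ball x0 r) = ennreal ((d - a) * measure \<mu> (ball x0 r))" .
  have "measure (mu_hat \<mu>) ({a<..d} \<times> ball x0 r) = measure (lborel \<Otimes>\<^sub>M \<mu>) ({a<..d} \<times> ball x0 r)"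
    unfolding mu_hat_def by (rule measure_completion) (auto simp: sets_mu intro!: pair_measureI)
  then show "measure (mu_hat \<mu>) ({a<..d} \<times> ball x0 r) = (d - a) * measure \<mu> (ball x0 r)"
    using e assms by (simp add: measure_def)
qed

text \<open>Within the ball where \<psi> = 1, u and the joint version of its truncation have the same values
  almost everywhere.\<close>

lemma average_u_eq:
  assumes r: "r \<le> 11 * R / 20" and t: "t1 \<le> a" "d \<le> t2" and q: "0 < q"
  shows "average (mu_hat \<mu>) ({a<..d} \<times> ball x0 r) (\<lambda>(t, x). u t x powr q)
    = enn2real (\<integral>\<^sup>+z. ennreal (trunc_joint z powr q) * indicator ({a<..d} \<times> ball x0 r) z \<partial>(lborel \<Otimes>\<^sub>M \<mu>)) /
      measure (mu_hat \<mu>) ({a<..d} \<times> ball x0 r)"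
proof -
  let ?Q = "{a<..d} \<times> ball x0 r"
  have Qs: "?Q \<in> sets (lborel \<Otimes>\<^sub>M \<mu>)" by (auto simp: sets_mu intro!: pair_measureI)
  let ?O = "{t1<..t2} \<times> (UNIV :: 'a set)"
  have "?O \<in> sets (lborel \<Otimes>\<^sub>M \<mu>)" by (intro pair_measureI) (auto simp: sets_mu)
  then have O: "?O \<inter> space (mu_hat \<mu>) \<in> sets (mu_hat \<mu>)"
    unfolding mu_hat_def by (auto simp: space_pair_measure)
  have "(\<lambda>(t, x). u t x) \<in> borel_measurable (restrict_space (mu_hat \<mu>) ?O)"
    using sc by (simp add: supercaloric_def)
  then have um: "(\<lambda>z. indicator ?O z *\<^sub>R (case z of (t, x) \<Rightarrow> u t x)) \<in> borel_measurable (mu_hat \<mu>)"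
    using borel_measurable_restrict_space_iff[OF O] by blast
  have Qm: "indicat_real ?Q \<in> borel_measurable (mu_hat \<mu>)"
    using Qs by (intro borel_measurable_indicator) (simp add: mu_hat_def)
  have m: "(\<lambda>z. indicator ?Q z *\<^sub>R (case z of (t, x) \<Rightarrow> u t x powr q)) \<in> borel_measurable (mu_hat \<mu>)"
  proof -
    have "(\<lambda>z. indicator ?Q z *\<^sub>R (indicator ?O z *\<^sub>R (case z of (t, x) \<Rightarrow> u t x)) powr q)
      \<in> borel_measurable (mu_hat \<mu>)"
      by (intro borel_measurable_scaleR Qm powr_real_measurable um measurable_const) simp
    also have "(\<lambda>z. indicator ?Q z *\<^sub>R (indicator ?O z *\<^sub>R (case z of (t, x) \<Rightarrow> u t x)) powr q)
      = (\<lambda>z. indicator ?Q z *\<^sub>R (case z of (t, x) \<Rightarrow> u t x powr q))"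
      using t by (auto simp: fun_eq_iff indicator_def)
    finally show ?thesis .
  qed
  obtain g where g[measurable]: "g \<in> borel_measurable (lborel \<Otimes>\<^sub>M \<mu>)"
    and ae: "AE z in lborel \<Otimes>\<^sub>M \<mu>. indicator ?Q z *\<^sub>R (case z of (t, x) \<Rightarrow> u t x powr q) = g z"
    using completion_ex_borel_measurable_real m unfolding mu_hat_def by blast
  have [measurable]: "?Q \<in> sets (lborel \<Otimes>\<^sub>M \<mu>)" by (rule Qs)
  have "AE z in lborel \<Otimes>\<^sub>M \<mu>. g z = indicator ?Q z *\<^sub>R (trunc_joint z powr q)"
  proof (rule lm.AE_pair_measure)
    show "{z \<in> space (lborel \<Otimes>\<^sub>M \<mu>). g z = indicator ?Q z *\<^sub>R (trunc_joint z powr q)} \<in> sets (lborel \<Otimes>\<^sub>M \<mu>)"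
      by measurable
    show "AE s in lborel. AE x in \<mu>. g (s, x) = indicator ?Q (s, x) *\<^sub>R (trunc_joint (s, x) powr q)"
      using lm.AE_pair[OF ae] trunc_joint_AE
    proof eventually_elim
      case (elim s)
      show ?case
      proof (cases "s \<in> {a<..d}")
        case True
        then have s: "s \<in> {t1<..t2}" using t by auto
        from elim(2) s have "AE x in \<mu>. trunc_joint (s, x) = trunc s x" by blast
        with elim(1) trunc_eq_u(1)[OF s] show ?thesis
        proof eventually_elim
          case (elim x)
          have "ball x0 r \<subseteq> ball x0 (11 * R / 20)" using r by auto
          then show ?case using elim by (auto simp: indicator_def)
        qed
      next
        case False
        from elim(1) show ?thesis by eventually_elim (use False in auto)
      qed
    qed
  qed
  with ae have ae': "AE z in lborel \<Otimes>\<^sub>M \<mu>. indicator ?Q z *\<^sub>R (case z of (t, x) \<Rightarrow> u t x powr q)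
    = indicator ?Q z *\<^sub>R (trunc_joint z powr q)"
    by eventually_elim simp
  have "(LINT z:?Q|mu_hat \<mu>. (case z of (t, x) \<Rightarrow> u t x powr q))
    = enn2real (\<integral>\<^sup>+z. ennreal (case z of (t, x) \<Rightarrow> u t x powr q) * indicator ?Q z \<partial>(lborel \<Otimes>\<^sub>M \<mu>))"
    by (rule set_integral_mu_hat[OF m]) auto
  also have "(\<integral>\<^sup>+z. ennreal (case z of (t, x) \<Rightarrow> u t x powr q) * indicator ?Q z \<partial>(lborel \<Otimes>\<^sub>M \<mu>))
    = (\<integral>\<^sup>+z. ennreal (trunc_joint z powr q) * indicator ?Q z \<partial>(lborel \<Otimes>\<^sub>M \<mu>))"
    by (rule nn_integral_cong_AE) (use ae' in eventually_elim, auto simp: indicator_def)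
  finally show ?thesis unfolding average_def by simp
qed

lemma steklov_average_ge:
  assumes q: "0 < q" "q < 1" and h: "0 < h" and e: "0 < e" and ab: "t1 + h \<le> a" "c + h \<le> d" "d \<le> t2" "a < d"
  shows "enn2real (\<integral>\<^sup>+z. ennreal (trunc_joint z powr q) * indicator ({a<..c} \<times> ball x0 r) z \<partial>(lborel \<Otimes>\<^sub>M \<mu>)) /
    ((d - a) * measure \<mu> (ball x0 r))
     \<le> average (mu_hat \<mu>) ({a<..d} \<times> ball x0 r) (\<lambda>(t, x). steklov h e t x powr q)"
proof -
  let ?Q = "{a<..d} \<times> ball x0 r"
  have Qs: "?Q \<in> sets (lborel \<Otimes>\<^sub>M \<mu>)" by (auto simp: sets_mu intro!: pair_measureI)
  have Qm: "indicat_real ?Q \<in> borel_measurable (mu_hat \<mu>)"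
    using Qs by (intro borel_measurable_indicator) (simp add: mu_hat_def)
  have vm: "(\<lambda>z. indicator ({t1 + h<..t2} \<times> UNIV) z *\<^sub>R (case z of (t, x) \<Rightarrow> steklov h e t x))
    \<in> borel_measurable (mu_hat \<mu>)"
    unfolding mu_hat_def by (rule measurable_completion[OF steklov_joint_measurable[OF h]])
  have m: "(\<lambda>z. indicator ?Q z *\<^sub>R (case z of (t, x) \<Rightarrow> steklov h e t x powr q)) \<in> borel_measurable (mu_hat \<mu>)"
  proof -
    have "(\<lambda>z. indicator ?Q z *\<^sub>R (indicator ({t1 + h<..t2} \<times> UNIV) z *\<^sub>R (case z of (t, x) \<Rightarrow> steklov h e t x))
      powr q) \<in> borel_measurable (mu_hat \<mu>)"
      by (intro borel_measurable_scaleR Qm powr_real_measurable vm measurable_const) simp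
    also have "(\<lambda>z. indicator ?Q z *\<^sub>R (indicator ({t1 + h<..t2} \<times> UNIV) z *\<^sub>R (case z of (t, x) \<Rightarrow> steklov h e t
      x)) powr q) = (\<lambda>z. indicator ?Q z *\<^sub>R (case z of (t, x) \<Rightarrow> steklov h e t x powr q))"
      using ab by (auto simp: fun_eq_iff indicator_def)
    finally show ?thesis .
  qed
  let ?N = "\<integral>\<^sup>+z. ennreal (case z of (t, x) \<Rightarrow> steklov h e t x powr q) * indicator ?Q z \<partial>(lborel \<Otimes>\<^sub>M \<mu>)"
  have "(LINT z:?Q|mu_hat \<mu>. (case z of (t, x) \<Rightarrow> steklov h e t x powr q)) = enn2real ?N"
    by (rule set_integral_mu_hat[OF m]) auto
  then have mov_avg: "average (mu_hat \<mu>) ?Q (\<lambda>(t, x). steklov h e t x powr q)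
    = enn2real ?N / ((d - a) * measure \<mu> (ball x0 r))"
    unfolding average_def using cylinder_measure(2)[of a d r] ab by simp
  have "?N \<le> (\<integral>\<^sup>+z. ennreal ((K + 2 * \<tau> + e) powr q) * indicator ?Q z \<partial>(lborel \<Otimes>\<^sub>M \<mu>))"
  proof (rule nn_integral_mono)
    fix z :: "real \<times> 'a"
    obtain t x where z: "z = (t, x)" by (cases z)
    show "ennreal (case z of (t, x) \<Rightarrow> steklov h e t x powr q) * indicator ?Q z
      \<le> ennreal ((K + 2 * \<tau> + e) powr q) * indicator ?Q z"
    proof (cases "z \<in> ?Q")
      case True
      then have t: "t1 + h < t" "t \<le> t2" using ab z by auto
      have "steklov h e t x powr q \<le> (K + 2 * \<tau> + e) powr q"
        using steklov_pos[OF h t e, of x] steklov_le[OF h t, of e x] q by (intro powr_mono2) auto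
      then show ?thesis using True z by (simp add: ennreal_leI)
    qed simp
  qed
  also have "\<dots> = ennreal ((K + 2 * \<tau> + e) powr q) * emeasure (lborel \<Otimes>\<^sub>M \<mu>) ?Q"
    by (rule nn_integral_cmult_indicator[OF Qs])
  also have "\<dots> < \<infinity>" using cylinder_measure(1)[of a d r] ab by (simp add: ennreal_mult_less_top)
  finally have fin: "?N < \<infinity>" .
  have "enn2real (\<integral>\<^sup>+z. ennreal (trunc_joint z powr q) * indicator ({a<..c} \<times> ball x0 r) z \<partial>(lborel \<Otimes>\<^sub>M \<mu>))
    \<le> enn2real ?N"
    using fin by (intro enn2real_mono average_powr_cylinder q h e ab) auto
  then show ?thesis unfolding mov_avg using ab by (intro divide_right_mono) auto
qed

end

section \<open>Removing the average\<close>

context supersolution_in_time begin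

lemma u_einf_nonneg:
  assumes "t1 \<le> a" "r \<le> R"
  shows "0 \<le> einf_cyl \<mu> a t2 (ball x0 r) u"
  unfolding einf_cyl_def
proof (rule INF_greatest)
  fix t assume "t \<in> {a<..t2}"
  then have t: "t \<in> {t1<..t2}" using assms by auto
  have "ereal 0 \<le> essinf_on \<mu> (ball x0 r) (u t)"
  proof (rule essinf_ge[OF u_borel[OF t]])
    show "AE x in \<mu>. x \<in> ball x0 r \<longrightarrow> 0 \<le> u t x" using u_range[OF t] by eventually_elim (use assms in auto)
  qed simp
  then show "0 \<le> essinf_on \<mu> (ball x0 r) (u t)" by (simp add: zero_ereal_def)
qed

text \<open>If u(t) lies below a level on a set of positive measure, then so does the mean of the
  average over this set, up to the compensator: integrals of u over the set are continuous in
  time.\<close>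

lemma einf_average_le:
  assumes h: "\<And>n. 0 < h n" "h \<longlonglongrightarrow> 0" and e: "\<And>n. 0 < e n" "e \<longlonglongrightarrow> 0"
    and a: "\<And>n. t1 + h n \<le> a n" "a \<longlonglongrightarrow> a0" "t1 \<le> a0"
    and r: "incseq r" "r \<longlonglongrightarrow> r0" "r0 \<le> R / 2"
    and c: "einf_cyl \<mu> a0 t2 (ball x0 r0) u + ereal (2 * \<tau>) < ereal c"
  shows "eventually (\<lambda>n. einf_cyl \<mu> (a n) t2 (ball x0 (r n)) (steklov (h n) (e n)) \<le> ereal c) sequentially"
proof -
  have "einf_cyl \<mu> a0 t2 (ball x0 r0) u < ereal (c - 2 * \<tau>)"
    using c by (cases "einf_cyl \<mu> a0 t2 (ball x0 r0) u") auto
  then obtain t where t: "t \<in> {a0<..t2}" and "essinf_on \<mu> (ball x0 r0) (u t) < ereal (c - 2 * \<tau>)"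
    unfolding einf_cyl_def INF_less_iff by blast
  then obtain d where d: "essinf_on \<mu> (ball x0 r0) (u t) < ereal d" "d < c - 2 * \<tau>"
    using ereal_dense2 by (metis ereal_less(3) less_ereal.simps(1))
  have tt: "t \<in> {t1<..t2}" using t a by auto
  note [measurable] = u_borel[OF tt]
  define D where "D = {x. u t x < d}"
  have Ds[measurable]: "D \<in> sets borel" unfolding D_def by measurable
  have rle: "r n \<le> r0" for n using r by (meson incseq_le)
  have un: "(\<Union>n. D \<inter> ball x0 (r n)) = D \<inter> ball x0 r0"
  proof (intro equalityI subsetI)
    fix x assume x: "x \<in> D \<inter> ball x0 r0"
    then have "eventually (\<lambda>n. dist x0 x < r n) sequentially" using r(2) by (intro order_tendstoD(1)) auto
    then show "x \<in> (\<Union>n. D \<inter> ball x0 (r n))" using x by (auto simp: eventually_sequentially)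
  next
    fix x assume "x \<in> (\<Union>n. D \<inter> ball x0 (r n))"
    then obtain n where "x \<in> D" "dist x0 x < r n" by auto
    then show "x \<in> D \<inter> ball x0 r0" using rle[of n] by simp
  qed
  have pos: "emeasure \<mu> (D \<inter> ball x0 r0) \<noteq> 0"
  proof
    assume "emeasure \<mu> (D \<inter> ball x0 r0) = 0"
    then have "D \<inter> ball x0 r0 \<in> null_sets \<mu>" using Ds by (auto simp: null_sets_def sets_mu)
    then have "AE x in \<mu>. x \<notin> D \<inter> ball x0 r0" by (rule AE_not_in)
    then have "AE x in \<mu>. x \<in> ball x0 r0 \<longrightarrow> d \<le> u t x" by eventually_elim (auto simp: D_def)
    from essinf_ge[OF u_borel[OF tt] _ this] d(1) show False by (simp add: not_less[symmetric])
  qed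
  have "\<exists>k. emeasure \<mu> (D \<inter> ball x0 (r k)) \<noteq> 0"
  proof (rule ccontr)
    assume "\<not> ?thesis"
    then have "D \<inter> ball x0 (r k) \<in> null_sets \<mu>" for k using Ds by (auto simp: null_sets_def sets_mu)
    then have "(\<Union>n. D \<inter> ball x0 (r n)) \<in> null_sets \<mu>" by (intro null_sets_UN) auto
    then show False using pos unfolding un by auto
  qed
  then obtain k where k: "emeasure \<mu> (D \<inter> ball x0 (r k)) \<noteq> 0" by blast
  define P where "P = D \<inter> ball x0 (r k)"
  have [measurable]: "P \<in> sets borel" unfolding P_def by measurable
  have PB2: "P \<subseteq> B2" using rle[of k] r(3) by (auto simp: P_def)
  have PB: "P \<subseteq> B" using PB2 R by auto
  have Pfin: "emeasure \<mu> P < \<infinity>"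
  proof -
    have "emeasure \<mu> P \<le> emeasure \<mu> B" using PB by (intro emeasure_mono) (auto simp: sets_mu)
    then show ?thesis using emeasure_ball[of x0 R] by (rule le_less_trans)
  qed
  define M where "M = measure \<mu> P"
  have M: "M > 0" using k Pfin unfolding M_def P_def
    by (simp add: measure_def enn2real_positive_iff less_top zero_less_iff_neq_zero)
  have iP: "integrable \<mu> (indicat_real P)" using Pfin by (intro integrable_real_indicator) (auto simp: sets_mu)
  let ?p = "indicat_real P"
  have pL: "?p \<in> L2 \<mu> B2" by (rule L2_of_bounded[OF sets_mu _ _ emeasure_ball, where K=1]) (auto simp: indicator_def)
  have "indicator B2 x * ?p x = ?p x" for x using PB2 by (cases "x \<in> P") auto
  then have p1: "(\<lambda>x. indicator B2 x * ?p x) = ?p" by blast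
  have kap: "(LINT x:B2|\<mu>. ?p x) = M"
    unfolding set_lebesgue_integral_def M_def using p1 by (simp add: sets_mu)
  have pB: "?p \<in> L2 \<mu> B" by (rule L2_of_bounded[OF sets_mu _ _ emeasure_ball, where K=1]) (auto simp: indicator_def)
  define f where "f = I ?p"
  have fc: "continuous_on {t1<..t2} f" unfolding f_def by (rule I_continuous[OF pB])
  have ft: "f t \<le> d * M"
  proof -
    have "f t = (LINT x|\<mu>. indicator B x *\<^sub>R (u t x * ?p x))" by (simp add: f_def I_alt set_lebesgue_integral_def)
    also have "\<dots> \<le> (LINT x|\<mu>. d * ?p x)"
    proof (rule integral_mono)
      show "integrable \<mu> (\<lambda>x. indicator B x *\<^sub>R (u t x * ?p x))"
        using L2_prod_integrable[OF sets_mu _ u_L2[OF tt] pB] by (simp add: set_integrable_def)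
      show "integrable \<mu> (\<lambda>x. d * ?p x)" by (intro integrable_mult_right iP)
      show "indicator B x *\<^sub>R (u t x * ?p x) \<le> d * ?p x" for x
        using PB by (auto simp: indicator_def P_def D_def)
    qed
    also have "\<dots> = d * M" by (simp add: M_def sets_mu)
    finally show ?thesis .
  qed
  define \<eta> where "\<eta> = (c - 2 * \<tau> - d) / 3"
  have \<eta>: "\<eta> > 0" using d(2) by (simp add: \<eta>_def)
  have "\<exists>\<delta>>0. \<forall>s\<in>{t1<..t2}. dist s t < \<delta> \<longrightarrow> dist (f s) (f t) < \<eta> * M"
    using fc tt \<eta> M unfolding continuous_on_iff by (metis mult_pos_pos)
  then obtain \<delta> where \<delta>: "\<delta> > 0" "\<And>s. s \<in> {t1<..t2} \<Longrightarrow> dist s t < \<delta> \<Longrightarrow> dist (f s) (f t) < \<eta> * M" by blast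
  have "eventually (\<lambda>n. h n < \<delta>) sequentially" using h(2) \<delta>(1) by (rule order_tendstoD(2))
  moreover have "eventually (\<lambda>n. e n < \<eta>) sequentially" using e(2) \<eta> by (rule order_tendstoD(2))
  moreover have "eventually (\<lambda>n. a n < t) sequentially" using a(2) t by (intro order_tendstoD(2)) auto
  moreover have "eventually (\<lambda>n. n \<ge> k) sequentially" by (rule eventually_ge_at_top)
  ultimately show ?thesis
  proof eventually_elim
    case (elim n)
    show ?case
    proof (rule ccontr)
      assume "\<not> ?case"
      then have gt: "ereal c < einf_cyl \<mu> (a n) t2 (ball x0 (r n)) (steklov (h n) (e n))" by simp
      have t': "t1 + h n < t" "t \<le> t2" using elim(3) a(1)[of n] t by auto
      have "einf_cyl \<mu> (a n) t2 (ball x0 (r n)) (steklov (h n) (e n))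
        \<le> essinf_on \<mu> (ball x0 (r n)) (steklov (h n) (e n) t)"
        unfolding einf_cyl_def by (rule INF_lower) (use elim t in auto)
      with gt have gt': "ereal c \<le> essinf_on \<mu> (ball x0 (r n)) (steklov (h n) (e n) t)" by simp
      have "r k \<le> r n" using r(1) elim(4) by (auto simp: incseq_def)
      then have Pn: "P \<subseteq> ball x0 (r n)" by (auto simp: P_def)
      have vc: "AE x in \<mu>. x \<in> P \<longrightarrow> c \<le> steklov (h n) (e n) t x"
        using essinf_AE[of "ball x0 (r n)" "steklov (h n) (e n) t", OF borel_open[OF open_ball]]
      proof eventually_elim
        case (elim x)
        show ?case
        proof
          assume "x \<in> P"
          then have "ereal c \<le> ereal (steklov (h n) (e n) t x)" using elim gt' Pn by (meson order_trans subsetD)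
          then show "c \<le> steklov (h n) (e n) t x" by simp
        qed
      qed
      have vb[measurable]: "steklov (h n) (e n) t \<in> borel_measurable borel" unfolding steklov_def[abs_def]
        by measurable
      have "c * M = (LINT x|\<mu>. c * ?p x)" by (simp add: M_def sets_mu)
      also have "\<dots> \<le> (LINT x|\<mu>. indicator B2 x *\<^sub>R (steklov (h n) (e n) t x * ?p x))"
      proof (rule integral_mono_AE)
        show "integrable \<mu> (\<lambda>x. c * ?p x)" by (intro integrable_mult_right iP)
        have "steklov (h n) (e n) t \<in> L2 \<mu> B2"
        proof (rule L2_of_bounded[OF sets_mu _ vb emeasure_ball, where K="K + 2 * \<tau> + e n"])
          show "AE x in \<mu>. x \<in> B2 \<longrightarrow> \<bar>steklov (h n) (e n) t x\<bar> \<le> K + 2 * \<tau> + e n"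
            using steklov_le[OF h(1) t', of "e n"] steklov_pos[OF h(1) t' e(1)]
              by (intro AE_I2) (simp add: abs_of_pos)
        qed simp
        from L2_prod_integrable[OF sets_mu _ this pL]
        show "integrable \<mu> (\<lambda>x. indicator B2 x *\<^sub>R (steklov (h n) (e n) t x * ?p x))"
          by (simp add: set_integrable_def)
        show "AE x in \<mu>. c * ?p x \<le> indicator B2 x *\<^sub>R (steklov (h n) (e n) t x * ?p x)"
          using vc by eventually_elim (use PB2 in \<open>auto simp: indicator_def\<close>)
      qed
      also have "\<dots> = pairing \<mu> B2 (steklov (h n) (e n)) ?p t" by (simp add: pairing_def set_lebesgue_integral_def)
      also have "\<dots> = mov_avg f (h n) t + (mov_avg compensator (h n) t + e n) * M"
        using steklov_pairing(1)[OF pL h(1) t', of "e n"] unfolding p1 kap f_def .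
      also have "\<dots> \<le> (d * M + \<eta> * M) + (2 * \<tau> + \<eta>) * M"
      proof (intro add_mono mult_right_mono)
        show "mov_avg f (h n) t \<le> d * M + \<eta> * M"
        proof -
          have i: "f integrable_on {t - h n..t}"
            by (rule integrable_continuous_real[OF continuous_on_subset[OF fc]]) (use t' in auto)
          have "integral {t - h n..t} f \<le> integral {t - h n..t} (\<lambda>s. d * M + \<eta> * M)"
          proof (rule integral_le[OF i])
            fix s assume s: "s \<in> {t - h n..t}"
            then have "dist s t < \<delta>" using elim(1) by (auto simp: dist_real_def)
            moreover have "s \<in> {t1<..t2}" using s t' by auto
            ultimately have "dist (f s) (f t) < \<eta> * M" using \<delta>(2) by blast
            then show "f s \<le> d * M + \<eta> * M" using ft by (simp add: dist_real_def abs_less_iff)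
          qed auto
          also have "\<dots> = h n * (d * M + \<eta> * M)" using h(1)[of n] by simp
          finally show ?thesis unfolding mov_avg_def using h(1)[of n] by (simp add: divide_le_eq mult.commute)
        qed
        show "mov_avg compensator (h n) t \<le> 2 * \<tau>" by (rule mov_avg_compensator(2)[OF h(1) t'])
        show "e n \<le> \<eta>" using elim by simp
      qed (use M in simp)
      also have "\<dots> = (d + 2 * \<tau> + 2 * \<eta>) * M" by (simp add: algebra_simps)
      also have "\<dots> < c * M" using M d(2) by (intro mult_strict_right_mono) (simp_all add: \<eta>_def field_simps)
      finally show False by simp
    qed
  qed
qed

text \<open>With time step \<delta> (T - Ts n) the averages needed in the n-th inequality do not reach back
  beyond t1. Its left-hand side dominates the integral of u^q over sets that increase to the full
  cylinder, so that monotone convergence applies; the infima are handled by \<open>einf_average_le\<close>.\<close>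

lemma harnack_limit:
  assumes q: "0 < q" "q < 1" and C: "0 < C" and \<delta>: "0 < \<delta>"
    and T: "t1 = t2 - 4 * \<delta> * T" "incseq Ts" "\<And>n. 0 < Ts n" "\<And>n. Ts n < T" "Ts \<longlonglongrightarrow> T"
    and r: "incseq r" "\<And>n. 0 < r n" "r \<longlonglongrightarrow> r0" "r0 \<le> R / 2"
    and e: "\<And>n. 0 < e n" "e \<longlonglongrightarrow> 0"
    and H: "\<And>n. ereal ((average (mu_hat \<mu>) ({t2 - 3 * \<delta> * Ts n<..t2 - 2 * \<delta> * Ts n} \<times> ball x0 (r n))
               (\<lambda>(t, x). steklov (\<delta> * (T - Ts n)) (e n) t x powr q)) powr (1 / q))
         \<le> ereal C * einf_cyl \<mu> (t2 - \<delta> * Ts n) t2 (ball x0 (r n)) (steklov (\<delta> * (T - Ts n)) (e n))"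
  shows "ereal ((average (mu_hat \<mu>) ({t2 - 3 * \<delta> * T<..t2 - 2 * \<delta> * T} \<times> ball x0 r0) (\<lambda>(t, x). u t x powr q))
    powr (1 / q))
     \<le> ereal C * (einf_cyl \<mu> (t2 - \<delta> * T) t2 (ball x0 r0) u + ereal (2 * \<tau>))"
proof -
  define h where "h n = \<delta> * (T - Ts n)" for n
  have h: "0 < h n" for n using \<delta> T(4)[of n] by (simp add: h_def)
  have Tpos: "0 < T" using T(3,4)[of 0] by simp
  have dT: "0 < \<delta> * T" using \<delta> Tpos by simp
  have "(\<lambda>n. \<delta> * (T - Ts n)) \<longlonglongrightarrow> \<delta> * (T - T)" by (intro tendsto_intros T)
  then have h0: "h \<longlonglongrightarrow> 0" unfolding h_def by simp
  have dTs: "\<delta> * Ts n < \<delta> * T" "0 < \<delta> * Ts n" for n using \<delta> T(3,4)[of n] by auto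
  have hT: "h n = \<delta> * T - \<delta> * Ts n" for n by (simp add: h_def right_diff_distrib)
  have r0: "0 < r0" "r n \<le> r0" for n
  proof -
    show "r n \<le> r0" for n using r(1,3) by (rule incseq_le)
    then show "0 < r0" using r(2) less_le_trans by blast
  qed
  have rR: "r0 \<le> 11 * R / 20" using r(4) R by simp
  define Q where "Q = {t2 - 3 * \<delta> * T<..t2 - 2 * \<delta> * T} \<times> ball x0 r0"
  define En where "En n = {t2 - 3 * \<delta> * Ts n<..t2 - 2 * \<delta> * T} \<times> ball x0 (r n)" for n
  define N where "N = density (lborel \<Otimes>\<^sub>M \<mu>) (\<lambda>z. ennreal (trunc_joint z powr q))"
  have Ns: "emeasure N X = (\<integral>\<^sup>+z. ennreal (trunc_joint z powr q) * indicator X z \<partial>(lborel \<Otimes>\<^sub>M \<mu>))"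
    if X: "X \<in> sets (lborel \<Otimes>\<^sub>M \<mu>)" for X
    unfolding N_def by (rule emeasure_density[OF _ X]) measurable
  have cyl: "{c<..d} \<times> ball x0 s \<in> sets (lborel \<Otimes>\<^sub>M \<mu>)" for c d s :: real
    by (auto simp: sets_mu intro!: pair_measureI)
  define mQ where "mQ = (\<delta> * T) * measure \<mu> (ball x0 r0)"
  have ballpos: "s > 0 \<Longrightarrow> measure \<mu> (ball x0 s) > 0" for s
    using emeasure_ball_pos[of s x0] emeasure_ball[of x0 s] by (simp add: measure_def enn2real_positive_iff)
  have mQ: "mQ > 0" unfolding mQ_def by (rule mult_pos_pos[OF dT ballpos[OF r0(1)]])
  have Qle: "t2 - 3 * \<delta> * T \<le> t2 - 2 * \<delta> * T" using less_imp_le[OF dT] by (simp add: algebra_simps)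
  have avu: "average (mu_hat \<mu>) Q (\<lambda>(t, x). u t x powr q) = enn2real (emeasure N Q) / mQ"
  proof -
    have "t1 \<le> t2 - 3 * \<delta> * T" "t2 - 2 * \<delta> * T \<le> t2" using T(1) less_imp_le[OF dT] by (simp_all add: algebra_simps)
    from average_u_eq[OF rR this q(1)] show ?thesis
      unfolding Q_def Ns[OF cyl] cylinder_measure(2)[OF Qle] mQ_def by simp
  qed
  have Nfin: "emeasure N Q < \<infinity>"
  proof -
    have "emeasure N Q \<le> (\<integral>\<^sup>+z. ennreal (K powr q) * indicator Q z \<partial>(lborel \<Otimes>\<^sub>M \<mu>))"
      unfolding Q_def Ns[OF cyl]
    proof (intro nn_integral_mono mult_right_mono ennreal_leI)
      show "trunc_joint z powr q \<le> K powr q" for z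
        using trunc_joint_nonneg[of z] trunc_joint_le_K[of "fst z" "snd z"] q by (intro powr_mono2) auto
    qed auto
    also have "\<dots> = ennreal (K powr q) * emeasure (lborel \<Otimes>\<^sub>M \<mu>) Q" unfolding Q_def
      by (rule nn_integral_cmult_indicator[OF cyl])
    also have "\<dots> < \<infinity>" unfolding Q_def using cylinder_measure(1)[OF Qle] by (simp add: ennreal_mult_less_top)
    finally show ?thesis .
  qed
  have Elim: "(\<lambda>n. enn2real (emeasure N (En n))) \<longlonglongrightarrow> enn2real (emeasure N Q)"
  proof -
    have un: "(\<Union>n. En n) = Q"
    proof (intro equalityI subsetI)
      fix z assume "z \<in> (\<Union>n. En n)"
      then obtain n where n: "z \<in> En n" by blast
      have "\<delta> * Ts n < \<delta> * T" by (rule dTs)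
      then show "z \<in> Q" using n r0(2)[of n] by (auto simp: En_def Q_def)
    next
      fix z assume z: "z \<in> Q"
      have "(\<lambda>n. t2 - 3 * \<delta> * Ts n) \<longlonglongrightarrow> t2 - 3 * \<delta> * T" by (intro tendsto_intros T)
      then have "eventually (\<lambda>n. t2 - 3 * \<delta> * Ts n < fst z) sequentially" using z
        by (intro order_tendstoD(2)) (auto simp: Q_def)
      moreover have "eventually (\<lambda>n. dist x0 (snd z) < r n) sequentially" using z r(3)
        by (intro order_tendstoD(1)) (auto simp: Q_def)
      ultimately have "eventually (\<lambda>n. z \<in> En n) sequentially"
        by eventually_elim (use z in \<open>cases z, auto simp: En_def Q_def\<close>)
      then show "z \<in> (\<Union>n. En n)" by (auto simp: eventually_sequentially)
    qed
    have inc: "incseq En"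
    proof (rule incseq_SucI)
      fix n
      have "Ts n \<le> Ts (Suc n)" "r n \<le> r (Suc n)" using T(2) r(1) by (auto simp: incseq_Suc_iff)
      moreover from this have "3 * \<delta> * Ts n \<le> 3 * \<delta> * Ts (Suc n)" using \<delta> by simp
      ultimately show "En n \<subseteq> En (Suc n)" unfolding En_def by auto
    qed
    have sN: "range En \<subseteq> sets N" unfolding N_def En_def using cyl by auto
    have "(\<lambda>n. emeasure N (En n)) \<longlonglongrightarrow> emeasure N (\<Union>n. En n)" by (rule Lim_emeasure_incseq[OF sN inc])
    then show ?thesis unfolding un using Nfin by (intro tendsto_enn2real) auto
  qed
  have low: "enn2real (emeasure N (En n)) / mQ
      \<le> average (mu_hat \<mu>) ({t2 - 3 * \<delta> * Ts n<..t2 - 2 * \<delta> * Ts n} \<times> ball x0 (r n)) (\<lambda>(t, x). steklov (h n)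
        (e n) t x powr q)" for n
  proof -
    let ?a = "t2 - 3 * \<delta> * Ts n" and ?d = "t2 - 2 * \<delta> * Ts n"
    have "enn2real (emeasure N (En n)) / mQ \<le> enn2real (emeasure N (En n)) / ((?d - ?a) * measure \<mu> (ball x0 (r n)))"
    proof (rule divide_left_mono)
      have "(?d - ?a) = \<delta> * Ts n" by simp
      moreover have "measure \<mu> (ball x0 (r n)) \<le> measure \<mu> (ball x0 r0)"
        using r0(2)[of n] emeasure_ball[of x0 r0]
          by (intro measure_mono_fmeasurable) (auto simp: fmeasurable_def sets_mu)
      ultimately show "(?d - ?a) * measure \<mu> (ball x0 (r n)) \<le> mQ"
        unfolding mQ_def using dTs[of n] by (simp add: mult_mono)
      show "0 < mQ * ((?d - ?a) * measure \<mu> (ball x0 (r n)))"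
        using mQ dTs(2)[of n] ballpos[OF r(2), of n] by simp
    qed simp
    also have "\<dots> \<le> average (mu_hat \<mu>) ({?a<..?d} \<times> ball x0 (r n)) (\<lambda>(t, x). steklov (h n) (e n) t x powr q)"
      unfolding En_def Ns[OF cyl]
      by (rule steklov_average_ge[OF q h e(1)]) (use T(1) dTs[of n] hT[of n] in \<open>simp_all add: algebra_simps\<close>)
    finally show ?thesis .
  qed
  let ?L = "(enn2real (emeasure N Q) / mQ) powr (1 / q)"
  let ?X = "einf_cyl \<mu> (t2 - \<delta> * T) t2 (ball x0 r0) u"
  have key: "?L \<le> C * c" if c: "?X + ereal (2 * \<tau>) < ereal c" for c
  proof (rule tendsto_upperbound)
    show "(\<lambda>n. (enn2real (emeasure N (En n)) / mQ) powr (1 / q)) \<longlonglongrightarrow> ?L"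
      using mQ q by (intro tendsto_powr' tendsto_divide tendsto_const Elim) (auto intro!: always_eventually
        divide_nonneg_pos)
    have "eventually (\<lambda>n. einf_cyl \<mu> (t2 - \<delta> * Ts n) t2 (ball x0 (r n)) (steklov (h n) (e n)) \<le> ereal c) sequentially"
    proof (rule einf_average_le[OF h h0 e _ _ _ r(1,3,4) c])
      show "t1 + h n \<le> t2 - \<delta> * Ts n" for n using T(1) dTs[of n] hT[of n] by (simp add: algebra_simps)
      show "(\<lambda>n. t2 - \<delta> * Ts n) \<longlonglongrightarrow> t2 - \<delta> * T" by (intro tendsto_intros T)
      show "t1 \<le> t2 - \<delta> * T" using T(1) dT by (simp add: algebra_simps)
    qed
    then show "eventually (\<lambda>n. (enn2real (emeasure N (En n)) / mQ) powr (1 / q) \<le> C * c) sequentially"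
    proof eventually_elim
      case (elim n)
      have "(enn2real (emeasure N (En n)) / mQ) powr (1 / q)
         \<le> (average (mu_hat \<mu>) ({t2 - 3 * \<delta> * Ts n<..t2 - 2 * \<delta> * Ts n} \<times> ball x0 (r n)) (\<lambda>(t, x). steklov (h n)
           (e n) t x powr q)) powr (1 / q)"
        using mQ q by (intro powr_mono2 low) auto
      then have "ereal ((enn2real (emeasure N (En n)) / mQ) powr (1 / q))
         \<le> ereal C * einf_cyl \<mu> (t2 - \<delta> * Ts n) t2 (ball x0 (r n)) (steklov (h n) (e n))"
        using H[of n] unfolding h_def[symmetric] by (meson ereal_less_eq(3) order_trans)
      also have "\<dots> \<le> ereal C * ereal c" using C elim by (intro ereal_mult_left_mono) auto
      finally show ?case by simp
    qed
  qed simp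
  have X0: "0 \<le> ?X" by (rule u_einf_nonneg) (use T(1) dT r(4) R in \<open>simp_all add: algebra_simps\<close>)
  show ?thesis
  proof (cases ?X)
    case (real X)
    have "?L \<le> C * (X + 2 * \<tau>)"
    proof (rule field_le_epsilon)
      fix \<epsilon> :: real assume \<epsilon>: "\<epsilon> > 0"
      have "?L \<le> C * (X + 2 * \<tau> + \<epsilon> / C)" using \<epsilon> C real by (intro key) auto
      also have "\<dots> = C * (X + 2 * \<tau>) + \<epsilon>" using C by (simp add: distrib_left)
      finally show "?L \<le> C * (X + 2 * \<tau>) + \<epsilon>" .
    qed
    then show ?thesis using real avu unfolding Q_def by simp
  next
    case PInf
    then show ?thesis using C by simp
  next
    case MInf
    then show ?thesis using X0 by simp
  qed
qed

end

section \<open>The equivalence\<close>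

lemma wPH_imp_wPH0: "wPH \<mu> F E EL j J W q \<Longrightarrow> wPH0 \<mu> F E EL j J W q"
  unfolding wPH_def wPH0_def by blast

lemma tail_of_nonneg:
  assumes "\<And>t x. t \<in> {a<..b} \<Longrightarrow> 0 \<le> u t x"
  shows "tail \<mu> J lam a b x0 R (neg_part u) = 0"
proof -
  have "esssup (restrict_space \<mu> (ball x0 (lam * R))) (\<lambda>z. \<integral>\<^sup>+y\<in>- ball x0 R. ennreal \<bar>neg_part u s y\<bar> \<partial>J z) = 0"
    if "s \<in> {a<..b}" for s
  proof -
    have "(\<integral>\<^sup>+y\<in>- ball x0 R. ennreal \<bar>neg_part u s y\<bar> \<partial>J z) = 0" for z
      using assms[OF that] by (simp add: neg_part_def max_def)
    then have "esssup (restrict_space \<mu> (ball x0 (lam * R))) (\<lambda>z. \<integral>\<^sup>+y\<in>- ball x0 R. ennreal \<bar>neg_part u s y\<bar> \<partial>J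
      z) \<le> 0"
      by (intro esssup_I) auto
    then show ?thesis by simp
  qed
  then have "tail \<mu> J lam a b x0 R (neg_part u) = (\<integral>\<^sup>+s. 0 \<partial>(lebesgue :: real measure))"
    unfolding tail_def by (intro nn_integral_cong) (auto simp: indicator_def)
  then show ?thesis by simp
qed

text \<open>The scale enters only through the centre and the product of parameter and radius, so it is
  the same for radius R/2 with parameter 2 \<lambda>' and for radius R with parameter \<lambda>'. If the tail of
  u is infinite there is nothing to prove.\<close>

lemma (in jump_diffusion) wPH0_imp_wPH:
  assumes W: "scale_function W" and q: "0 < q" "q < 1" and w: "wPH0 \<mu> F E EL j J W q"
  shows "wPH \<mu> F E EL j J W q"
proof -
  obtain \<delta> C lam0 where \<delta>: "0 < \<delta>" and C: "1 < C" and lam0: "0 < lam0" "lam0 < 1"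
    and H: "\<And>x0 R lam t0 u. 0 < R \<Longrightarrow> ereal R < Rbar \<mu> \<Longrightarrow> 0 < lam \<Longrightarrow> lam \<le> lam0 \<Longrightarrow>
           nonneg_on \<mu> (t0 - 4 * \<delta> * W x0 (lam * R)) t0 (ball x0 R) u \<Longrightarrow>
           bounded_in \<mu> (t0 - 4 * \<delta> * W x0 (lam * R)) t0 (ball x0 R) u \<Longrightarrow>
           supercaloric \<mu> F E EL j J (t0 - 4 * \<delta> * W x0 (lam * R)) t0 (ball x0 R) u \<Longrightarrow>
           nonneg_on \<mu> (t0 - 4 * \<delta> * W x0 (lam * R)) t0 UNIV u \<Longrightarrow>
           wPH_inequality \<mu> J q \<delta> C (W x0 (lam * R)) lam x0 R t0 u"
    using w unfolding wPH0_def by (elim exE conjE) blast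
  have main: "wPH_inequality \<mu> J q \<delta> (2 * C) (W x0 (lam * R)) lam x0 R t0 u"
    if R: "0 < R" "ereal R < Rbar \<mu>" and lam: "0 < lam" "lam \<le> lam0 / 2"
      and nn: "nonneg_on \<mu> (t0 - 4 * \<delta> * W x0 (lam * R)) t0 (ball x0 R) u"
      and bdd: "bounded_in \<mu> (t0 - 4 * \<delta> * W x0 (lam * R)) t0 (ball x0 R) u"
      and sup: "supercaloric \<mu> F E EL j J (t0 - 4 * \<delta> * W x0 (lam * R)) t0 (ball x0 R) u"
    for x0 R lam t0 u
  proof -
    define T where "T = W x0 (lam * R)"
    define t1 where "t1 = t0 - 4 * \<delta> * T"
    have lR: "0 < lam * R" using lam R by simp
    have Wx: "\<And>r. 0 < r \<Longrightarrow> 0 < W x0 r" "strict_mono_on {0<..} (W x0)" "continuous_on {0<..} (W x0)"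
      using W unfolding scale_function_def by blast+
    have T: "0 < T" unfolding T_def by (rule Wx(1)[OF lR])
    have t1: "t1 < t0" unfolding t1_def using \<delta> T by simp
    obtain K0 where K0: "\<And>t. t \<in> {t1<..t0} \<Longrightarrow> AE x in \<mu>. x \<in> ball x0 R \<longrightarrow> \<bar>u t x\<bar> \<le> K0"
      using bdd unfolding bounded_in_def t1_def T_def by blast
    define K where "K = max K0 1"
    have r: "0 < 11 * R / 20" "11 * R / 20 < 3 * R / 5" using R by auto
    obtain \<psi> where \<psi>: "\<psi> \<in> F" "\<psi> \<in> C0 (ball x0 (3 * R / 5))" "\<And>x. 0 \<le> \<psi> x" "\<And>x. \<psi> x \<le> 1"
      "\<And>x. x \<in> ball x0 (11 * R / 20) \<Longrightarrow> \<psi> x = 1" using cutoff_exists[OF r, of x0] by blast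
    obtain S where S: "finite S" "S \<subseteq> {t1<..t0}" "t0 \<in> S"
      "\<And>\<phi> t. \<phi> \<in> L2 \<mu> (ball x0 R) \<Longrightarrow> t \<in> {t1<..t0} - S \<Longrightarrow> pairing \<mu> (ball x0 R) u \<phi> differentiable (at t)"
      using sup unfolding supercaloric_def t1_def T_def by blast
    have sup': "supersolution \<mu> F E EL j J u t1 t0 x0 R K \<psi>"
    proof unfold_locales
      show "AE x in \<mu>. x \<in> ball x0 R \<longrightarrow> \<bar>u t x\<bar> \<le> K" if "t \<in> {t1<..t0}" for t
        using K0[OF that] by eventually_elim (auto simp: K_def)
    qed (use R t1 sup nn \<psi> in \<open>auto simp: K_def t1_def T_def\<close>)
    interpret s: supersolution \<mu> F E EL j J u t1 t0 x0 R K \<psi> by (rule sup')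
    have ein: "0 \<le> einf_cyl \<mu> (t0 - \<delta> * T) t0 (ball x0 (lam * R)) u"
      unfolding einf_cyl_def
    proof (rule INF_greatest)
      fix t assume "t \<in> {t0 - \<delta> * T<..t0}"
      moreover have "0 < \<delta> * T" using \<delta> T by simp
      ultimately have t: "t \<in> {t1<..t0}" unfolding t1_def by auto
      have "lam * R \<le> 1 * R" using lam lam0 R by (intro mult_right_mono) auto
      then have "ereal 0 \<le> essinf_on \<mu> (ball x0 (lam * R)) (u t)"
        using s.u_range[OF t] by (intro essinf_ge[OF s.u_borel[OF t]]) (auto elim!: eventually_mono)
      then show "0 \<le> essinf_on \<mu> (ball x0 (lam * R)) (u t)" by (simp add: zero_ereal_def)
    qed
    show ?thesis
    proof (cases "tail \<mu> J (2 / 3) t1 t0 x0 R (neg_part u) = \<infinity>")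
      case True
      have inf: "einf_cyl \<mu> (t0 - \<delta> * T) t0 (ball x0 (lam * R)) u
        + enn2ereal (tail \<mu> J (2 / 3) t1 t0 x0 R (neg_part u)) = \<infinity>"
        using ein True by (cases "einf_cyl \<mu> (t0 - \<delta> * T) t0 (ball x0 (lam * R)) u") auto
      show ?thesis using C unfolding wPH_inequality_def T_def[symmetric] t1_def[symmetric] inf by simp
    next
      case False
      interpret c: supersolution_in_time \<mu> F E EL j J u t1 t0 x0 R K \<psi> S
        by unfold_locales (use S False in \<open>auto simp: less_top\<close>)
      \<comment> \<open>parameters increasing strictly to lam, so that all cylinders below are strictly smaller\<close>
      define l where "l n = lam * (1 - 1 / real (n + 2))" for n
      have l: "0 < l n" "l n < lam" for n using lam by (auto simp: l_def)
      have linc: "l n < l (Suc n)" for n using lam by (auto simp: l_def field_simps)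
      have lim: "l \<longlonglongrightarrow> lam"
      proof -
        have "(\<lambda>n. 1 / real (n + 2)) \<longlonglongrightarrow> 0" using LIMSEQ_ignore_initial_segment[OF lim_1_over_n, of 2] by simp
        then have "(\<lambda>n. lam * (1 - 1 / real (n + 2))) \<longlonglongrightarrow> lam * (1 - 0)" by (intro tendsto_intros)
        then show ?thesis unfolding l_def by simp
      qed
      define Ts where "Ts n = W x0 (l n * R)" for n
      have lRpos: "0 < l n * R" for n using l R by simp
      have Tsp: "0 < Ts n" for n unfolding Ts_def by (rule Wx(1)[OF lRpos])
      have TsT: "Ts n < T" for n unfolding Ts_def T_def
        by (rule strict_mono_onD[OF Wx(2)]) (use lRpos lR l R in auto)
      have Tsinc: "incseq Ts"
      proof (rule incseq_SucI)
        fix n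
        have "l n * R < l (Suc n) * R" using linc R by simp
        then have "Ts n < Ts (Suc n)" unfolding Ts_def by (intro strict_mono_onD[OF Wx(2)]) (use lRpos in auto)
        then show "Ts n \<le> Ts (Suc n)" by simp
      qed
      have Tslim: "Ts \<longlonglongrightarrow> T"
      proof -
        have "isCont (W x0) (lam * R)" using Wx(3) lR by (simp add: continuous_on_eq_continuous_at)
        moreover have "(\<lambda>n. l n * R) \<longlonglongrightarrow> lam * R" by (intro tendsto_intros lim)
        ultimately show ?thesis unfolding Ts_def T_def by (rule isCont_tendsto_compose)
      qed
      define e where "e n = 1 / real (Suc n)" for n
      have e: "0 < e n" for n by (simp add: e_def)
      have elim: "e \<longlonglongrightarrow> 0" unfolding e_def using LIMSEQ_Suc[OF lim_1_over_n] .
      have rinc: "incseq (\<lambda>n. l n * R)" using linc R by (intro incseq_SucI mult_right_mono) (auto simp: less_imp_le)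
      have rlim: "(\<lambda>n. l n * R) \<longlonglongrightarrow> lam * R" by (intro tendsto_intros lim)
      have lamR: "lam * R \<le> R / 2" using lam lam0 R by simp
      have ineq: "ereal ((average (mu_hat \<mu>) ({t0 - 3 * \<delta> * Ts n<..t0 - 2 * \<delta> * Ts n} \<times> ball x0 (l n * R))
               (\<lambda>(t, x). c.steklov (\<delta> * (T - Ts n)) (e n) t x powr q)) powr (1 / q))
         \<le> ereal C * einf_cyl \<mu> (t0 - \<delta> * Ts n) t0 (ball x0 (l n * R)) (c.steklov (\<delta> * (T - Ts n)) (e n))" for n
      proof -
        let ?h = "\<delta> * (T - Ts n)" and ?a = "t0 - 4 * \<delta> * Ts n"
        let ?steklov = "c.steklov ?h (e n)"
        have h: "0 < ?h" using \<delta> TsT[of n] by simp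
        have ha: "t1 + ?h \<le> ?a" unfolding t1_def using h by (simp add: algebra_simps)
        have at0: "?a < t0" using \<delta> Tsp[of n] by simp
        have rad: "2 * l n * (R / 2) = l n * R" by simp
        have vp: "0 < ?steklov t x" if "t \<in> {?a<..t0}" for t x
          by (rule c.steklov_pos[OF h _ _ e]) (use that ha in auto)
        have "wPH_inequality \<mu> J q \<delta> C (W x0 (2 * l n * (R / 2))) (2 * l n) x0 (R / 2) t0 ?steklov"
        proof (rule H)
          show "0 < R / 2" using R by simp
          show "ereal (R / 2) < Rbar \<mu>" using R by (intro le_less_trans[OF _ R(2)]) simp
          show "0 < 2 * l n" "2 * l n \<le> lam0" using l[of n] lam by auto
          show "nonneg_on \<mu> (t0 - 4 * \<delta> * W x0 (2 * l n * (R / 2))) t0 (ball x0 (R / 2)) ?steklov"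
            "nonneg_on \<mu> (t0 - 4 * \<delta> * W x0 (2 * l n * (R / 2))) t0 UNIV ?steklov"
            unfolding rad Ts_def[symmetric] nonneg_on_def using vp by (auto simp: less_imp_le)
          show "bounded_in \<mu> (t0 - 4 * \<delta> * W x0 (2 * l n * (R / 2))) t0 (ball x0 (R / 2)) ?steklov"
            unfolding rad Ts_def[symmetric] bounded_in_def
          proof (intro exI[of _ "K + 2 * c.\<tau> + e n"] ballI AE_I2 impI)
            fix t x assume t: "t \<in> {?a<..t0}"
            have "?steklov t x \<le> K + 2 * c.\<tau> + e n" by (rule c.steklov_le[OF h]) (use t ha in auto)
            then show "\<bar>?steklov t x\<bar> \<le> K + 2 * c.\<tau> + e n" using vp[OF t, of x] by simp
          qed
          show "supercaloric \<mu> F E EL j J (t0 - 4 * \<delta> * W x0 (2 * l n * (R / 2))) t0 (ball x0 (R / 2)) ?steklov"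
            unfolding rad Ts_def[symmetric] by (rule c.steklov_supercaloric[OF h ha at0])
        qed
        moreover have "tail \<mu> J (2 / 3) ?a t0 x0 (R / 2) (neg_part ?steklov) = 0"
          by (rule tail_of_nonneg) (use vp in \<open>auto simp: less_imp_le\<close>)
        ultimately show ?thesis unfolding wPH_inequality_def rad Ts_def[symmetric]
          by (simp add: zero_ennreal.rep_eq)
      qed
      have "ereal ((average (mu_hat \<mu>) ({t0 - 3 * \<delta> * T<..t0 - 2 * \<delta> * T} \<times> ball x0 (lam * R)) (\<lambda>(t,
        x). u t x powr q)) powr (1 / q))
         \<le> ereal C * (einf_cyl \<mu> (t0 - \<delta> * T) t0 (ball x0 (lam * R)) u + ereal (2 * c.\<tau>))"
        by (rule c.harnack_limit[OF q _ \<delta> t1_def Tsinc Tsp TsT Tslim rinc lRpos rlim lamR e elim ineq])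
          (use C in simp)
      also have "\<dots> \<le> ereal (2 * C) * (einf_cyl \<mu> (t0 - \<delta> * T) t0 (ball x0 (lam * R)) u + ereal c.\<tau>)"
      proof (cases "einf_cyl \<mu> (t0 - \<delta> * T) t0 (ball x0 (lam * R)) u")
        case (real X)
        then have "0 \<le> C * X" using ein C by simp
        then show ?thesis using real by (simp add: algebra_simps)
      qed (use ein C in auto)
      also have "ereal c.\<tau> = enn2ereal (tail \<mu> J (2 / 3) t1 t0 x0 R (neg_part u))"
        unfolding c.\<tau>_def using False
          by (cases "tail \<mu> J (2 / 3) t1 t0 x0 R (neg_part u)") (auto simp: enn2ereal_ennreal)
      finally show ?thesis unfolding wPH_inequality_def T_def[symmetric] t1_def[symmetric] .
    qed
  qed
  show ?thesis
    unfolding wPH_def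
  proof (rule exI[of _ \<delta>], rule exI[of _ "2 * C"], rule exI[of _ "lam0 / 2"], intro conjI allI impI)
    show "0 < \<delta>" "1 < 2 * C" "0 < lam0 / 2" "lam0 / 2 < 1" using \<delta> C lam0 by auto
  qed (use main in blast)
qed

theorem proposition5p1:
  fixes \<mu> :: "'a::polish_space measure"
    and F :: "('a \<Rightarrow> real) set"
    and E EL :: "('a \<Rightarrow> real) \<Rightarrow> ('a \<Rightarrow> real) \<Rightarrow> real"
    and j :: "('a \<times> 'a) measure"
    and J :: "'a \<Rightarrow> 'a measure"
    and W :: "'a \<Rightarrow> real \<Rightarrow> real"
    and q :: real
  assumes "metric_measure_space \<mu>"
    and "VD \<mu>"
    and "RVD \<mu>"
    and "regular_dirichlet_form \<mu> F E"
    and "beurling_deny_without_killing \<mu> F E EL j J"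
    and "scale_function W"
    and "0 < q" and "q < 1"
  shows "wPH0 \<mu> F E EL j J W q \<longleftrightarrow> wPH \<mu> F E EL j J W q"
proof
  interpret jump_diffusion \<mu> F E EL j J
    using assms by unfold_locales
  show "wPH \<mu> F E EL j J W q" if "wPH0 \<mu> F E EL j J W q"
    by (rule wPH0_imp_wPH[OF assms(6-8) that])
qed (rule wPH_imp_wPH0)

end
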